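(* Let $(X,g)$ be an asymptotically hyperbolic manifold of dimension $n+1$, with product decomposition $[0,\varepsilon)\times\partial X$ near $\partial X$ in which $g=\frac{dx^2}{x^2}+\frac{h(x,y,dy)}{x^2}$, $h(0,y,dy)=h_0$. For $f_1,f_2\in C_0^\infty(X^\circ)$ let $u(t,z)\in C^\infty(\mathbb R_+\times X^\circ)$ satisfy $$\Big(D_t^2-\Delta+\frac{n^2}{4}\Big)u(t,z)=0\ \text{ on }\ \mathbb R_+\times X^\circ,\qquad u(0,z)=f_1(z),\quad D_tu(0,z)=f_2(z).$$ Let $z=(x,y)\in(0,\varepsilon)\times\partial X$ be the coordinates near $\partial X$ given by the product decomposition. Then there exist $w_k\in C^\infty(\mathbb R\times\partial X)$, $k=0,1,2,\dots$, such that, as $x\downarrow 0$, $$x^{-\frac n2}\,u(s-\log x,x,y)\ \sim\ \sum_{k=0}^\infty w_k(s,y)\,x^k ,$$ where $\sim$ means asymptotic expansion: for every $N$ the difference between the left side and $\sum_{k=0}^N w_k(s,y)x^k$ is $O(x^{N+1})$, locally uniformly in $(s,y)\in\mathbb R\times\partial X$.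
   Context: $X$ is a smooth compact manifold with boundary $\partial X$, $\dim X=n+1$, $n\ge1$, with interior $X^\circ$. A smooth Riemannian metric $g$ on $X^\circ$ makes $(X,g)$ asymptotically hyperbolic if for a smooth boundary defining function $x$ ($x>0$ on $X^\circ$, $x=0$ and $dx\ne0$ on $\partial X$) the tensor $H=x^2g$ extends to a smooth non-degenerate Riemannian metric on $X$ up to $\partial X$, and $|dx|_H=1$ at $\partial X$. It is known that for each representative $h_0$ of the conformal class of $x^2g|_{\partial X}$ there are $\varepsilon>0$ and a unique product structure $[0,\varepsilon)\times\partial X$ near $\partial X$ in which $g=\frac{dx^2}{x^2}+\frac{h(x,y,dy)}{x^2}$, with $h(x,\cdot)$ a smooth family of metrics on $\partial X$ (smooth up to $x=0$) and $h(0,y,dy)=h_0$; $h_0$ and the corresponding $x$ are fixed. $\Delta$ is the positive Laplace operator of $g$, and $D_t=\frac1i\frac{\partial}{\partial t}$. *)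

theory Defs
  imports "HOL-Analysis.Analysis"
begin

section \<open>Smooth maps\<close>

primrec Ck_on :: "nat \<Rightarrow> 'a::real_normed_vector set \<Rightarrow> ('a \<Rightarrow> 'b::real_normed_vector) \<Rightarrow> bool" where
  "Ck_on 0 S f \<longleftrightarrow> continuous_on S f"
| "Ck_on (Suc k) S f \<longleftrightarrow>
     (\<forall>p\<in>S. f differentiable (at p)) \<and> (\<forall>v. Ck_on k S (\<lambda>p. frechet_derivative f (at p) v))"

text \<open>Smoothness on an arbitrary set means that the map has local smooth extensions to open sets
  of the ambient vector space. On relatively open subsets of a half space this is smoothness up to
  the boundary.\<close>

definition smooth_on :: "'a::real_normed_vector set \<Rightarrow> ('a \<Rightarrow> 'b::real_normed_vector) \<Rightarrow> bool" where
  "smooth_on S f \<longleftrightarrow>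
     (\<forall>p\<in>S. \<exists>V F. open V \<and> p \<in> V \<and> (\<forall>k. Ck_on k V F) \<and> (\<forall>q\<in>V \<inter> S. F q = f q))"

text \<open>Derivatives are taken within \<open>S\<close>, so that they are also meaningful
  at boundary points of a half space.\<close>

definition partial :: "(real ^ 'm) set \<Rightarrow> 'm::finite \<Rightarrow> (real ^ 'm \<Rightarrow> 'b::real_normed_vector)
    \<Rightarrow> real ^ 'm \<Rightarrow> 'b" where
  "partial S i f q = frechet_derivative f (at q within S) (axis i 1)"

definition jacobian :: "(real ^ 'm) set \<Rightarrow> (real ^ 'm \<Rightarrow> real ^ 'k) \<Rightarrow> real ^ 'm
    \<Rightarrow> real ^ 'm::finite ^ 'k::finite" where
  "jacobian S f q = matrix (frechet_derivative f (at q within S))"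


section \<open>Manifolds with boundary\<close>

text \<open>The local model of an \<open>(n+1)\<close>-manifold with boundary, \<open>n = CARD('n)\<close>, is a half space in
  \<open>real ^ ('n option)\<close>: the coordinate \<open>None\<close> is the one which vanishes on the boundary, the
  coordinates \<open>Some i\<close> are the tangential ones.\<close>

definition half_space :: "(real ^ ('n::finite option)) set" where
  "half_space = {q. q $ None \<ge> 0}"

definition cons_coord :: "real \<Rightarrow> real ^ 'n::finite \<Rightarrow> real ^ ('n option)" where
  "cons_coord x \<eta> = (\<chi> j. case j of None \<Rightarrow> x | Some i \<Rightarrow> \<eta> $ i)"

text \<open>A chart is its domain together with its coordinate map, whose values outside
  the domain are irrelevant. The manifold is the whole type \<open>'a\<close>.\<close>

type_synonym ('a, 'n) chart = "'a set \<times> ('a \<Rightarrow> real ^ ('n option))"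

abbreviation cdom :: "('a, 'n::finite) chart \<Rightarrow> 'a set" where
  "cdom c \<equiv> fst c"

abbreviation cmap :: "('a, 'n::finite) chart \<Rightarrow> 'a \<Rightarrow> real ^ ('n option)" where
  "cmap c \<equiv> snd c"

definition cimg :: "('a, 'n::finite) chart \<Rightarrow> (real ^ ('n option)) set" where
  "cimg c = cmap c ` cdom c"

definition cinv :: "('a, 'n::finite) chart \<Rightarrow> real ^ ('n option) \<Rightarrow> 'a" where
  "cinv c = inv_into (cdom c) (cmap c)"

definition is_chart :: "('a::topological_space, 'n::finite) chart \<Rightarrow> bool" where
  "is_chart c \<longleftrightarrow> open (cdom c) \<and> openin (top_of_set half_space) (cimg c) \<and>
     homeomorphism (cdom c) (cimg c) (cmap c) (cinv c)"

definition compatible :: "('a, 'n::finite) chart \<Rightarrow> ('a, 'n) chart \<Rightarrow> bool" where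
  "compatible c c' \<longleftrightarrow>
     smooth_on (cmap c ` (cdom c \<inter> cdom c')) (cmap c' \<circ> cinv c) \<and>
     smooth_on (cmap c' ` (cdom c \<inter> cdom c')) (cmap c \<circ> cinv c')"

text \<open>A smooth structure is a maximal smooth atlas.\<close>

definition smooth_structure :: "('a::topological_space, 'n::finite) chart set \<Rightarrow> bool" where
  "smooth_structure A \<longleftrightarrow>
     (\<forall>c\<in>A. is_chart c) \<and> (\<Union>c\<in>A. cdom c) = UNIV \<and> (\<forall>c\<in>A. \<forall>c'\<in>A. compatible c c') \<and>
     (\<forall>c. is_chart c \<and> (\<forall>c'\<in>A. compatible c c') \<longrightarrow> c \<in> A)"

definition compact_smooth_manifold ::
    "('a::{t2_space,second_countable_topology}, 'n::finite) chart set \<Rightarrow> bool" where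
  "compact_smooth_manifold A \<longleftrightarrow> smooth_structure A \<and> compact (UNIV :: 'a set)"

definition mbdry :: "('a, 'n::finite) chart set \<Rightarrow> 'a set" where
  "mbdry A = {p. \<exists>c\<in>A. p \<in> cdom c \<and> cmap c p $ None = 0}"

definition minterior :: "('a, 'n::finite) chart set \<Rightarrow> 'a set" where
  "minterior A = - mbdry A"

definition smooth_fun :: "('a, 'n::finite) chart set \<Rightarrow> 'a set \<Rightarrow> ('a \<Rightarrow> 'b::real_normed_vector)
    \<Rightarrow> bool" where
  "smooth_fun A M f \<longleftrightarrow> (\<forall>c\<in>A. smooth_on (cmap c ` (cdom c \<inter> M)) (f \<circ> cinv c))"

definition C0_infinity :: "('a::topological_space, 'n::finite) chart set \<Rightarrow> ('a \<Rightarrow> complex) \<Rightarrow> bool"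
  where
  "C0_infinity A f \<longleftrightarrow> smooth_fun A (minterior A) f \<and>
     compact (closure {z\<in>minterior A. f z \<noteq> 0}) \<and>
     closure {z\<in>minterior A. f z \<noteq> 0} \<subseteq> minterior A"

text \<open>\<open>C\<^sup>\<infinity>(\<real>\<^sub>+ \<times> X\<degree>)\<close>, smooth up to \<open>t = 0\<close>.\<close>

definition smooth_evolution :: "('a, 'n::finite) chart set \<Rightarrow> (real \<Rightarrow> 'a \<Rightarrow> complex) \<Rightarrow> bool" where
  "smooth_evolution A u \<longleftrightarrow>
     (\<forall>c\<in>A. smooth_on ({0..} \<times> cmap c ` (cdom c \<inter> minterior A)) (\<lambda>(t, q). u t (cinv c q)))"


section \<open>The boundary\<close>

text \<open>A chart of the manifold induces one of its boundary, by restriction of the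
  tangential coordinates.\<close>

definition bdom :: "('a, 'n::finite) chart set \<Rightarrow> ('a, 'n) chart \<Rightarrow> 'a set" where
  "bdom A c = cdom c \<inter> mbdry A"

definition bmap :: "('a, 'n::finite) chart \<Rightarrow> 'a \<Rightarrow> real ^ 'n" where
  "bmap c p = (\<chi> i. cmap c p $ Some i)"

definition binv :: "('a, 'n::finite) chart set \<Rightarrow> ('a, 'n) chart \<Rightarrow> real ^ 'n \<Rightarrow> 'a" where
  "binv A c = inv_into (bdom A c) (bmap c)"

text \<open>\<open>C\<^sup>\<infinity>(\<real> \<times> \<partial>X)\<close>.\<close>

definition smooth_line_bdry :: "('a, 'n::finite) chart set \<Rightarrow> (real \<Rightarrow> 'a \<Rightarrow> complex) \<Rightarrow> bool" where
  "smooth_line_bdry A w \<longleftrightarrow>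
     (\<forall>c\<in>A. smooth_on (UNIV \<times> bmap c ` bdom A c) (\<lambda>(s, \<eta>). w s (binv A c \<eta>)))"


section \<open>Riemannian metrics\<close>

definition pos_def :: "real ^ 'm::finite ^ 'm \<Rightarrow> bool" where
  "pos_def M \<longleftrightarrow> transpose M = M \<and> (\<forall>v. v \<noteq> 0 \<longrightarrow> v \<bullet> (M *v v) > 0)"

text \<open>A metric is given by its component matrices in all charts, subject to the transformation
  law of a covariant 2-tensor.\<close>

type_synonym ('a, 'n) metric = "('a, 'n) chart \<Rightarrow> 'a \<Rightarrow> real ^ ('n option) ^ ('n option)"

definition riemannian_metric_on :: "('a, 'n::finite) chart set \<Rightarrow> 'a set \<Rightarrow> ('a, 'n) metric \<Rightarrow> bool"
  where
  "riemannian_metric_on A M g \<longleftrightarrow>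
     (\<forall>c\<in>A. smooth_on (cmap c ` (cdom c \<inter> M)) (g c \<circ> cinv c)) \<and>
     (\<forall>c\<in>A. \<forall>p\<in>cdom c \<inter> M. pos_def (g c p)) \<and>
     (\<forall>c\<in>A. \<forall>c'\<in>A. \<forall>p\<in>cdom c \<inter> cdom c' \<inter> M.
        let J = jacobian (cmap c ` (cdom c \<inter> cdom c')) (cmap c' \<circ> cinv c) (cmap c p)
        in g c p = transpose J ** g c' p ** J)"

text \<open>Families of metrics on the boundary, smooth in \<open>x \<in> [0, \<epsilon>)\<close>; component matrices are taken
  with respect to the induced boundary charts.\<close>

type_synonym ('a, 'n) bmetric = "('a, 'n) chart \<Rightarrow> 'a \<Rightarrow> real ^ 'n ^ 'n"

definition bdry_metric_family ::
    "('a, 'n::finite) chart set \<Rightarrow> real \<Rightarrow> (real \<Rightarrow> ('a, 'n) bmetric) \<Rightarrow> bool" where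
  "bdry_metric_family A \<epsilon> h \<longleftrightarrow>
     (\<forall>c\<in>A. smooth_on ({0..<\<epsilon>} \<times> bmap c ` bdom A c) (\<lambda>(x, \<eta>). h x c (binv A c \<eta>))) \<and>
     (\<forall>c\<in>A. \<forall>x\<in>{0..<\<epsilon>}. \<forall>y\<in>bdom A c. pos_def (h x c y)) \<and>
     (\<forall>c\<in>A. \<forall>c'\<in>A. \<forall>x\<in>{0..<\<epsilon>}. \<forall>y\<in>bdom A c \<inter> bdom A c'.
        let J = jacobian (bmap c ` (bdom A c \<inter> bdom A c')) (bmap c' \<circ> binv A c) (bmap c y)
        in h x c y = transpose J ** h x c' y ** J)"

definition differential :: "('a, 'n::finite) chart \<Rightarrow> ('a \<Rightarrow> real) \<Rightarrow> 'a \<Rightarrow> real ^ ('n option)" where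
  "differential c f p = (\<chi> i. partial (cimg c) i (f \<circ> cinv c) (cmap c p))"

definition covector_norm :: "('a, 'n::finite) metric \<Rightarrow> ('a, 'n) chart \<Rightarrow> 'a \<Rightarrow> real ^ ('n option)
    \<Rightarrow> real" where
  "covector_norm H c p \<xi> = sqrt (\<xi> \<bullet> (matrix_inv (H c p) *v \<xi>))"

text \<open>The positive Laplace operator
  \<open>- |g|\<^sup>-\<^sup>1\<^sup>/\<^sup>2 \<Sum>\<^sub>i\<^sub>j \<partial>\<^sub>i (|g|\<^sup>1\<^sup>/\<^sup>2 g\<^sup>i\<^sup>j \<partial>\<^sub>j f)\<close>, computed in the chart \<open>c\<close>.\<close>

definition laplacian :: "('a, 'n::finite) metric \<Rightarrow> ('a, 'n) chart \<Rightarrow> ('a \<Rightarrow> complex) \<Rightarrow> 'a \<Rightarrow> complex"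
  where
  "laplacian g c f p =
     (let S = cimg c; G = g c \<circ> cinv c; F = f \<circ> cinv c; q = cmap c p
      in - (\<Sum>i\<in>UNIV. \<Sum>j\<in>UNIV.
              partial S i
                (\<lambda>r. of_real (sqrt (det (G r)) * matrix_inv (G r) $ i $ j) * partial S j F r) q)
           / of_real (sqrt (det (G q))))"

definition Dt :: "(real \<Rightarrow> 'a \<Rightarrow> complex) \<Rightarrow> real \<Rightarrow> 'a \<Rightarrow> complex" where
  "Dt u t z = (1 / \<i>) * vector_derivative (\<lambda>\<tau>. u \<tau> z) (at t within {0..})"


section \<open>Asymptotically hyperbolic metrics\<close>

definition bdry_defining :: "('a, 'n::finite) chart set \<Rightarrow> ('a \<Rightarrow> real) \<Rightarrow> bool" where
  "bdry_defining A \<rho> \<longleftrightarrow> smooth_fun A UNIV \<rho> \<and> (\<forall>p\<in>minterior A. \<rho> p > 0) \<and>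
     (\<forall>p\<in>mbdry A. \<rho> p = 0) \<and> (\<forall>c\<in>A. \<forall>p\<in>bdom A c. differential c \<rho> p \<noteq> 0)"

definition asymptotically_hyperbolic :: "('a, 'n::finite) chart set \<Rightarrow> ('a, 'n) metric \<Rightarrow> bool" where
  "asymptotically_hyperbolic A g \<longleftrightarrow> riemannian_metric_on A (minterior A) g \<and>
     (\<exists>\<rho> H. bdry_defining A \<rho> \<and> riemannian_metric_on A UNIV H \<and>
        (\<forall>c\<in>A. \<forall>p\<in>cdom c \<inter> minterior A. H c p = (\<rho> p)\<^sup>2 *\<^sub>R g c p) \<and>
        (\<forall>c\<in>A. \<forall>p\<in>bdom A c. covector_norm H c p (differential c \<rho> p) = 1))"

text \<open>For \<open>\<Phi> : [0, \<epsilon>) \<times> \<partial>X \<rightarrow> X\<close>, the product coordinates \<open>(x, \<eta>)\<close> near the boundary,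
  where \<open>\<eta>\<close> are the boundary coordinates induced by \<open>c\<close>.\<close>

definition collar_chart :: "('a, 'n::finite) chart set \<Rightarrow> real \<Rightarrow> (real \<times> 'a \<Rightarrow> 'a) \<Rightarrow> ('a, 'n) chart
    \<Rightarrow> ('a, 'n) chart" where
  "collar_chart A \<epsilon> \<Phi> c =
     (\<Phi> ` ({0..<\<epsilon>} \<times> bdom A c),
      \<lambda>p. case inv_into ({0..<\<epsilon>} \<times> mbdry A) \<Phi> p of (x, y) \<Rightarrow> cons_coord x (bmap c y))"

definition product_metric_matrix :: "real ^ 'n ^ 'n \<Rightarrow> real ^ ('n::finite option) ^ ('n option)" where
  "product_metric_matrix M = (\<chi> i j. case (i, j) of
       (None, None) \<Rightarrow> 1 | (Some k, Some l) \<Rightarrow> M $ k $ l | _ \<Rightarrow> 0)"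

text \<open>\<open>\<Phi>\<close> is a diffeomorphism of \<open>[0, \<epsilon>) \<times> \<partial>X\<close> onto an open neighbourhood of \<open>\<partial>X\<close>, the identity on
  the boundary, with \<open>\<Phi>\<^sup>* g = (dx\<^sup>2 + h(x)) / x\<^sup>2\<close> and \<open>h(0) = h\<^sub>0\<close>. As \<open>A\<close> is a maximal atlas, the
  membership of all collar charts in \<open>A\<close> says that the injection \<open>\<Phi>\<close> is open, and smooth up to
  \<open>x = 0\<close> together with its inverse.\<close>

definition product_decomposition :: "('a, 'n::finite) chart set \<Rightarrow> ('a, 'n) metric
    \<Rightarrow> real \<Rightarrow> (real \<times> 'a \<Rightarrow> 'a) \<Rightarrow> (real \<Rightarrow> ('a, 'n) bmetric) \<Rightarrow> ('a, 'n) bmetric \<Rightarrow> bool" where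
  "product_decomposition A g \<epsilon> \<Phi> h h0 \<longleftrightarrow>
     \<epsilon> > 0 \<and> inj_on \<Phi> ({0..<\<epsilon>} \<times> mbdry A) \<and> (\<forall>y\<in>mbdry A. \<Phi> (0, y) = y) \<and>
     (\<forall>c\<in>A. collar_chart A \<epsilon> \<Phi> c \<in> A) \<and>
     bdry_metric_family A \<epsilon> h \<and> (\<forall>c\<in>A. \<forall>y\<in>bdom A c. h 0 c y = h0 c y) \<and>
     (\<forall>c\<in>A. \<forall>x\<in>{0<..<\<epsilon>}. \<forall>y\<in>bdom A c.
        g (collar_chart A \<epsilon> \<Phi> c) (\<Phi> (x, y)) = (1 / x\<^sup>2) *\<^sub>R product_metric_matrix (h x c y))"


section \<open>Asymptotic expansions at the boundary\<close>

definition asymp_expansion :: "'a::topological_space set \<Rightarrow> (real \<Rightarrow> real \<Rightarrow> 'a \<Rightarrow> complex)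
    \<Rightarrow> (nat \<Rightarrow> real \<Rightarrow> 'a \<Rightarrow> complex) \<Rightarrow> bool" where
  "asymp_expansion Y v w \<longleftrightarrow>
     (\<forall>N. \<forall>s0. \<forall>y0\<in>Y. \<exists>V C. open V \<and> (s0, y0) \<in> V \<and>
        (\<forall>\<^sub>F x in at_right 0. \<forall>(s, y)\<in>V \<inter> UNIV \<times> Y.
           norm (v x s y - (\<Sum>k\<le>N. w k s y * of_real (x ^ k))) \<le> C * x ^ (N + 1)))"

end

theory Submission
  imports Defs
begin

text \<open>
In the coordinates \<open>(x, s, y)\<close>, \<open>s = t + ln x\<close>, the function \<open>w = x\<^sup>-\<^sup>n\<^sup>/\<^sup>2 (det h)\<^sup>1\<^sup>/\<^sup>4 u\<close>
solves \<open>\<partial>\<^sub>x (x \<partial>\<^sub>x + 2 \<partial>\<^sub>s) w + x a\<^sub>i\<^sub>j \<partial>\<^sub>i \<partial>\<^sub>j w + x c\<^sub>i \<partial>\<^sub>i w + b w = 0\<close>, whose coefficients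
are smooth up to \<open>x = 0\<close> and independent of \<open>s\<close>. The initial data are compactly supported in the
interior, so \<open>w\<close> vanishes for very negative \<open>s\<close> by finite speed of propagation. An energy estimate
with multiplier \<open>Y w = (x \<partial>\<^sub>x + 2 \<partial>\<^sub>s) w\<close> and a weight which localises to a characteristic cone,
applied to all tangential derivatives of \<open>w\<close>, gives with the Sobolev inequality the bound
\<open>O(1/x)\<close> for each of them. The equation and integration along the characteristics of \<open>Y\<close> improve
this step by step until all derivatives of \<open>w\<close>, also those in \<open>x\<close>, are bounded. Hence they have
smooth limits at \<open>x = 0\<close>, and Taylor's formula gives the expansion in a chart. Coefficients of
asymptotic expansions are unique, so the local ones fit together over \<open>\<partial>X\<close>.
\<close>

section \<open>Iterated directional derivatives\<close>

text \<open>In (x, s, y) the principal part is built from two null fields, d/dx and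
  \<open>Yd\<close>. The energy based on \<open>Yd w\<close> gives no control of d/dx w and controls
  the tangential gradient only with a factor x. This suffices because derivatives in s and y commute
  with x and with \<open>Yd\<close>, and all terms with a tangential gradient carry the same factor
  x. Nothing is known about w at x = 0 beforehand, so no boundary term there can be evaluated. Hence
  the weights are cut off near x = 0 by a function of s - 2 ln x, whose derivatives are zero or of
  favourable sign; the resulting bounds do not depend on the cutoff parameter. The power 1/x lost
  afterwards is the price of a single d/dx in the Sobolev inequality. A second obstacle is t = 0.
  Near the boundary the data vanish, and the extension of u by zero to t < 0 is shown to be C2, the
  second time derivative being taken from the equation. That is enough for finite speed of
  propagation, which yields w = 0 for s < s0. For small x the set t = 0, which is s = ln x, then
  falls into this zero set, and w becomes smooth.\<close>

abbreviation sum_UNIV :: "('i::finite \<Rightarrow> 'b::comm_monoid_add) \<Rightarrow> 'b" (binder "\<Sum>!" 10) where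
 "\<Sum>!i. f i \<equiv> \<Sum>i\<in>UNIV. f i"

text \<open>The direction comes first, so that \<open>dd v\<close> maps functions to functions and
  can be iterated. Where f is not differentiable the value is arbitrary; hence the differentiability
  premises of the rules below.\<close>

definition dd :: "'a::real_normed_vector \<Rightarrow> ('a \<Rightarrow> 'b::real_normed_vector) \<Rightarrow> 'a \<Rightarrow> 'b" where
 "dd v f p = frechet_derivative f (at p) v"

definition Cinf_on :: "'a::real_normed_vector set \<Rightarrow> ('a \<Rightarrow> 'b::real_normed_vector) \<Rightarrow> bool" where
 "Cinf_on S f \<longleftrightarrow> (\<forall>k. Ck_on k S f)"

lemma Ck_on_Suc_iff:
 "Ck_on (Suc k) S f \<longleftrightarrow> (\<forall>p\<in>S. f differentiable (at p)) \<and> (\<forall>v. Ck_on k S (dd v f))"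
 by (simp add: dd_def[abs_def])

declare Ck_on.simps(2) [simp del]

lemma Ck_on_SucD: "Ck_on (Suc k) S f \<Longrightarrow> Ck_on k S f"
proof (induction k arbitrary: f)
 case 0
 then show ?case
  by (auto simp: Ck_on_Suc_iff intro!: continuous_at_imp_continuous_on differentiable_imp_continuous_within)
next
 case (Suc k)
 then show ?case by (meson Ck_on_Suc_iff)
qed

lemma Ck_on_le: "Ck_on k S f \<Longrightarrow> j \<le> k \<Longrightarrow> Ck_on j S f"
 by (induction k) (use Ck_on_SucD le_Suc_eq in blast)+

lemma Ck_on_continuous: "Ck_on k S f \<Longrightarrow> continuous_on S f"
 using Ck_on_le[of k S f 0] by simp

lemma Ck_on_subset: "Ck_on k S f \<Longrightarrow> T \<subseteq> S \<Longrightarrow> Ck_on k T f"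
 by (induction k arbitrary: f) (auto intro: continuous_on_subset simp: Ck_on_Suc_iff)

lemma dd_cong_open:
 assumes "open S" "\<And>q. q \<in> S \<Longrightarrow> f q = g q" "p \<in> S"
 shows "dd v f p = dd v g p"
proof -
 have "(f has_derivative D) (at p) \<longleftrightarrow> (g has_derivative D) (at p)" for D
  using assms has_derivative_transform_within_open[of f D p UNIV S g] has_derivative_transform_within_open[of g D p UNIV S f]
  by auto
 then show ?thesis by (simp add: dd_def frechet_derivative_def)
qed

lemma differentiable_cong_open:
 assumes "open S" "\<And>q. q \<in> S \<Longrightarrow> f q = g q" "p \<in> S" "f differentiable (at p)"
 shows "g differentiable (at p)"
 using assms has_derivative_transform_within_open[of f _ p UNIV S g] unfolding differentiable_def by blast

text \<open>Derivatives at p are two-sided, so the functions must agree in a neighbourhood of p;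
  this is where openness enters.\<close>

lemma Ck_on_cong:
 assumes "open S" "\<And>q. q \<in> S \<Longrightarrow> f q = g q" "Ck_on k S f"
 shows "Ck_on k S g"
 using assms(2,3)
proof (induction k arbitrary: f g)
 case 0
 then show ?case by (auto cong: continuous_on_cong)
next
 case (Suc k)
 have "\<And>v. Ck_on k S (dd v g)"
 proof (rule Suc.IH)
  show "dd v f q = dd v g q" if "q \<in> S" for v q
   using dd_cong_open[OF assms(1) Suc.prems(1) that] .
  show "Ck_on k S (dd v f)" for v using Suc.prems by (auto simp: Ck_on_Suc_iff)
 qed
 then show ?case
  using Suc.prems differentiable_cong_open[OF assms(1) Suc.prems(1)] by (auto simp: Ck_on_Suc_iff)
qed

text \<open>Differentiability is a condition at single points, and the continuity at the bottom of
  the recursion is local on open sets. Smoothness can thus be checked on a neighbourhood of each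
  point.\<close>

lemma Ck_on_Union: "(\<And>S. S \<in> \<S> \<Longrightarrow> open S \<and> Ck_on k S f) \<Longrightarrow> Ck_on k (\<Union>\<S>) f"
proof (induction k arbitrary: f)
 case 0
 then show ?case using continuous_on_open_Union[of \<S> f] by auto
next
 case (Suc k)
 have "Ck_on k (\<Union>\<S>) (dd v f)" for v
  by (rule Suc.IH) (use Suc.prems in \<open>auto simp: Ck_on_Suc_iff\<close>)
 then show ?case using Suc.prems by (auto simp: Ck_on_Suc_iff)
qed

lemma has_derivative_dd:
 "f differentiable (at p) \<Longrightarrow> (f has_derivative (\<lambda>v. dd v f p)) (at p)"
 unfolding dd_def frechet_derivative_works by simp

lemma dd_eqI: "(f has_derivative D) (at p) \<Longrightarrow> dd v f p = D v"
 unfolding dd_def using frechet_derivative_at by metis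

lemma linear_dd: "f differentiable (at p) \<Longrightarrow> linear (\<lambda>v. dd v f p)"
 using has_derivative_dd has_derivative_linear by blast

lemma dd_sum_dir:
 "f differentiable (at p) \<Longrightarrow> dd (\<Sum>i\<in>I. c i *\<^sub>R v i) f p = (\<Sum>i\<in>I. c i *\<^sub>R dd (v i) f p)"
 using linear_sum[OF linear_dd, of f p "\<lambda>i. c i *\<^sub>R v i" I] linear_scale[OF linear_dd, of f p] by simp

lemma dd_line_vector:
 assumes "f differentiable (at (p + \<tau> *\<^sub>R v))"
 shows "((\<lambda>\<sigma>. f (p + \<sigma> *\<^sub>R v)) has_vector_derivative dd v f (p + \<tau> *\<^sub>R v)) (at \<tau> within T)"
proof -
 have 1: "((\<lambda>\<sigma>. p + \<sigma> *\<^sub>R v) has_derivative (\<lambda>h. h *\<^sub>R v)) (at \<tau> within T)"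
  by (auto intro!: derivative_eq_intros)
 have 2: "(f has_derivative (\<lambda>u. dd u f (p + \<tau> *\<^sub>R v))) (at (p + \<tau> *\<^sub>R v))"
  using has_derivative_dd assms by blast
 have "((\<lambda>\<sigma>. f (p + \<sigma> *\<^sub>R v)) has_derivative (\<lambda>h. dd (h *\<^sub>R v) f (p + \<tau> *\<^sub>R v))) (at \<tau> within T)"
  using has_derivative_compose[OF 1 2] .
 moreover have "dd (h *\<^sub>R v) f (p + \<tau> *\<^sub>R v) = h *\<^sub>R dd v f (p + \<tau> *\<^sub>R v)" for h
  using linear_scale[OF linear_dd[OF assms]] .
 ultimately show ?thesis by (simp add: has_vector_derivative_def)
qed

lemma dd_line:
 fixes f :: "'a::real_normed_vector \<Rightarrow> real"
 assumes "f differentiable (at (p + \<tau> *\<^sub>R v))"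
 shows "((\<lambda>\<sigma>. f (p + \<sigma> *\<^sub>R v)) has_real_derivative dd v f (p + \<tau> *\<^sub>R v)) (at \<tau> within T)"
 using dd_line_vector[OF assms] by (simp add: has_real_derivative_iff_has_vector_derivative)

lemma dd_line0:
 fixes f :: "'a::real_normed_vector \<Rightarrow> real"
 assumes "f differentiable (at p)"
 shows "((\<lambda>\<sigma>. f (p + \<sigma> *\<^sub>R v)) has_real_derivative dd v f p) (at 0)"
 using dd_line[of f p 0 v UNIV] assms by simp

lemma dd_eq_line:
 fixes f :: "'a::real_normed_vector \<Rightarrow> real"
 assumes "f differentiable (at p)"
  and "((\<lambda>\<sigma>. f (p + \<sigma> *\<^sub>R v)) has_real_derivative d) (at 0)"
 shows "dd v f p = d"
 using dd_line0[OF assms(1)] assms(2) DERIV_unique by blast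

lemma Ck_on_const [simp, intro]: "Ck_on k S (\<lambda>_. c)"
proof (induction k arbitrary: c)
 case (Suc k)
 have "dd v (\<lambda>_. c) = (\<lambda>_. 0)" for v :: 'a by (simp add: dd_def fun_eq_iff)
 then show ?case using Suc by (simp add: Ck_on_Suc_iff del: Ck_on.simps)
qed simp

lemma dd_bounded_linear:
 "bounded_linear L \<Longrightarrow> f differentiable (at p) \<Longrightarrow> dd v (\<lambda>q. L (f q)) p = L (dd v f p)"
 by (intro dd_eqI[OF bounded_linear.has_derivative] has_derivative_dd)

lemma differentiable_bounded_linear:
 "bounded_linear L \<Longrightarrow> f differentiable (at p) \<Longrightarrow> (\<lambda>q. L (f q)) differentiable (at p)"
 unfolding differentiable_def using bounded_linear.has_derivative by blast

lemma Ck_on_bounded_linear: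
 assumes "open S" "bounded_linear L" "Ck_on k S f"
 shows "Ck_on k S (\<lambda>q. L (f q))"
 using assms(3)
proof (induction k arbitrary: f)
 case 0
 then show ?case using assms(2) by (auto intro: bounded_linear.continuous_on)
next
 case (Suc k)
 have "Ck_on k S (dd v (\<lambda>q. L (f q)))" for v
 proof (rule Ck_on_cong[OF assms(1) _ Suc.IH[of "dd v f"]])
  show "L (dd v f q) = dd v (\<lambda>q. L (f q)) q" if "q \<in> S" for q
   using that Suc.prems by (simp add: Ck_on_Suc_iff dd_bounded_linear[OF assms(2)])
 qed (use Suc.prems in \<open>auto simp: Ck_on_Suc_iff\<close>)
 then show ?case
  using Suc.prems differentiable_bounded_linear[OF assms(2)] by (auto simp: Ck_on_Suc_iff)
qed

lemma Ck_on_ident [simp, intro]: "Ck_on k S (\<lambda>p. p)"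
proof (cases k)
 case (Suc j)
 have "dd v (\<lambda>p. p) = (\<lambda>_. v)" for v :: 'a by (simp add: dd_def fun_eq_iff)
 then show ?thesis using Suc by (simp add: Ck_on_Suc_iff del: Ck_on.simps)
qed simp

lemma Ck_on_linear: "open S \<Longrightarrow> bounded_linear L \<Longrightarrow> Ck_on k S L"
 using Ck_on_bounded_linear[of S L k "\<lambda>p. p"] by simp

lemma dd_add: "f differentiable (at p) \<Longrightarrow> g differentiable (at p) \<Longrightarrow>
  dd v (\<lambda>q. f q + g q) p = dd v f p + dd v g p"
 by (rule dd_eqI[of _ "\<lambda>v. dd v f p + dd v g p"])
   (intro has_derivative_add has_derivative_dd)

lemma dd_diff: "f differentiable (at p) \<Longrightarrow> g differentiable (at p) \<Longrightarrow>
  dd v (\<lambda>q. f q - g q) p = dd v f p - dd v g p"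
 by (rule dd_eqI[of _ "\<lambda>v. dd v f p - dd v g p"])
   (intro has_derivative_diff has_derivative_dd)

lemma dd_minus: "f differentiable (at p) \<Longrightarrow> dd v (\<lambda>q. - f q) p = - dd v f p"
 by (rule dd_eqI[of _ "\<lambda>v. - dd v f p"]) (intro has_derivative_minus has_derivative_dd)

lemma dd_sum: "(\<And>i. i \<in> I \<Longrightarrow> f i differentiable (at p)) \<Longrightarrow>
  dd v (\<lambda>q. \<Sum>i\<in>I. f i q) p = (\<Sum>i\<in>I. dd v (f i) p)"
 by (rule dd_eqI[of _ "\<lambda>v. \<Sum>i\<in>I. dd v (f i) p"]) (intro has_derivative_sum has_derivative_dd)

lemma dd_mult:
 fixes f g :: "'a::real_normed_vector \<Rightarrow> real"
 shows "f differentiable (at p) \<Longrightarrow> g differentiable (at p) \<Longrightarrow>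
  dd v (\<lambda>q. f q * g q) p = dd v f p * g p + f p * dd v g p"
 by (rule trans[OF dd_eqI[OF has_derivative_mult[OF has_derivative_dd has_derivative_dd]]]) auto

lemma dd_const [simp]: "dd v (\<lambda>_. c) p = 0"
 by (simp add: dd_def)

lemma dd_linear: "bounded_linear L \<Longrightarrow> dd v L p = L v"
 by (rule dd_eqI) (rule bounded_linear_imp_has_derivative)

lemma Ck_on_add:
 assumes "open S" "Ck_on k S f" "Ck_on k S g"
 shows "Ck_on k S (\<lambda>q. f q + g q)"
 using assms(2,3)
proof (induction k arbitrary: f g)
 case (Suc k)
 have "Ck_on k S (dd v (\<lambda>q. f q + g q))" for v
  by (rule Ck_on_cong[OF assms(1) _ Suc.IH[of "dd v f" "dd v g"]])
   (use Suc.prems in \<open>auto simp: Ck_on_Suc_iff dd_add\<close>)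
 then show ?case using Suc.prems by (auto simp: Ck_on_Suc_iff)
qed (auto intro: continuous_intros)

lemma Ck_on_sum:
 assumes "open S" "\<And>i. i \<in> I \<Longrightarrow> Ck_on k S (f i)"
 shows "Ck_on k S (\<lambda>q. \<Sum>i\<in>I. f i q)"
 using assms(2)
proof (induction I rule: infinite_finite_induct)
 case (insert i I)
 then show ?case using Ck_on_add[OF assms(1), of k "f i" "\<lambda>q. \<Sum>i\<in>I. f i q"] by auto
qed auto

lemma Ck_on_mult:
 fixes f g :: "'a::real_normed_vector \<Rightarrow> real"
 assumes "open S" "Ck_on k S f" "Ck_on k S g"
 shows "Ck_on k S (\<lambda>q. f q * g q)"
 using assms(2,3)
proof (induction k arbitrary: f g)
 case (Suc k)
 have "Ck_on k S (dd v (\<lambda>q. f q * g q))" for v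
 proof (rule Ck_on_cong[OF assms(1)])
  show "Ck_on k S (\<lambda>q. dd v f q * g q + f q * dd v g q)"
   using Suc.prems Suc.prems[THEN Ck_on_SucD]
   by (intro Ck_on_add[OF assms(1)] Suc.IH) (auto simp: Ck_on_Suc_iff)
 qed (use Suc.prems in \<open>auto simp: Ck_on_Suc_iff dd_mult\<close>)
 then show ?case using Suc.prems by (auto simp: Ck_on_Suc_iff)
qed (auto intro: continuous_intros)

lemma Ck_on_cmult:
 fixes f :: "'a::real_normed_vector \<Rightarrow> real"
 shows "open S \<Longrightarrow> Ck_on k S f \<Longrightarrow> Ck_on k S (\<lambda>q. c * f q)"
 by (rule Ck_on_mult) auto

lemma Ck_on_minus:
 fixes f :: "'a::real_normed_vector \<Rightarrow> real"
 shows "open S \<Longrightarrow> Ck_on k S f \<Longrightarrow> Ck_on k S (\<lambda>q. - f q)"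
 using Ck_on_cmult[of S k f "-1"] by simp

lemma Ck_on_diff:
 fixes f :: "'a::real_normed_vector \<Rightarrow> real"
 shows "open S \<Longrightarrow> Ck_on k S f \<Longrightarrow> Ck_on k S g \<Longrightarrow> Ck_on k S (\<lambda>q. f q - g q)"
 using Ck_on_add[of S k f "\<lambda>q. - g q"] Ck_on_minus[of S k g] by simp

lemma Ck_on_prod:
 fixes f :: "'i \<Rightarrow> 'a::real_normed_vector \<Rightarrow> real"
 assumes "open S" "\<And>i. i \<in> I \<Longrightarrow> Ck_on k S (f i)"
 shows "Ck_on k S (\<lambda>q. \<Prod>i\<in>I. f i q)"
 using assms(2)
proof (induction I rule: infinite_finite_induct)
 case (insert i I)
 then show ?case using Ck_on_mult[OF assms(1), of k "f i" "\<lambda>q. \<Prod>i\<in>I. f i q"] by auto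
qed auto

lemma differentiable_compose_at:
 "f differentiable (at p) \<Longrightarrow> g differentiable (at (f p)) \<Longrightarrow> (\<lambda>q. g (f q)) differentiable (at p)"
 using differentiable_chain_at[of f p g] by (simp add: o_def)

lemma dd_compose:
 "f differentiable (at p) \<Longrightarrow> g differentiable (at (f p)) \<Longrightarrow>
  dd v (\<lambda>q. g (f q)) p = dd (dd v f p) g (f p)"
 by (rule dd_eqI[OF has_derivative_compose[OF has_derivative_dd has_derivative_dd]])

lemma dd_compose_Basis:
 fixes f :: "'a::real_normed_vector \<Rightarrow> 'c::euclidean_space" and g :: "'c \<Rightarrow> real"
 assumes "f differentiable (at p)" "g differentiable (at (f p))"
 shows "dd v (\<lambda>q. g (f q)) p = (\<Sum>b\<in>Basis. (dd v f p \<bullet> b) * dd b g (f p))"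
proof -
 have "dd v (\<lambda>q. g (f q)) p = dd (\<Sum>b\<in>Basis. (dd v f p \<bullet> b) *\<^sub>R b) g (f p)"
  using dd_compose[OF assms] by (simp add: euclidean_representation)
 then show ?thesis using dd_sum_dir[OF assms(2)] by simp
qed

text \<open>The chain rule in coordinates turns a derivative of the composite into a sum of products
  in which one factor is again a composite, of f with a partial derivative of g. The induction
  therefore runs over all g.\<close>

lemma Ck_on_compose:
 fixes f :: "'a::real_normed_vector \<Rightarrow> 'c::euclidean_space" and g :: "'c \<Rightarrow> real"
 assumes "open S" "Ck_on k S f" "Ck_on k T g" "f ` S \<subseteq> T"
 shows "Ck_on k S (\<lambda>q. g (f q))"
 using assms(2,3)
proof (induction k arbitrary: g)
 case 0
 then show ?case using assms(4) by (auto intro: continuous_on_compose2)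
next
 case (Suc k)
 have fd: "f differentiable (at p)" "g differentiable (at (f p))" if "p \<in> S" for p
  using Suc.prems that assms(4) by (auto simp: Ck_on_Suc_iff)
 have "Ck_on k S (dd v (\<lambda>q. g (f q)))" for v
 proof (rule Ck_on_cong[OF assms(1)])
  have "Ck_on k S (dd v f)" using Suc.prems by (simp add: Ck_on_Suc_iff)
  then show "Ck_on k S (\<lambda>p. \<Sum>b\<in>Basis. (dd v f p \<bullet> b) * dd b g (f p))"
   using Suc.prems(2)
   by (intro Ck_on_sum Ck_on_mult Suc.IH[OF Ck_on_SucD[OF Suc.prems(1)]] assms(1)
     Ck_on_bounded_linear[OF assms(1) bounded_linear_inner_left]) (auto simp: Ck_on_Suc_iff)
 qed (simp add: dd_compose_Basis[OF fd])
 moreover have "(\<lambda>q. g (f q)) differentiable (at p)" if "p \<in> S" for p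
  by (rule differentiable_compose_at[OF fd[OF that]])
 ultimately show ?case by (auto simp: Ck_on_Suc_iff)
qed

lemma Ck_on_real:
 assumes "\<And>x. x \<in> S \<Longrightarrow> (f has_real_derivative g x) (at x)" "Ck_on k S g" "open S"
 shows "Ck_on (Suc k) S f"
proof -
 have "dd v f x = v * g x" if "x \<in> S" for v x
  using dd_eqI[of f "\<lambda>h. g x * h" x v] assms(1)[OF that] by (simp add: has_field_derivative_def)
 then have "Ck_on k S (dd v f)" for v
  by (intro Ck_on_cong[OF assms(3) _ Ck_on_cmult[OF assms(3,2), of v]]) auto
 then show ?thesis
  using assms(1) by (auto simp: Ck_on_Suc_iff real_differentiable_def)
qed

lemma Ck_on_exp: "Ck_on k UNIV (exp :: real \<Rightarrow> real)"
 by (induction k) (auto intro!: Ck_on_real[of _ exp exp] DERIV_exp continuous_intros)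

lemma Ck_on_powr: "Ck_on k {0<..} (\<lambda>x::real. x powr a)"
proof (induction k arbitrary: a)
 case 0
 then show ?case by (auto intro!: continuous_intros)
next
 case (Suc k)
 show ?case
  by (rule Ck_on_real[of _ _ "\<lambda>x. a * x powr (a - 1)"])
   (auto intro!: Ck_on_cmult Suc has_real_derivative_powr)
qed

lemma Ck_on_inverse: "Ck_on k {0<..} (\<lambda>x::real. inverse x)"
 by (rule Ck_on_cong[OF _ _ Ck_on_powr[of k "-1"]]) (auto simp: powr_minus)

lemma Ck_on_ln: "Ck_on k {0<..} (ln :: real \<Rightarrow> real)"
proof (cases k)
 case 0
 then show ?thesis by (auto intro!: continuous_intros)
next
 case (Suc j)
 show ?thesis unfolding Suc
  by (rule Ck_on_real[of _ _ "\<lambda>x. inverse x"]) (auto intro!: Ck_on_inverse derivative_eq_intros simp: divide_inverse)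
qed

text \<open>Schwarz's theorem: the second difference over the parallelogram spanned by h v and h w
  is, by two applications of the mean value theorem, h^2 times a mixed derivative at a nearby point,
  and it is symmetric in v and w.\<close>

lemma dd_commute:
 fixes f :: "'a::real_normed_vector \<Rightarrow> real"
 assumes S: "open S" "p \<in> S" and C: "Ck_on 2 S f"
 shows "dd v (dd w f) p = dd w (dd v f) p"
proof (rule ccontr)
 assume ne: "dd v (dd w f) p \<noteq> dd w (dd v f) p"
 have C': "Ck_on (Suc (Suc 0)) S f" using C by (simp add: numeral_2_eq_2 del: Ck_on.simps)
 have df: "f differentiable (at q)" "dd u f differentiable (at q)"
  "continuous_on S (dd u (dd u' f))" if "q \<in> S" for q u u'
  using C' that by (auto simp: Ck_on_Suc_iff)
 define e where "e = \<bar>dd v (dd w f) p - dd w (dd v f) p\<bar> / 2"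
 have e: "e > 0" using ne by (simp add: e_def)
 have cont: "\<exists>r>0. \<forall>q\<in>ball p r. q \<in> S \<and> \<bar>dd u (dd u' f) q - dd u (dd u' f) p\<bar> < e" for u u'
 proof -
  have "isCont (dd u (dd u' f)) p" using df(3)[OF S(2)] S continuous_on_eq_continuous_at by blast
  then obtain r1 where r1: "r1 > 0" "\<And>q. dist q p < r1 \<Longrightarrow> dist (dd u (dd u' f) q) (dd u (dd u' f) p) < e"
   using e by (auto simp: continuous_at_eps_delta)
  obtain r2 where "r2 > 0" "ball p r2 \<subseteq> S" using S open_contains_ball by blast
  then show ?thesis using r1
   by (intro exI[of _ "min r1 r2"]) (auto simp: dist_commute dist_real_def subset_iff)
 qed
 obtain r1 where r1: "r1 > 0" "\<And>q. q \<in> ball p r1 \<Longrightarrow> q \<in> S \<and> \<bar>dd v (dd w f) q - dd v (dd w f) p\<bar> < e"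
  using cont[of v w] by auto
 obtain r2 where r2: "r2 > 0" "\<And>q. q \<in> ball p r2 \<Longrightarrow> q \<in> S \<and> \<bar>dd w (dd v f) q - dd w (dd v f) p\<bar> < e"
  using cont[of w v] by auto
 define r where "r = min r1 r2"
 define h where "h = r / (2 * (norm v + norm w + 1))"
 have pos: "norm v + norm w + 1 > 0" by (simp add: add_nonneg_pos)
 have h: "h > 0" using r1(1) r2(1) pos by (simp add: h_def r_def)
 have "h * (norm v + norm w) < r"
 proof -
  have "h * (norm v + norm w + 1) = r / 2"
   unfolding h_def using pos
   by (metis is_num_normalize(1) less_numeral_extra(3)
     nonzero_mult_divide_mult_cancel_right pos times_divide_eq_left)
  moreover have "r > 0" using r1(1) r2(1) by (simp add: r_def)
  moreover have "h * (norm v + norm w + 1) = h * (norm v + norm w) + h" by (simp add: algebra_simps)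
  ultimately show ?thesis using h by linarith
 qed
 then have inb: "p + a *\<^sub>R v + b *\<^sub>R w \<in> ball p r" if "0 \<le> a" "a \<le> h" "0 \<le> b" "b \<le> h" for a b
 proof -
  have "norm (a *\<^sub>R v + b *\<^sub>R w) \<le> a * norm v + b * norm w"
   using norm_triangle_ineq[of "a *\<^sub>R v" "b *\<^sub>R w"] that by simp
  also have "\<dots> \<le> h * norm v + h * norm w" using that by (intro add_mono mult_right_mono) auto
  also have "\<dots> < r" using \<open>h * (norm v + norm w) < r\<close> by (simp add: algebra_simps)
  finally have "norm (- (a *\<^sub>R v + b *\<^sub>R w)) < r" by (simp only: norm_minus_cancel)
  then show ?thesis by (simp add: dist_norm algebra_simps)
 qed
 define \<Delta> where "\<Delta> = f (p + h *\<^sub>R v + h *\<^sub>R w) - f (p + h *\<^sub>R w) - (f (p + h *\<^sub>R v) - f p)"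
 \<comment> \<open>Stated for arbitrary v and w subject to the inclusion, so that it serves both
   orders of differentiation.\<close>
 have key: "\<exists>q\<in>ball p r. f (p + h *\<^sub>R v + h *\<^sub>R w) - f (p + h *\<^sub>R w) - (f (p + h *\<^sub>R v) - f p) = h * h * dd w (dd v f) q"
  if inb: "\<And>a b. \<lbrakk>0 \<le> a; a \<le> h; 0 \<le> b; b \<le> h\<rbrakk> \<Longrightarrow> p + a *\<^sub>R v + b *\<^sub>R w \<in> ball p r" for v w
 proof -
  have inS: "p + a *\<^sub>R v + b *\<^sub>R w \<in> S" if "0 \<le> a" "a \<le> h" "0 \<le> b" "b \<le> h" for a b
   using inb[OF that] r1 by (auto simp: r_def)
  define G where "G = (\<lambda>\<sigma>. f (p + h *\<^sub>R w + \<sigma> *\<^sub>R v) - f (p + \<sigma> *\<^sub>R v))"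
  have "DERIV G \<sigma> :> dd v f (p + h *\<^sub>R w + \<sigma> *\<^sub>R v) - dd v f (p + \<sigma> *\<^sub>R v)" if "0 \<le> \<sigma>" "\<sigma> \<le> h" for \<sigma>
   unfolding G_def using inS[of \<sigma> h] inS[of \<sigma> 0] that h
   by (intro DERIV_diff dd_line df(1)) (auto simp: algebra_simps)
  then obtain \<xi> where xi: "0 < \<xi>" "\<xi> < h" "G h - G 0 = (h - 0) * (dd v f (p + h *\<^sub>R w + \<xi> *\<^sub>R v) - dd v f (p + \<xi> *\<^sub>R v))"
   using MVT2[of 0 h G "\<lambda>\<sigma>. dd v f (p + h *\<^sub>R w + \<sigma> *\<^sub>R v) - dd v f (p + \<sigma> *\<^sub>R v)"] h by blast
  have "DERIV (\<lambda>\<tau>. dd v f ((p + \<xi> *\<^sub>R v) + \<tau> *\<^sub>R w)) \<tau> :> dd w (dd v f) ((p + \<xi> *\<^sub>R v) + \<tau> *\<^sub>R w)" if "0 \<le> \<tau>" "\<tau> \<le> h" for \<tau>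
   using inS[of \<xi> \<tau>] that xi by (intro dd_line df(2)) auto
  then obtain \<zeta> where ze: "0 < \<zeta>" "\<zeta> < h"
   "dd v f ((p + \<xi> *\<^sub>R v) + h *\<^sub>R w) - dd v f ((p + \<xi> *\<^sub>R v) + 0 *\<^sub>R w) = (h - 0) * dd w (dd v f) ((p + \<xi> *\<^sub>R v) + \<zeta> *\<^sub>R w)"
   using MVT2[of 0 h "\<lambda>\<tau>. dd v f ((p + \<xi> *\<^sub>R v) + \<tau> *\<^sub>R w)" "\<lambda>\<tau>. dd w (dd v f) ((p + \<xi> *\<^sub>R v) + \<tau> *\<^sub>R w)"] h by blast
  have "G h - G 0 = h * h * dd w (dd v f) (p + \<xi> *\<^sub>R v + \<zeta> *\<^sub>R w)"
   using xi(3) ze(3) by (simp add: algebra_simps)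
  moreover have "G h - G 0 = f (p + h *\<^sub>R v + h *\<^sub>R w) - f (p + h *\<^sub>R w) - (f (p + h *\<^sub>R v) - f p)"
   by (simp add: G_def algebra_simps)
  ultimately show ?thesis using inb[of \<xi> \<zeta>] xi ze by (metis less_imp_le)
 qed
 obtain q1 where q1: "q1 \<in> ball p r" "\<Delta> = h * h * dd w (dd v f) q1"
  using key[OF inb] by (auto simp: \<Delta>_def)
 have "p + a *\<^sub>R w + b *\<^sub>R v \<in> ball p r" if "0 \<le> a" "a \<le> h" "0 \<le> b" "b \<le> h" for a b
  using inb[OF that(3,4,1,2)] by (simp add: algebra_simps)
 from key[OF this] obtain q2 where q2: "q2 \<in> ball p r" "\<Delta> = h * h * dd v (dd w f) q2"
  by (auto simp: \<Delta>_def algebra_simps)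
 have eq: "dd w (dd v f) q1 = dd v (dd w f) q2" using q1(2) q2(2) h by simp
 have "\<bar>dd v (dd w f) q2 - dd v (dd w f) p\<bar> < e" using r1(2)[of q2] q2(1) by (auto simp: r_def)
 moreover have "\<bar>dd w (dd v f) q1 - dd w (dd v f) p\<bar> < e" using r2(2)[of q1] q1(1) by (auto simp: r_def)
 moreover have "\<bar>c - A\<bar> < \<bar>A - B\<bar> / 2 \<Longrightarrow> \<bar>c - B\<bar> < \<bar>A - B\<bar> / 2 \<Longrightarrow> False" for A B c :: real
  using abs_triangle_ineq4[of "c - B" "c - A"] by simp
 ultimately show False using eq unfolding e_def by metis
qed

section \<open>Smooth functions on open sets\<close>

lemma Cinf_on_dd: "Cinf_on S f \<Longrightarrow> Cinf_on S (dd v f)"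
 using Ck_on_Suc_iff[of _ S f] by (auto simp: Cinf_on_def)

lemma Cinf_on_differentiable: "Cinf_on S f \<Longrightarrow> p \<in> S \<Longrightarrow> f differentiable (at p)"
 using Ck_on_Suc_iff[of 0 S f] by (auto simp: Cinf_on_def)

lemma Cinf_on_continuous: "Cinf_on S f \<Longrightarrow> continuous_on S f"
 using Ck_on_continuous[of 0 S f] by (auto simp: Cinf_on_def)

lemma Cinf_on_commute:
 fixes f :: "'a::real_normed_vector \<Rightarrow> real"
 shows "open S \<Longrightarrow> Cinf_on S f \<Longrightarrow> p \<in> S \<Longrightarrow> dd v (dd w f) p = dd w (dd v f) p"
 using dd_commute[of S p f v w] by (auto simp: Cinf_on_def)

lemma Cinf_on_subset: "Cinf_on S f \<Longrightarrow> T \<subseteq> S \<Longrightarrow> Cinf_on T f"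
 using Ck_on_subset[of _ S f T] by (auto simp: Cinf_on_def)

lemma Cinf_on_cong: "open S \<Longrightarrow> (\<And>q. q \<in> S \<Longrightarrow> f q = g q) \<Longrightarrow> Cinf_on S f \<Longrightarrow> Cinf_on S g"
 using Ck_on_cong[of S f g] by (auto simp: Cinf_on_def)

lemma Cinf_on_const [simp, intro]: "Cinf_on S (\<lambda>_. c)"
 by (simp add: Cinf_on_def del: Ck_on.simps)

lemma Cinf_on_linear: "open S \<Longrightarrow> bounded_linear L \<Longrightarrow> Cinf_on S L"
 unfolding Cinf_on_def using Ck_on_linear by blast

lemma Cinf_on_bounded_linear: "open S \<Longrightarrow> bounded_linear L \<Longrightarrow> Cinf_on S f \<Longrightarrow> Cinf_on S (\<lambda>q. L (f q))"
 unfolding Cinf_on_def using Ck_on_bounded_linear by blast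

lemma Cinf_on_add: "open S \<Longrightarrow> Cinf_on S f \<Longrightarrow> Cinf_on S g \<Longrightarrow> Cinf_on S (\<lambda>q. f q + g q)"
 unfolding Cinf_on_def using Ck_on_add by blast

lemma Cinf_on_sum: "open S \<Longrightarrow> (\<And>i. i \<in> I \<Longrightarrow> Cinf_on S (f i)) \<Longrightarrow> Cinf_on S (\<lambda>q. \<Sum>i\<in>I. f i q)"
 using Ck_on_sum[of S I _ f] by (auto simp: Cinf_on_def)

context
 fixes S :: "'a::real_normed_vector set" and f g :: "'a \<Rightarrow> real"
 assumes S: "open S"
begin

lemma Cinf_on_mult: "Cinf_on S f \<Longrightarrow> Cinf_on S g \<Longrightarrow> Cinf_on S (\<lambda>q. f q * g q)"
 unfolding Cinf_on_def using Ck_on_mult[OF S] by blast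

lemma Cinf_on_cmult: "Cinf_on S f \<Longrightarrow> Cinf_on S (\<lambda>q. c * f q)"
 unfolding Cinf_on_def using Ck_on_cmult[OF S] by blast

lemma Cinf_on_minus: "Cinf_on S f \<Longrightarrow> Cinf_on S (\<lambda>q. - f q)"
 unfolding Cinf_on_def using Ck_on_minus[OF S] by blast

lemma Cinf_on_diff: "Cinf_on S f \<Longrightarrow> Cinf_on S g \<Longrightarrow> Cinf_on S (\<lambda>q. f q - g q)"
 unfolding Cinf_on_def using Ck_on_diff[OF S] by blast

end

lemma Cinf_on_prod:
 fixes f :: "'i \<Rightarrow> 'a::real_normed_vector \<Rightarrow> real"
 shows "open S \<Longrightarrow> (\<And>i. i \<in> I \<Longrightarrow> Cinf_on S (f i)) \<Longrightarrow> Cinf_on S (\<lambda>q. \<Prod>i\<in>I. f i q)"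
 using Ck_on_prod[of S I _ f] by (auto simp: Cinf_on_def)

lemma Cinf_on_compose:
 fixes f :: "'a::real_normed_vector \<Rightarrow> 'c::euclidean_space" and g :: "'c \<Rightarrow> real"
 shows "open S \<Longrightarrow> Cinf_on S f \<Longrightarrow> Cinf_on T g \<Longrightarrow> f ` S \<subseteq> T \<Longrightarrow> Cinf_on S (\<lambda>q. g (f q))"
 using Ck_on_compose[of S _ f T g] by (auto simp: Cinf_on_def)

lemma Cinf_on_compose_real:
 fixes f :: "'a::real_normed_vector \<Rightarrow> real"
 assumes "open S" "Cinf_on S f" "\<And>q. q \<in> S \<Longrightarrow> f q > 0"
 shows "Cinf_on S (\<lambda>q. f q powr a)" "Cinf_on S (\<lambda>q. ln (f q))" "Cinf_on S (\<lambda>q. inverse (f q))"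
proof -
 have sub: "f ` S \<subseteq> {0<..}" using assms(3) by auto
 have C: "Cinf_on {0<..} (\<lambda>x::real. x powr a)" "Cinf_on {0<..} (ln :: real \<Rightarrow> real)"
  "Cinf_on {0<..} (\<lambda>x::real. inverse x)"
  using Ck_on_powr Ck_on_ln Ck_on_inverse by (auto simp: Cinf_on_def)
 show "Cinf_on S (\<lambda>q. f q powr a)" "Cinf_on S (\<lambda>q. ln (f q))" "Cinf_on S (\<lambda>q. inverse (f q))"
  using Cinf_on_compose[OF assms(1,2) C(1) sub] Cinf_on_compose[OF assms(1,2) C(2) sub]
   Cinf_on_compose[OF assms(1,2) C(3) sub] by auto
qed

section \<open>A Sobolev inequality on cubes\<close>

text \<open>Translation invariance makes the integral of every difference quotient zero, and
  dominated convergence carries this over to the derivative. Working along one direction avoids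
  iterated integrals.\<close>

lemma integral_line_derivative_zero:
 fixes f g :: "'a::euclidean_space \<Rightarrow> real"
 assumes K: "compact K" "\<And>z. z \<notin> K \<Longrightarrow> f z = 0"
  and der: "\<And>z. ((\<lambda>\<tau>. f (z + \<tau> *\<^sub>R v)) has_real_derivative g z) (at 0)"
  and cf: "continuous_on UNIV f" and cg: "continuous_on UNIV g"
 shows "integrable lborel g" "integral\<^sup>L lborel g = 0"
proof -
 have fK: "integrable lborel h" if "continuous_on UNIV h" "\<And>z. z \<notin> K \<Longrightarrow> h z = 0" for h :: "'a \<Rightarrow> real"
 proof -
  have "integrable lborel (\<lambda>z. indicator K z *\<^sub>R h z)"
   using K(1) that(1) by (intro borel_integrable_compact) (auto intro: continuous_on_subset)
  moreover have "(\<lambda>z. indicator K z *\<^sub>R h z) = h" using that(2) by (auto simp: indicator_def fun_eq_iff)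
  ultimately show ?thesis by simp
 qed
 have oK: "open (- K)" using K(1) by (simp add: compact_imp_closed open_Compl)
 have g0: "g z = 0" if "z \<notin> K" for z
 proof -
  have "((\<lambda>\<tau>::real. z + \<tau> *\<^sub>R v) \<longlongrightarrow> z + 0 *\<^sub>R v) (at 0)" by (intro tendsto_intros)
  then have "\<forall>\<^sub>F \<tau> in at 0. z + \<tau> *\<^sub>R v \<in> - K"
   using oK that by (intro topological_tendstoD) auto
  then have ev: "\<forall>\<^sub>F \<tau> in nhds 0. f (z + \<tau> *\<^sub>R v) = 0"
   using K(2) that by (auto simp: eventually_at_filter elim!: eventually_mono)
  then have "((\<lambda>\<tau>. 0) has_real_derivative g z) (at 0)"
   using der[of z] DERIV_cong_ev[OF refl ev refl] by blast
  then show ?thesis using DERIV_unique[OF DERIV_const] by metis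
 qed
 show ig: "integrable lborel g" using fK[OF cg g0] .
 have i_f: "integrable lborel f" using fK[OF cf K(2)] .
 have "compact (g ` K)" using K(1) cg by (meson compact_continuous_image continuous_on_subset subset_UNIV)
 then obtain M where M: "\<And>z. z \<in> K \<Longrightarrow> \<bar>g z\<bar> \<le> M" "M \<ge> 0"
  using compact_imp_bounded[of "g ` K"] by (auto simp: bounded_iff) (metis abs_ge_zero order_trans linear abs_le_zero_iff)
 have gM: "\<bar>g z\<bar> \<le> M" for z using M g0[of z] by (cases "z \<in> K") auto
 \<comment> \<open>The steps 1/(n+1) are at most 1, so all difference quotients vanish outside this
   enlargement of K by the length of v; M times its indicator is the integrable majorant.\<close>
 define K' where "K' = {x + y |x y. x \<in> K \<and> y \<in> cball 0 (norm v)}"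
 have cK': "compact K'" unfolding K'_def using K(1) by (intro compact_sums) auto
 have der': "((\<lambda>\<sigma>. f (z + \<sigma> *\<^sub>R v)) has_real_derivative g (z + \<tau> *\<^sub>R v)) (at \<tau>)" for z \<tau>
 proof -
  have "((\<lambda>\<sigma>. f ((z + \<tau> *\<^sub>R v) + \<sigma> *\<^sub>R v)) has_real_derivative g (z + \<tau> *\<^sub>R v)) (at (\<tau> - \<tau>))"
   using der[of "z + \<tau> *\<^sub>R v"] by simp
  then have "((\<lambda>\<sigma>. f ((z + \<tau> *\<^sub>R v) + (\<sigma> - \<tau>) *\<^sub>R v)) has_real_derivative g (z + \<tau> *\<^sub>R v)) (at \<tau>)"
   using DERIV_at_within_shift[of "\<lambda>\<sigma>. f ((z + \<tau> *\<^sub>R v) + \<sigma> *\<^sub>R v)" "g (z + \<tau> *\<^sub>R v)" "-\<tau>" \<tau> UNIV]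
   by (simp add: algebra_simps)
  then show ?thesis by (simp add: algebra_simps)
 qed
 define F where "F = (\<lambda>(n::nat) z. (f (z + (1 / real (Suc n)) *\<^sub>R v) - f z) * real (Suc n))"
 have trans: "integral\<^sup>L lborel (\<lambda>z. f (z + c)) = integral\<^sup>L lborel f" "integrable lborel (\<lambda>z. f (z + c))" for c
 proof -
  have mf: "f \<in> borel_measurable borel" using cf by (rule borel_measurable_continuous_onI)
  have "integral\<^sup>L (distr lborel borel ((+) c)) f = integral\<^sup>L lborel (\<lambda>z. f (c + z))"
   by (rule integral_distr) (use mf in auto)
  then show "integral\<^sup>L lborel (\<lambda>z. f (z + c)) = integral\<^sup>L lborel f"
   by (simp add: lborel_distr_plus add.commute)
  have "integrable (distr lborel borel ((+) c)) f = integrable lborel (\<lambda>z. f (c + z))"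
   by (rule integrable_distr_eq) (use mf in auto)
  then show "integrable lborel (\<lambda>z. f (z + c))"
   using i_f by (simp add: lborel_distr_plus add.commute)
 qed
 have F0: "integral\<^sup>L lborel (F n) = 0" for n
  unfolding F_def using trans i_f by simp
 have bound: "\<bar>F n z\<bar> \<le> M * indicator K' z" for n z
 proof (cases "F n z = 0")
  case False
  define h where "h = 1 / real (Suc n)"
  have h: "0 < h" "h \<le> 1" by (auto simp: h_def field_simps)
  obtain \<xi> where xi: "f (z + h *\<^sub>R v) - f (z + 0 *\<^sub>R v) = (h - 0) * g (z + \<xi> *\<^sub>R v)" "0 < \<xi>" "\<xi> < h"
   using MVT2[of 0 h "\<lambda>\<sigma>. f (z + \<sigma> *\<^sub>R v)" "\<lambda>\<sigma>. g (z + \<sigma> *\<^sub>R v)"] der' h by metis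
  have "F n z = g (z + \<xi> *\<^sub>R v)"
   using xi(1) h by (simp add: F_def h_def field_simps)
  then have le: "\<bar>F n z\<bar> \<le> M" using gM by simp
  have "z + \<xi> *\<^sub>R v \<in> K" using False \<open>F n z = g _\<close> g0 by metis
  moreover have "- \<xi> *\<^sub>R v \<in> cball 0 (norm v)" using xi h by (simp add: mult_left_le_one_le)
  moreover have "z = (z + \<xi> *\<^sub>R v) + - \<xi> *\<^sub>R v" by simp
  ultimately have "z \<in> K'" unfolding K'_def by blast
  then show ?thesis using le by simp
 qed (use M in \<open>auto simp: indicator_def\<close>)
 have lim: "(\<lambda>n. F n z) \<longlonglongrightarrow> g z" for z
 proof -
  have "((\<lambda>h. (f (z + h *\<^sub>R v) - f z) / h) \<longlongrightarrow> g z) (at 0)"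
   using der[of z] by (simp add: DERIV_def)
  moreover have "filterlim (\<lambda>n. 1 / real (Suc n)) (at 0) sequentially"
   unfolding filterlim_at using LIMSEQ_Suc[OF lim_1_over_n] by simp
  ultimately have "((\<lambda>n. (f (z + (1 / real (Suc n)) *\<^sub>R v) - f z) / (1 / real (Suc n))) \<longlongrightarrow> g z) sequentially"
   by (rule filterlim_compose)
  then show ?thesis by (simp add: F_def)
 qed
 have "(\<lambda>n. integral\<^sup>L lborel (F n)) \<longlonglongrightarrow> integral\<^sup>L lborel g"
 proof (rule integral_dominated_convergence[where w="\<lambda>z. M * indicator K' z"])
  show "g \<in> borel_measurable lborel" "\<And>n. F n \<in> borel_measurable lborel"
   using ig trans(2) i_f unfolding F_def by (auto intro!: borel_measurable_times borel_measurable_diff)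
  have "integrable lborel (\<lambda>z. indicator K' z *\<^sub>R M)"
   by (intro borel_integrable_compact cK') auto
  then show "integrable lborel (\<lambda>z. M * indicator K' z)" by (simp add: mult.commute)
 qed (use lim bound in auto)
 then show "integral\<^sup>L lborel g = 0"
  using F0 LIMSEQ_unique[OF tendsto_const[of 0]] by simp
qed

text \<open>The bound of |f 0| by |f t| plus the integral of |f'| is averaged over t in [0, r]. Only
  values on one side of the point enter.\<close>

lemma point_le_integral_1d:
 fixes f f' :: "real \<Rightarrow> real"
 assumes r: "r > 0"
  and der: "\<And>t. t \<in> {0..r} \<Longrightarrow> (f has_real_derivative f' t) (at t within {0..r})"
  and cf': "continuous_on {0..r} f'"
 shows "ennreal \<bar>f 0\<bar> \<le> (\<integral>\<^sup>+t. ennreal (max 1 (1/r) * (\<bar>f t\<bar> + \<bar>f' t\<bar>)) * indicator {0..r} t \<partial>lborel)"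
proof -
 have cf: "continuous_on {0..r} f" using der DERIV_continuous_on by blast
 have int: "(\<lambda>t. \<bar>f t\<bar>) integrable_on {0..r}" "(\<lambda>t. \<bar>f' t\<bar>) integrable_on {0..r}"
  using cf cf' by (auto intro!: integrable_continuous_interval continuous_intros)
 define J where "J = integral {0..r} (\<lambda>t. \<bar>f' t\<bar>)"
 have pt: "\<bar>f 0\<bar> \<le> \<bar>f t\<bar> + J" if t: "t \<in> {0..r}" for t
 proof -
  have sub: "{0..t} \<subseteq> {0..r}" using t by auto
  have "(f' has_integral (f t - f 0)) {0..t}"
   using der t sub
   by (intro fundamental_theorem_of_calculus)
    (auto simp: has_real_derivative_iff_has_vector_derivative[symmetric] intro!: DERIV_subset[OF der])
  then have "f t - f 0 = integral {0..t} f'" by (simp add: integral_unique)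
  also have "\<bar>\<dots>\<bar> \<le> integral {0..t} (\<lambda>t. \<bar>f' t\<bar>)"
   using integral_norm_bound_integral[of f' "{0..t}" "\<lambda>t. \<bar>f' t\<bar>"] continuous_on_subset[OF cf' sub]
   by (simp add: integrable_continuous_interval continuous_intros)
  also have "\<dots> \<le> J" unfolding J_def using sub int(2) cf'
   by (intro integral_subset_le) (auto intro!: integrable_continuous_interval continuous_intros intro: continuous_on_subset)
  finally show ?thesis by linarith
 qed
 have "r * \<bar>f 0\<bar> = integral {0..r} (\<lambda>t. \<bar>f 0\<bar>)" using r by simp
 also have "\<dots> \<le> integral {0..r} (\<lambda>t. \<bar>f t\<bar> + J)"
  using int pt by (intro integral_le integrable_add) auto
 also have "\<dots> = integral {0..r} (\<lambda>t. \<bar>f t\<bar>) + r * J"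
  using int r by (subst integral_add) auto
 finally have "\<bar>f 0\<bar> \<le> (1/r) * integral {0..r} (\<lambda>t. \<bar>f t\<bar>) + J" using r by (simp add: field_simps)
 also have "\<dots> = integral {0..r} (\<lambda>t. (1/r) * \<bar>f t\<bar> + \<bar>f' t\<bar>)"
  unfolding J_def using int integrable_on_mult_right[OF int(1), of "1/r"] by (subst integral_add) auto
 also have "\<dots> \<le> integral {0..r} (\<lambda>t. max 1 (1/r) * (\<bar>f t\<bar> + \<bar>f' t\<bar>))"
 proof (intro integral_le integrable_add integrable_on_mult_right int)
  show "(1/r) * \<bar>f t\<bar> + \<bar>f' t\<bar> \<le> max 1 (1/r) * (\<bar>f t\<bar> + \<bar>f' t\<bar>)" for t
   using mult_right_mono[of "1/r" "max 1 (1/r)" "\<bar>f t\<bar>"] mult_right_mono[of 1 "max 1 (1/r)" "\<bar>f' t\<bar>"]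
   by (simp add: distrib_left)
 qed
 finally have le: "\<bar>f 0\<bar> \<le> integral {0..r} (\<lambda>t. max 1 (1/r) * (\<bar>f t\<bar> + \<bar>f' t\<bar>))" .
 have "(\<integral>\<^sup>+t. ennreal (max 1 (1/r) * (\<bar>f t\<bar> + \<bar>f' t\<bar>)) * indicator {0..r} t \<partial>lborel)
   = ennreal (integral {0..r} (\<lambda>t. max 1 (1/r) * (\<bar>f t\<bar> + \<bar>f' t\<bar>)))"
  by (rule nn_integral_has_integral_lebesgue'[OF _ integrable_integral])
    (intro integrable_on_mult_right integrable_add int mult_nonneg_nonneg; simp)+
 then show ?thesis using le by (simp add: ennreal_leI)
qed

text \<open>A word of directions whose last letter acts first. Words, unlike multi-indices, need no
  fixed order of the directions.\<close>

primrec Dl :: "'a list \<Rightarrow> ('a::real_normed_vector \<Rightarrow> real) \<Rightarrow> 'a \<Rightarrow> real" where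
 "Dl [] f = f"
| "Dl (v # l) f = dd v (Dl l f)"

lemma Ck_on_Dl: "Ck_on (k + length l) S f \<Longrightarrow> Ck_on k S (Dl l f)"
proof (induction l arbitrary: k)
 case (Cons v l)
 then have "Ck_on (Suc k) S (Dl l f)" by (metis add_Suc_right add_Suc length_Cons)
 then show ?case by (simp add: Ck_on_Suc_iff)
qed auto

lemma Cinf_on_Dl: "Cinf_on S f \<Longrightarrow> Cinf_on S (Dl l f)"
 by (induction l) (auto intro: Cinf_on_dd)

lemma length_subseqs_le: "l \<in> set (subseqs bs) \<Longrightarrow> length l \<le> length bs"
 by (induction bs arbitrary: l) (auto simp: Let_def le_SucI)

text \<open>Measurability is carried along in the induction, because the integral of a sum is split
  at each step.\<close>

lemma sum_list_le_nn_integral: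
 fixes \<phi> :: "'b \<Rightarrow> real"
 assumes "\<And>l. l \<in> set L \<Longrightarrow> ennreal (\<phi> l) \<le> (\<integral>\<^sup>+t. ennreal (\<psi> l t) * indicator A t \<partial>M)"
  and "\<And>l. l \<in> set L \<Longrightarrow> (\<lambda>t. ennreal (\<psi> l t) * indicator A t) \<in> borel_measurable M"
  and "\<And>l. l \<in> set L \<Longrightarrow> 0 \<le> \<phi> l" "\<And>l t. l \<in> set L \<Longrightarrow> 0 \<le> \<psi> l t"
 shows "ennreal (\<Sum>l\<leftarrow>L. \<phi> l) \<le> (\<integral>\<^sup>+t. ennreal (\<Sum>l\<leftarrow>L. \<psi> l t) * indicator A t \<partial>M)
  \<and> (\<lambda>t. ennreal (\<Sum>l\<leftarrow>L. \<psi> l t) * indicator A t) \<in> borel_measurable M"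
 using assms
proof (induction L)
 case (Cons a L)
 have nn: "0 \<le> (\<Sum>l\<leftarrow>L. \<phi> l)" "\<And>t. 0 \<le> (\<Sum>l\<leftarrow>L. \<psi> l t)"
  using Cons.prems by (auto intro!: sum_list_nonneg)
 have IH: "ennreal (\<Sum>l\<leftarrow>L. \<phi> l) \<le> (\<integral>\<^sup>+t. ennreal (\<Sum>l\<leftarrow>L. \<psi> l t) * indicator A t \<partial>M)"
  "(\<lambda>t. ennreal (\<Sum>l\<leftarrow>L. \<psi> l t) * indicator A t) \<in> borel_measurable M"
  using Cons by auto
 have eq: "ennreal (\<Sum>l\<leftarrow>a # L. \<psi> l t) * indicator A t =
   ennreal (\<psi> a t) * indicator A t + ennreal (\<Sum>l\<leftarrow>L. \<psi> l t) * indicator A t" for t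
  using nn(2) Cons.prems(4)[of a t] by (simp add: ennreal_plus distrib_right)
 have "ennreal (\<Sum>l\<leftarrow>a # L. \<phi> l) = ennreal (\<phi> a) + ennreal (\<Sum>l\<leftarrow>L. \<phi> l)"
  using nn(1) Cons.prems(3)[of a] by (simp add: ennreal_plus)
 also have "\<dots> \<le> (\<integral>\<^sup>+t. ennreal (\<psi> a t) * indicator A t \<partial>M) + (\<integral>\<^sup>+t. ennreal (\<Sum>l\<leftarrow>L. \<psi> l t) * indicator A t \<partial>M)"
  using IH Cons.prems(1)[of a] by (intro add_mono) auto
 also have "\<dots> = (\<integral>\<^sup>+t. ennreal (\<Sum>l\<leftarrow>a # L. \<psi> l t) * indicator A t \<partial>M)"
  unfolding eq using IH(2) Cons.prems(2)[of a] by (intro nn_integral_add[symmetric]) auto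
 finally have 1: "ennreal (\<Sum>l\<leftarrow>a # L. \<phi> l) \<le> (\<integral>\<^sup>+t. ennreal (\<Sum>l\<leftarrow>a # L. \<psi> l t) * indicator A t \<partial>M)" .
 have 2: "(\<lambda>t. ennreal (\<Sum>l\<leftarrow>a # L. \<psi> l t) * indicator A t) \<in> borel_measurable M"
  unfolding eq using IH(2) Cons.prems(2)[of a] by (intro borel_measurable_add) auto
 show ?case using 1 2 by blast
qed simp

text \<open>Each direction of \<open>bs\<close> occurs at most once in a word. For a basis these are
  the mixed derivatives whose L1 norms on a cube bound the function pointwise.\<close>

definition mixed_sum :: "'a list \<Rightarrow> ('a::real_normed_vector \<Rightarrow> real) \<Rightarrow> 'a \<Rightarrow> real" where
 "mixed_sum bs f w = (\<Sum>l\<leftarrow>subseqs bs. \<bar>Dl l f w\<bar>)"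

lemma mixed_sum_nonneg: "0 \<le> mixed_sum bs f w"
 unfolding mixed_sum_def by (intro sum_list_nonneg) auto

lemma mixed_sum_Cons:
 "mixed_sum (b # bs) f w = (\<Sum>l\<leftarrow>subseqs bs. \<bar>Dl l f w\<bar> + \<bar>dd b (Dl l f) w\<bar>)"
 by (simp add: mixed_sum_def Let_def comp_def sum_list_addf)

lemma continuous_on_mixed_sum:
 assumes "Ck_on (length bs) S f"
 shows "continuous_on S (mixed_sum bs f)"
proof -
 have "continuous_on S (\<lambda>w. \<Sum>l\<leftarrow>L. \<bar>Dl l f w\<bar>)" if "set L \<subseteq> set (subseqs bs)" for L
  using that
 proof (induction L)
  case (Cons l L)
  have "Ck_on 0 S (Dl l f)"
   by (rule Ck_on_Dl, rule Ck_on_le[OF assms]) (use length_subseqs_le[of l bs] Cons.prems in auto)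
  then show ?case using Cons by (auto intro!: continuous_intros)
 qed auto
 then show ?thesis unfolding mixed_sum_def[abs_def] by auto
qed

text \<open>Induction over the directions: z has the coordinates of the corner in the directions of
  \<open>bs\<close>, and only these are integrated. A new direction b is inserted by the
  one-dimensional inequality, applied to every derivative already present; this turns the sum over
  words in \<open>bs\<close> into the one over words in \<open>b # bs\<close>.\<close>

lemma sobolev_product:
 fixes f :: "'a::euclidean_space \<Rightarrow> real"
 defines "M \<equiv> (\<lambda>_. lborel :: real measure)"
 assumes \<Omega>: "open \<Omega>" "cbox a (a + r *\<^sub>R One) \<subseteq> \<Omega>" and r: "r > 0"
  and "Ck_on (length bs) \<Omega> f" "distinct bs" "set bs \<subseteq> Basis"
  and "z \<in> cbox a (a + r *\<^sub>R One)" "\<And>b. b \<in> set bs \<Longrightarrow> z \<bullet> b = a \<bullet> b"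
 shows "ennreal \<bar>f z\<bar> \<le> (\<integral>\<^sup>+y. ennreal (max 1 (1/r) ^ length bs * mixed_sum bs f (z + (\<Sum>b\<in>set bs. y b *\<^sub>R b)))
   * indicator (cbox a (a + r *\<^sub>R One)) (z + (\<Sum>b\<in>set bs. y b *\<^sub>R b)) \<partial>Pi\<^sub>M (set bs) M)"
 using assms(5-9)
proof (induction bs)
 case Nil
 interpret product_sigma_finite M unfolding M_def by standard
 show ?case using Nil by (simp add: mixed_sum_def nn_integral_empty space_PiM_empty emeasure_PiM_empty)
next
 case (Cons b bs)
 interpret product_sigma_finite M unfolding M_def by standard
 let ?B = "cbox a (a + r *\<^sub>R One)" and ?C = "max 1 (1/r)" and ?I = "set bs"
 define w where "w = (\<lambda>y. z + (\<Sum>c\<in>?I. y c *\<^sub>R c))"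
 define h where "h = (\<lambda>w. ennreal (?C ^ Suc (length bs) * mixed_sum (b # bs) f w) * indicator ?B w)"
 have b: "b \<in> Basis" "b \<notin> ?I" "z \<bullet> b = a \<bullet> b" using Cons.prems by auto
 have hm: "h \<in> borel_measurable borel"
 proof -
  have "continuous_on ?B (\<lambda>w. ?C ^ Suc (length bs) * mixed_sum (b # bs) f w)"
   using continuous_on_mixed_sum[OF Cons.prems(1)] \<Omega>(2) by (intro continuous_intros) (auto intro: continuous_on_subset)
  then have "(\<lambda>w. indicator ?B w *\<^sub>R (?C ^ Suc (length bs) * mixed_sum (b # bs) f w)) \<in> borel_measurable borel"
   by (intro borel_measurable_continuous_on_indicator) auto
  then have "(\<lambda>w. ennreal (indicator ?B w *\<^sub>R (?C ^ Suc (length bs) * mixed_sum (b # bs) f w))) \<in> borel_measurable borel"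
   by measurable
  moreover have "(\<lambda>w. ennreal (indicator ?B w *\<^sub>R (?C ^ Suc (length bs) * mixed_sum (b # bs) f w))) = h"
   by (auto simp: h_def indicator_def fun_eq_iff)
  ultimately show ?thesis by simp
 qed
 have eqw: "z + (\<Sum>c\<in>set (b # bs). (x(b := t)) c *\<^sub>R c) = w x + t *\<^sub>R b" for x t
 proof -
  have "(\<Sum>c\<in>?I. (x(b := t)) c *\<^sub>R c) = (\<Sum>c\<in>?I. x c *\<^sub>R c)" using b(2) by (intro sum.cong) auto
  then show ?thesis using b(2) by (simp add: w_def algebra_simps)
 qed
 have meas: "(\<lambda>y. h (z + (\<Sum>c\<in>insert b ?I. y c *\<^sub>R c))) \<in> borel_measurable (Pi\<^sub>M (insert b ?I) M)"
 proof (rule measurable_compose[OF _ hm])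
  show "(\<lambda>y. z + (\<Sum>c\<in>insert b ?I. y c *\<^sub>R c)) \<in> borel_measurable (Pi\<^sub>M (insert b ?I) M)"
  proof (intro borel_measurable_add borel_measurable_const borel_measurable_sum borel_measurable_scaleR)
   fix c assume "c \<in> insert b ?I"
   then have "(\<lambda>y. y c) \<in> measurable (Pi\<^sub>M (insert b ?I) M) (M c)" by (rule measurable_component_singleton)
   then show "(\<lambda>y. y c) \<in> borel_measurable (Pi\<^sub>M (insert b ?I) M)" by (simp add: M_def)
  qed
 qed
 \<comment> \<open>The line through \<open>w x\<close> in direction b meets the cube exactly for t
   in [0, r], because the b-coordinate of \<open>w x\<close> is still that of the corner.\<close>
 have step: "ennreal (?C ^ length bs * mixed_sum bs f (w x)) * indicator ?B (w x) \<le> (\<integral>\<^sup>+t. h (w x + t *\<^sub>R b) \<partial>lborel)" for x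
 proof (cases "w x \<in> ?B")
  case True
  let ?g = "\<lambda>l t. ?C * (\<bar>Dl l f (w x + t *\<^sub>R b)\<bar> + \<bar>dd b (Dl l f) (w x + t *\<^sub>R b)\<bar>)" and ?m = "\<lambda>t. mixed_sum (b # bs) f (w x + t *\<^sub>R b)"
  have wb: "w x \<bullet> b = a \<bullet> b"
  proof -
   have "(\<Sum>c\<in>?I. x c *\<^sub>R c) \<bullet> b = 0"
    using b Cons.prems by (auto simp: inner_sum_left inner_Basis intro!: sum.neutral)
   then show ?thesis using b by (simp add: w_def inner_add_left)
  qed
  have inB: "w x + t *\<^sub>R b \<in> ?B \<longleftrightarrow> t \<in> {0..r}" for t
  proof -
   have "(w x + t *\<^sub>R b) \<bullet> c = w x \<bullet> c + (if c = b then t else 0)" if "c \<in> Basis" for c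
    using that b by (simp add: inner_add_left inner_Basis)
   then show ?thesis using True b wb
    by (auto simp: mem_box inner_add_left split: if_splits)
  qed
  have 1: "ennreal \<bar>Dl l f (w x)\<bar> \<le> (\<integral>\<^sup>+t. ennreal (?g l t) * indicator {0..r} t \<partial>lborel)
   \<and> (\<lambda>t. ennreal (?g l t) * indicator {0..r} t) \<in> borel_measurable lborel"
   if l: "l \<in> set (subseqs bs)" for l
  proof -
   have "Ck_on (Suc 0) \<Omega> (Dl l f)"
    by (rule Ck_on_Dl, rule Ck_on_le[OF Cons.prems(1)]) (use length_subseqs_le[OF l] in auto)
   then have d: "\<And>p. p \<in> \<Omega> \<Longrightarrow> Dl l f differentiable (at p)" "continuous_on \<Omega> (dd b (Dl l f))" "continuous_on \<Omega> (Dl l f)"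
    using Ck_on_continuous[of "Suc 0" \<Omega> "Dl l f"] by (auto simp: Ck_on_Suc_iff)
   have c: "continuous_on {0..r} (\<lambda>t. g (w x + t *\<^sub>R b))" if "continuous_on \<Omega> g" for g :: "'a \<Rightarrow> real"
    by (rule continuous_on_compose2[OF that]) (use inB \<Omega>(2) in \<open>auto intro!: continuous_intros\<close>)
   have "continuous_on {0..r} (\<lambda>t. ?g l t)"
    by (intro continuous_intros c d)
   then have "(\<lambda>t. indicator {0..r} t *\<^sub>R (?g l t)) \<in> borel_measurable borel"
    by (intro borel_measurable_continuous_on_indicator) auto
   then have "(\<lambda>t. ennreal (indicator {0..r} t *\<^sub>R (?g l t))) \<in> borel_measurable lborel"
    by measurable
   moreover have "(\<lambda>t. ennreal (indicator {0..r} t *\<^sub>R (?g l t)))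
     = (\<lambda>t. ennreal (?g l t) * indicator {0..r} t)"
    by (auto simp: indicator_def fun_eq_iff)
   moreover have "ennreal \<bar>Dl l f (w x + 0 *\<^sub>R b)\<bar> \<le> (\<integral>\<^sup>+t. ennreal (?g l t) * indicator {0..r} t \<partial>lborel)"
    using inB \<Omega>(2) by (intro point_le_integral_1d r dd_line c d) auto
   ultimately show ?thesis by (simp only: scaleR_zero_left add_0_right)
  qed
  have "ennreal (mixed_sum bs f (w x)) \<le> (\<integral>\<^sup>+t. ennreal (\<Sum>l\<leftarrow>subseqs bs. ?g l t) * indicator {0..r} t \<partial>lborel)
   \<and> (\<lambda>t. ennreal (\<Sum>l\<leftarrow>subseqs bs. ?g l t) * indicator {0..r} t) \<in> borel_measurable lborel"
   unfolding mixed_sum_def by (rule sum_list_le_nn_integral) (use 1 in auto)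
  then have 2: "ennreal (mixed_sum bs f (w x)) \<le> (\<integral>\<^sup>+t. ennreal (?C * ?m t) * indicator {0..r} t \<partial>lborel)"
    "(\<lambda>t. ennreal (?C * ?m t) * indicator {0..r} t) \<in> borel_measurable lborel"
   unfolding mixed_sum_Cons sum_list_const_mult by auto
  have "ennreal (?C ^ length bs * mixed_sum bs f (w x)) = ennreal (?C ^ length bs) * ennreal (mixed_sum bs f (w x))"
   by (intro ennreal_mult mixed_sum_nonneg) auto
  also have "\<dots> \<le> ennreal (?C ^ length bs) * (\<integral>\<^sup>+t. ennreal (?C * ?m t) * indicator {0..r} t \<partial>lborel)"
   using 2 by (intro mult_left_mono) auto
  also have "\<dots> = (\<integral>\<^sup>+t. ennreal (?C ^ length bs) * (ennreal (?C * ?m t) * indicator {0..r} t) \<partial>lborel)"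
   by (rule nn_integral_cmult[symmetric]) (use 2 in auto)
  also have "\<dots> = (\<integral>\<^sup>+t. h (w x + t *\<^sub>R b) \<partial>lborel)"
  proof (rule nn_integral_cong)
   fix t
   have "ennreal (?C ^ length bs) * ennreal (?C * ?m t) = ennreal (?C ^ Suc (length bs) * ?m t)"
    by (subst ennreal_mult[symmetric]) (auto intro!: mult_nonneg_nonneg mixed_sum_nonneg simp: ac_simps)
   moreover have "indicator {0..r} t = (indicator ?B (w x + t *\<^sub>R b) :: ennreal)"
    using inB[of t] by (auto simp: indicator_def)
   ultimately show "ennreal (?C ^ length bs) * (ennreal (?C * ?m t) * indicator {0..r} t) = h (w x + t *\<^sub>R b)"
    by (simp only: h_def mult.assoc[symmetric])
  qed
  finally show ?thesis using True by simp
 qed simp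
 have "ennreal \<bar>f z\<bar> \<le> (\<integral>\<^sup>+x. ennreal (?C ^ length bs * mixed_sum bs f (w x)) * indicator ?B (w x) \<partial>Pi\<^sub>M ?I M)"
  unfolding w_def using Cons.prems by (intro Cons.IH) (auto intro: Ck_on_SucD)
 also have "\<dots> \<le> (\<integral>\<^sup>+x. (\<integral>\<^sup>+t. h (w x + t *\<^sub>R b) \<partial>lborel) \<partial>Pi\<^sub>M ?I M)"
  by (intro nn_integral_mono step)
 also have "\<dots> = (\<integral>\<^sup>+y. h (z + (\<Sum>c\<in>insert b ?I. y c *\<^sub>R c)) \<partial>Pi\<^sub>M (insert b ?I) M)"
  unfolding product_nn_integral_insert[OF finite_set b(2) meas]
  using eqw by (simp add: M_def del: fun_upd_apply sum.insert)
 finally show ?case by (simp add: h_def)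
qed

text \<open>The point is the lowest corner of the cube. In the application x is then nowhere smaller
  on the cube than at the point, and the size of the cube does not shrink as the point approaches x
  = 0.\<close>

lemma sobolev_cube:
 fixes f :: "'a::euclidean_space \<Rightarrow> real"
 assumes \<Omega>: "open \<Omega>" "cbox a (a + r *\<^sub>R One) \<subseteq> \<Omega>" and r: "r > 0"
  and f: "Ck_on (length bs) \<Omega> f" and bs: "distinct bs" "set bs = Basis"
 shows "ennreal \<bar>f a\<bar> \<le> (\<integral>\<^sup>+w. ennreal (max 1 (1/r) ^ length bs * mixed_sum bs f w)
   * indicator (cbox a (a + r *\<^sub>R One)) w \<partial>lborel)"
proof -
 let ?B = "cbox a (a + r *\<^sub>R One)"
 define h where "h = (\<lambda>w. ennreal (max 1 (1/r) ^ length bs * mixed_sum bs f w) * indicator ?B w)"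
 have hm: "h \<in> borel_measurable borel"
 proof -
  have "continuous_on ?B (\<lambda>w. max 1 (1/r) ^ length bs * mixed_sum bs f w)"
   using continuous_on_mixed_sum[OF f] \<Omega>(2) by (intro continuous_intros) (auto intro: continuous_on_subset)
  then have "(\<lambda>w. indicator ?B w *\<^sub>R (max 1 (1/r) ^ length bs * mixed_sum bs f w)) \<in> borel_measurable borel"
   by (intro borel_measurable_continuous_on_indicator) auto
  then have "(\<lambda>w. ennreal (indicator ?B w *\<^sub>R (max 1 (1/r) ^ length bs * mixed_sum bs f w))) \<in> borel_measurable borel"
   by measurable
  moreover have "(\<lambda>w. ennreal (indicator ?B w *\<^sub>R (max 1 (1/r) ^ length bs * mixed_sum bs f w))) = h"
   by (auto simp: h_def indicator_def fun_eq_iff)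
  ultimately show ?thesis by simp
 qed
 have "a \<in> ?B" using r by (auto simp: mem_box inner_add_left)
 then have "ennreal \<bar>f a\<bar> \<le> (\<integral>\<^sup>+y. h (a + (\<Sum>b\<in>Basis. y b *\<^sub>R b)) \<partial>Pi\<^sub>M Basis (\<lambda>_. lborel))"
  unfolding h_def using sobolev_product[OF \<Omega> r f bs(1), of a] bs(2) by auto
 also have "\<dots> = (\<integral>\<^sup>+w. h (a + w) \<partial>distr (Pi\<^sub>M Basis (\<lambda>_. lborel)) borel (\<lambda>y. \<Sum>b\<in>Basis. y b *\<^sub>R b))"
  using hm by (subst nn_integral_distr) (auto intro!: measurable_compose[OF _ hm])
 also have "\<dots> = (\<integral>\<^sup>+w. h (a + w) \<partial>lborel)" using lborel_eq[where 'a='a] by simp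
 also have "\<dots> = (\<integral>\<^sup>+w. h w \<partial>distr lborel borel ((+) a))"
  using hm by (subst nn_integral_distr) auto
 also have "\<dots> = (\<integral>\<^sup>+w. h w \<partial>lborel)" by (simp add: lborel_distr_plus)
 finally show ?thesis by (simp add: h_def)
qed

section \<open>Energy estimates for the model operator\<close>

type_synonym 'n pt = "real \<times> real \<times> (real ^ 'n)"

type_synonym 'n fn = "'n pt \<Rightarrow> real"

definition eX :: "'n::finite pt" where "eX = (1, 0, 0)"
definition eS :: "'n::finite pt" where "eS = (0, 1, 0)"
definition eH :: "'n::finite \<Rightarrow> 'n pt" where "eH i = (0, 0, axis i 1)"

text \<open>In the variables (x, t, y) with t = s - ln x this is the null field x d/dx + d/dt, while
  \<open>eX\<close> becomes the other one, d/dx - (1/x) d/dt. The function s - 2 ln x is constant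
  along it.\<close>

definition Yd :: "'n::finite fn \<Rightarrow> 'n fn" where
 "Yd f z = fst z * dd eX f z + 2 * dd eS f z"

text \<open>Extension by zero reduces this to the whole space: f vanishes on the part of the region
  outside K, so the extended function has the extended derivative everywhere.\<close>

lemma LINT_dd_eq_0:
 fixes f :: "'a::euclidean_space \<Rightarrow> real"
 assumes \<Omega>: "open \<Omega>" and K: "compact K" "K \<subseteq> \<Omega>" and f: "Ck_on 1 \<Omega> f"
  and f0: "\<And>z. z \<in> \<Omega> - K \<Longrightarrow> f z = 0"
 shows "set_integrable lborel \<Omega> (dd v f)" "(LINT z:\<Omega>|lborel. dd v f z) = 0"
proof -
 define F where "F = (\<lambda>z. indicator \<Omega> z *\<^sub>R f z)"
 define G where "G = (\<lambda>z. indicator \<Omega> z *\<^sub>R dd v f z)"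
 have oK: "open (- K)" using K by (simp add: compact_imp_closed open_Compl)
 have op: "open (\<Omega> - K)" using \<Omega> K by (simp add: compact_imp_closed open_Diff)
 have df: "f differentiable (at z)" if "z \<in> \<Omega>" for z
  using f that by (auto simp: Ck_on_Suc_iff)
 have dd0: "dd v f z = 0" if "z \<in> \<Omega> - K" for z
  using dd_cong_open[OF op, of f "\<lambda>_. 0" z v] f0 that by auto
 have F0: "F z = 0" "G z = 0" if "z \<notin> K" for z using that f0 dd0 by (auto simp: F_def G_def indicator_def)
 have FF: "F z = f z" "G z = dd v f z" if "z \<in> \<Omega>" for z using that by (auto simp: F_def G_def)
 have U: "(\<Union>{\<Omega>, - K}) = UNIV" using K by auto
 have cont: "continuous_on UNIV h" if "continuous_on \<Omega> h" "\<And>z. z \<notin> K \<Longrightarrow> h z = 0" for h :: "'a \<Rightarrow> real"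
 proof -
  have "continuous_on (- K) h" using that(2) continuous_on_cong[of "- K" "- K" h "\<lambda>_. 0"] by simp
  then show ?thesis using continuous_on_open_Union[of "{\<Omega>, - K}" h] that(1) \<Omega> oK U by auto
 qed
 have cfg: "continuous_on \<Omega> f" "continuous_on \<Omega> (dd v f)"
  using Ck_on_continuous[OF f] f by (auto simp: Ck_on_Suc_iff)
 have cF: "continuous_on UNIV F" "continuous_on UNIV G"
  using continuous_on_cong[OF refl FF(1), of \<Omega>] continuous_on_cong[OF refl FF(2), of \<Omega>] cfg
  by (intro cont F0; simp)+
 have der: "((\<lambda>\<tau>. F (z + \<tau> *\<^sub>R v)) has_real_derivative G z) (at 0)" for z
 proof -
  have ev: "\<forall>\<^sub>F \<tau> in nhds (0::real). z + \<tau> *\<^sub>R v \<in> S" if "open S" "z \<in> S" for S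
  proof -
   have "((\<lambda>\<tau>::real. z + \<tau> *\<^sub>R v) \<longlongrightarrow> z + 0 *\<^sub>R v) (nhds 0)"
    by (intro tendsto_intros) (simp add: filterlim_def)
   then show ?thesis using that by (intro topological_tendstoD) auto
  qed
  show ?thesis
  proof (cases "z \<in> \<Omega>")
   case True
   have "\<forall>\<^sub>F \<tau> in nhds 0. f (z + \<tau> *\<^sub>R v) = F (z + \<tau> *\<^sub>R v)"
    using ev[OF \<Omega> True] by eventually_elim (simp add: FF)
   from DERIV_cong_ev[OF refl this refl, of "dd v f z"] show ?thesis
    using dd_line0[OF df[OF True], of v] FF[OF True] by simp
  next
   case False
   then have zK: "z \<in> - K" using K by auto
   have "\<forall>\<^sub>F \<tau> in nhds 0. 0 = F (z + \<tau> *\<^sub>R v)"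
    using ev[OF oK zK] by eventually_elim (simp add: F0)
   from DERIV_cong_ev[OF refl this refl, of 0] show ?thesis
    using F0(2)[of z] zK by simp
  qed
 qed
 have "integrable lborel G" "integral\<^sup>L lborel G = 0"
  using integral_line_derivative_zero[OF K(1) F0(1) der cF] by auto
 then show "set_integrable lborel \<Omega> (dd v f)" "(LINT z:\<Omega>|lborel. dd v f z) = 0"
  by (auto simp: set_integrable_def set_lebesgue_integral_def G_def)
qed

lemma set_integrable_compact_support:
 fixes f :: "'a::euclidean_space \<Rightarrow> real"
 assumes \<Omega>: "open \<Omega>" and K: "compact K" "K \<subseteq> \<Omega>" and f: "continuous_on \<Omega> f"
  and f0: "\<And>z. z \<in> \<Omega> - K \<Longrightarrow> f z = 0"
 shows "set_integrable lborel \<Omega> f"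
proof -
 have "integrable lborel (\<lambda>z. indicator K z *\<^sub>R f z)"
  using K f by (intro borel_integrable_compact) (auto intro: continuous_on_subset)
 moreover have "(\<lambda>z. indicator K z *\<^sub>R f z) = (\<lambda>z. indicator \<Omega> z *\<^sub>R f z)"
  using f0 K by (auto simp: indicator_def fun_eq_iff)
 ultimately show ?thesis by (simp add: set_integrable_def)
qed

abbreviation "qform a z \<xi> \<equiv> \<Sum>!i j. a i j z * \<xi> i * \<xi> j :: real"

abbreviation "sqn \<xi> \<equiv> \<Sum>!i. (\<xi> i :: real)\<^sup>2"

definition qf :: "('n::finite \<Rightarrow> 'n \<Rightarrow> 'n fn) \<Rightarrow> 'n fn \<Rightarrow> 'n fn" where
 "qf a w z = (\<Sum>!i j. a i j z * dd (eH i) w z * dd (eH j) w z)"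

text \<open>The principal part only: the product of the two null fields plus x times an elliptic
  operator in y. The lower-order terms are kept apart and treated as errors.\<close>

definition wave_op :: "('n::finite \<Rightarrow> 'n \<Rightarrow> 'n fn) \<Rightarrow> 'n fn \<Rightarrow> 'n fn" where
 "wave_op a w z = dd eX (Yd w) z + fst z * (\<Sum>!i j. a i j z * dd (eH i) (dd (eH j) w) z)"

text \<open>Energy current of the multiplier \<open>2 \<psi> Yd w\<close>; the terms in \<open>w * w\<close> are added to control \<open>w\<close> itself.\<close>

definition JX :: "('n::finite \<Rightarrow> 'n \<Rightarrow> 'n fn) \<Rightarrow> 'n fn \<Rightarrow> 'n fn \<Rightarrow> 'n fn" where
 "JX a w \<psi> z = \<psi> z * (Yd w z * Yd w z) - fst z * (fst z * (\<psi> z * qf a w z)) - 2 * (fst z * (\<psi> z * (w z * w z)))"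

definition JS :: "('n::finite \<Rightarrow> 'n \<Rightarrow> 'n fn) \<Rightarrow> 'n fn \<Rightarrow> 'n fn \<Rightarrow> 'n fn" where
 "JS a w \<psi> z = - (2 * (fst z * (\<psi> z * qf a w z))) - 4 * (\<psi> z * (w z * w z))"

definition JH :: "('n::finite \<Rightarrow> 'n \<Rightarrow> 'n fn) \<Rightarrow> 'n fn \<Rightarrow> 'n fn \<Rightarrow> 'n \<Rightarrow> 'n fn" where
 "JH a w \<psi> i z = 2 * (fst z * (\<psi> z * ((\<Sum>!j. a i j z * dd (eH j) w z) * Yd w z)))"

definition divJ :: "('n::finite \<Rightarrow> 'n \<Rightarrow> 'n fn) \<Rightarrow> 'n fn \<Rightarrow> 'n fn \<Rightarrow> 'n fn" where
 "divJ a w \<psi> z = dd eX (JX a w \<psi>) z + dd eS (JS a w \<psi>) z + (\<Sum>!i. dd (eH i) (JH a w \<psi> i) z)"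

context
 fixes \<Omega> :: "'n::finite pt set" and a :: "'n \<Rightarrow> 'n \<Rightarrow> 'n fn"
 assumes \<Omega>: "open \<Omega>"
  and a: "\<And>i j. Ck_on 1 \<Omega> (a i j)" and sym: "\<And>i j z. z \<in> \<Omega> \<Longrightarrow> a i j z = a j i z"
begin

context
 fixes w \<psi> :: "'n fn"
 assumes w: "Ck_on 2 \<Omega> w" and \<psi>: "Ck_on 1 \<Omega> \<psi>"
begin

lemma C1_dd: "Ck_on 1 \<Omega> (dd v w)" and C1_w: "Ck_on 1 \<Omega> w"
proof -
 have "Ck_on (Suc 1) \<Omega> w" using w by (simp add: numeral_2_eq_2)
 then show "Ck_on 1 \<Omega> (dd v w)" "Ck_on 1 \<Omega> w"
  using Ck_on_SucD Ck_on_Suc_iff[THEN iffD1, THEN conjunct2, THEN spec] by blast+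
qed

lemma C1_fst: "Ck_on 1 \<Omega> (fst :: 'n fn)"
 by (rule Ck_on_linear[OF \<Omega> bounded_linear_fst])

lemma C1_Yd: "Ck_on 1 \<Omega> (Yd w)"
proof -
 have "Ck_on 1 \<Omega> (\<lambda>z. fst z * dd eX w z + 2 * dd eS w z)"
  by (intro Ck_on_add Ck_on_mult Ck_on_const C1_dd C1_fst \<Omega>)
 then show ?thesis by (simp add: Yd_def[abs_def])
qed

lemma C1_qf: "Ck_on 1 \<Omega> (qf a w)"
proof -
 have "Ck_on 1 \<Omega> (\<lambda>z. \<Sum>!i j. a i j z * dd (eH i) w z * dd (eH j) w z)"
  by (intro Ck_on_sum Ck_on_mult C1_dd \<Omega> a)
 then show ?thesis by (simp add: qf_def[abs_def])
qed

lemma C1_JX: "Ck_on 1 \<Omega> (JX a w \<psi>)"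
 unfolding JX_def[abs_def] by (intro Ck_on_diff Ck_on_mult C1_w C1_fst C1_Yd C1_qf \<Omega> \<psi>) auto

lemma C1_JS: "Ck_on 1 \<Omega> (JS a w \<psi>)"
 unfolding JS_def[abs_def] by (intro Ck_on_diff Ck_on_minus Ck_on_mult C1_w C1_fst C1_qf \<Omega> \<psi>) auto

lemma C1_JH: "Ck_on 1 \<Omega> ((JH a w \<psi>) i)"
 unfolding JH_def[abs_def] by (intro Ck_on_mult Ck_on_sum C1_dd C1_fst C1_Yd \<Omega> \<psi> a) auto

lemma C1_diff: "Ck_on 1 \<Omega> f \<Longrightarrow> z \<in> \<Omega> \<Longrightarrow> f differentiable (at z)"
 by (simp add: Ck_on_Suc_iff)

text \<open>The symmetry of a merges the two terms in which the derivative falls on a component of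
  the gradient.\<close>

lemma dd_qf:
 assumes z: "z \<in> \<Omega>"
 shows "dd v (qf a w) z = (\<Sum>!i j. dd v (a i j) z * dd (eH i) w z * dd (eH j) w z)
  + 2 * (\<Sum>!i j. a i j z * dd (eH j) w z * dd (eH i) (dd v w) z)"
proof -
 note d = C1_diff[OF _ z]
 have "dd v (qf a w) z = (\<Sum>!i j. (dd v (a i j) z * dd (eH i) w z + a i j z * dd v (dd (eH i) w) z) * dd (eH j) w z
   + a i j z * dd (eH i) w z * dd v (dd (eH j) w) z)"
  unfolding qf_def[abs_def]
  by (simp add: dd_sum dd_mult d[OF a] d[OF C1_dd])
 also have "\<dots> = (\<Sum>!i j. dd v (a i j) z * dd (eH i) w z * dd (eH j) w z)
   + (\<Sum>!i j. a i j z * dd (eH j) w z * dd (eH i) (dd v w) z)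
   + (\<Sum>!i j. a i j z * dd (eH i) w z * dd (eH j) (dd v w) z)"
 proof -
  have comm: "dd v (dd (eH i) w) z = dd (eH i) (dd v w) z" for i
   by (rule dd_commute[OF \<Omega> z w])
  show ?thesis unfolding comm by (simp add: sum.distrib algebra_simps)
 qed
 also have "(\<Sum>!i j. a i j z * dd (eH i) w z * dd (eH j) (dd v w) z)
   = (\<Sum>!j i. a i j z * dd (eH i) w z * dd (eH j) (dd v w) z)"
  by (rule sum.swap)
 also have "\<dots> = (\<Sum>!i j. a i j z * dd (eH j) w z * dd (eH i) (dd v w) z)"
  using sym[OF z] by simp
 finally show ?thesis by simp
qed

lemma dd_fst: "dd v fst z = fst v"
 by (rule dd_linear[OF bounded_linear_fst])

text \<open>All second derivatives of w end up in \<open>wave_op a w\<close>. The mixed ones, in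
  \<open>eH i\<close> with \<open>eX\<close> or \<open>eS\<close>, occur in the tangential flux and,
  with opposite sign, in the derivatives of \<open>qf\<close>. What is left has a derivative of
  \<psi> or of a coefficient, apart from the term in which \<open>eX\<close> falls on the factor x
  and the terms that come from w * w.\<close>

lemma divJ_eq:
 assumes z: "z \<in> \<Omega>"
 shows "(divJ a w \<psi>) z = 2 * \<psi> z * Yd w z * wave_op a w z + dd eX \<psi> z * (Yd w z)\<^sup>2
  + 2 * fst z * Yd w z * (\<Sum>!i j. a i j z * dd (eH i) \<psi> z * dd (eH j) w z)
  - fst z * Yd \<psi> z * qf a w z
  + 2 * fst z * \<psi> z * Yd w z * (\<Sum>!i j. dd (eH i) (a i j) z * dd (eH j) w z)
  - 2 * fst z * \<psi> z * qf a w z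
  - fst z * \<psi> z * (\<Sum>!i j. Yd (a i j) z * dd (eH i) w z * dd (eH j) w z)
  - 4 * \<psi> z * w z * Yd w z - 2 * (w z)\<^sup>2 * (\<psi> z + Yd \<psi> z)"
proof -
 note d = C1_diff[OF _ z]
 note ds = d[OF C1_w] d[OF C1_dd] d[OF C1_fst] d[OF C1_Yd] d[OF C1_qf] d[OF a] d[OF \<psi>]
 define x where "x = fst z"
 define P where "P = Yd w z"
 define Q where "Q = qf a w z"
 define QX where "QX = (\<Sum>!i j. dd eX (a i j) z * dd (eH i) w z * dd (eH j) w z)"
 define QS where "QS = (\<Sum>!i j. dd eS (a i j) z * dd (eH i) w z * dd (eH j) w z)"
 define TX where "TX = (\<Sum>!i j. a i j z * dd (eH j) w z * dd (eH i) (dd eX w) z)"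
 define TS where "TS = (\<Sum>!i j. a i j z * dd (eH j) w z * dd (eH i) (dd eS w) z)"
 define B1 where "B1 = (\<Sum>!i j. a i j z * dd (eH i) \<psi> z * dd (eH j) w z)"
 define B2 where "B2 = (\<Sum>!i j. dd (eH i) (a i j) z * dd (eH j) w z)"
 define B3 where "B3 = (\<Sum>!i j. a i j z * dd (eH i) (dd (eH j) w) z)"
 have fX: "fst (eX :: 'n pt) = 1" "fst (eS :: 'n pt) = 0" "fst (eH i :: 'n pt) = 0" for i
  by (auto simp: eX_def eS_def eH_def)
 have 1: "dd eX (JX a w \<psi>) z = dd eX \<psi> z * P * P + 2 * \<psi> z * P * dd eX (Yd w) z
   - 2 * x * \<psi> z * Q - x * x * dd eX \<psi> z * Q - x * x * \<psi> z * (QX + 2 * TX)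
   - 2 * \<psi> z * (w z * w z) - 2 * x * dd eX \<psi> z * (w z * w z) - 2 * x * \<psi> z * (2 * w z * dd eX w z)"
 proof -
  have "dd eX (qf a w) z = QX + 2 * TX" by (simp add: dd_qf[OF z] QX_def TX_def)
  then show ?thesis
   unfolding JX_def[abs_def] x_def P_def Q_def
   by (simp only: dd_diff dd_mult dd_const dd_fst fX ds differentiable_mult differentiable_diff differentiable_const)
    (simp add: algebra_simps)
 qed
 have 2: "dd eS (JS a w \<psi>) z = - 2 * x * dd eS \<psi> z * Q - 2 * x * \<psi> z * (QS + 2 * TS)
   - 4 * dd eS \<psi> z * (w z * w z) - 4 * \<psi> z * (2 * w z * dd eS w z)"
 proof -
  have "dd eS (qf a w) z = QS + 2 * TS" by (simp add: dd_qf[OF z] QS_def TS_def)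
  then show ?thesis
   unfolding JS_def[abs_def] x_def Q_def
   by (simp only: dd_diff dd_minus dd_mult dd_const dd_fst fX ds differentiable_mult differentiable_diff differentiable_minus differentiable_const)
    (simp add: algebra_simps)
 qed
 have Yi: "dd (eH i) (Yd w) z = x * dd (eH i) (dd eX w) z + 2 * dd (eH i) (dd eS w) z" for i
  unfolding Yd_def[abs_def] by (simp add: dd_add dd_mult ds dd_fst fX x_def)
 have 3: "dd (eH i) ((JH a w \<psi>) i) z = 2 * (x * dd (eH i) \<psi> z * (\<Sum>!j. a i j z * dd (eH j) w z) * P
   + x * \<psi> z * (\<Sum>!j. dd (eH i) (a i j) z * dd (eH j) w z + a i j z * dd (eH i) (dd (eH j) w) z) * P
   + x * \<psi> z * (\<Sum>!j. a i j z * dd (eH j) w z) * (x * dd (eH i) (dd eX w) z + 2 * dd (eH i) (dd eS w) z))" for i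
 proof -
  define T where "T = (\<lambda>z. \<Sum>!j. a i j z * dd (eH j) w z)"
  have C: "Ck_on 1 \<Omega> T" unfolding T_def by (intro Ck_on_mult Ck_on_sum C1_dd \<Omega> a)
  have T': "dd (eH i) T z = (\<Sum>!j. dd (eH i) (a i j) z * dd (eH j) w z + a i j z * dd (eH i) (dd (eH j) w) z)"
   unfolding T_def by (simp add: dd_sum dd_mult ds)
  have eq: "(JH a w \<psi>) i = (\<lambda>z. 2 * (fst z * (\<psi> z * (T z * Yd w z))))" by (simp add: JH_def T_def fun_eq_iff)
  have "dd (eH i) ((JH a w \<psi>) i) z = 2 * (x * dd (eH i) \<psi> z * T z * P
   + x * \<psi> z * dd (eH i) T z * P
   + x * \<psi> z * T z * (x * dd (eH i) (dd eX w) z + 2 * dd (eH i) (dd eS w) z))"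
   unfolding eq P_def
   by (simp only: dd_mult dd_const dd_fst fX ds d[OF C] Yi differentiable_mult differentiable_const)
    (simp add: algebra_simps x_def)
  then show ?thesis unfolding T' unfolding T_def .
 qed
 have 4: "(\<Sum>!i. dd (eH i) ((JH a w \<psi>) i) z) = 2 * (x * P * B1 + x * \<psi> z * P * (B2 + B3) + x * \<psi> z * (x * TX + 2 * TS))"
  unfolding 3 B1_def B2_def B3_def TX_def TS_def
  by (simp add: sum.distrib sum_distrib_left sum_distrib_right distrib_left distrib_right ac_simps)
 have 5: "(\<Sum>!i j. Yd (a i j) z * dd (eH i) w z * dd (eH j) w z) = x * QX + 2 * QS"
  unfolding Yd_def QX_def QS_def x_def by (simp add: sum.distrib sum_distrib_left algebra_simps)
 have P: "P = x * dd eX w z + 2 * dd eS w z" by (simp add: P_def Yd_def x_def)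
 have 6: "w z * P = x * (w z * dd eX w z) + 2 * (w z * dd eS w z)" by (simp add: P algebra_simps)
 have "(divJ a w \<psi>) z = 2 * \<psi> z * P * (dd eX (Yd w) z + x * B3) + dd eX \<psi> z * P\<^sup>2 + 2 * x * P * B1
  - x * (x * dd eX \<psi> z + 2 * dd eS \<psi> z) * Q + 2 * x * \<psi> z * P * B2 - 2 * x * \<psi> z * Q
  - x * \<psi> z * (x * QX + 2 * QS) - 4 * \<psi> z * (w z * P) - 2 * (w z)\<^sup>2 * (\<psi> z + (x * dd eX \<psi> z + 2 * dd eS \<psi> z))"
  unfolding divJ_def 1 2 4 6 power2_eq_square by (simp add: algebra_simps)
 then show ?thesis
  unfolding 5 wave_op_def B1_def[symmetric] B2_def[symmetric] B3_def[symmetric] Q_def[symmetric]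
   P_def[symmetric] x_def[symmetric] Yd_def[of \<psi>] by (simp add: mult.assoc)
qed

lemma LINT_divJ:
 assumes K: "compact K" "K \<subseteq> \<Omega>"
  and off: "\<And>z. z \<in> \<Omega> - K \<Longrightarrow> \<psi> z = 0 \<or> w z = 0 \<and> (\<forall>v. dd v w z = 0)"
 shows "set_integrable lborel \<Omega> (divJ a w \<psi>)" "(LINT z:\<Omega>|lborel. (divJ a w \<psi>) z) = 0"
proof -
 have 0: "(JX a w \<psi>) z = 0" "(JS a w \<psi>) z = 0" "(JH a w \<psi>) i z = 0" if "z \<in> \<Omega> - K" for z i
 proof -
  have "w z = 0" "dd v w z = 0" if "\<psi> z \<noteq> 0" for v
   using off[OF \<open>z \<in> \<Omega> - K\<close>] that by blast+
  then show "(JX a w \<psi>) z = 0" "(JS a w \<psi>) z = 0" "(JH a w \<psi>) i z = 0"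
   by (cases "\<psi> z = 0"; simp add: JX_def JS_def JH_def Yd_def qf_def)+
 qed
 note IX = LINT_dd_eq_0[OF \<Omega> K C1_JX 0(1), of eX]
 note IS = LINT_dd_eq_0[OF \<Omega> K C1_JS 0(2), of eS]
 have IH: "set_integrable lborel \<Omega> (dd (eH i) ((JH a w \<psi>) i))" "(LINT z:\<Omega>|lborel. dd (eH i) ((JH a w \<psi>) i) z) = 0" for i
  by (rule LINT_dd_eq_0[OF \<Omega> K C1_JH 0(3)], assumption)+
 have sI: "set_integrable lborel \<Omega> (\<lambda>z. \<Sum>!i. dd (eH i) ((JH a w \<psi>) i) z)"
  "(LINT z:\<Omega>|lborel. (\<Sum>!i. dd (eH i) ((JH a w \<psi>) i) z)) = 0"
 proof -
  have eq: "(\<lambda>z. indicator \<Omega> z *\<^sub>R (\<Sum>!i. dd (eH i) ((JH a w \<psi>) i) z)) = (\<lambda>z. \<Sum>!i. indicator \<Omega> z *\<^sub>R dd (eH i) ((JH a w \<psi>) i) z)"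
   by (simp only: scaleR_sum_right)
  have I: "integrable lborel (\<lambda>z. indicator \<Omega> z *\<^sub>R dd (eH i) ((JH a w \<psi>) i) z)"
   "integral\<^sup>L lborel (\<lambda>z. indicator \<Omega> z *\<^sub>R dd (eH i) ((JH a w \<psi>) i) z) = 0" for i
   using IH[of i] unfolding set_integrable_def set_lebesgue_integral_def by blast+
  show "set_integrable lborel \<Omega> (\<lambda>z. \<Sum>!i. dd (eH i) ((JH a w \<psi>) i) z)"
   unfolding set_integrable_def eq using I(1) by (intro Bochner_Integration.integrable_sum)
  show "(LINT z:\<Omega>|lborel. (\<Sum>!i. dd (eH i) ((JH a w \<psi>) i) z)) = 0"
   unfolding set_lebesgue_integral_def eq using I by (subst Bochner_Integration.integral_sum) auto
 qed
 show "set_integrable lborel \<Omega> (divJ a w \<psi>)" unfolding divJ_def[abs_def]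
  using IX(1) IS(1) sI(1) by (intro set_integral_add)
 show "(LINT z:\<Omega>|lborel. (divJ a w \<psi>) z) = 0" unfolding divJ_def
  using IX IS sI by (simp add: set_integral_add)
qed

end

end

section \<open>The weighted energy inequality\<close>

definition grad2 :: "'n::finite fn \<Rightarrow> 'n fn" where
 "grad2 w z = (\<Sum>!i. (dd (eH i) w z)\<^sup>2)"

text \<open>The tangential gradient is controlled only with the factor x, which degenerates at the
  boundary; all error terms have to respect this.\<close>

definition energy :: "('n::finite \<Rightarrow> 'n \<Rightarrow> 'n fn) \<Rightarrow> 'n fn \<Rightarrow> 'n fn" where
 "energy a w z = (Yd w z)\<^sup>2 + fst z * qf a w z + (w z)\<^sup>2"

abbreviation energy_bound :: "('n::finite \<Rightarrow> 'n \<Rightarrow> 'n fn) \<Rightarrow> 'n pt set \<Rightarrow> 'i set \<Rightarrow> ('i \<Rightarrow> 'n fn) \<Rightarrow> 'n fn \<Rightarrow> 'n fn \<Rightarrow> bool" where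
 "energy_bound a \<Omega> I W \<psi> k \<equiv> set_integrable lborel \<Omega> (\<lambda>z. \<psi> z * (\<Sum>i\<in>I. energy a (W i) z)) \<and>
   (LINT z:\<Omega>|lborel. \<psi> z * (\<Sum>i\<in>I. energy a (W i) z)) \<le> (LINT z:\<Omega>|lborel. k z * (\<Sum>i\<in>I. (Yd (W i) z)\<^sup>2))"

abbreviation null_off :: "'n::finite fn \<Rightarrow> 'n fn \<Rightarrow> 'i set \<Rightarrow> ('i \<Rightarrow> 'n fn) \<Rightarrow> 'n pt \<Rightarrow> bool" where
 "null_off \<psi> k I W z \<equiv> \<psi> z = 0 \<and> k z = 0 \<or> (\<forall>i\<in>I. W i z = 0 \<and> (\<forall>v. dd v (W i) z = 0))"

text \<open>The left side collects the terms of \<open>divJ_eq\<close> quadratic in the first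
  derivatives of w in which \<psi> is differentiated, with P for \<open>Yd w\<close> and \<xi> for
  the tangential gradient.\<close>

abbreviation weight_ineq :: "('n::finite \<Rightarrow> 'n \<Rightarrow> 'n fn) \<Rightarrow> 'n fn \<Rightarrow> 'n fn \<Rightarrow> real \<Rightarrow> 'n pt \<Rightarrow> real \<Rightarrow> ('n \<Rightarrow> real) \<Rightarrow> bool" where
 "weight_ineq a \<psi> k \<mu> z P \<xi> \<equiv> dd eX \<psi> z * P\<^sup>2 - fst z * Yd \<psi> z * qform a z \<xi>
     + 2 * fst z * P * (\<Sum>!i j. a i j z * dd (eH i) \<psi> z * \<xi> j)
    \<ge> \<mu> * \<psi> z * (P\<^sup>2 + fst z * qform a z \<xi>) - k z * P\<^sup>2"

text \<open>The algebraic part of the energy inequality. R stands for \<open>wave_op a w\<close>, B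
  and Q for the sums with differentiated coefficients, Y for \<open>Yd \<psi>\<close>, and T1, T2,
  T3 for the terms with a derivative of the weight. Products are split by 2 p q \<le> p^2 + q^2; the
  losses stay below 6 + 2 M / \<theta>.\<close>

lemma divJ_lower_bound_real:
 fixes x \<psi> P R B Q T1 T2 T3 Y w q g M \<theta> \<mu> k :: real
 assumes x: "0 < x" "x \<le> 1" and \<psi>: "0 \<le> \<psi>" and \<theta>: "0 < \<theta>" and M: "0 \<le> M"
  and g: "0 \<le> g" "\<theta> * g \<le> q" and B: "B\<^sup>2 \<le> M * g" and Q: "\<bar>Q\<bar> \<le> M * g"
  and T: "T1 - T3 + T2 \<ge> \<mu> * \<psi> * (P\<^sup>2 + x * q) - k * P\<^sup>2" and Y: "- Y - \<psi> \<ge> \<mu> * \<psi>" and \<mu>: "0 \<le> \<mu>"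
 shows "2 * \<psi> * P * R + T1 + T2 - T3 + 2 * x * \<psi> * P * B - 2 * x * \<psi> * q - x * \<psi> * Q - 4 * \<psi> * w * P - 2 * w\<^sup>2 * (\<psi> + Y)
  \<ge> \<psi> * ((\<mu> - 6 - 2 * M / \<theta>) * (P\<^sup>2 + x * q + w\<^sup>2) - R\<^sup>2) - k * P\<^sup>2"
proof -
 have q: "0 \<le> q" using g \<theta> by (smt (verit) mult_nonneg_nonneg)
 define m where "m = M / \<theta>"
 define y where "y = x * q"
 have Mg: "M * g \<le> m * q"
 proof -
  have "M / \<theta> * (\<theta> * g) \<le> M / \<theta> * q" using g(2) M \<theta> by (intro mult_left_mono) auto
  then show ?thesis using \<theta> by (simp add: m_def)
 qed
 have m: "0 \<le> m" using M \<theta> by (simp add: m_def)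
 have y: "0 \<le> y" using x q by (simp add: y_def)
 have 1: "2 * (P * R) \<ge> - P\<^sup>2 - R\<^sup>2" using zero_le_power2[of "P + R"] by (simp add: power2_sum)
 have 2: "2 * (x * (P * B)) \<ge> - P\<^sup>2 - m * y"
 proof -
  have "2 * (P * B) \<ge> - P\<^sup>2 - B\<^sup>2" using zero_le_power2[of "P + B"] by (simp add: power2_sum)
  then have "2 * (P * B) \<ge> - P\<^sup>2 - m * q" using B Mg by linarith
  then have "x * (2 * (P * B)) \<ge> x * (- P\<^sup>2 - m * q)" using x by (intro mult_left_mono) auto
  moreover have "x * P\<^sup>2 \<le> 1 * P\<^sup>2" using x by (intro mult_right_mono) auto
  ultimately show ?thesis by (simp add: algebra_simps y_def)
 qed
 have 3: "x * Q \<le> m * y"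
 proof -
  have "x * Q \<le> x * (m * q)" using Q Mg x by (intro mult_left_mono) auto
  then show ?thesis by (simp add: algebra_simps y_def)
 qed
 have 4: "4 * (w * P) \<le> 2 * w\<^sup>2 + 2 * P\<^sup>2" using zero_le_power2[of "w - P"] by (simp add: power2_diff)
 have 5: "- 2 * w\<^sup>2 * (\<psi> + Y) \<ge> 2 * w\<^sup>2 * (\<mu> * \<psi>)"
 proof -
  have "2 * w\<^sup>2 * (- Y - \<psi>) \<ge> 2 * w\<^sup>2 * (\<mu> * \<psi>)" using Y by (intro mult_left_mono) auto
  then show ?thesis by (simp add: algebra_simps)
 qed
 have 6: "\<psi> * (2 * (P * R) + 2 * (x * (P * B)) - 2 * y - x * Q - 4 * (w * P)) \<ge>
  \<psi> * (- 4 * P\<^sup>2 - R\<^sup>2 - 2 * (m * y) - 2 * y - 2 * w\<^sup>2)"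
  by (rule mult_left_mono[OF _ \<psi>]) (use 1 2 3 4 in linarith)
 have 7: "\<psi> * ((\<mu> - 6 - 2 * m) * (P\<^sup>2 + y + w\<^sup>2) - R\<^sup>2) \<le>
   \<psi> * (\<mu> * (P\<^sup>2 + y) + \<mu> * (2 * w\<^sup>2) - 4 * P\<^sup>2 - R\<^sup>2 - 2 * (m * y) - 2 * y - 2 * w\<^sup>2)"
 proof (rule mult_left_mono[OF _ \<psi>])
  have "0 \<le> \<mu> * w\<^sup>2" "0 \<le> m * P\<^sup>2" "0 \<le> m * w\<^sup>2" using \<mu> m by simp_all
  moreover have "(\<mu> - 6 - 2 * m) * (P\<^sup>2 + y + w\<^sup>2) = \<mu> * P\<^sup>2 + \<mu> * y + \<mu> * w\<^sup>2 - 6 * P\<^sup>2 - 6 * y - 6 * w\<^sup>2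
   - 2 * (m * P\<^sup>2) - 2 * (m * y) - 2 * (m * w\<^sup>2)" by (simp add: algebra_simps)
  moreover have "\<mu> * (P\<^sup>2 + y) + \<mu> * (2 * w\<^sup>2) = \<mu> * P\<^sup>2 + \<mu> * y + 2 * (\<mu> * w\<^sup>2)" by (simp add: algebra_simps)
  moreover have "p1 + p2 + p3 - 6 * p - 6 * y - 6 * v - 2 * a - 2 * b - 2 * c - r \<le> p1 + p2 + 2 * p3 - 4 * p - r - 2 * b - 2 * y - 2 * v"
   if "0 \<le> p3" "0 \<le> a" "0 \<le> c" "0 \<le> p" "0 \<le> v" for p1 p2 p3 p v a b c r :: real
   using that y by linarith
  ultimately show "(\<mu> - 6 - 2 * m) * (P\<^sup>2 + y + w\<^sup>2) - R\<^sup>2 \<le>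
   \<mu> * (P\<^sup>2 + y) + \<mu> * (2 * w\<^sup>2) - 4 * P\<^sup>2 - R\<^sup>2 - 2 * (m * y) - 2 * y - 2 * w\<^sup>2"
   by (metis zero_le_power2)
 qed
 have T': "T1 - T3 + T2 \<ge> \<psi> * (\<mu> * (P\<^sup>2 + y)) - k * P\<^sup>2" using T by (simp add: y_def algebra_simps)
 have e1: "2 * \<psi> * P * R + T1 + T2 - T3 + 2 * x * \<psi> * P * B - 2 * x * \<psi> * q - x * \<psi> * Q - 4 * \<psi> * w * P - 2 * w\<^sup>2 * (\<psi> + Y)
   = \<psi> * (2 * (P * R) + 2 * (x * (P * B)) - 2 * y - x * Q - 4 * (w * P)) + (T1 - T3 + T2) + - 2 * w\<^sup>2 * (\<psi> + Y)"
  by (simp add: algebra_simps y_def)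
 have e2: "\<psi> * (\<mu> * (P\<^sup>2 + y) + \<mu> * (2 * w\<^sup>2) - 4 * P\<^sup>2 - R\<^sup>2 - 2 * (m * y) - 2 * y - 2 * w\<^sup>2)
  = \<psi> * (\<mu> * (P\<^sup>2 + y)) + 2 * w\<^sup>2 * (\<mu> * \<psi>) + \<psi> * (- 4 * P\<^sup>2 - R\<^sup>2 - 2 * (m * y) - 2 * y - 2 * w\<^sup>2)"
  by (simp add: algebra_simps)
 have e3: "\<psi> * ((\<mu> - 6 - 2 * M / \<theta>) * (P\<^sup>2 + x * q + w\<^sup>2) - R\<^sup>2) - k * P\<^sup>2
   = \<psi> * ((\<mu> - 6 - 2 * m) * (P\<^sup>2 + y + w\<^sup>2) - R\<^sup>2) - k * P\<^sup>2" by (simp add: m_def y_def)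
 have lin: "l \<le> A + v + S \<Longrightarrow> S \<le> E \<Longrightarrow> v \<le> u \<Longrightarrow> A - c \<le> t \<Longrightarrow> l - c \<le> E + t + u" for l A v S E u c t :: real
  by linarith
 show ?thesis unfolding e1 e3 by (rule lin[OF 7[unfolded e2] 6 5 T'])
qed

text \<open>The functions \<open>W i\<close> are estimated together, because the bound for
  \<open>wave_op\<close> of each involves all of them. \<Lambda> is found before the weight, so that
  a whole family of weights can share one \<mu>.\<close>

lemma energy_estimate:
 fixes W :: "'i \<Rightarrow> 'n::finite fn"
 assumes \<Omega>: "open \<Omega>" and a: "\<And>i j. Ck_on 1 \<Omega> (a i j)" and sym: "\<And>i j z. z \<in> \<Omega> \<Longrightarrow> a i j z = a j i z"
  and I: "finite I" and W: "\<And>i. i \<in> I \<Longrightarrow> Ck_on 2 \<Omega> (W i)"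
  and x: "\<And>z. z \<in> \<Omega> \<Longrightarrow> 0 < fst z \<and> fst z \<le> 1"
  and \<theta>: "0 < \<theta>" "\<And>z \<xi>. z \<in> \<Omega> \<Longrightarrow> \<theta> * sqn \<xi> \<le> qform a z \<xi>"
  and M: "0 \<le> M" "\<And>z \<xi>. z \<in> \<Omega> \<Longrightarrow> (\<Sum>!i j. dd (eH i) (a i j) z * \<xi> j)\<^sup>2 \<le> M * sqn \<xi>"
   "\<And>z \<xi>. z \<in> \<Omega> \<Longrightarrow> \<bar>\<Sum>!i j. Yd (a i j) z * \<xi> i * \<xi> j\<bar> \<le> M * sqn \<xi>"
  and C: "0 \<le> C" "\<And>z i. z \<in> \<Omega> \<Longrightarrow> i \<in> I \<Longrightarrow> (wave_op a (W i) z)\<^sup>2 \<le> C * (\<Sum>j\<in>I. fst z * grad2 (W j) z + (W j z)\<^sup>2)"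
 shows "\<exists>\<Lambda>. \<forall>\<psi> k \<mu> K. compact K \<longrightarrow> K \<subseteq> \<Omega> \<longrightarrow> Ck_on 1 \<Omega> \<psi> \<longrightarrow> continuous_on \<Omega> k \<longrightarrow>
   (\<forall>z\<in>\<Omega>. 0 \<le> \<psi> z) \<longrightarrow> \<mu> \<ge> \<Lambda> \<longrightarrow>
   (\<forall>z\<in>\<Omega> - K. null_off \<psi> k I W z) \<longrightarrow>
   (\<forall>z\<in>\<Omega>. \<forall>P \<xi>. weight_ineq a \<psi> k \<mu> z P \<xi>) \<longrightarrow>
   (\<forall>z\<in>\<Omega>. - Yd \<psi> z - \<psi> z \<ge> \<mu> * \<psi> z) \<longrightarrow>
   energy_bound a \<Omega> I W \<psi> k"
proof -
 \<comment> \<open>6 + 2 M / \<theta> is lost pointwise, the last summand pays for the squares of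
   \<open>wave_op a (W i)\<close>, and the remaining 1 is the coefficient with which the energy
   survives.\<close>
 define \<Lambda> where "\<Lambda> = 7 + 2 * M / \<theta> + real (card I) * C * (1 / \<theta> + 1)"
 have L0: "0 \<le> \<Lambda>" using M C \<theta> by (simp add: \<Lambda>_def)
 have main: "energy_bound a \<Omega> I W \<psi> k"
  if K: "compact K" "K \<subseteq> \<Omega>" and \<psi>: "Ck_on 1 \<Omega> \<psi>" and k: "continuous_on \<Omega> k" and \<psi>0: "\<And>z. z \<in> \<Omega> \<Longrightarrow> 0 \<le> \<psi> z"
   and \<mu>: "\<mu> \<ge> \<Lambda>"
   and off: "\<And>z. z \<in> \<Omega> - K \<Longrightarrow> null_off \<psi> k I W z"
   and w1: "\<And>z P \<xi>. z \<in> \<Omega> \<Longrightarrow> weight_ineq a \<psi> k \<mu> z P \<xi>"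
   and w2: "\<And>z. z \<in> \<Omega> \<Longrightarrow> - Yd \<psi> z - \<psi> z \<ge> \<mu> * \<psi> z"
  for \<psi> k :: "'n fn" and \<mu> K
 proof -
  have dJ: "divJ a (W i) \<psi> z = 2 * \<psi> z * Yd (W i) z * wave_op a (W i) z + dd eX \<psi> z * (Yd (W i) z)\<^sup>2
   + 2 * fst z * Yd (W i) z * (\<Sum>!i' j. a i' j z * dd (eH i') \<psi> z * dd (eH j) (W i) z)
   - fst z * Yd \<psi> z * qf a (W i) z
   + 2 * fst z * \<psi> z * Yd (W i) z * (\<Sum>!i' j. dd (eH i') (a i' j) z * dd (eH j) (W i) z)
   - 2 * fst z * \<psi> z * qf a (W i) z
   - fst z * \<psi> z * (\<Sum>!i' j. Yd (a i' j) z * dd (eH i') (W i) z * dd (eH j) (W i) z)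
   - 4 * \<psi> z * W i z * Yd (W i) z - 2 * (W i z)\<^sup>2 * (\<psi> z + Yd \<psi> z)" if "i \<in> I" "z \<in> \<Omega>" for i z
   by (rule divJ_eq[where a=a and \<Omega>=\<Omega>]; (rule \<Omega> a W[OF that(1)] \<psi> that | rule sym, assumption))
  have off': "\<psi> z = 0 \<or> W i z = 0 \<and> (\<forall>v. dd v (W i) z = 0)" if "z \<in> \<Omega> - K" "i \<in> I" for z i
   using off[OF that(1)] that(2) by blast
  have D: "set_integrable lborel \<Omega> (divJ a (W i) \<psi>)" "(LINT z:\<Omega>|lborel. divJ a (W i) \<psi> z) = 0" if "i \<in> I" for i
   by (rule LINT_divJ[where a=a]; (rule \<Omega> a W[OF that] \<psi> K | rule sym, assumption | rule off'[OF _ that], assumption))+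
  have e0: "0 \<le> qf a w z" if "z \<in> \<Omega>" for w z
  proof -
   have "0 \<le> \<theta> * (\<Sum>!i. (dd (eH i) w z)\<^sup>2)" using \<theta>(1) by (intro mult_nonneg_nonneg sum_nonneg) auto
   also have "\<dots> \<le> qf a w z" unfolding qf_def by (rule \<theta>(2)[OF that])
   finally show ?thesis .
  qed
  have pt: "(\<Sum>i\<in>I. divJ a (W i) \<psi> z) \<ge> \<psi> z * (\<Sum>i\<in>I. energy a (W i) z) - k z * (\<Sum>i\<in>I. (Yd (W i) z)\<^sup>2)" if z: "z \<in> \<Omega>" for z
  proof -
   define E where "E = (\<Sum>i\<in>I. energy a (W i) z)"
   have gq: "\<theta> * grad2 w z \<le> qf a w z" for w
    unfolding grad2_def qf_def by (rule \<theta>(2)[OF z])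
   have one: "divJ a (W i) \<psi> z \<ge> \<psi> z * ((\<mu> - 6 - 2 * M / \<theta>) * energy a (W i) z - (wave_op a (W i) z)\<^sup>2) - k z * (Yd (W i) z)\<^sup>2"
    if i: "i \<in> I" for i
   proof -
    have "0 \<le> grad2 (W i) z" by (simp add: grad2_def sum_nonneg)
    show ?thesis
     unfolding dJ[OF i z] energy_def
     by (rule divJ_lower_bound_real[OF _ _ \<psi>0[OF z] \<theta>(1) M(1) \<open>0 \<le> grad2 (W i) z\<close> gq
       M(2)[OF z, of "\<lambda>j. dd (eH j) (W i) z", folded grad2_def] M(3)[OF z, of "\<lambda>j. dd (eH j) (W i) z", folded grad2_def]
       _ w2[OF z]])
      (use x[OF z] \<mu> L0 w1[OF z, of "Yd (W i) z" "\<lambda>j. dd (eH j) (W i) z", folded qf_def] in auto)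
   qed
   have R: "(\<Sum>i\<in>I. (wave_op a (W i) z)\<^sup>2) \<le> real (card I) * C * (1 / \<theta> + 1) * E"
   proof -
    have "fst z * grad2 (W j) z + (W j z)\<^sup>2 \<le> (1 / \<theta> + 1) * energy a (W j) z" for j
    proof -
     have "grad2 (W j) z \<le> 1 / \<theta> * qf a (W j) z" using gq[of "W j"] \<theta>(1) by (simp add: field_simps)
     then have "fst z * grad2 (W j) z \<le> fst z * (1 / \<theta> * qf a (W j) z)" using x[OF z] by (intro mult_left_mono) auto
     moreover have "0 \<le> fst z * qf a (W j) z" using x[OF z] e0[OF z] by simp
     moreover have "0 \<le> 1 / \<theta> * (Yd (W j) z)\<^sup>2" "0 \<le> 1 / \<theta> * (W j z)\<^sup>2" using \<theta>(1) by simp_all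
     moreover have "(1 / \<theta> + 1) * energy a (W j) z = 1 / \<theta> * (Yd (W j) z)\<^sup>2 + fst z * (1 / \<theta> * qf a (W j) z) + 1 / \<theta> * (W j z)\<^sup>2
       + (Yd (W j) z)\<^sup>2 + fst z * qf a (W j) z + (W j z)\<^sup>2"
      unfolding energy_def by (simp only: algebra_simps mult_1_left)
     ultimately show ?thesis using zero_le_power2[of "Yd (W j) z"] by linarith
    qed
    then have "(\<Sum>j\<in>I. fst z * grad2 (W j) z + (W j z)\<^sup>2) \<le> (1 / \<theta> + 1) * E"
     unfolding E_def sum_distrib_left by (intro sum_mono)
    then have "C * (\<Sum>j\<in>I. fst z * grad2 (W j) z + (W j z)\<^sup>2) \<le> C * ((1 / \<theta> + 1) * E)"
     using C(1) by (rule mult_left_mono)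
    then have "(wave_op a (W i) z)\<^sup>2 \<le> C * ((1 / \<theta> + 1) * E)" if "i \<in> I" for i
     using C(2)[OF z that] by linarith
    then have "(\<Sum>i\<in>I. (wave_op a (W i) z)\<^sup>2) \<le> (\<Sum>i\<in>I. C * ((1 / \<theta> + 1) * E))" by (rule sum_mono)
    then show ?thesis by (simp add: algebra_simps)
   qed
   have E0: "0 \<le> E" unfolding E_def energy_def using x[OF z] e0[OF z] by (intro sum_nonneg add_nonneg_nonneg) auto
   have "\<psi> z * E \<le> \<psi> z * ((\<mu> - 6 - 2 * M / \<theta>) * E - (\<Sum>i\<in>I. (wave_op a (W i) z)\<^sup>2))"
   proof (rule mult_left_mono[OF _ \<psi>0[OF z]])
    have "(1 + real (card I) * C * (1 / \<theta> + 1)) * E \<le> (\<mu> - 6 - 2 * M / \<theta>) * E"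
     using \<mu> E0 by (intro mult_right_mono) (auto simp: \<Lambda>_def)
    then show "E \<le> (\<mu> - 6 - 2 * M / \<theta>) * E - (\<Sum>i\<in>I. (wave_op a (W i) z)\<^sup>2)" using R by (simp add: distrib_right)
   qed
   moreover have "(\<Sum>i\<in>I. \<psi> z * ((\<mu> - 6 - 2 * M / \<theta>) * energy a (W i) z - (wave_op a (W i) z)\<^sup>2) - k z * (Yd (W i) z)\<^sup>2)
     = \<psi> z * ((\<mu> - 6 - 2 * M / \<theta>) * E - (\<Sum>i\<in>I. (wave_op a (W i) z)\<^sup>2)) - k z * (\<Sum>i\<in>I. (Yd (W i) z)\<^sup>2)"
    by (simp add: E_def sum_subtractf sum_distrib_left right_diff_distrib)
   moreover have "\<dots> \<le> (\<Sum>i\<in>I. divJ a (W i) \<psi> z)"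
    unfolding calculation(2)[symmetric] by (intro sum_mono one)
   ultimately show ?thesis unfolding E_def by linarith
  qed
  have cY: "continuous_on \<Omega> (Yd (W i))" "continuous_on \<Omega> (qf a (W i))" "continuous_on \<Omega> (W i)" if "i \<in> I" for i
   by (rule Ck_on_continuous[OF C1_Yd[where a=a]] Ck_on_continuous[OF C1_qf[where a=a]] Ck_on_continuous[OF W[OF that]];
     (rule \<Omega> a W[OF that] \<psi> | rule sym, assumption))+
  have off0: "energy a (W i) z = 0" "Yd (W i) z = 0" if "\<forall>i\<in>I. W i z = 0 \<and> (\<forall>v. dd v (W i) z = 0)" "i \<in> I" for i z
  proof -
   have "W i z = 0" "\<And>v. dd v (W i) z = 0" using that by blast+
   then show "energy a (W i) z = 0" "Yd (W i) z = 0" by (simp_all add: energy_def Yd_def qf_def)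
  qed
  have i1: "set_integrable lborel \<Omega> (\<lambda>z. \<psi> z * (\<Sum>i\<in>I. energy a (W i) z))"
  proof (rule set_integrable_compact_support[OF \<Omega> K])
   show "continuous_on \<Omega> (\<lambda>z. \<psi> z * (\<Sum>i\<in>I. energy a (W i) z))"
    unfolding energy_def by (intro continuous_intros cY Ck_on_continuous[OF \<psi>])
   show "\<psi> z * (\<Sum>i\<in>I. energy a (W i) z) = 0" if "z \<in> \<Omega> - K" for z
    using off[OF that]
   proof
    assume *: "\<forall>i\<in>I. W i z = 0 \<and> (\<forall>v. dd v (W i) z = 0)"
    have "(\<Sum>i\<in>I. energy a (W i) z) = 0" by (rule sum.neutral) (use off0(1)[OF *] in simp)
    then show ?thesis by simp
   qed simp
  qed
  have i2: "set_integrable lborel \<Omega> (\<lambda>z. k z * (\<Sum>i\<in>I. (Yd (W i) z)\<^sup>2))"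
  proof (rule set_integrable_compact_support[OF \<Omega> K])
   show "continuous_on \<Omega> (\<lambda>z. k z * (\<Sum>i\<in>I. (Yd (W i) z)\<^sup>2))"
    by (intro continuous_intros cY k)
   show "k z * (\<Sum>i\<in>I. (Yd (W i) z)\<^sup>2) = 0" if "z \<in> \<Omega> - K" for z
    using off[OF that]
   proof
    assume *: "\<forall>i\<in>I. W i z = 0 \<and> (\<forall>v. dd v (W i) z = 0)"
    have "(\<Sum>i\<in>I. (Yd (W i) z)\<^sup>2) = 0" by (rule sum.neutral) (use off0(2)[OF *] in simp)
    then show ?thesis by simp
   qed simp
  qed
  have eq: "(\<lambda>z. indicator \<Omega> z *\<^sub>R (\<Sum>i\<in>I. divJ a (W i) \<psi> z)) = (\<lambda>z. \<Sum>i\<in>I. indicator \<Omega> z *\<^sub>R divJ a (W i) \<psi> z)"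
   by (simp only: scaleR_sum_right)
  have i3: "set_integrable lborel \<Omega> (\<lambda>z. \<Sum>i\<in>I. divJ a (W i) \<psi> z)"
   unfolding set_integrable_def eq using D(1) by (intro Bochner_Integration.integrable_sum) (simp add: set_integrable_def)
  have z3: "(LINT z:\<Omega>|lborel. (\<Sum>i\<in>I. divJ a (W i) \<psi> z)) = 0"
   unfolding set_lebesgue_integral_def eq using D
   by (subst Bochner_Integration.integral_sum) (auto simp: set_integrable_def set_lebesgue_integral_def)
  have "(LINT z:\<Omega>|lborel. \<psi> z * (\<Sum>i\<in>I. energy a (W i) z) - k z * (\<Sum>i\<in>I. (Yd (W i) z)\<^sup>2)) \<le> (LINT z:\<Omega>|lborel. (\<Sum>i\<in>I. divJ a (W i) \<psi> z))"
   by (rule set_integral_mono[OF set_integral_diff(1)[OF i1 i2] i3]) (use pt in auto)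
  then have "(LINT z:\<Omega>|lborel. \<psi> z * (\<Sum>i\<in>I. energy a (W i) z)) \<le> (LINT z:\<Omega>|lborel. k z * (\<Sum>i\<in>I. (Yd (W i) z)\<^sup>2))"
   unfolding z3 set_integral_diff(2)[OF i1 i2] by simp
  then show ?thesis using i1 by blast
 qed
 show ?thesis
  by (rule exI[of _ \<Lambda>], intro allI impI, rule main; (assumption | (drule (1) bspec, assumption) | fastforce))
qed

text \<open>The function vanishes almost everywhere on the region; within a ball around p its zero
  set is closed and of full measure, hence contains p.\<close>

lemma LINT_continuous_nonneg_eq_0:
 fixes f :: "'a::euclidean_space \<Rightarrow> real"
 assumes \<Omega>: "open \<Omega>" and f: "continuous_on \<Omega> f" "\<And>z. z \<in> \<Omega> \<Longrightarrow> 0 \<le> f z"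
  and int: "set_integrable lborel \<Omega> f" "(LINT z:\<Omega>|lborel. f z) \<le> 0" and p: "p \<in> \<Omega>"
 shows "f p = 0"
proof -
 have nn: "0 \<le> indicator \<Omega> z *\<^sub>R f z" for z using f(2) by (auto simp: indicator_def)
 have "0 \<le> integral\<^sup>L lborel (\<lambda>z. indicator \<Omega> z *\<^sub>R f z)" by (rule integral_nonneg_AE) (use nn in auto)
 then have "integral\<^sup>L lborel (\<lambda>z. indicator \<Omega> z *\<^sub>R f z) = 0"
  using int(2) by (simp add: set_lebesgue_integral_def)
 then have "AE z in lborel. indicator \<Omega> z *\<^sub>R f z = 0"
  using integral_nonneg_eq_0_iff_AE[OF int(1)[unfolded set_integrable_def]] nn by simp
 then have AE: "AE z in lebesgue. indicator \<Omega> z *\<^sub>R f z = 0" by (rule AE_completion)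
 obtain e where e: "e > 0" "cball p e \<subseteq> \<Omega>" using \<Omega> p open_contains_cball by blast
 have "closed (f -` {0} \<inter> cball p e)"
  using f(1) e(2) by (intro continuous_on_closed_vimage[THEN iffD1, rule_format]) (auto intro: continuous_on_subset)
 then have "p \<in> f -` {0} \<inter> cball p e"
 proof (rule mem_closed_if_AE_lebesgue_open[OF open_ball])
  show "AE z\<in>ball p e in lebesgue. z \<in> f -` {0} \<inter> cball p e"
  proof -
   have sub: "z \<in> \<Omega>" "z \<in> cball p e" if "z \<in> ball p e" for z using that e(2) by auto
   show ?thesis using AE by eventually_elim (use sub in \<open>auto simp: indicator_def\<close>)
  qed
  show "p \<in> ball p e" using e by simp
 qed
 then show ?thesis by simp
qed

text \<open>A cutoff of class C1, the regularity that the energy inequality asks of a weight. Its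
  logarithmic derivative is bounded away from the edge of the support.\<close>

definition psq :: "real \<Rightarrow> real" where "psq r = (max 0 r)\<^sup>2"

lemma psq_deriv: "(psq has_real_derivative 2 * max 0 r) (at r)"
proof -
 have lim: "((\<lambda>h. (psq (r + h) - psq r) / h) \<longlongrightarrow> 2 * max 0 r) (at 0)"
 proof (rule LIM_I)
  fix e :: real assume e: "e > 0"
  show "\<exists>s>0. \<forall>h. h \<noteq> 0 \<and> norm (h - 0) < s \<longrightarrow> norm ((psq (r + h) - psq r) / h - 2 * max 0 r) < e"
  proof (intro exI conjI allI impI)
   show "e / 3 > 0" using e by simp
   fix h :: real assume h: "h \<noteq> 0 \<and> norm (h - 0) < e / 3"
   define M N where "M = max 0 r" and "N = max 0 (r + h)"
   have MN: "\<bar>N - M\<bar> \<le> \<bar>h\<bar>" unfolding M_def N_def by linarith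
   have 1: "\<bar>(N\<^sup>2 - M\<^sup>2) - 2 * M * h\<bar> \<le> 3 * (\<bar>h\<bar> * \<bar>h\<bar>)"
   proof -
    \<comment> \<open>The product is nonzero only if r > 0 and r + h < 0, and then M is at most
      |h|.\<close>
    have "M * (N - M - h) \<le> \<bar>h\<bar> * \<bar>h\<bar> \<and> - (M * (N - M - h)) \<le> \<bar>h\<bar> * \<bar>h\<bar>"
    proof (cases "r > 0 \<and> r + h < 0")
     case True
     then have "0 \<le> M" "M \<le> \<bar>h\<bar>" "\<bar>N - M - h\<bar> \<le> \<bar>h\<bar>" unfolding M_def N_def by linarith+
     then have "\<bar>M * (N - M - h)\<bar> \<le> \<bar>h\<bar> * \<bar>h\<bar>" unfolding abs_mult by (intro mult_mono) auto
     then show ?thesis by linarith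
    next
     case False
     then have "M = 0 \<or> N - M - h = 0" unfolding M_def N_def by linarith
     then show ?thesis by auto
    qed
    moreover have "(N - M)\<^sup>2 \<le> \<bar>h\<bar> * \<bar>h\<bar>" using mult_mono[OF MN MN] by (simp add: power2_eq_square abs_mult[symmetric])
    moreover have "(N\<^sup>2 - M\<^sup>2) - 2 * M * h = (N - M)\<^sup>2 + 2 * (M * (N - M - h))"
     by (simp add: power2_eq_square algebra_simps)
    moreover have "0 \<le> (N - M)\<^sup>2" by simp
    ultimately show ?thesis
     by linarith
   qed
   have "\<bar>(N\<^sup>2 - M\<^sup>2) / h - 2 * M\<bar> = \<bar>(N\<^sup>2 - M\<^sup>2) - 2 * M * h\<bar> / \<bar>h\<bar>"
    using h by (subst abs_divide[symmetric]) (simp add: diff_divide_distrib)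
   also have "\<dots> \<le> 3 * \<bar>h\<bar>" using 1 h by (simp add: divide_le_eq)
   also have "\<dots> < e" using h by simp
   finally show "norm ((psq (r + h) - psq r) / h - 2 * max 0 r) < e" by (simp add: psq_def M_def N_def)
  qed
 qed
 then show ?thesis by (simp add: DERIV_def)
qed

lemma Ck_on_psq: "Ck_on 1 UNIV psq"
proof -
 have "Ck_on (Suc 0) UNIV psq"
  by (rule Ck_on_real[OF psq_deriv]) (auto intro!: continuous_intros)
 then show ?thesis by simp
qed

lemma psq_nonneg: "0 \<le> psq r" by (simp add: psq_def)

lemma dd_real_compose:
 fixes f :: "'a::real_normed_vector \<Rightarrow> real"
 assumes "f differentiable (at p)" "(g has_real_derivative g') (at (f p))"
 shows "dd v (\<lambda>z. g (f z)) p = g' * dd v f p"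
proof (rule dd_eqI)
 show "((\<lambda>z. g (f z)) has_derivative (\<lambda>v. g' * dd v f p)) (at p)"
  using has_derivative_compose[OF has_derivative_dd[OF assms(1)] assms(2)[unfolded has_field_derivative_def]] .
qed

text \<open>Completing the square: the form A is non-negative at \<xi> + (P / D) y, and the last
  hypothesis bounds the multiple of its value at y that remains. With G and D for the derivatives of
  a phase along d/dx and - \<open>Yd\<close>, this hypothesis says that the differential of the
  phase is causal.\<close>

lemma quadratic_form_bracket:
 fixes A :: "'n::finite \<Rightarrow> 'n \<Rightarrow> real"
 assumes sym: "\<And>i j. A i j = A j i" and pos: "\<And>\<xi>. 0 \<le> (\<Sum>!i j. A i j * \<xi> i * \<xi> j)"
  and D: "0 < D" and x: "0 \<le> x" and G: "x * (\<Sum>!i j. A i j * y i * y j) \<le> G * D"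
 shows "0 \<le> G * P\<^sup>2 + x * D * (\<Sum>!i j. A i j * \<xi> i * \<xi> j) + 2 * x * P * (\<Sum>!i j. A i j * y i * \<xi> j)"
proof -
 define q where "q = (\<Sum>!i j. A i j * \<xi> i * \<xi> j)"
 define r where "r = (\<Sum>!i j. A i j * y i * y j)"
 define m where "m = (\<Sum>!i j. A i j * y i * \<xi> j)"
 have m': "(\<Sum>!i j. A i j * \<xi> i * y j) = m"
 proof -
  have "A i j * \<xi> i * y j = A j i * y j * \<xi> i" for i j using sym[of i j] by simp
  then have "(\<Sum>!j i. A i j * \<xi> i * y j) = m" unfolding m_def by (intro sum.cong refl)
  then show ?thesis by (subst sum.swap)
 qed
 define l where "l = P / D"
 have "0 \<le> (\<Sum>!i j. A i j * (\<xi> i + l * y i) * (\<xi> j + l * y j))" by (rule pos)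
 also have "\<dots> = q + l * (\<Sum>!i j. A i j * \<xi> i * y j) + l * m + l * l * r"
  unfolding q_def r_def m_def by (simp add: sum.distrib sum_distrib_left algebra_simps)
 finally have "0 \<le> q + 2 * l * m + l * l * r" unfolding m' by simp
 then have "0 \<le> (x * D) * (q + 2 * l * m + l * l * r)" using x D by (intro mult_nonneg_nonneg) auto
 also have "\<dots> = x * D * q + 2 * x * P * m + (P\<^sup>2 / D) * (x * r)"
  using D by (simp add: l_def power2_eq_square field_simps)
 also have "\<dots> \<le> x * D * q + 2 * x * P * m + (P\<^sup>2 / D) * (G * D)"
  using G D by (intro add_left_mono mult_left_mono) (auto simp: r_def)
 also have "\<dots> = G * P\<^sup>2 + x * D * q + 2 * x * P * m" using D by simp
 finally show ?thesis by (simp add: q_def m_def)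
qed

text \<open>The weight of the energy estimate. Its support is bounded away from \<open>x = 0\<close>, uniformly in
 \<open>s\<close>, by the second factor, which is a function of the null coordinate \<open>s - 2 ln x\<close>
 and hence annihilated by \<open>Yd\<close>.\<close>

definition wt :: "(real \<Rightarrow> real) \<Rightarrow> real \<Rightarrow> real \<Rightarrow> (real \<Rightarrow> real) \<Rightarrow> (real \<Rightarrow> real) \<Rightarrow> real ^ 'n::finite \<Rightarrow> 'n fn" where
 "wt cf \<kappa> \<mu> F G y0 z = cf (fst z) * (psq (1 - \<kappa> * (exp (fst (snd z)) * inverse (fst z * fst z)))
   * (exp (\<mu> * (fst z - fst (snd z))) * psq (F (fst (snd z)) + G (fst z) - (snd (snd z) - y0) \<bullet> (snd (snd z) - y0))))"

text \<open>Each factor of the weight has its task. The exponential gives the coercive terms, since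
  \<open>Yd\<close> of x - s is x - 2 \<le> -1 and its derivative in x is 1. The phase F + G - |y -
  y0|^2 localises in y; the cone condition makes its differential causal, so its contribution is
  non-negative by \<open>quadratic_form_bracket\<close>. Where \<open>cf\<close> falls,
  \<open>- cf'\<close> is split into a multiple of \<open>cf\<close>, which \<mu> absorbs, and the
  error \<open>kk\<close>.\<close>

lemma wt_properties:
 fixes a :: "'n::finite \<Rightarrow> 'n \<Rightarrow> 'n fn"
 assumes \<Omega>: "open \<Omega>" and x: "\<And>z. z \<in> \<Omega> \<Longrightarrow> 0 < fst z \<and> fst z \<le> 1"
  and sym: "\<And>i j z. z \<in> \<Omega> \<Longrightarrow> a i j z = a j i z"
  and pos: "\<And>z \<xi>. z \<in> \<Omega> \<Longrightarrow> 0 \<le> qform a z \<xi>"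
  and A0: "\<And>z \<xi>. z \<in> \<Omega> \<Longrightarrow> qform a z \<xi> \<le> A0 * sqn \<xi>"
  and cf: "\<And>r. (cf has_real_derivative cf' r) (at r)" "continuous_on UNIV cf'" "\<And>r. 0 \<le> cf r" "\<And>r. cf' r \<le> 0"
  and kk: "\<And>r. - cf' r \<le> m * cf r + kk r" "0 \<le> m"
  and F: "\<And>r. (F has_real_derivative F' r) (at r)" "continuous_on UNIV F'"
  and G: "\<And>r. (G has_real_derivative G' r) (at r)" "continuous_on UNIV G'"
  and \<kappa>: "0 < \<kappa>" and \<mu>: "0 \<le> \<mu>"
  and cone: "\<And>x s y. (x, s, y) \<in> \<Omega> \<Longrightarrow> cf x > 0 \<Longrightarrow> F s + G x - (y - y0) \<bullet> (y - y0) > 0 \<Longrightarrow>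
    0 < - (x * G' x + 2 * F' s) \<and> x * (4 * A0 * ((y - y0) \<bullet> (y - y0))) \<le> G' x * - (x * G' x + 2 * F' s)"
 shows "Ck_on 1 \<Omega> (wt cf \<kappa> \<mu> F G y0)"
  and "\<And>z P \<xi>. z \<in> \<Omega> \<Longrightarrow> weight_ineq a (wt cf \<kappa> \<mu> F G y0) (wt kk \<kappa> \<mu> F G y0) (\<mu> - m - 1) z P \<xi>"
  and "\<And>z. z \<in> \<Omega> \<Longrightarrow> - Yd (wt cf \<kappa> \<mu> F G y0) z - wt cf \<kappa> \<mu> F G y0 z \<ge> (\<mu> - m - 1) * wt cf \<kappa> \<mu> F G y0 z"
proof -
 let ?w = "\<lambda>c. wt c \<kappa> \<mu> F G y0"
 let ?x = "fst :: 'n fn" and ?s = "\<lambda>z::'n pt. fst (snd z)" and ?e = "\<lambda>z::'n pt. snd (snd z)"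
 define f2 where "f2 = (\<lambda>z::'n pt. 1 - \<kappa> * (exp (?s z) * inverse (?x z * ?x z)))"
 define f3 where "f3 = (\<lambda>z::'n pt. \<mu> * (?x z - ?s z))"
 define f4 where "f4 = (\<lambda>z::'n pt. F (?s z) + G (?x z) - (?e z - y0) \<bullet> (?e z - y0))"
 have wt: "?w c = (\<lambda>z. c (?x z) * (psq (f2 z) * (exp (f3 z) * psq (f4 z))))" for c
  by (simp add: wt_def fun_eq_iff f2_def f3_def f4_def)
 have bl: "bounded_linear ?x" "bounded_linear ?s"
  by (auto intro: bounded_linear_compose bounded_linear_fst bounded_linear_snd)
 have ble: "bounded_linear (\<lambda>z::'n pt. ?e z $ i)" for i
  by (intro bounded_linear_compose[OF bounded_linear_vec_nth] bounded_linear_compose[OF bounded_linear_snd] bounded_linear_snd)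
 have Cx: "Ck_on 1 \<Omega> ?x" "Ck_on 1 \<Omega> ?s" "Ck_on 1 \<Omega> (\<lambda>z. ?e z $ i)" for i
  by (intro Ck_on_linear[OF \<Omega>] bl ble)+
 have Ccf: "Ck_on 1 UNIV cf" using Ck_on_real[of UNIV cf cf' 0] cf by simp
 have CF: "Ck_on 1 UNIV F" using Ck_on_real[of UNIV F F' 0] F by simp
 have CG: "Ck_on 1 UNIV G" using Ck_on_real[of UNIV G G' 0] G by simp
 have cmp: "Ck_on 1 \<Omega> (\<lambda>z. g (f z))" if "Ck_on 1 \<Omega> f" "Ck_on 1 UNIV g" for f :: "'n fn" and g :: "real \<Rightarrow> real"
  by (rule Ck_on_compose[OF \<Omega> that]) auto
 have inner: "(\<lambda>z::'n pt. (?e z - y0) \<bullet> (?e z - y0)) = (\<lambda>z. \<Sum>!i. (?e z $ i - y0 $ i) * (?e z $ i - y0 $ i))"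
  by (simp add: inner_vec_def)
 have Cin: "Ck_on 1 \<Omega> (\<lambda>z. inverse (?x z * ?x z))"
  by (rule Ck_on_compose[OF \<Omega> Ck_on_mult[OF \<Omega> Cx(1) Cx(1)] Ck_on_inverse]) (use x in auto)
 have C2: "Ck_on 1 \<Omega> f2" unfolding f2_def
  by (intro Ck_on_diff Ck_on_cmult Ck_on_mult \<Omega> cmp[OF Cx(2) Ck_on_exp] Cin Ck_on_const)
 have C3: "Ck_on 1 \<Omega> f3" unfolding f3_def by (intro Ck_on_cmult Ck_on_diff \<Omega> Cx)
 have C4': "Ck_on 1 \<Omega> (\<lambda>z. (?e z - y0) \<bullet> (?e z - y0))"
  unfolding inner by (intro Ck_on_sum Ck_on_mult Ck_on_diff \<Omega> Cx Ck_on_const)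
 have C4: "Ck_on 1 \<Omega> f4" unfolding f4_def
  by (intro Ck_on_diff Ck_on_add \<Omega> C4' cmp[OF Cx(2) CF] cmp[OF Cx(1) CG])
 note Cs = cmp[OF Cx(1) Ccf] cmp[OF C2 Ck_on_psq] cmp[OF C3 Ck_on_exp] cmp[OF C4 Ck_on_psq]
 show C: "Ck_on 1 \<Omega> (?w cf)"
  unfolding wt by (intro Ck_on_mult \<Omega> Cs)
 have key: "(weight_ineq a (?w cf) (?w kk) (\<mu> - m - 1) z P \<xi>) \<and>
   - Yd (?w cf) z - ?w cf z \<ge> (\<mu> - m - 1) * ?w cf z"
  if z: "z \<in> \<Omega>" for z P \<xi>
 proof -
  obtain x s y where zz: "z = (x, s, y)" by (cases z)
  have x0: "0 < x" "x \<le> 1" using assms(2)[OF z] by (auto simp: zz)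
  have d: "f differentiable (at z)" if "Ck_on 1 \<Omega> f" for f :: "'n fn"
   using that z by (simp add: Ck_on_Suc_iff)
  have dx: "dd v ?x z = fst v" "dd v ?s z = fst (snd v)" "dd v (\<lambda>z. ?e z $ i) z = snd (snd v) $ i" for v i
   using dd_linear[OF bl(1)] dd_linear[OF bl(2)] dd_linear[OF ble] by auto
  define f where "f = f4 z"
  define M where "M = max 0 f"
  define R where "R = 1 - \<kappa> * exp s / x\<^sup>2"
  define N where "N = max 0 R"
  define E where "E = exp (\<mu> * (x - s))"
  have fz: "f2 z = R" "exp (f3 z) = E" "f4 z = f" "f = F s + G x - (y - y0) \<bullet> (y - y0)"
   by (auto simp: zz f2_def f3_def f4_def f_def R_def E_def power2_eq_square divide_inverse)
  have d4': "dd v (\<lambda>z. (?e z - y0) \<bullet> (?e z - y0)) z = 2 * (\<Sum>!i. (y $ i - y0 $ i) * snd (snd v) $ i)" for v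
   unfolding inner
   by (simp only: dd_sum dd_mult dd_diff dd_const dx d[OF Cx(3)] differentiable_mult differentiable_diff differentiable_const)
     (simp add: zz sum_distrib_left algebra_simps)
  have d4: "dd v f4 z = F' s * fst (snd v) + G' x * fst v - 2 * (\<Sum>!i. (y $ i - y0 $ i) * snd (snd v) $ i)" for v
  proof -
   have 1: "dd v (\<lambda>z. F (?s z)) z = F' s * fst (snd v)" "dd v (\<lambda>z. G (?x z)) z = G' x * fst v"
    using dd_real_compose[OF d[OF Cx(2)] F(1)] dd_real_compose[OF d[OF Cx(1)] G(1)] dx by (auto simp: zz)
   show ?thesis unfolding f4_def
    using 1 d4'[of v] d[OF cmp[OF Cx(2) CF]] d[OF cmp[OF Cx(1) CG]] d[OF C4']
    by (simp add: dd_diff dd_add)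
  qed
  have d3: "dd v f3 z = \<mu> * (fst v - fst (snd v))" for v
   unfolding f3_def using d[OF Cx(1)] d[OF Cx(2)] by (simp add: dd_mult dd_diff dx)
  have d2: "dd v f2 z = - \<kappa> * exp s / x\<^sup>2 * fst (snd v) + 2 * \<kappa> * exp s / x^3 * fst v" for v
  proof -
   have 1: "dd v (\<lambda>z. exp (?s z)) z = exp s * fst (snd v)"
    using dd_real_compose[OF d[OF Cx(2)] DERIV_exp] dx by (auto simp: zz)
   have "((\<lambda>r. inverse (r * r)) has_real_derivative - 2 / x^3) (at x)"
    using x0 by (auto intro!: derivative_eq_intros simp: field_simps power3_eq_cube)
   then have 2: "dd v (\<lambda>z. inverse (?x z * ?x z)) z = - 2 / x^3 * fst v"
    using dd_real_compose[OF d[OF Cx(1)], of "\<lambda>r. inverse (r * r)" "- 2 / x^3" v] dx by (auto simp: zz)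
   show ?thesis unfolding f2_def
    by (simp only: dd_diff dd_mult dd_const 1 2 d[OF cmp[OF Cx(2) Ck_on_exp]] d[OF Cin] differentiable_mult differentiable_diff differentiable_const)
      (simp add: zz power2_eq_square field_simps)
  qed
  have dw: "dd v (?w cf) z = cf' x * fst v * (N\<^sup>2 * (E * M\<^sup>2)) + cf x * (2 * N * dd v f2 z * (E * M\<^sup>2)
    + N\<^sup>2 * (E * dd v f3 z * M\<^sup>2 + E * (2 * M * dd v f4 z)))" for v
  proof -
   have 1: "dd v (\<lambda>z. cf (?x z)) z = cf' x * fst v"
    using dd_real_compose[OF d[OF Cx(1)] cf(1)] dx by (auto simp: zz)
   have 2: "dd v (\<lambda>z. psq (f2 z)) z = 2 * N * dd v f2 z"
    using dd_real_compose[OF d[OF C2] psq_deriv] by (auto simp: fz N_def)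
   have 3: "dd v (\<lambda>z. exp (f3 z)) z = E * dd v f3 z"
    using dd_real_compose[OF d[OF C3] DERIV_exp] by (auto simp: fz)
   have 4: "dd v (\<lambda>z. psq (f4 z)) z = 2 * M * dd v f4 z"
    using dd_real_compose[OF d[OF C4] psq_deriv] by (auto simp: fz M_def)
   show ?thesis unfolding wt
    by (simp only: dd_mult 1 2 3 4 fz(1-3) d[OF Cs(1)] d[OF Cs(2)] d[OF Cs(3)] d[OF Cs(4)] differentiable_mult)
     (simp only: psq_def M_def[symmetric] N_def[symmetric], simp add: zz)
  qed
  have w0: "?w c z = c x * (N\<^sup>2 * (E * M\<^sup>2))" for c
   unfolding wt by (simp add: fz psq_def M_def N_def) (simp add: zz)
  have eX: "fst (eX::'n pt) = 1" "fst (snd (eX::'n pt)) = 0" "snd (snd (eX::'n pt)) = 0"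
   "fst (eS::'n pt) = 0" "fst (snd (eS::'n pt)) = 1" "snd (snd (eS::'n pt)) = 0"
   "fst (eH i::'n pt) = 0" "fst (snd (eH i::'n pt)) = 0" "snd (snd (eH i::'n pt)) = axis i 1" for i
   by (auto simp: eX_def eS_def eH_def)
  have ax: "(\<Sum>!i. (y $ i - y0 $ i) * (axis j 1 :: real^'n) $ i) = y $ j - y0 $ j" for j
   by (simp add: axis_def if_distrib cong: if_cong)
  define B where "B = cf x * N\<^sup>2 * E"
  \<comment> \<open>The derivative in x that falls on the null cutoff. It is non-negative and
    cancels in \<open>Yd\<close>, so no bound for its size is required.\<close>
  define Z where "Z = cf x * (2 * N * (2 * \<kappa> * exp s / x^3) * (E * M\<^sup>2))"
  define D where "D = - (x * G' x + 2 * F' s)"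
  have nn: "0 \<le> B" "0 \<le> M" "0 \<le> N" "0 \<le> E" "0 \<le> Z"
   using cf(3)[of x] x0 \<kappa> by (auto simp: B_def M_def N_def E_def Z_def)
  have WX: "dd eX (?w cf) z = cf' x * (N\<^sup>2 * E * M\<^sup>2) + Z + B * (\<mu> * M\<^sup>2) + B * (2 * M) * G' x"
   unfolding dw d2 d3 d4 eX by (simp add: B_def Z_def algebra_simps)
  have WS: "dd eS (?w cf) z = - (x / 2) * Z - B * (\<mu> * M\<^sup>2) + B * (2 * M) * F' s"
   unfolding dw d2 d3 d4 eX using x0 by (simp add: B_def Z_def power2_eq_square power3_eq_cube field_simps)
  have WH: "dd (eH i) (?w cf) z = B * (2 * M) * (- 2 * (y $ i - y0 $ i))" for i
   unfolding dw d2 d3 d4 eX ax by (simp add: B_def algebra_simps)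
  have WY: "Yd (?w cf) z = x * cf' x * (N\<^sup>2 * E * M\<^sup>2) + (x - 2) * (\<mu> * (B * M\<^sup>2)) - B * (2 * M) * D"
   unfolding Yd_def WX WS by (simp add: zz D_def algebra_simps)
  define q where "q = qform a z \<xi>"
  have q0: "0 \<le> q" unfolding q_def by (rule pos[OF z])
  define L where "L = (\<Sum>!i j. a i j z * (- 2 * (y $ i - y0 $ i)) * \<xi> j)"
  have LH: "(\<Sum>!i j. a i j z * dd (eH i) (?w cf) z * \<xi> j) = B * (2 * M) * L"
   unfolding WH L_def by (simp add: sum_distrib_left algebra_simps)
  \<comment> \<open>Where the phase or the cutoff in x is not positive, M or B is zero; the cone
    condition enters only on the support of the weight.\<close>
  have cone': "0 \<le> B * (2 * M) * (G' x * P\<^sup>2 + x * D * q + 2 * x * P * L) \<and> 0 \<le> B * (2 * M) * D"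
  proof (cases "cf x > 0 \<and> f > 0")
   case True
   then have c: "0 < D" "x * (4 * A0 * ((y - y0) \<bullet> (y - y0))) \<le> G' x * D"
    using cone[of x s y] z by (auto simp: zz fz D_def)
   have "(\<Sum>!i j. a i j z * (- 2 * (y $ i - y0 $ i)) * (- 2 * (y $ j - y0 $ j))) \<le> A0 * (\<Sum>!i. (- 2 * (y $ i - y0 $ i))\<^sup>2)"
    by (rule A0[OF z])
   also have "\<dots> = 4 * A0 * ((y - y0) \<bullet> (y - y0))"
    by (simp add: inner_vec_def power2_eq_square sum_distrib_left algebra_simps)
   finally have "x * (\<Sum>!i j. a i j z * (- 2 * (y $ i - y0 $ i)) * (- 2 * (y $ j - y0 $ j))) \<le> G' x * D"
    using c(2) x0 by (meson mult_left_mono less_imp_le order_trans)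
   then have "0 \<le> G' x * P\<^sup>2 + x * D * q + 2 * x * P * L"
    unfolding q_def L_def using x0 c(1) z by (intro quadratic_form_bracket sym pos) auto
   then show ?thesis using nn c(1) by simp
  next
   case False
   then have "B = 0 \<or> M = 0" using cf(3)[of x] by (auto simp: B_def M_def)
   then show ?thesis by auto
  qed
  have xi: "0 \<le> - cf' x * (N\<^sup>2 * E * M\<^sup>2)" using cf(4)[of x] nn by (simp add: mult_nonpos_nonneg)
  have BM: "B * M\<^sup>2 = cf x * (N\<^sup>2 * E * M\<^sup>2)" by (simp add: B_def)
  define U where "U = N\<^sup>2 * E * M\<^sup>2"
  have U: "0 \<le> U" using nn by (simp add: U_def)
  have kb: "- cf' x * U \<le> m * (cf x * U) + kk x * U"
   using mult_right_mono[OF kk(1)[of x] U] by (simp add: algebra_simps)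
  have chU: "0 \<le> cf x * U" using cf(3)[of x] U by simp
  have first: "(\<mu> - m - 1) * (cf x * U) * (P\<^sup>2 + x * q) - kk x * U * P\<^sup>2
    \<le> (cf' x * U + Z + \<mu> * (cf x * U) + B * (2 * M) * G' x) * P\<^sup>2
     - x * (x * cf' x * U + (x - 2) * (\<mu> * (cf x * U)) - B * (2 * M) * D) * q + 2 * x * P * (B * (2 * M) * L)"
  proof -
   have 1: "(\<mu> - m - 1) * (cf x * U) * P\<^sup>2 - kk x * U * P\<^sup>2 \<le> (cf' x * U + Z + \<mu> * (cf x * U)) * P\<^sup>2"
   proof -
    have "(\<mu> - m - 1) * (cf x * U) - kk x * U \<le> cf' x * U + Z + \<mu> * (cf x * U)"
     using kb nn(5) chU by (simp add: left_diff_distrib)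
    then show ?thesis using mult_right_mono[of _ _ "P\<^sup>2"] by (metis left_diff_distrib zero_le_power2)
   qed
   have 2: "(\<mu> - m - 1) * (cf x * U) * (x * q) \<le> - x * (x * cf' x * U + (x - 2) * (\<mu> * (cf x * U))) * q"
   proof -
    have "(\<mu> - m - 1) * (cf x * U) \<le> \<mu> * (cf x * U)"
     using chU kk(2) by (intro mult_right_mono) auto
    also have "\<mu> * (cf x * U) \<le> (2 - x) * (\<mu> * (cf x * U))"
     using x0 mult_right_mono[of 1 "2 - x" "\<mu> * (cf x * U)"] chU \<mu> by simp
    also have "\<dots> \<le> - (x * cf' x * U + (x - 2) * (\<mu> * (cf x * U)))"
     using mult_nonneg_nonneg[OF less_imp_le[OF x0(1)] xi] by (simp add: U_def algebra_simps)
    finally have "(\<mu> - m - 1) * (cf x * U) * (x * q) \<le> - (x * cf' x * U + (x - 2) * (\<mu> * (cf x * U))) * (x * q)"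
     using x0 q0 by (intro mult_right_mono) auto
    then show ?thesis by (simp add: algebra_simps)
   qed
   show ?thesis using 1 2 cone'[THEN conjunct1] by (simp add: algebra_simps)
  qed
  have second: "(\<mu> - m - 1) * (cf x * U) \<le> - (x * cf' x * U + (x - 2) * (\<mu> * (cf x * U)) - B * (2 * M) * D) - cf x * U"
  proof -
   have "\<mu> * (cf x * U) \<le> (2 - x) * (\<mu> * (cf x * U))"
    using x0 mult_right_mono[of 1 "2 - x" "\<mu> * (cf x * U)"] chU \<mu> by simp
   also have "\<dots> \<le> - (x * cf' x * U + (x - 2) * (\<mu> * (cf x * U)))"
    using mult_nonneg_nonneg[OF less_imp_le[OF x0(1)] xi] by (simp add: U_def algebra_simps)
   finally have 1: "\<mu> * (cf x * U) \<le> - (x * cf' x * U + (x - 2) * (\<mu> * (cf x * U)))" .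
   have "0 \<le> m * (cf x * U)" using kk(2) chU by simp
   moreover have "(\<mu> - m - 1) * (cf x * U) = \<mu> * (cf x * U) - m * (cf x * U) - cf x * U" by (simp add: algebra_simps)
   ultimately show ?thesis using 1 cone'[THEN conjunct2] by linarith
  qed
  have fz1: "fst z = x" by (simp add: zz)
  have w0': "?w c z = c x * U" for c unfolding w0 U_def by simp
  have WX': "dd eX (?w cf) z = cf' x * U + Z + \<mu> * (cf x * U) + B * (2 * M) * G' x"
   unfolding WX U_def by (simp add: B_def algebra_simps)
  have WY': "Yd (?w cf) z = x * cf' x * U + (x - 2) * (\<mu> * (cf x * U)) - B * (2 * M) * D"
   unfolding WY U_def BM by simp
  show ?thesis
   unfolding LH w0' WX' WY' fz1 q_def[symmetric] using first second by blast
 qed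
 show "\<And>z P \<xi>. z \<in> \<Omega> \<Longrightarrow> weight_ineq a (?w cf) (?w kk) (\<mu> - m - 1) z P \<xi>"
  by (rule key[THEN conjunct1])
 show "\<And>z. z \<in> \<Omega> \<Longrightarrow> - Yd (?w cf) z - ?w cf z \<ge> (\<mu> - m - 1) * ?w cf z"
  by (rule key[THEN conjunct2])
qed

section \<open>Bounds for quadratic and linear forms\<close>

lemma abs_quadratic_form_le:
 fixes A :: "'n::finite \<Rightarrow> 'n \<Rightarrow> real"
 assumes "\<And>i j. \<bar>A i j\<bar> \<le> C"
 shows "\<bar>\<Sum>!i j. A i j * \<xi> i * \<xi> j\<bar> \<le> C * real CARD('n) * sqn \<xi>"
proof -
 have C: "0 \<le> C" using assms[of undefined undefined] by linarith
 have "\<bar>\<Sum>!i j. A i j * \<xi> i * \<xi> j\<bar> \<le> (\<Sum>!i j. C * (((\<xi> i)\<^sup>2 + (\<xi> j)\<^sup>2) / 2))"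
 proof (rule order_trans[OF sum_abs], rule sum_mono, rule order_trans[OF sum_abs], rule sum_mono)
  fix i j
  have "\<bar>\<xi> i\<bar> * \<bar>\<xi> j\<bar> \<le> ((\<xi> i)\<^sup>2 + (\<xi> j)\<^sup>2) / 2"
   using zero_le_power2[of "\<bar>\<xi> i\<bar> - \<bar>\<xi> j\<bar>"] by (simp add: power2_diff)
  then have "\<bar>A i j\<bar> * (\<bar>\<xi> i\<bar> * \<bar>\<xi> j\<bar>) \<le> C * (((\<xi> i)\<^sup>2 + (\<xi> j)\<^sup>2) / 2)"
   using assms C by (intro mult_mono) auto
  then show "\<bar>A i j * \<xi> i * \<xi> j\<bar> \<le> C * (((\<xi> i)\<^sup>2 + (\<xi> j)\<^sup>2) / 2)" by (simp add: abs_mult mult.assoc)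
 qed
 also have "\<dots> = C * real CARD('n) * sqn \<xi>"
 proof -
  define N where "N = sqn \<xi>"
  have "(\<Sum>!j. C * (((\<xi> i)\<^sup>2 + (\<xi> j)\<^sup>2) / 2)) = C * (real CARD('n) * (\<xi> i)\<^sup>2 + N) / 2" for i
   by (simp add: N_def sum_distrib_left[symmetric] sum.distrib sum_divide_distrib[symmetric])
  then have "(\<Sum>!i j. C * (((\<xi> i)\<^sup>2 + (\<xi> j)\<^sup>2) / 2)) = (\<Sum>!i. C * (real CARD('n) * (\<xi> i)\<^sup>2 + N) / 2)"
   by (intro sum.cong refl)
  also have "\<dots> = C * (real CARD('n) * N + real CARD('n) * N) / 2"
   by (simp add: N_def sum_distrib_left[symmetric] sum.distrib sum_divide_distrib[symmetric])
  finally show ?thesis by (simp add: N_def)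
 qed
 finally show ?thesis .
qed

lemma linear_form_square_le:
 fixes \<xi> :: "'n::finite \<Rightarrow> real"
 assumes "\<And>j. \<bar>c j\<bar> \<le> C"
 shows "(\<Sum>!j. c j * \<xi> j)\<^sup>2 \<le> C\<^sup>2 * real CARD('n) * sqn \<xi>"
proof -
 have "(\<Sum>!j. c j * \<xi> j)\<^sup>2 = (\<Sum>!i j. (c i * c j) * \<xi> i * \<xi> j)"
  by (simp add: power2_eq_square sum_product algebra_simps)
 also have "\<dots> \<le> C\<^sup>2 * real CARD('n) * sqn \<xi>"
 proof -
  have "\<bar>c i * c j\<bar> \<le> C\<^sup>2" for i j
   unfolding abs_mult power2_eq_square using assms[of i] by (intro mult_mono assms) auto
  from abs_quadratic_form_le[where \<xi>=\<xi> and A="\<lambda>i j. c i * c j", OF this] show ?thesis by linarith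
 qed
 finally show ?thesis .
qed

section \<open>The model equation near a boundary point\<close>

definition reg :: "real \<Rightarrow> real \<Rightarrow> real ^ 'n::finite \<Rightarrow> 'n pt set" where
 "reg x0 \<rho> y0 = {0<..<x0} \<times> UNIV \<times> ball y0 \<rho>"

lemma open_reg: "open (reg x0 \<rho> y0)"
 unfolding reg_def by (intro open_Times open_UNIV open_ball open_greaterThanLessThan)

text \<open>Smoothness up to x = 0 in the form of bounds on the open side x > 0, uniform in s, which
  is unrestricted in \<open>reg\<close>.\<close>

definition bsmooth :: "'n::finite pt set \<Rightarrow> 'n fn \<Rightarrow> bool" where
 "bsmooth \<Omega> f \<longleftrightarrow> Cinf_on \<Omega> f \<and> (\<forall>l. \<exists>C. \<forall>z\<in>\<Omega>. \<bar>Dl l f z\<bar> \<le> C)"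

lemma Dl_append: "Dl (l @ l') f = Dl l (Dl l' f)"
 by (induction l) auto

lemma bsmooth_dd: "bsmooth \<Omega> f \<Longrightarrow> bsmooth \<Omega> (dd v f)"
proof -
 assume f: "bsmooth \<Omega> f"
 then have "\<exists>C. \<forall>z\<in>\<Omega>. \<bar>Dl (l @ [v]) f z\<bar> \<le> C" for l unfolding bsmooth_def by blast
 then show ?thesis using f Cinf_on_dd[of \<Omega> f v] by (simp add: bsmooth_def Dl_append)
qed

lemma bsmooth_Cinf: "bsmooth \<Omega> f \<Longrightarrow> Cinf_on \<Omega> f"
 by (simp add: bsmooth_def)

lemma bsmooth_bound: "bsmooth \<Omega> f \<Longrightarrow> \<exists>C\<ge>0. \<forall>z\<in>\<Omega>. \<bar>f z\<bar> \<le> C"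
proof -
 assume "bsmooth \<Omega> f"
 then have "\<exists>C. \<forall>z\<in>\<Omega>. \<bar>Dl [] f z\<bar> \<le> C" unfolding bsmooth_def by blast
 then obtain C where "\<forall>z\<in>\<Omega>. \<bar>f z\<bar> \<le> C" by auto
 then show ?thesis by (intro exI[of _ "max C 0"]) (simp add: le_max_iff_disj)
qed

lemma Dl_cong:
 assumes "open \<Omega>" "\<And>z. z \<in> \<Omega> \<Longrightarrow> f z = g z" "z \<in> \<Omega>"
 shows "Dl l f z = Dl l g z"
 using assms(3)
proof (induction l arbitrary: z)
 case (Cons v l)
 then show ?case using dd_cong_open[OF assms(1), of "Dl l f" "Dl l g" z v] by simp
qed (use assms in auto)

lemma bsmooth_const: "open \<Omega> \<Longrightarrow> bsmooth \<Omega> (\<lambda>_. c)"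
proof -
 have "\<exists>d. Dl l (\<lambda>_. c) = (\<lambda>_::'a pt. d)" for l
 proof (induction l)
  case (Cons v l)
  then obtain d where "Dl l (\<lambda>_. c) = (\<lambda>_::'a pt. d)" by blast
  then have "Dl (v # l) (\<lambda>_. c) = (\<lambda>_::'a pt. 0)" by (intro ext) simp
  then show ?case by blast
 qed auto
 then have "\<exists>C. \<forall>z\<in>\<Omega>. \<bar>Dl l (\<lambda>_. c) z\<bar> \<le> C" for l
 proof -
  obtain d where "Dl l (\<lambda>_. c) = (\<lambda>_::'a pt. d)" using \<open>\<And>l. \<exists>d. Dl l (\<lambda>_. c) = (\<lambda>_::'a pt. d)\<close> by blast
  then show ?thesis by (intro exI[of _ "\<bar>d\<bar>"]) simp
 qed
 then show "bsmooth \<Omega> (\<lambda>_. c)" unfolding bsmooth_def by simp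
qed

lemma Dl_minus:
 assumes "open \<Omega>" "Cinf_on \<Omega> f" "z \<in> \<Omega>"
 shows "Dl l (\<lambda>z. - f z) z = - Dl l f z"
 using assms(3)
proof (induction l arbitrary: z)
 case (Cons v l)
 have "dd v (Dl l (\<lambda>z. - f z)) z = dd v (\<lambda>z. - Dl l f z) z"
  by (rule dd_cong_open[OF assms(1)]) (use Cons in auto)
 also have "\<dots> = - dd v (Dl l f) z"
  by (rule dd_minus) (rule Cinf_on_differentiable[OF Cinf_on_Dl[OF assms(2)] Cons.prems])
 finally show ?case by simp
qed auto

lemma bsmooth_minus: "open \<Omega> \<Longrightarrow> bsmooth \<Omega> f \<Longrightarrow> bsmooth \<Omega> (\<lambda>z. - f z)"
 unfolding bsmooth_def using Cinf_on_minus[of \<Omega> f] Dl_minus[of \<Omega> f] by simp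

text \<open>The directions whose derivatives commute with multiplication by x and with
  \<open>Yd\<close>; \<open>eX\<close> does not.\<close>

definition tang :: "'n::finite pt set" where "tang = insert eS (range eH)"

lemma fst_tang: "v \<in> tang \<Longrightarrow> fst v = 0"
 by (auto simp: tang_def eS_def eH_def)

lemma finite_tang: "finite tang" by (simp add: tang_def)

lemma eH_tang: "eH i \<in> tang" and eS_tang: "eS \<in> tang" by (auto simp: tang_def)

definition tlists :: "nat \<Rightarrow> 'n::finite pt list set" where
 "tlists k = {l. set l \<subseteq> tang \<and> length l \<le> k}"

abbreviation "grad_sum k w z \<equiv> \<Sum>l\<in>tlists k. fst z * grad2 (Dl l w) z + (Dl l w z)\<^sup>2"

abbreviation "jet_sum k w z \<equiv> \<Sum>l\<in>tlists k. (Dl l w z)\<^sup>2 + (Yd (Dl l w) z)\<^sup>2"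

abbreviation "jet_l2 k w p q C \<equiv> set_integrable lborel (cbox p q) (\<lambda>z. jet_sum k w z) \<and>
 (LINT z:cbox p q|lborel. jet_sum k w z) \<le> C"

lemma finite_tlists: "finite (tlists k)"
 unfolding tlists_def by (rule finite_lists_length_le[OF finite_tang])

locale wave_eq =
 fixes x0 \<rho> \<theta> :: real and y0 :: "real ^ 'n::finite"
  and a :: "'n \<Rightarrow> 'n \<Rightarrow> 'n fn" and c :: "'n \<Rightarrow> 'n fn" and b :: "'n fn"
 assumes x0: "0 < x0" "x0 \<le> 1" and \<rho>: "0 < \<rho>" and \<theta>: "0 < \<theta>"
  and a: "\<And>i j. bsmooth (reg x0 \<rho> y0) (a i j)" and c: "\<And>i. bsmooth (reg x0 \<rho> y0) (c i)"
  and b: "bsmooth (reg x0 \<rho> y0) b"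
  and sym: "\<And>i j z. z \<in> reg x0 \<rho> y0 \<Longrightarrow> a i j z = a j i z"
  and ell: "\<And>z \<xi>. z \<in> reg x0 \<rho> y0 \<Longrightarrow> \<theta> * sqn \<xi> \<le> qform a z \<xi>"
begin

abbreviation \<Omega> :: "'n pt set" where "\<Omega> \<equiv> reg x0 \<rho> y0"

text \<open>The first-order terms carry the factor x, which matches the factor of the tangential
  gradient in \<open>energy\<close>.\<close>

definition solves :: "'n fn \<Rightarrow> bool" where
 "solves w \<longleftrightarrow> (\<forall>z\<in>\<Omega>. wave_op a w z + fst z * (\<Sum>!i. c i z * dd (eH i) w z) + b z * w z = 0)"

lemma x_bounds: "z \<in> \<Omega> \<Longrightarrow> 0 < fst z \<and> fst z \<le> 1"
 using x0 by (auto simp: reg_def)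

lemma a_C1: "Ck_on 1 \<Omega> (a i j)"
 using bsmooth_Cinf[OF a] by (simp add: Cinf_on_def)

lemma a_nonneg: "z \<in> \<Omega> \<Longrightarrow> 0 \<le> qform a z \<xi>"
 by (rule order_trans[OF _ ell]) (use \<theta> in \<open>auto intro!: mult_nonneg_nonneg sum_nonneg\<close>)

lemma uniform_bound:
 fixes f :: "'n \<Rightarrow> 'n \<Rightarrow> 'n fn"
 assumes "\<And>i j. bsmooth \<Omega> (f i j)"
 shows "\<exists>C\<ge>0. \<forall>z\<in>\<Omega>. \<forall>i j :: 'n. \<bar>f i j z\<bar> \<le> C"
proof -
 obtain K where K: "\<And>i j. 0 \<le> K i j" "\<And>i j z. z \<in> \<Omega> \<Longrightarrow> \<bar>f i j z\<bar> \<le> K i j"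
 proof -
  have "\<forall>p. \<exists>C\<ge>0. \<forall>z\<in>\<Omega>. \<bar>f (fst p) (snd p) z\<bar> \<le> C" using bsmooth_bound[OF assms] by blast
  from choice[OF this] obtain K where "\<And>p. 0 \<le> K p \<and> (\<forall>z\<in>\<Omega>. \<bar>f (fst p) (snd p) z\<bar> \<le> K p)" by blast
  then show ?thesis by (intro that[of "\<lambda>i j. K (i, j)"]) (metis fst_conv snd_conv)+
 qed
 have "\<bar>f i j z\<bar> \<le> (\<Sum>!i j. K i j)" if "z \<in> \<Omega>" for i j z
 proof -
  have "\<bar>f i j z\<bar> \<le> K i j" using K that by blast
  also have "\<dots> \<le> (\<Sum>!j. K i j)" by (rule member_le_sum) (use K(1) in auto)
  also have "\<dots> \<le> (\<Sum>!i j. K i j)"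
   by (rule member_le_sum[of i UNIV "\<lambda>i. \<Sum>!j. K i j"]) (use K(1) in \<open>auto intro!: sum_nonneg\<close>)
  finally show ?thesis .
 qed
 then show ?thesis using K by (intro exI[of _ "\<Sum>!i j. K i j"]) (auto intro!: sum_nonneg)
qed

lemma upper_bound: "\<exists>A0\<ge>1. \<forall>z\<in>\<Omega>. \<forall>\<xi>. qform a z \<xi> \<le> A0 * sqn \<xi>"
proof -
 obtain C where C: "0 \<le> C" "\<And>z i j. z \<in> \<Omega> \<Longrightarrow> \<bar>a i j z\<bar> \<le> C" using uniform_bound[where f=a, OF a] by blast
 show ?thesis
 proof (intro exI[of _ "C * real CARD('n) + 1"] conjI ballI allI)
  fix z :: "'n pt" and \<xi> :: "'n \<Rightarrow> real" assume z: "z \<in> \<Omega>"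
  have "0 \<le> sqn \<xi>" by (simp add: sum_nonneg)
  moreover have "\<bar>\<Sum>!i j. a i j z * \<xi> i * \<xi> j\<bar> \<le> C * real CARD('n) * sqn \<xi>"
   by (rule abs_quadratic_form_le) (rule C(2)[OF z])
  ultimately show "qform a z \<xi> \<le> (C * real CARD('n) + 1) * sqn \<xi>"
   by (simp add: distrib_right)
 qed (use C in auto)
qed

lemma derivative_bounds: "\<exists>M\<ge>0. (\<forall>z\<in>\<Omega>. \<forall>\<xi>. (\<Sum>!i j. dd (eH i) (a i j) z * \<xi> j)\<^sup>2 \<le> M * sqn \<xi>)
  \<and> (\<forall>z\<in>\<Omega>. \<forall>\<xi>. \<bar>\<Sum>!i j. Yd (a i j) z * \<xi> i * \<xi> j\<bar> \<le> M * sqn \<xi>)"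
proof -
 obtain C1 where C1: "0 \<le> C1" "\<And>z i j. z \<in> \<Omega> \<Longrightarrow> \<bar>dd eX (a i j) z\<bar> \<le> C1"
  using uniform_bound[where f="\<lambda>i j. dd eX (a i j)", OF bsmooth_dd[OF a]] by blast
 obtain C2 where C2: "0 \<le> C2" "\<And>z i j. z \<in> \<Omega> \<Longrightarrow> \<bar>dd eS (a i j) z\<bar> \<le> C2"
  using uniform_bound[where f="\<lambda>i j. dd eS (a i j)", OF bsmooth_dd[OF a]] by blast
 obtain C3 where C3: "0 \<le> C3" "\<And>z i j. z \<in> \<Omega> \<Longrightarrow> \<bar>dd (eH i) (a i j) z\<bar> \<le> C3"
  using uniform_bound[where f="\<lambda>i j. dd (eH i) (a i j)", OF bsmooth_dd[OF a]] by blast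
 define n where "n = real CARD('n)"
 define M where "M = (n * C3)\<^sup>2 * n + (C1 + 2 * C2) * n"
 have n: "0 \<le> n" by (simp add: n_def)
 show ?thesis
 proof (intro exI[of _ M] conjI ballI allI)
  show "0 \<le> M" using C1 C2 n by (simp add: M_def)
  fix z :: "'n pt" and \<xi> :: "'n \<Rightarrow> real" assume z: "z \<in> \<Omega>"
  have N: "0 \<le> sqn \<xi>" by (simp add: sum_nonneg)
  have "\<bar>\<Sum>!i. dd (eH i) (a i j) z\<bar> \<le> n * C3" for j
  proof -
   have "(\<Sum>!i. \<bar>dd (eH i) (a i j) z\<bar>) \<le> (\<Sum>i\<in>(UNIV::'n set). C3)" by (rule sum_mono) (rule C3(2)[OF z])
   also have "\<dots> = n * C3" by (simp add: n_def)
   finally show ?thesis using sum_abs[of "\<lambda>i. dd (eH i) (a i j) z" UNIV] by linarith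
  qed
  from linear_form_square_le[where \<xi>=\<xi> and c="\<lambda>j. \<Sum>!i. dd (eH i) (a i j) z", OF this]
  have "(\<Sum>!j i. dd (eH i) (a i j) z * \<xi> j)\<^sup>2 \<le> (n * C3)\<^sup>2 * n * sqn \<xi>"
   by (simp add: sum_distrib_right n_def)
  also have "\<dots> \<le> M * sqn \<xi>"
   using N C1 C2 n by (intro mult_right_mono) (auto simp: M_def)
  finally show "(\<Sum>!i j. dd (eH i) (a i j) z * \<xi> j)\<^sup>2 \<le> M * sqn \<xi>"
   by (subst sum.swap)
  have Y: "\<bar>Yd (a i j) z\<bar> \<le> C1 + 2 * C2" for i j
  proof -
   have "\<bar>fst z * dd eX (a i j) z\<bar> \<le> 1 * C1"
    unfolding abs_mult using x_bounds[OF z] C1(2)[OF z] by (intro mult_mono) auto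
   then show ?thesis using C2(2)[OF z, of i j] by (simp add: Yd_def)
  qed
  have "\<bar>\<Sum>!i j. Yd (a i j) z * \<xi> i * \<xi> j\<bar> \<le> (C1 + 2 * C2) * n * sqn \<xi>"
   unfolding n_def by (rule abs_quadratic_form_le[OF Y])
  also have "\<dots> \<le> M * sqn \<xi>"
   using N n by (intro mult_right_mono) (auto simp: M_def)
  finally show "\<bar>\<Sum>!i j. Yd (a i j) z * \<xi> i * \<xi> j\<bar> \<le> M * sqn \<xi>" .
 qed
qed

text \<open>The errors that the energy can absorb: bounded smooth multiples of tangential words of
  length at most k, or of x times one further tangential derivative of them. A tangential derivative
  leads from k to k + 1. \<open>lower_cong\<close> is included because the identities hold on
  \<Omega> only.\<close>

inductive lower :: "'n fn \<Rightarrow> nat \<Rightarrow> 'n fn \<Rightarrow> bool" for w where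
 lower_H: "bsmooth \<Omega> f \<Longrightarrow> l \<in> tlists k \<Longrightarrow> lower w k (\<lambda>z. f z * (fst z * dd (eH i) (Dl l w) z))"
| lower_0: "bsmooth \<Omega> f \<Longrightarrow> l \<in> tlists k \<Longrightarrow> lower w k (\<lambda>z. f z * Dl l w z)"
| lower_add: "lower w k f \<Longrightarrow> lower w k g \<Longrightarrow> lower w k (\<lambda>z. f z + g z)"
| lower_cong: "lower w k f \<Longrightarrow> (\<And>z. z \<in> \<Omega> \<Longrightarrow> f z = g z) \<Longrightarrow> lower w k g"

lemma lower_zero: "lower w k (\<lambda>_. 0)"
 using lower_cong[OF lower_0[OF bsmooth_const[OF open_reg], of "[]" k w 0]] by (simp add: tlists_def)

lemma lower_sum: "(\<And>i. i \<in> I \<Longrightarrow> lower w k (f i)) \<Longrightarrow> lower w k (\<lambda>z. \<Sum>i\<in>I. f i z)"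
 by (induction I rule: infinite_finite_induct) (auto intro: lower_zero lower_add)

lemma lower_bound:
 assumes "lower w k f"
 shows "\<exists>C\<ge>0. \<forall>z\<in>\<Omega>. (f z)\<^sup>2 \<le> C * grad_sum k w z"
 using assms
proof induction
 case (lower_H f l k i)
 obtain C where C: "0 \<le> C" "\<And>z. z \<in> \<Omega> \<Longrightarrow> \<bar>f z\<bar> \<le> C" using bsmooth_bound[OF lower_H(1)] by blast
 show ?case
 proof (intro exI[of _ "C\<^sup>2"] conjI ballI)
  fix z :: "'n pt" assume z: "z \<in> \<Omega>"
  have x: "0 \<le> fst z" "fst z \<le> 1" using x_bounds[OF z] by auto
  have g: "0 \<le> grad2 u z" for u by (simp add: grad2_def sum_nonneg)
  have "(dd (eH i) (Dl l w) z)\<^sup>2 \<le> grad2 (Dl l w) z"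
   unfolding grad2_def by (rule member_le_sum) auto
  \<comment> \<open>One of the two factors x is given up, since the energy contains a single
    one.\<close>
  then have "(fst z)\<^sup>2 * (dd (eH i) (Dl l w) z)\<^sup>2 \<le> fst z * grad2 (Dl l w) z"
   using x by (intro mult_mono) (auto simp: power2_eq_square mult_left_le)
  also have "\<dots> \<le> fst z * grad2 (Dl l w) z + (Dl l w z)\<^sup>2" by simp
  also have "\<dots> \<le> grad_sum k w z"
   using lower_H(2) x g finite_tlists by (intro member_le_sum) auto
  finally have 1: "(fst z)\<^sup>2 * (dd (eH i) (Dl l w) z)\<^sup>2 \<le> grad_sum k w z" .
  have "(f z)\<^sup>2 \<le> C\<^sup>2" using C(2)[OF z] C(1) by (metis abs_le_square_iff abs_of_nonneg)
  then have "(f z)\<^sup>2 * ((fst z)\<^sup>2 * (dd (eH i) (Dl l w) z)\<^sup>2) \<le> C\<^sup>2 * grad_sum k w z"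
   using 1 by (intro mult_mono) auto
  then show "(f z * (fst z * dd (eH i) (Dl l w) z))\<^sup>2 \<le> C\<^sup>2 * grad_sum k w z"
   by (simp add: power_mult_distrib)
 qed auto
next
 case (lower_0 f l k)
 obtain C where C: "0 \<le> C" "\<And>z. z \<in> \<Omega> \<Longrightarrow> \<bar>f z\<bar> \<le> C" using bsmooth_bound[OF lower_0(1)] by blast
 show ?case
 proof (intro exI[of _ "C\<^sup>2"] conjI ballI)
  fix z :: "'n pt" assume z: "z \<in> \<Omega>"
  have x: "0 \<le> fst z" "fst z \<le> 1" using x_bounds[OF z] by auto
  have g: "0 \<le> grad2 u z" for u by (simp add: grad2_def sum_nonneg)
  have "(Dl l w z)\<^sup>2 \<le> fst z * grad2 (Dl l w) z + (Dl l w z)\<^sup>2" using x g by simp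
  also have "\<dots> \<le> grad_sum k w z"
   using lower_0(2) x g finite_tlists by (intro member_le_sum) auto
  finally have 1: "(Dl l w z)\<^sup>2 \<le> grad_sum k w z" .
  have "(f z)\<^sup>2 \<le> C\<^sup>2" using C(2)[OF z] C(1) by (metis abs_le_square_iff abs_of_nonneg)
  then have "(f z)\<^sup>2 * (Dl l w z)\<^sup>2 \<le> C\<^sup>2 * grad_sum k w z"
   using 1 by (intro mult_mono) auto
  then show "(f z * Dl l w z)\<^sup>2 \<le> C\<^sup>2 * grad_sum k w z"
   by (simp add: power_mult_distrib)
 qed auto
next
 case (lower_add k f g)
 then obtain C C' where C: "0 \<le> C" "0 \<le> C'"
  "\<And>z. z \<in> \<Omega> \<Longrightarrow> (f z)\<^sup>2 \<le> C * grad_sum k w z"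
  "\<And>z. z \<in> \<Omega> \<Longrightarrow> (g z)\<^sup>2 \<le> C' * grad_sum k w z" by blast
 have sq: "(p + q)\<^sup>2 \<le> 2 * p\<^sup>2 + 2 * q\<^sup>2" for p q :: real
  using zero_le_power2[of "p - q"] by (simp add: power2_sum power2_diff)
 have "(f z + g z)\<^sup>2 \<le> (2 * C + 2 * C') * grad_sum k w z" if "z \<in> \<Omega>" for z
 proof -
  define S where "S = grad_sum k w z"
  have "(f z + g z)\<^sup>2 \<le> 2 * (C * S) + 2 * (C' * S)"
   using sq[of "f z" "g z"] C(3)[OF that] C(4)[OF that] unfolding S_def[symmetric] by linarith
  also have "\<dots> = (2 * C + 2 * C') * S" by (simp add: distrib_right)
  finally show ?thesis by (simp add: S_def)
 qed
 then show ?case using C by (intro exI[of _ "2 * C + 2 * C'"]) auto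
next
 case (lower_cong k f g)
 from lower_cong(3) obtain C where "C \<ge> 0" "\<forall>z\<in>\<Omega>. (f z)\<^sup>2 \<le> C * grad_sum k w z" by blast
 then show ?case using lower_cong(2) by (intro exI[of _ C]) simp
qed

section \<open>Commutation of the equation with tangential derivatives\<close>

context
 fixes w :: "'n fn"
 assumes w: "Cinf_on \<Omega> w"
begin

lemma dd_tang_mult_x:
 assumes "Cinf_on \<Omega> u" "z \<in> \<Omega>" "v \<in> tang"
 shows "dd v (\<lambda>z. fst z * u z) z = fst z * dd v u z"
proof -
 have "dd v (\<lambda>z. fst z * u z) z = dd v fst z * u z + fst z * dd v u z"
  by (rule dd_mult) (use Cinf_on_differentiable[OF assms(1,2)] Cinf_on_differentiable[OF Cinf_on_linear[OF open_reg bounded_linear_fst] assms(2)] in auto)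
 then show ?thesis using fst_tang[OF assms(3)] dd_linear[OF bounded_linear_fst, of v z] by simp
qed

lemma Cinf_x_mult: "Cinf_on \<Omega> u \<Longrightarrow> Cinf_on \<Omega> (\<lambda>z. fst z * u z)"
 by (rule Cinf_on_mult[OF open_reg Cinf_on_linear[OF open_reg bounded_linear_fst]])

text \<open>Smoothness is proved in the same induction, because the sum rule needs differentiability
  of each summand.\<close>

lemma lower_dd_Cinf:
 assumes "lower w k f" "v \<in> tang"
 shows "lower w (Suc k) (dd v f) \<and> Cinf_on \<Omega> f"
 using assms(1)
proof induction
 case (lower_H f l k i)
 let ?u = "dd (eH i) (Dl l w)"
 have Cu: "Cinf_on \<Omega> ?u" by (intro Cinf_on_dd Cinf_on_Dl w)
 have Cf: "Cinf_on \<Omega> f" using lower_H bsmooth_Cinf by blast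
 have l: "l \<in> tlists (Suc k)" "v # l \<in> tlists (Suc k)" using lower_H(2) assms(2) by (auto simp: tlists_def)
 have eq: "dd v f z * (fst z * ?u z) + f z * (fst z * dd (eH i) (Dl (v # l) w) z) = dd v (\<lambda>z. f z * (fst z * ?u z)) z" if z: "z \<in> \<Omega>" for z
 proof -
  have "dd v (\<lambda>z. f z * (fst z * ?u z)) z = dd v f z * (fst z * ?u z) + f z * dd v (\<lambda>z. fst z * ?u z) z"
   by (rule dd_mult) (use Cinf_on_differentiable[OF Cf z] Cinf_on_differentiable[OF Cinf_x_mult[OF Cu] z] in auto)
  moreover have "dd v (\<lambda>z. fst z * ?u z) z = fst z * dd v ?u z" by (rule dd_tang_mult_x[OF Cu z assms(2)])
  moreover have "dd v ?u z = dd (eH i) (Dl (v # l) w) z"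
   using Cinf_on_commute[OF open_reg Cinf_on_Dl[OF w] z, of v "eH i"] by simp
  ultimately show ?thesis by simp
 qed
 have "lower w (Suc k) (\<lambda>z. dd v f z * (fst z * ?u z) + f z * (fst z * dd (eH i) (Dl (v # l) w) z))"
  using lower_H(1) l by (intro lower_add lower.lower_H bsmooth_dd)
 then have "lower w (Suc k) (dd v (\<lambda>z. f z * (fst z * ?u z)))" by (rule lower_cong) (rule eq)
 then show ?case using Cinf_on_mult[OF open_reg Cf Cinf_x_mult[OF Cu]] by blast
next
 case (lower_0 f l k)
 have Cu: "Cinf_on \<Omega> (Dl l w)" by (intro Cinf_on_Dl w)
 have Cf: "Cinf_on \<Omega> f" using lower_0 bsmooth_Cinf by blast
 have l: "l \<in> tlists (Suc k)" "v # l \<in> tlists (Suc k)" using lower_0(2) assms(2) by (auto simp: tlists_def)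
 have "lower w (Suc k) (\<lambda>z. dd v f z * Dl l w z + f z * Dl (v # l) w z)"
  using lower_0(1) l by (intro lower_add lower.lower_0 bsmooth_dd)
 then have "lower w (Suc k) (dd v (\<lambda>z. f z * Dl l w z))"
  by (rule lower_cong) (use dd_mult[OF Cinf_on_differentiable[OF Cf] Cinf_on_differentiable[OF Cu]] in auto)
 then show ?case using Cinf_on_mult[OF open_reg Cf Cu] by blast
next
 case (lower_add k f g)
 then have d: "z \<in> \<Omega> \<Longrightarrow> f differentiable (at z)" "z \<in> \<Omega> \<Longrightarrow> g differentiable (at z)" for z
  using Cinf_on_differentiable by blast+
 have "lower w (Suc k) (\<lambda>z. dd v f z + dd v g z)" using lower_add by (intro lower.lower_add) auto
 then have "lower w (Suc k) (dd v (\<lambda>z. f z + g z))" by (rule lower_cong) (simp add: dd_add d)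
 then show ?case using lower_add by (auto intro: Cinf_on_add open_reg)
next
 case (lower_cong k f g)
 have "lower w (Suc k) (dd v g)"
  by (rule lower.lower_cong[OF lower_cong(3)[THEN conjunct1]]) (rule dd_cong_open[OF open_reg lower_cong(2)])
 moreover have "Cinf_on \<Omega> g" by (rule Cinf_on_cong[OF open_reg lower_cong(2) lower_cong(3)[THEN conjunct2]])
 ultimately show ?case by blast
qed

lemma Cinf_Yd: "Cinf_on \<Omega> u \<Longrightarrow> Cinf_on \<Omega> (Yd u)"
 unfolding Yd_def[abs_def] by (intro Cinf_on_add Cinf_x_mult Cinf_on_dd Cinf_on_cmult open_reg)

lemma Yd_tang:
 assumes "Cinf_on \<Omega> u" "z \<in> \<Omega>" "v \<in> tang"
 shows "Yd (dd v u) z = dd v (Yd u) z"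
proof -
 note d = Cinf_on_differentiable[OF _ assms(2)]
 have "dd v (Yd u) z = dd v (\<lambda>z. fst z * dd eX u z) z + dd v (\<lambda>z. 2 * dd eS u z) z"
  unfolding Yd_def[abs_def] by (intro dd_add d Cinf_x_mult Cinf_on_dd Cinf_on_cmult open_reg assms)
 also have "dd v (\<lambda>z. fst z * dd eX u z) z = fst z * dd v (dd eX u) z"
  by (rule dd_tang_mult_x) (intro Cinf_on_dd assms)+
 also have "dd v (\<lambda>z. 2 * dd eS u z) z = 2 * dd v (dd eS u) z"
  using d[OF Cinf_on_dd[OF assms(1)], of eS] by (simp add: dd_mult)
 finally show ?thesis
  unfolding Yd_def Cinf_on_commute[OF open_reg assms(1,2), of v eX] Cinf_on_commute[OF open_reg assms(1,2), of v eS] by simp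
qed

text \<open>v commutes with x, with \<open>eX\<close> and with \<open>Yd\<close>, so only the
  coefficients a are differentiated. The commutator keeps the factor x and contains tangential
  second derivatives alone, which makes it a \<open>lower\<close> term.\<close>

lemma wave_op_tang:
 assumes u: "Cinf_on \<Omega> u" and z: "z \<in> \<Omega>" and v: "v \<in> tang"
 shows "wave_op a (dd v u) z = dd v (wave_op a u) z - (\<Sum>!i j. dd v (a i j) z * (fst z * dd (eH i) (dd (eH j) u) z))"
proof -
 note d = Cinf_on_differentiable[OF _ z]
 note Ca = bsmooth_Cinf[OF a]
 have C2: "Cinf_on \<Omega> (\<lambda>z. \<Sum>!i j. a i j z * dd (eH i) (dd (eH j) u) z)"
  by (intro Cinf_on_sum Cinf_on_mult Cinf_on_dd Ca u open_reg)
 have "dd v (wave_op a u) z = dd v (dd eX (Yd u)) z + dd v (\<lambda>z. fst z * (\<Sum>!i j. a i j z * dd (eH i) (dd (eH j) u) z)) z"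
  unfolding wave_op_def[abs_def] by (intro dd_add d Cinf_on_dd Cinf_Yd u Cinf_x_mult C2)
 also have "dd v (dd eX (Yd u)) z = dd eX (dd v (Yd u)) z"
  by (rule Cinf_on_commute[OF open_reg Cinf_Yd[OF u] z])
 also have "\<dots> = dd eX (Yd (dd v u)) z"
  by (rule dd_cong_open[OF open_reg _ z]) (simp add: Yd_tang u v)
 also have "dd v (\<lambda>z. fst z * (\<Sum>!i j. a i j z * dd (eH i) (dd (eH j) u) z)) z
   = fst z * dd v (\<lambda>z. \<Sum>!i j. a i j z * dd (eH i) (dd (eH j) u) z) z"
  by (rule dd_tang_mult_x[OF C2 z v])
 also have "dd v (\<lambda>z. \<Sum>!i j. a i j z * dd (eH i) (dd (eH j) u) z) z
   = (\<Sum>!i j. dd v (a i j) z * dd (eH i) (dd (eH j) u) z + a i j z * dd v (dd (eH i) (dd (eH j) u)) z)"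
  using d[OF Ca] d[OF Cinf_on_dd[OF Cinf_on_dd[OF u]]] by (simp add: dd_sum dd_mult)
 also have "\<dots> = (\<Sum>!i j. dd v (a i j) z * dd (eH i) (dd (eH j) u) z + a i j z * dd (eH i) (dd (eH j) (dd v u)) z)"
 proof -
  have "dd v (dd (eH i) (dd (eH j) u)) z = dd (eH i) (dd (eH j) (dd v u)) z" for i j
  proof -
   have "dd v (dd (eH i) (dd (eH j) u)) z = dd (eH i) (dd v (dd (eH j) u)) z"
    by (rule Cinf_on_commute[OF open_reg Cinf_on_dd[OF u] z])
   also have "\<dots> = dd (eH i) (dd (eH j) (dd v u)) z"
    by (rule dd_cong_open[OF open_reg _ z]) (rule Cinf_on_commute[OF open_reg u])
   finally show ?thesis .
  qed
  then show ?thesis by simp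
 qed
 finally show ?thesis unfolding wave_op_def by (simp add: sum.distrib sum_distrib_left algebra_simps)
qed

text \<open>In the commutator the inner derivative \<open>eH j\<close> is counted as a letter of the
  word and only the outer one uses the factor x. Hence words no longer than l itself suffice, and
  the system of all words up to length k is closed.\<close>

lemma wave_op_lower:
 assumes "solves w" "set l \<subseteq> tang"
 shows "lower w (length l) (wave_op a (Dl l w))"
 using assms(2)
proof (induction l)
 case Nil
 have "lower w 0 (\<lambda>z. (\<Sum>!i. (- c i z) * (fst z * dd (eH i) (Dl [] w) z)) + (- b z) * Dl [] w z)"
  by (intro lower_add lower_sum lower_H lower_0 bsmooth_minus open_reg c b) (auto simp: tlists_def)
 then have "lower w 0 (wave_op a w)"
 proof (rule lower_cong)
  fix z :: "'n pt" assume "z \<in> \<Omega>"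
  then have "wave_op a w z + fst z * (\<Sum>!i. c i z * dd (eH i) w z) + b z * w z = 0"
   using assms(1) by (auto simp: solves_def)
  moreover have "(\<Sum>!i. (- c i z) * (fst z * dd (eH i) w z)) = - (fst z * (\<Sum>!i. c i z * dd (eH i) w z))"
   by (simp add: sum_distrib_left sum_negf algebra_simps)
  ultimately show "(\<Sum>!i. (- c i z) * (fst z * dd (eH i) (Dl [] w) z)) + (- b z) * Dl [] w z = wave_op a w z" by simp
 qed
 then show ?case by simp
next
 case (Cons v l)
 have v: "v \<in> tang" "set l \<subseteq> tang" using Cons.prems by auto
 have "lower w (Suc (length l)) (\<lambda>z. (\<Sum>!i j. (- dd v (a i j) z) * (fst z * dd (eH i) (Dl (eH j # l) w) z)))"
  using v(2) by (intro lower_sum lower_H bsmooth_minus open_reg bsmooth_dd a) (auto simp: tlists_def eH_tang)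
 moreover have "lower w (Suc (length l)) (dd v (wave_op a (Dl l w)))"
  using lower_dd_Cinf[OF Cons.IH[OF v(2)] v(1)] by blast
 ultimately have "lower w (Suc (length l)) (\<lambda>z. dd v (wave_op a (Dl l w)) z + (\<Sum>!i j. (- dd v (a i j) z) * (fst z * dd (eH i) (Dl (eH j # l) w) z)))"
  by (rule lower_add[rotated])
 then have "lower w (Suc (length l)) (wave_op a (dd v (Dl l w)))"
  by (rule lower_cong) (simp add: wave_op_tang[OF Cinf_on_Dl[OF w] _ v(1)] sum_negf)
 then show ?case by simp
qed

lemma lower_mono: "lower w k f \<Longrightarrow> k \<le> k' \<Longrightarrow> lower w k' f"
proof (induction rule: lower.induct)
 case (lower_H f l k i)
 then show ?case by (intro lower.lower_H) (auto simp: tlists_def)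
next
 case (lower_0 f l k)
 then show ?case by (intro lower.lower_0) (auto simp: tlists_def)
qed (auto intro: lower.lower_add lower.lower_cong)

lemma wave_op_bound:
 assumes "solves w"
 shows "\<exists>C\<ge>0. \<forall>z\<in>\<Omega>. \<forall>l\<in>tlists k. (wave_op a (Dl l w) z)\<^sup>2 \<le> C * grad_sum k w z"
proof -
 have "\<forall>l\<in>tlists k. \<exists>C\<ge>0. \<forall>z\<in>\<Omega>. (wave_op a (Dl l w) z)\<^sup>2 \<le> C * grad_sum k w z"
  using lower_bound[OF lower_mono[OF wave_op_lower[OF assms]]] by (auto simp: tlists_def)
 from bchoice[OF this] obtain C where C: "\<And>l. l \<in> tlists k \<Longrightarrow> 0 \<le> C l"
  "\<And>l z. l \<in> tlists k \<Longrightarrow> z \<in> \<Omega> \<Longrightarrow> (wave_op a (Dl l w) z)\<^sup>2 \<le> C l * grad_sum k w z"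
  by blast
 show ?thesis
 proof (intro exI[of _ "\<Sum>l\<in>tlists k. C l"] conjI ballI)
  show "0 \<le> (\<Sum>l\<in>tlists k. C l)" using C by (intro sum_nonneg)
  fix z :: "'n pt" and l :: "'n pt list" assume *: "z \<in> \<Omega>" "l \<in> tlists k"
  have "0 \<le> grad_sum k w z"
   using x_bounds[OF *(1)] by (intro sum_nonneg add_nonneg_nonneg mult_nonneg_nonneg) (auto simp: grad2_def intro!: sum_nonneg)
  moreover have "C l \<le> (\<Sum>l\<in>tlists k. C l)" using C *(2) by (intro member_le_sum finite_tlists) auto
  ultimately have "C l * grad_sum k w z \<le> (\<Sum>l\<in>tlists k. C l) * grad_sum k w z"
   by (intro mult_right_mono)
  then show "(wave_op a (Dl l w) z)\<^sup>2 \<le> (\<Sum>l\<in>tlists k. C l) * grad_sum k w z"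
   using C(2)[OF *(2,1)] by linarith
 qed
qed

end

end

section \<open>Finite speed of propagation\<close>

lemma continuous_on_energy:
 assumes "open \<Omega>" "\<And>i j. continuous_on \<Omega> (a i j)" "Ck_on 1 \<Omega> w"
 shows "continuous_on \<Omega> (energy a w)" "continuous_on \<Omega> (Yd w)" "continuous_on \<Omega> (qf a w)"
proof -
 have d: "continuous_on \<Omega> (dd v w)" for v
  using assms(3) by (simp add: Ck_on_Suc_iff del: split_paired_All)
 have w: "continuous_on \<Omega> w" using Ck_on_continuous[OF assms(3)] .
 show Y: "continuous_on \<Omega> (Yd w)" unfolding Yd_def[abs_def] by (intro continuous_intros d)
 show q: "continuous_on \<Omega> (qf a w)" unfolding qf_def[abs_def] by (intro continuous_intros d assms(2))
 show "continuous_on \<Omega> (energy a w)" unfolding energy_def[abs_def] by (intro continuous_intros Y q w)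
qed

lemma psq_le: "r \<le> R \<Longrightarrow> 0 \<le> R \<Longrightarrow> psq r \<le> R\<^sup>2"
 unfolding psq_def by (intro power_mono) auto

lemma psq_pos: "0 < r \<Longrightarrow> 0 < psq r" unfolding psq_def by simp

lemma psq_nonpos: "r \<le> 0 \<Longrightarrow> psq r = 0" unfolding psq_def by simp

lemma le_psq: "0 \<le> r \<Longrightarrow> r \<le> R \<Longrightarrow> r\<^sup>2 \<le> psq R" unfolding psq_def by (intro power_mono) auto

lemma wt_nonneg: "(\<And>r. 0 \<le> cf r) \<Longrightarrow> 0 \<le> wt cf \<kappa> \<mu> F G y0 z"
 unfolding wt_def by (intro mult_nonneg_nonneg psq_nonneg) auto

lemma dist_sq: "(y - y0) \<bullet> (y - y0) = (dist y0 y)\<^sup>2"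
 by (simp add: dist_norm norm_minus_commute power2_norm_eq_inner)

context wave_eq
begin

text \<open>\<mu> is fixed before \<kappa> and K. The estimate is therefore uniform in the null
  cutoff, whose support comes closer to x = 0 as \<kappa> decreases.\<close>

lemma energy_estimate_region:
 fixes W :: "'i \<Rightarrow> 'n fn"
 assumes \<Omega>': "open \<Omega>'" "\<Omega>' \<subseteq> \<Omega>" and I: "finite I" and W: "\<And>i. i \<in> I \<Longrightarrow> Ck_on 2 \<Omega>' (W i)"
  and C: "0 \<le> C" "\<And>z i. z \<in> \<Omega>' \<Longrightarrow> i \<in> I \<Longrightarrow> (wave_op a (W i) z)\<^sup>2 \<le> C * (\<Sum>j\<in>I. fst z * grad2 (W j) z + (W j z)\<^sup>2)"
  and cf: "\<And>r. (cf has_real_derivative cf' r) (at r)" "continuous_on UNIV cf'" "\<And>r. 0 \<le> cf r" "\<And>r. cf' r \<le> 0"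
  and kk: "\<And>r. - cf' r \<le> m * cf r + kk r" "0 \<le> m" "continuous_on UNIV kk" "\<And>r. 0 \<le> kk r"
  and F: "\<And>r. (F has_real_derivative F' r) (at r)" "continuous_on UNIV F'"
  and G: "\<And>r. (G has_real_derivative G' r) (at r)" "continuous_on UNIV G'"
  and AA: "\<And>z \<xi>. z \<in> \<Omega>' \<Longrightarrow> qform a z \<xi> \<le> AA * sqn \<xi>"
  and cone: "\<And>x s y. (x, s, y) \<in> \<Omega>' \<Longrightarrow> cf x > 0 \<Longrightarrow> F s + G x - (y - y0) \<bullet> (y - y0) > 0 \<Longrightarrow>
    0 < - (x * G' x + 2 * F' s) \<and> x * (4 * AA * ((y - y0) \<bullet> (y - y0))) \<le> G' x * - (x * G' x + 2 * F' s)"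
 shows "\<exists>\<mu>\<ge>0. \<forall>\<kappa>>0. \<forall>K. compact K \<longrightarrow> K \<subseteq> \<Omega>' \<longrightarrow>
   (\<forall>z\<in>\<Omega>' - K. null_off (wt cf \<kappa> \<mu> F G y0) (wt kk \<kappa> \<mu> F G y0) I W z) \<longrightarrow>
   energy_bound a \<Omega>' I W (wt cf \<kappa> \<mu> F G y0) (wt kk \<kappa> \<mu> F G y0)"
proof -
 let ?w = "\<lambda>c \<kappa> \<mu>. wt c \<kappa> \<mu> F G y0"
 obtain M where M: "0 \<le> M" "\<And>z \<xi>. z \<in> \<Omega> \<Longrightarrow> (\<Sum>!i j. dd (eH i) (a i j) z * \<xi> j)\<^sup>2 \<le> M * sqn \<xi>"
  "\<And>z \<xi>. z \<in> \<Omega> \<Longrightarrow> \<bar>\<Sum>!i j. Yd (a i j) z * \<xi> i * \<xi> j\<bar> \<le> M * sqn \<xi>"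
  using derivative_bounds by blast
 have sub: "z \<in> \<Omega>" if "z \<in> \<Omega>'" for z using that \<Omega>' by blast
 have a1: "Ck_on 1 \<Omega>' (a i j)" for i j using Ck_on_subset[OF a_C1 \<Omega>'(2)] .
 have "\<exists>\<Lambda>. \<forall>\<psi> k \<mu> K. compact K \<longrightarrow> K \<subseteq> \<Omega>' \<longrightarrow> Ck_on 1 \<Omega>' \<psi> \<longrightarrow> continuous_on \<Omega>' k \<longrightarrow>
   (\<forall>z\<in>\<Omega>'. 0 \<le> \<psi> z) \<longrightarrow> \<mu> \<ge> \<Lambda> \<longrightarrow>
   (\<forall>z\<in>\<Omega>' - K. null_off \<psi> k I W z) \<longrightarrow>
   (\<forall>z\<in>\<Omega>'. \<forall>P \<xi>. weight_ineq a \<psi> k \<mu> z P \<xi>) \<longrightarrow>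
   (\<forall>z\<in>\<Omega>'. - Yd \<psi> z - \<psi> z \<ge> \<mu> * \<psi> z) \<longrightarrow>
   energy_bound a \<Omega>' I W \<psi> k"
 proof (rule energy_estimate[where a=a and \<theta>=\<theta> and M=M and C=C])
  show "0 < fst z \<and> fst z \<le> 1" if "z \<in> \<Omega>'" for z using x_bounds[OF sub[OF that]] .
  show "a i j z = a j i z" if "z \<in> \<Omega>'" for i j z using sym[OF sub[OF that]] .
  show "\<theta> * sqn \<xi> \<le> qform a z \<xi>" if "z \<in> \<Omega>'" for z \<xi>
   using ell[OF sub[OF that]] .
  show "(\<Sum>!i j. dd (eH i) (a i j) z * \<xi> j)\<^sup>2 \<le> M * sqn \<xi>" if "z \<in> \<Omega>'" for z \<xi>
   using M(2)[OF sub[OF that]] .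
  show "\<bar>\<Sum>!i j. Yd (a i j) z * \<xi> i * \<xi> j\<bar> \<le> M * sqn \<xi>" if "z \<in> \<Omega>'" for z \<xi>
   using M(3)[OF sub[OF that]] .
 qed (fact \<Omega>'(1) a1 I W \<theta> M(1) C)+
 then obtain \<Lambda> where \<Lambda>: "\<And>\<psi> k \<mu> K. compact K \<Longrightarrow> K \<subseteq> \<Omega>' \<Longrightarrow> Ck_on 1 \<Omega>' \<psi> \<Longrightarrow> continuous_on \<Omega>' k \<Longrightarrow>
   (\<forall>z\<in>\<Omega>'. 0 \<le> \<psi> z) \<Longrightarrow> \<mu> \<ge> \<Lambda> \<Longrightarrow>
   (\<forall>z\<in>\<Omega>' - K. null_off \<psi> k I W z) \<Longrightarrow>
   (\<forall>z\<in>\<Omega>'. \<forall>P \<xi>. weight_ineq a \<psi> k \<mu> z P \<xi>) \<Longrightarrow>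
   (\<forall>z\<in>\<Omega>'. - Yd \<psi> z - \<psi> z \<ge> \<mu> * \<psi> z) \<Longrightarrow>
   energy_bound a \<Omega>' I W \<psi> k"
  by blast
 \<comment> \<open>\<open>wt_properties\<close> delivers \<mu> - m - 1 as the coercivity constant,
   and this has to reach \<Lambda>.\<close>
 define \<mu> where "\<mu> = max \<Lambda> 0 + m + 1"
 have \<mu>: "0 \<le> \<mu>" "\<mu> - m - 1 \<ge> \<Lambda>" using kk(2) by (auto simp: \<mu>_def)
 show ?thesis
 proof (intro exI[of _ \<mu>] conjI allI impI)
  show "0 \<le> \<mu>" by fact
  fix \<kappa> :: real and K :: "'n pt set" assume \<kappa>: "0 < \<kappa>" and K: "compact K" "K \<subseteq> \<Omega>'"
   and off: "\<forall>z\<in>\<Omega>' - K. null_off (?w cf \<kappa> \<mu>) (?w kk \<kappa> \<mu>) I W z"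
  have ap: "0 \<le> qform a z \<xi>" if "z \<in> \<Omega>'" for z \<xi> using a_nonneg[OF sub[OF that]] .
  have sy: "a i j z = a j i z" if "z \<in> \<Omega>'" for i j z using sym[OF sub[OF that]] .
  have xb: "0 < fst z \<and> fst z \<le> 1" if "z \<in> \<Omega>'" for z using x_bounds[OF sub[OF that]] .
  have p1: "Ck_on 1 \<Omega>' (?w cf \<kappa> \<mu>)"
   by (rule wt_properties(1)[where a=a and kk=kk and m=m and ?A0.0=AA]) (fact \<Omega>'(1) xb sy ap AA cf kk F G \<kappa> \<mu> cone)+
  have p2: "weight_ineq a (?w cf \<kappa> \<mu>) (?w kk \<kappa> \<mu>) (\<mu> - m - 1) z P \<xi>" if "z \<in> \<Omega>'" for z P \<xi>
   by (rule wt_properties(2)[where a=a and ?A0.0=AA]) (fact \<Omega>'(1) xb sy ap AA cf kk F G \<kappa> \<mu> cone that)+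
  have p3: "- Yd (?w cf \<kappa> \<mu>) z - ?w cf \<kappa> \<mu> z \<ge> (\<mu> - m - 1) * ?w cf \<kappa> \<mu> z" if "z \<in> \<Omega>'" for z
   by (rule wt_properties(3)[where a=a and ?A0.0=AA and kk=kk]) (fact \<Omega>'(1) xb sy ap AA cf kk F G \<kappa> \<mu> cone that)+
  have ck: "continuous_on \<Omega>' (?w kk \<kappa> \<mu>)"
  proof -
   have cF: "continuous_on UNIV F" using F(1) DERIV_isCont continuous_at_imp_continuous_on by blast
   have cG: "continuous_on UNIV G" using G(1) DERIV_isCont continuous_at_imp_continuous_on by blast
   have cp: "continuous_on UNIV psq" using Ck_on_continuous[OF Ck_on_psq] .
   have c: "continuous_on \<Omega>' (\<lambda>z. g (f z))" if "continuous_on UNIV g" "continuous_on \<Omega>' f" for g :: "real \<Rightarrow> real" and f :: "'n fn"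
    by (rule continuous_on_compose2[OF that]) auto
   show ?thesis unfolding wt_def[abs_def]
    by (intro continuous_on_mult c[OF kk(3)] c[OF cp] continuous_on_diff continuous_on_add continuous_on_exp c[OF cF] c[OF cG]
      continuous_on_inverse continuous_on_inner continuous_on_fst continuous_on_snd continuous_on_id continuous_on_const)
     (auto dest!: xb)
  qed
  show "set_integrable lborel \<Omega>' (\<lambda>z. ?w cf \<kappa> \<mu> z * (\<Sum>i\<in>I. energy a (W i) z))"
   "(LINT z:\<Omega>'|lborel. ?w cf \<kappa> \<mu> z * (\<Sum>i\<in>I. energy a (W i) z))
    \<le> (LINT z:\<Omega>'|lborel. ?w kk \<kappa> \<mu> z * (\<Sum>i\<in>I. (Yd (W i) z)\<^sup>2))"
   using \<Lambda>[OF K p1 ck _ \<mu>(2) off] p2 p3 wt_nonneg[of cf, OF cf(3)] by blast+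
 qed
qed

text \<open>The case of the empty word, free of the smoothness that \<open>wave_op_bound\<close>
  assumes: finite speed of propagation is applied to a function known to be of class C2
  only.\<close>

lemma solves_bound1:
 assumes "solves w"
 shows "\<exists>C\<ge>0. \<forall>z\<in>\<Omega>. (wave_op a w z)\<^sup>2 \<le> C * (fst z * grad2 w z + (w z)\<^sup>2)"
proof -
 obtain Cc where Cc: "0 \<le> Cc" "\<And>z i. z \<in> \<Omega> \<Longrightarrow> \<bar>c i z\<bar> \<le> Cc"
  using uniform_bound[where f="\<lambda>i j. c i", OF c] by blast
 obtain Cb where Cb: "0 \<le> Cb" "\<And>z. z \<in> \<Omega> \<Longrightarrow> \<bar>b z\<bar> \<le> Cb" using bsmooth_bound[OF b] by blast
 define N where "N = Cc\<^sup>2 * real CARD('n)"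
 have N: "0 \<le> N" by (simp add: N_def)
 show ?thesis
 proof (intro exI[of _ "2 * N + 2 * Cb\<^sup>2"] conjI ballI)
  fix z assume z: "z \<in> \<Omega>"
  have x: "0 \<le> fst z" "fst z \<le> 1" using x_bounds[OF z] by auto
  define L where "L = (\<Sum>!i. c i z * dd (eH i) w z)"
  have g: "0 \<le> grad2 w z" by (simp add: grad2_def sum_nonneg)
  have L: "L\<^sup>2 \<le> N * grad2 w z"
   unfolding L_def N_def grad2_def by (rule linear_form_square_le) (rule Cc(2)[OF z])
  have "(fst z)\<^sup>2 * L\<^sup>2 \<le> fst z * (N * grad2 w z)"
   using x L by (intro mult_mono) (auto simp: power2_eq_square mult_left_le)
  then have 1: "(fst z * L)\<^sup>2 \<le> N * (fst z * grad2 w z)" by (simp add: power_mult_distrib algebra_simps)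
  have "(b z)\<^sup>2 \<le> Cb\<^sup>2" using Cb(2)[OF z] Cb(1) by (metis abs_le_square_iff abs_of_nonneg)
  then have 2: "(b z * w z)\<^sup>2 \<le> Cb\<^sup>2 * (w z)\<^sup>2" unfolding power_mult_distrib by (intro mult_right_mono) auto
  have "wave_op a w z + fst z * L + b z * w z = 0" using assms z by (simp add: solves_def L_def)
  then have "wave_op a w z = - (fst z * L + b z * w z)" by simp
  then have "(wave_op a w z)\<^sup>2 = (fst z * L + b z * w z)\<^sup>2" by (simp only: power2_minus)
  also have "\<dots> \<le> 2 * (fst z * L)\<^sup>2 + 2 * (b z * w z)\<^sup>2"
   using zero_le_power2[of "fst z * L - b z * w z"] by (simp add: power2_sum power2_diff)
  also have "\<dots> \<le> 2 * (N * (fst z * grad2 w z)) + 2 * (Cb\<^sup>2 * (w z)\<^sup>2)" using 1 2 by linarith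
  also have "\<dots> \<le> (2 * N + 2 * Cb\<^sup>2) * (fst z * grad2 w z + (w z)\<^sup>2)"
  proof -
   have "0 \<le> N * (w z)\<^sup>2" "0 \<le> Cb\<^sup>2 * (fst z * grad2 w z)" using N x g by simp_all
   then show ?thesis by (simp add: algebra_simps)
  qed
  finally show "(wave_op a w z)\<^sup>2 \<le> (2 * N + 2 * Cb\<^sup>2) * (fst z * grad2 w z + (w z)\<^sup>2)" .
 qed (use N in auto)
qed

text \<open>The backward characteristic cone of a point with small \<open>s\<close> stays in the chart, because its
 extent in the boundary variables is at most of order \<open>e\<^sup>s\<close>.\<close>

lemma finite_speed:
 assumes w: "Ck_on 2 \<Omega> w" and sol: "solves w"
  and init: "\<And>z v. z \<in> \<Omega> \<Longrightarrow> exp (fst (snd z)) \<le> fst z \<Longrightarrow> w z = 0 \<and> dd v w z = 0"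
 shows "\<exists>s0 r0. 0 < r0 \<and> r0 \<le> \<rho> \<and> (\<forall>x s y. (x, s, y) \<in> \<Omega> \<longrightarrow> s < s0 \<longrightarrow> dist y0 y < r0 \<longrightarrow> w (x, s, y) = 0)"
proof -
 obtain A0 where A0: "1 \<le> A0" "\<And>z \<xi>. z \<in> \<Omega> \<Longrightarrow> qform a z \<xi> \<le> A0 * sqn \<xi>"
  using upper_bound by blast
 obtain C where C: "0 \<le> C" "\<And>z. z \<in> \<Omega> \<Longrightarrow> (wave_op a w z)\<^sup>2 \<le> C * (fst z * grad2 w z + (w z)\<^sup>2)"
  using solves_bound1[OF sol] by blast
 \<comment> \<open>The phase will be \<alpha> (\<sigma> - e^s) + x - |y - y0|^2. For x < 2 e^s,
   minus its derivative along \<open>Yd\<close> is at least (\<alpha> - 1) x, and this \<alpha>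
   makes it exceed 4 A0 \<rho>^2 x, as the cone condition asks.\<close>
 define \<alpha> where "\<alpha> = 4 * A0 * \<rho>\<^sup>2 + 4"
 have \<alpha>: "4 \<le> \<alpha>" using A0 by (simp add: \<alpha>_def)
 \<comment> \<open>On the part of the support with x < e^s, both x and e^s are below 2 \<sigma> and
   |y - y0|^2 is below \<alpha> \<sigma>; the two bounds keep this part inside the region.\<close>
 define \<sigma> where "\<sigma> = min (x0 / 8) (\<rho>\<^sup>2 / (8 * \<alpha>))"
 have \<sigma>: "0 < \<sigma>" "4 * \<sigma> < x0" "\<alpha> * \<sigma> \<le> \<rho>\<^sup>2 / 8"
 proof -
  show "0 < \<sigma>" using x0 \<rho> \<alpha> by (simp add: \<sigma>_def)
  show "4 * \<sigma> < x0" using x0 by (simp add: \<sigma>_def min_def)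
  have "\<alpha> * \<sigma> \<le> \<alpha> * (\<rho>\<^sup>2 / (8 * \<alpha>))" using \<alpha> by (intro mult_left_mono) (auto simp: \<sigma>_def)
  then show "\<alpha> * \<sigma> \<le> \<rho>\<^sup>2 / 8" using \<alpha> by simp
 qed
 \<comment> \<open>w vanishes for x \<ge> e^s, that is for t \<le> 0. The factor 2 leaves room, so
   that a closed condition x \<le> e^s describes a compact part of this open set.\<close>
 define \<Omega>' where "\<Omega>' = \<Omega> \<inter> {z. fst z < 2 * exp (fst (snd z))}"
 have \<Omega>': "open \<Omega>'" "\<Omega>' \<subseteq> \<Omega>"
  unfolding \<Omega>'_def by (auto intro!: open_Int open_reg open_Collect_less continuous_intros)
 define F where "F = (\<lambda>s::real. \<alpha> * (\<sigma> - exp s))"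
 define G where "G = (\<lambda>x::real. x)"
 let ?w = "\<lambda>c \<kappa> \<mu>. wt c \<kappa> \<mu> F G y0"
 have ball: "(y - y0) \<bullet> (y - y0) < \<rho>\<^sup>2" "0 < x" "x < x0" if "(x, s, y) \<in> \<Omega>" for x s y
  using that \<rho> by (auto simp: dist_sq reg_def intro!: power_strict_mono)
 have "\<exists>\<mu>\<ge>0. \<forall>\<kappa>>0. \<forall>K. compact K \<longrightarrow> K \<subseteq> \<Omega>' \<longrightarrow>
   (\<forall>z\<in>\<Omega>' - K. null_off (?w (\<lambda>_. 1) \<kappa> \<mu>) (?w (\<lambda>_. 0) \<kappa> \<mu>) {()} (\<lambda>_. w) z) \<longrightarrow>
   energy_bound a \<Omega>' {()} (\<lambda>_. w) (?w (\<lambda>_. 1) \<kappa> \<mu>) (?w (\<lambda>_. 0) \<kappa> \<mu>)"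
  (is "\<exists>\<mu>\<ge>0. ?E \<mu>")
 proof (rule energy_estimate_region[where W="\<lambda>_. w" and C=C and m=0 and cf'="\<lambda>_. 0" and F'="\<lambda>s. - \<alpha> * exp s" and G'="\<lambda>_. 1" and AA=A0])
  show "Ck_on 2 \<Omega>' w" by (rule Ck_on_subset[OF w \<Omega>'(2)])
  show "(wave_op a w z)\<^sup>2 \<le> C * (\<Sum>j\<in>{()}. fst z * grad2 w z + (w z)\<^sup>2)" if "z \<in> \<Omega>'" for z
   using C(2)[of z] that \<Omega>' by auto
  show "(F has_real_derivative - \<alpha> * exp r) (at r)" for r
   unfolding F_def by (auto intro!: derivative_eq_intros)
  show "(G has_real_derivative 1) (at r)" for r unfolding G_def by (auto intro!: derivative_eq_intros)
  show "qform a z \<xi> \<le> A0 * sqn \<xi>" if "z \<in> \<Omega>'" for z \<xi>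
   using A0(2)[of z] that \<Omega>' by blast
  fix x s :: real and y :: "real ^ 'n" assume z: "(x, s, y) \<in> \<Omega>'"
  then have xs: "x < 2 * exp s" "(x, s, y) \<in> \<Omega>" by (auto simp: \<Omega>'_def)
  note b = ball[OF xs(2)]
  have "(\<alpha> - 1) * x \<le> - (x * 1 + 2 * (- \<alpha> * exp s))"
   using xs \<alpha> mult_left_mono[of x "2 * exp s" \<alpha>] by (simp add: algebra_simps)
  moreover have "4 * A0 * ((y - y0) \<bullet> (y - y0)) \<le> 4 * A0 * \<rho>\<^sup>2" using b A0 by (intro mult_left_mono) auto
  then have "x * (4 * A0 * ((y - y0) \<bullet> (y - y0))) \<le> x * (\<alpha> - 1)"
   using b by (intro mult_left_mono) (auto simp: \<alpha>_def)
  moreover have "0 < (\<alpha> - 1) * x" using \<alpha> b by simp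
  ultimately show "0 < - (x * 1 + 2 * (- \<alpha> * exp s)) \<and> x * (4 * A0 * ((y - y0) \<bullet> (y - y0))) \<le> 1 * - (x * 1 + 2 * (- \<alpha> * exp s))"
   by (simp add: mult.commute)
 qed (use \<Omega>' C in \<open>auto intro!: continuous_intros\<close>)
 then obtain \<mu> where \<mu>: "?E \<mu>"
  by (elim exE conjE)
 have zero: "w z = 0" if z: "z \<in> \<Omega>'" and \<kappa>: "0 < \<kappa>" and pos: "0 < ?w (\<lambda>_. 1) \<kappa> \<mu> z" for z \<kappa>
 proof -
  \<comment> \<open>The null cutoff gives \<kappa> e^s < x^2; together with x < e^s this yields x >
    \<kappa> and s > ln \<kappa>.\<close>
  define K where "K = ({\<kappa>..4 * \<sigma>} \<times> {ln \<kappa>..ln (2 * \<sigma>)} \<times> cball y0 (\<rho> / 2)) \<inter> {z. fst z \<le> exp (fst (snd z))}"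
  have K: "compact K" unfolding K_def
   by (intro compact_Int_closed compact_Times compact_Icc compact_cball closed_Collect_le continuous_intros)
  have K': "K \<subseteq> \<Omega>'"
  proof
   fix z assume "z \<in> K"
   moreover have "exp r < 2 * exp r" for r :: real by simp
   ultimately show "z \<in> \<Omega>'" using \<kappa> \<sigma> \<rho> unfolding K_def \<Omega>'_def reg_def
    by (cases z) (auto intro: le_less_trans)
  qed
  have off: "null_off (?w (\<lambda>_. 1) \<kappa> \<mu>) (?w (\<lambda>_. 0) \<kappa> \<mu>) {()} (\<lambda>_. w) z"
   if z: "z \<in> \<Omega>' - K" for z
  proof (cases "exp (fst (snd z)) \<le> fst z")
   case True
   then show ?thesis using init[of z] z \<Omega>' by blast
  next
   case False
   obtain x s y where zz: "z = (x, s, y)" by (cases z)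
   have xs: "x < exp s" "(x, s, y) \<in> \<Omega>" using False z by (auto simp: zz \<Omega>'_def)
   note b = ball[OF xs(2)]
   have "?w (\<lambda>_. 1) \<kappa> \<mu> z = 0"
   proof (rule ccontr)
    assume "?w (\<lambda>_. 1) \<kappa> \<mu> z \<noteq> 0"
    then have "psq (1 - \<kappa> * (exp s * inverse (x * x))) \<noteq> 0" "psq (F s + G x - (y - y0) \<bullet> (y - y0)) \<noteq> 0"
     by (auto simp: wt_def zz)
    then have 1: "0 < 1 - \<kappa> * (exp s * inverse (x * x))" and 2: "0 < F s + G x - (y - y0) \<bullet> (y - y0)"
     using psq_nonpos not_less by blast+
    have "\<kappa> * exp s < x * x" using 1 b by (simp add: field_simps)
    moreover have "\<kappa> * x \<le> \<kappa> * exp s" using xs \<kappa> by simp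
    ultimately have "\<kappa> * x < x * x" by linarith
    then have xk: "\<kappa> < x" using b by simp
    have e0: "0 \<le> (y - y0) \<bullet> (y - y0)" by simp
    have 3: "\<alpha> * exp s + (y - y0) \<bullet> (y - y0) < \<alpha> * \<sigma> + x" using 2 by (simp add: F_def G_def algebra_simps)
    have "4 * exp s \<le> \<alpha> * exp s" using \<alpha> by simp
    then have es0: "\<alpha> * exp s - exp s < \<alpha> * \<sigma>" "(y - y0) \<bullet> (y - y0) < \<alpha> * \<sigma>"
     using 3 xs e0 exp_gt_zero[of s] by linarith+
    have "1 * exp s \<le> \<alpha> / 2 * exp s" using \<alpha> by (intro mult_right_mono) auto
    moreover have "\<alpha> * exp s = \<alpha> / 2 * exp s + \<alpha> / 2 * exp s" "\<alpha> * (exp s / 2) = \<alpha> / 2 * exp s" by simp_all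
    ultimately have "\<alpha> * (exp s / 2) < \<alpha> * \<sigma>" using es0 by linarith
    then have es: "exp s < 2 * \<sigma>" using \<alpha> by simp
    have d1: "(dist y0 y)\<^sup>2 < \<alpha> * \<sigma>" using es0(2) by (simp only: dist_sq)
    have "(\<rho> / 2)\<^sup>2 = \<rho>\<^sup>2 / 4" by (simp add: power_divide)
    then have "(dist y0 y)\<^sup>2 < (\<rho> / 2)\<^sup>2" using d1 \<sigma>(3) zero_le_power2[of \<rho>] by linarith
    then have "dist y0 y < \<rho> / 2" by (rule power2_less_imp_less) (use \<rho> in simp)
    moreover have "ln \<kappa> \<le> ln (exp s)" by (subst ln_le_cancel_iff) (use xk xs \<kappa> in auto)
    moreover have "ln (exp s) \<le> ln (2 * \<sigma>)" by (subst ln_le_cancel_iff) (use es \<sigma> in auto)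
    ultimately have "z \<in> K" using xk xs es \<sigma> by (auto simp: K_def zz)
    then show False using z by blast
   qed
   then show ?thesis by (simp add: wt_def)
  qed
  \<comment> \<open>The cutoff in x is constant, so there is no error density, and the weighted
    energy has integral at most 0.\<close>
  have "set_integrable lborel \<Omega>' (\<lambda>z. ?w (\<lambda>_. 1) \<kappa> \<mu> z * energy a w z) \<and>
   (LINT z:\<Omega>'|lborel. ?w (\<lambda>_. 1) \<kappa> \<mu> z * energy a w z) \<le> (LINT z:\<Omega>'|lborel. 0)"
  proof -
   have "\<forall>z\<in>\<Omega>' - K. null_off (?w (\<lambda>_. 1) \<kappa> \<mu>) (?w (\<lambda>_. 0) \<kappa> \<mu>) {()} (\<lambda>_. w) z"
    using off by blast
   from \<mu>[THEN spec, THEN mp, OF \<kappa>, THEN spec, THEN mp, OF K, THEN mp, OF K', THEN mp, OF this]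
   show ?thesis by (simp add: wt_def)
  qed
  then have int: "set_integrable lborel \<Omega>' (\<lambda>z. ?w (\<lambda>_. 1) \<kappa> \<mu> z * energy a w z)"
   "(LINT z:\<Omega>'|lborel. ?w (\<lambda>_. 1) \<kappa> \<mu> z * energy a w z) \<le> 0" by (auto simp: set_lebesgue_integral_def)
  have qf0: "0 \<le> fst z * qf a w z" if "z \<in> \<Omega>" for z
   unfolding qf_def using a_nonneg[OF that] x_bounds[OF that] by (intro mult_nonneg_nonneg) auto
  have e0: "(w z)\<^sup>2 \<le> energy a w z" if "z \<in> \<Omega>" for z
   using qf0[OF that] by (simp add: energy_def)
  have c1: "continuous_on \<Omega>' (?w (\<lambda>_. 1) \<kappa> \<mu>)"
  proof -
   have cp: "continuous_on UNIV psq" using Ck_on_continuous[OF Ck_on_psq] .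
   have cps: "continuous_on \<Omega>' (\<lambda>z. psq (f z))" if "continuous_on \<Omega>' f" for f :: "'n fn"
    by (rule continuous_on_compose2[OF cp that]) auto
   show ?thesis unfolding wt_def[abs_def] F_def G_def using x_bounds \<Omega>'(2)
    by (intro continuous_intros cps) force+
  qed
  have "?w (\<lambda>_. 1) \<kappa> \<mu> z * energy a w z = 0"
  proof (rule LINT_continuous_nonneg_eq_0[OF \<Omega>'(1) _ _ int z])
   have "Ck_on 1 \<Omega>' w" by (rule Ck_on_le[OF Ck_on_subset[OF w \<Omega>'(2)]]) simp
   then show "continuous_on \<Omega>' (\<lambda>z. ?w (\<lambda>_. 1) \<kappa> \<mu> z * energy a w z)"
    using c1 Ck_on_continuous[OF Ck_on_subset[OF a_C1 \<Omega>'(2)]]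
    by (intro continuous_intros continuous_on_energy(1)[OF \<Omega>'(1)])
   show "0 \<le> ?w (\<lambda>_. 1) \<kappa> \<mu> z * energy a w z" if "z \<in> \<Omega>'" for z
   proof (rule mult_nonneg_nonneg)
    show "0 \<le> ?w (\<lambda>_. 1) \<kappa> \<mu> z" by (rule wt_nonneg) simp
    show "0 \<le> energy a w z" using order_trans[OF zero_le_power2 e0[of z]] that \<Omega>' by blast
   qed
  qed
  then have "energy a w z = 0" using pos by simp
  then show ?thesis using e0[of z] z \<Omega>' by auto
 qed
 define r0 where "r0 = min \<rho> (sqrt (\<alpha> * \<sigma>) / 2)"
 have as: "0 < \<alpha> * \<sigma>" using \<alpha> \<sigma> by simp
 show ?thesis
 proof (rule exI[of _ "ln (\<sigma> / 2)"], rule exI[of _ r0], intro conjI allI impI)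
  show "0 < r0" "r0 \<le> \<rho>" using \<rho> as by (auto simp: r0_def)
  fix x s :: real and y :: "real ^ 'n" assume z: "(x, s, y) \<in> \<Omega>" and s: "s < ln (\<sigma> / 2)" and d: "dist y0 y < r0"
  show "w (x, s, y) = 0"
  proof (cases "exp s \<le> x")
   case True
   then show ?thesis using init[OF z] by simp
  next
   case False
   then have xs: "x < exp s" by simp
   note b = ball[OF z]
   have z': "(x, s, y) \<in> \<Omega>'"       proof -
    have "x < 2 * exp s" using xs exp_gt_zero[of s] by linarith
    then show ?thesis using z by (simp add: \<Omega>'_def)
   qed
   have "exp s < exp (ln (\<sigma> / 2))" using s by (simp only: exp_less_cancel_iff)
   then have es: "exp s < \<sigma> / 2" using \<sigma>(1) by simp
   have "dist y0 y \<le> sqrt (\<alpha> * \<sigma>) / 2" using d unfolding r0_def by simp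
   then have "(dist y0 y)\<^sup>2 \<le> (sqrt (\<alpha> * \<sigma>) / 2)\<^sup>2" by (rule power_mono) simp
   also have "\<dots> = \<alpha> * \<sigma> / 4" using as by (simp add: power_divide)
   finally have dd: "(y - y0) \<bullet> (y - y0) \<le> \<alpha> * \<sigma> / 4" by (simp add: dist_sq)
   have "\<alpha> * exp s \<le> \<alpha> * (\<sigma> / 2)" using es \<alpha> by (intro mult_left_mono) auto
   then have 1: "0 < F s + G x - (y - y0) \<bullet> (y - y0)"
    using dd as b(2) unfolding F_def G_def right_diff_distrib by linarith
   \<comment> \<open>Adapted to the given point: the argument of the null cutoff is 1/2
     there.\<close>
   define \<kappa> where "\<kappa> = x * x / (2 * exp s)"
   have \<kappa>: "0 < \<kappa>" using b by (simp add: \<kappa>_def)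
   have "1 - \<kappa> * (exp s * inverse (x * x)) = 1 / 2" using b by (simp add: \<kappa>_def field_simps)
   then have "0 < ?w (\<lambda>_. 1) \<kappa> \<mu> (x, s, y)"
    unfolding wt_def using 1 psq_pos by simp
   then show ?thesis by (rule zero[OF z' \<kappa>])
  qed
 qed
qed

end

section \<open>Bounds for tangential derivatives\<close>

lemma dd_zero_open: "open S \<Longrightarrow> (\<And>z. z \<in> S \<Longrightarrow> f z = 0) \<Longrightarrow> z \<in> S \<Longrightarrow> dd v f z = 0"
 using dd_cong_open[of S f "\<lambda>_. 0" z v] by simp

lemma Dl_zero_open:
 assumes "open S" "\<And>z. z \<in> S \<Longrightarrow> f z = 0" "z \<in> S"
 shows "Dl l f z = 0"
 using assms(3)
proof (induction l arbitrary: z)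
 case (Cons v l)
 then show ?case using dd_zero_open[OF assms(1), of "Dl l f" z v] by simp
qed (use assms in auto)

context wave_eq
begin

text \<open>The constant must not depend on the box, which may approach x = 0. The error density is
  supported where \<delta> \<le> x \<le> 2 \<delta>, in a compact set on which w is smooth, so its
  contribution is just a finite number. The null cutoff is adapted to the box, but neither this
  number nor the lower bound of the weight on the box depends on it.\<close>

lemma l2_bound:
 assumes w: "Cinf_on \<Omega> w" and sol: "solves w"
  and van: "\<And>z. z \<in> \<Omega> \<Longrightarrow> fst (snd z) < s0 \<Longrightarrow> w z = 0"
 shows "\<exists>\<delta> r. 0 < \<delta> \<and> 2 * \<delta> < x0 \<and> 0 < r \<and> r < \<rho> \<and> (\<forall>k. \<exists>C. \<forall>p q. cbox p q \<subseteq> {0<..\<delta>} \<times> {..s1} \<times> cball y0 r \<longrightarrow>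
   jet_l2 k w p q C)"
proof -
 obtain A0 where A0: "1 \<le> A0" "\<And>z \<xi>. z \<in> \<Omega> \<Longrightarrow> qform a z \<xi> \<le> A0 * sqn \<xi>"
  using upper_bound by blast
 \<comment> \<open>Bounds the length of the interval from s0 - 1 to s1 + 1, on which the phase has
   to be controlled.\<close>
 define S where "S = max 1 (s1 + 2 - s0)"
 have S: "1 \<le> S" "s1 + 2 - s0 \<le> S" by (auto simp: S_def)
 \<comment> \<open>The slope of the phase in s, so small that the phase changes by at most \<rho>^2
   / 8 over the length S and the cone stays within \<rho> / 2 of y0.\<close>
 define \<alpha> where "\<alpha> = \<rho>\<^sup>2 / (8 * S)"
 have \<alpha>: "0 < \<alpha>" "\<alpha> * S = \<rho>\<^sup>2 / 8" "\<alpha> \<le> \<rho>\<^sup>2 / 8"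
 proof -
  show "0 < \<alpha>" "\<alpha> * S = \<rho>\<^sup>2 / 8" using \<rho> S by (auto simp: \<alpha>_def)
  moreover have "\<alpha> * 1 \<le> \<alpha> * S" using S \<open>0 < \<alpha>\<close> by (intro mult_left_mono) auto
  ultimately show "\<alpha> \<le> \<rho>\<^sup>2 / 8" by linarith
 qed
 \<comment> \<open>The second bound makes 2 A0 \<rho>^2 \<le> \<beta> \<alpha> true for the \<beta>
   below, which is what the cone condition amounts to.\<close>
 define \<delta> where "\<delta> = min (x0 / 4) (\<alpha> / (4 * A0 * \<rho>))"
 have \<delta>: "0 < \<delta>" "2 * \<delta> < x0" "\<delta> \<le> 1 / 4" "\<delta> * (4 * A0 * \<rho>) \<le> \<alpha>"
 proof -
  show "0 < \<delta>" using x0 \<alpha>(1) A0(1) \<rho> unfolding \<delta>_def by simp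
  have "\<delta> \<le> x0 / 4" unfolding \<delta>_def by simp
  then show "2 * \<delta> < x0" "\<delta> \<le> 1 / 4" using x0 by linarith+
  have "\<delta> \<le> \<alpha> / (4 * A0 * \<rho>)" by (simp add: \<delta>_def)
  then show "\<delta> * (4 * A0 * \<rho>) \<le> \<alpha>" using A0 \<rho> by (simp add: field_simps)
 qed
 \<comment> \<open>The phase contains \<beta> x^2. This \<beta> is large enough for the cone
   condition, and still \<beta> x^2 \<le> \<alpha> / 2 for x \<le> 2 \<delta>, so the decrease in s
   dominates along \<open>Yd\<close>. With a quadratic term both sides of the cone condition contain
   the factor x.\<close>
 define \<beta> where "\<beta> = \<alpha> / (8 * \<delta>\<^sup>2)"
 have \<beta>: "0 < \<beta>" "\<beta> * \<delta>\<^sup>2 = \<alpha> / 8" using \<alpha> \<delta> by (auto simp: \<beta>_def)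
 have A0\<beta>: "2 * A0 * \<rho>\<^sup>2 \<le> \<beta> * \<alpha>"
 proof -
  have "(\<delta> * (4 * A0 * \<rho>))\<^sup>2 \<le> \<alpha>\<^sup>2" using \<delta> A0 \<rho> by (intro power_mono) auto
  then have "16 * A0 * (A0 * (\<delta>\<^sup>2 * \<rho>\<^sup>2)) \<le> \<alpha>\<^sup>2" by (simp add: power_mult_distrib power2_eq_square algebra_simps)
  moreover have "16 * A0 * (1 * (\<delta>\<^sup>2 * \<rho>\<^sup>2)) \<le> 16 * A0 * (A0 * (\<delta>\<^sup>2 * \<rho>\<^sup>2))"
   using A0 by (intro mult_left_mono mult_right_mono) auto
  ultimately have "16 * A0 * (\<delta>\<^sup>2 * \<rho>\<^sup>2) \<le> \<alpha>\<^sup>2" by linarith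
  then have "2 * A0 * \<rho>\<^sup>2 * (8 * \<delta>\<^sup>2) \<le> \<alpha> * \<alpha>" by (simp add: power2_eq_square algebra_simps)
  then show ?thesis using \<delta> by (simp add: \<beta>_def field_simps)
 qed
 define r where "r = min (\<rho> / 2) (min 1 (\<alpha> / 2))"
 have r: "0 < r" "r < \<rho>" "r\<^sup>2 \<le> \<alpha> / 2"
 proof -
  show "0 < r" "r < \<rho>" using \<rho> \<alpha> by (auto simp: r_def)
  have "r * r \<le> 1 * (\<alpha> / 2)" using \<rho> \<alpha> by (intro mult_mono) (auto simp: r_def)
  then show "r\<^sup>2 \<le> \<alpha> / 2" by (simp add: power2_eq_square)
 qed
 define \<Omega>' where "\<Omega>' = \<Omega> \<inter> {z. s0 - 1 < fst (snd z)}"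
 have \<Omega>': "open \<Omega>'" "\<Omega>' \<subseteq> \<Omega>"
  unfolding \<Omega>'_def by (auto intro!: open_Int open_reg open_Collect_less continuous_intros)
 define F where "F = (\<lambda>s::real. \<alpha> * (s1 + 1 - s))"
 define G where "G = (\<lambda>x::real. \<beta> * x\<^sup>2)"
 let ?w = "\<lambda>c \<kappa> \<mu>. wt c \<kappa> \<mu> F G y0"
 \<comment> \<open>For x \<le> \<delta> the logarithmic derivative of this cutoff is at most 2 /
   \<delta> in size, so the rate m = 2 / \<delta> absorbs it, and \<open>kk\<close> is left between
   \<delta> and 2 \<delta> only.\<close>
 define cf where "cf = (\<lambda>x. psq (2 * \<delta> - x))"
 define cf' where "cf' = (\<lambda>x. - (2 * max 0 (2 * \<delta> - x)))"
 define kk where "kk = (\<lambda>x. max 0 (2 * max 0 (2 * \<delta> - x) - 2 / \<delta> * psq (2 * \<delta> - x)))"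
 have ball: "(y - y0) \<bullet> (y - y0) < \<rho>\<^sup>2" "0 < x" "x < x0" if "(x, s, y) \<in> \<Omega>" for x s y
  using that \<rho> by (auto simp: dist_sq reg_def intro!: power_strict_mono)
 have x2: "\<beta> * x\<^sup>2 \<le> \<alpha> / 2" if "0 < x" "x \<le> 2 * \<delta>" for x
 proof -
  have "x\<^sup>2 \<le> (2 * \<delta>)\<^sup>2" using that by (intro power_mono) auto
  then have "\<beta> * x\<^sup>2 \<le> \<beta> * (2 * \<delta>)\<^sup>2" using \<beta> by (intro mult_left_mono) auto
  also have "\<dots> = \<alpha> / 2" using \<beta>(2) by (simp add: power_mult_distrib)
  finally show ?thesis .
 qed
 have cf0: "0 \<le> cf x" "cf' x \<le> 0" "0 \<le> kk x" for x by (auto simp: cf_def cf'_def kk_def psq_nonneg)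
 have cfd: "(cf has_real_derivative cf' x) (at x)" for x
 proof -
  have "((\<lambda>x. psq (2 * \<delta> - x)) has_real_derivative 2 * max 0 (2 * \<delta> - x) * (0 - 1)) (at x)"
   by (rule DERIV_chain2[OF psq_deriv]) (auto intro!: derivative_eq_intros)
  then show ?thesis by (simp add: cf_def cf'_def)
 qed
 have cpsq: "continuous_on UNIV psq" using Ck_on_continuous[OF Ck_on_psq] .
 have ckk: "continuous_on UNIV kk" unfolding kk_def
  by (intro continuous_intros continuous_on_compose2[OF cpsq]) auto
 have kk2: "kk x \<le> 2" if "0 < x" for x
 proof -
  have "max 0 (2 * \<delta> - x) \<le> 1" using that \<delta> by simp
  then have "2 * max 0 (2 * \<delta> - x) \<le> 2" using mult_left_mono[of "max 0 (2 * \<delta> - x)" 1 2] by simp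
  moreover have "0 \<le> 2 / \<delta> * psq (2 * \<delta> - x)" using \<delta> psq_nonneg by simp
  ultimately show ?thesis unfolding kk_def by linarith
 qed
 have kk0: "kk x = 0" if "x < \<delta> \<or> 2 * \<delta> < x" for x
  using that
 proof
  assume "x < \<delta>"
  then have m: "max 0 (2 * \<delta> - x) = 2 * \<delta> - x" "\<delta> \<le> 2 * \<delta> - x" using \<delta> by auto
  have "2 / \<delta> * (\<delta> * (2 * \<delta> - x)) \<le> 2 / \<delta> * ((2 * \<delta> - x) * (2 * \<delta> - x))"
   using m \<delta> by (intro mult_left_mono mult_right_mono) auto
  then have "2 * (2 * \<delta> - x) \<le> 2 / \<delta> * psq (2 * \<delta> - x)"
   using \<delta>(1) m by (simp add: psq_def power2_eq_square)
  then show ?thesis unfolding kk_def m(1) by simp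
 next
  assume "2 * \<delta> < x"
  then show ?thesis by (simp add: kk_def psq_def)
 qed
 have supp: "(y - y0) \<bullet> (y - y0) < \<rho>\<^sup>2 / 4" "s < s1 + 2"
  if "(x, s, y) \<in> \<Omega>'" "x \<le> 2 * \<delta>" "0 < F s + G x - (y - y0) \<bullet> (y - y0)" for x s y
 proof -
  have z: "(x, s, y) \<in> \<Omega>" "s0 - 1 < s" using that(1) by (auto simp: \<Omega>'_def)
  have b: "\<beta> * x\<^sup>2 \<le> \<alpha> / 2" using x2[of x] ball[OF z(1)] that(2) by blast
  have "\<alpha> * (s1 + 1 - s) \<le> \<alpha> * S" using z(2) S \<alpha> by (intro mult_left_mono) auto
  then show "(y - y0) \<bullet> (y - y0) < \<rho>\<^sup>2 / 4"
   using that(3) b \<alpha>(2,3) zero_less_power[OF \<rho>, of 2] unfolding F_def G_def by linarith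
  have e0: "0 \<le> (y - y0) \<bullet> (y - y0)" by simp
  have "0 < \<alpha> * (s1 + 1 - s) + \<alpha> / 2" using that(3) b e0 unfolding F_def G_def by linarith
  then have "0 < \<alpha> * (s1 + 1 - s + 1 / 2)" by (simp add: algebra_simps)
  then show "s < s1 + 2" using \<alpha> by (simp add: zero_less_mult_iff)
 qed
 have dist: "dist y0 y \<le> \<rho> / 2" if "(y - y0) \<bullet> (y - y0) < \<rho>\<^sup>2 / 4" for y :: "real ^ 'n"
 proof -
  have "(dist y0 y)\<^sup>2 < (\<rho> / 2)\<^sup>2" using that by (simp add: dist_sq power_divide)
  then show ?thesis using power2_less_imp_less[of "dist y0 y" "\<rho> / 2"] \<rho> by simp
 qed
 have CW: "Ck_on 2 \<Omega> (Dl l w)" for l using Cinf_on_Dl[OF w] by (simp add: Cinf_on_def)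
 have op: "open (\<Omega> \<inter> {z. fst (snd z) < s0})" by (auto intro!: open_Int open_reg open_Collect_less continuous_intros)
 have Wvan: "Dl l w z = 0" "dd v (Dl l w) z = 0" if "z \<in> \<Omega>" "fst (snd z) < s0" for l z v
  using Dl_zero_open[OF op, of w z l] Dl_zero_open[OF op, of w z "v # l"] van that by auto
 define Q where "Q = {\<delta>..2*\<delta>} \<times> {s0 - 1..s1 + 2} \<times> cball y0 (\<rho> / 2)"
 have Q: "compact Q" "Q \<subseteq> \<Omega>"
  unfolding Q_def reg_def using \<delta> \<rho> by (auto intro!: compact_Times)
 have main: "\<exists>C. \<forall>p q. cbox p q \<subseteq> {0<..\<delta>} \<times> {..s1} \<times> cball y0 r \<longrightarrow>
   jet_l2 k w p q C" for k
 proof -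
  let ?en = "\<lambda>z. \<Sum>i\<in>tlists k. energy a (Dl i w) z" and ?ys = "\<lambda>z. \<Sum>i\<in>tlists k. (Yd (Dl i w) z)\<^sup>2"
  obtain C where C: "0 \<le> C" "\<And>z l. z \<in> \<Omega> \<Longrightarrow> l \<in> tlists k \<Longrightarrow> (wave_op a (Dl l w) z)\<^sup>2 \<le> C * grad_sum k w z"
   using wave_op_bound[OF w sol, of k] by blast
  have "\<exists>\<mu>\<ge>0. \<forall>\<kappa>>0. \<forall>K. compact K \<longrightarrow> K \<subseteq> \<Omega>' \<longrightarrow>
    (\<forall>z\<in>\<Omega>' - K. null_off (?w cf \<kappa> \<mu>) (?w kk \<kappa> \<mu>) (tlists k) (\<lambda>i. Dl i w) z) \<longrightarrow>
    energy_bound a \<Omega>' (tlists k) (\<lambda>i. Dl i w) (?w cf \<kappa> \<mu>) (?w kk \<kappa> \<mu>)"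
   (is "\<exists>\<mu>\<ge>0. ?E \<mu>")
  proof (rule energy_estimate_region[where C=C and m="2 / \<delta>" and cf'=cf' and F'="\<lambda>s. - \<alpha>" and G'="\<lambda>x. 2 * \<beta> * x" and AA=A0])
   show "Ck_on 2 \<Omega>' (Dl l w)" for l by (rule Ck_on_subset[OF CW \<Omega>'(2)])
   show "(wave_op a (Dl l w) z)\<^sup>2 \<le> C * grad_sum k w z" if "z \<in> \<Omega>'" "l \<in> tlists k" for z l
    using C(2)[of z] that \<Omega>' by blast
   show "(F has_real_derivative - \<alpha>) (at r)" for r
    unfolding F_def by (auto intro!: derivative_eq_intros)
   show "(G has_real_derivative 2 * \<beta> * r) (at r)" for r unfolding G_def by (auto intro!: derivative_eq_intros)
   show "qform a z \<xi> \<le> A0 * sqn \<xi>" if "z \<in> \<Omega>'" for z \<xi>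
    using A0(2)[of z] that \<Omega>' by blast
   show "- cf' r \<le> 2 / \<delta> * cf r + kk r" for r by (simp add: cf_def cf'_def kk_def)
   show "continuous_on UNIV cf'" unfolding cf'_def by (intro continuous_intros)
   fix x s :: real and y :: "real ^ 'n" assume z: "(x, s, y) \<in> \<Omega>'" and cx: "0 < cf x"
   then have z: "(x, s, y) \<in> \<Omega>" by (auto simp: \<Omega>'_def)
   note b = ball[OF z]
   have "x < 2 * \<delta>" using cx psq_nonpos[of "2 * \<delta> - x"] by (force simp: cf_def)
   then have xb: "\<beta> * x\<^sup>2 \<le> \<alpha> / 2" using x2[of x] b by simp
   have D: "\<alpha> \<le> - (x * (2 * \<beta> * x) + 2 * - \<alpha>)" using xb by (simp add: power2_eq_square algebra_simps)
   have "4 * A0 * ((y - y0) \<bullet> (y - y0)) \<le> 4 * A0 * \<rho>\<^sup>2" using b A0(1) by (intro mult_left_mono) auto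
   also have "\<dots> \<le> 2 * \<beta> * \<alpha>" using A0\<beta> by linarith
   also have "\<dots> \<le> 2 * \<beta> * - (x * (2 * \<beta> * x) + 2 * - \<alpha>)" using D \<beta> by (intro mult_left_mono) auto
   finally have "x * (4 * A0 * ((y - y0) \<bullet> (y - y0))) \<le> x * (2 * \<beta> * - (x * (2 * \<beta> * x) + 2 * - \<alpha>))"
    using b(2) by (intro mult_left_mono) auto
   then have "x * (4 * A0 * ((y - y0) \<bullet> (y - y0))) \<le> 2 * \<beta> * x * - (x * (2 * \<beta> * x) + 2 * - \<alpha>)" by (simp only: ac_simps)
   then show "0 < - (x * (2 * \<beta> * x) + 2 * - \<alpha>) \<and> x * (4 * A0 * ((y - y0) \<bullet> (y - y0))) \<le> 2 * \<beta> * x * - (x * (2 * \<beta> * x) + 2 * - \<alpha>)"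
    using D \<alpha>(1) by linarith
  next
   show "0 \<le> 2 / \<delta>" using \<delta> by simp
   show "continuous_on UNIV (\<lambda>x. 2 * \<beta> * x)" by (intro continuous_intros)
  qed (fact \<Omega>' finite_tlists C(1) cfd cf0 ckk continuous_on_const)+
  then obtain \<mu> where \<mu>: "0 \<le> \<mu>" and est: "?E \<mu>"
   by (elim exE conjE)
  have cY: "continuous_on \<Omega> (Yd (Dl l w))" "continuous_on \<Omega> (Dl l w)" for l
  proof -
   have "Ck_on 1 \<Omega> (Dl l w)" by (rule Ck_on_le[OF CW]) simp
   then show "continuous_on \<Omega> (Yd (Dl l w))" "continuous_on \<Omega> (Dl l w)"
    using continuous_on_energy(2)[where a=a, OF open_reg Ck_on_continuous[OF a_C1]] Ck_on_continuous by blast+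
  qed
  have cYY: "continuous_on Q (\<lambda>z. ?ys z)"
   by (intro continuous_intros continuous_on_subset[OF cY(1) Q(2)])
  obtain M2 where M2: "0 \<le> M2" "\<And>z. z \<in> Q \<Longrightarrow> ?ys z \<le> M2"
  proof -
   have "bounded ((\<lambda>z. ?ys z) ` Q)"
    by (rule compact_imp_bounded[OF compact_continuous_image[OF cYY Q(1)]])
   then obtain B where B: "\<And>z. z \<in> Q \<Longrightarrow> \<bar>?ys z\<bar> \<le> B" by (auto simp: bounded_iff)
   show ?thesis by (rule that[of "max 0 B"]) (use B in \<open>auto simp: le_max_iff_disj dest: abs_le_D1\<close>)
  qed
  define T where "T = 2 * (1 * (exp (\<mu> * (2 - s0)) * (\<rho>\<^sup>2 / 4)\<^sup>2))"
  have T: "0 \<le> T" by (simp add: T_def)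
  have wkk: "?w kk \<kappa> \<mu> z * ?ys z \<le> T * M2 * indicator Q z" if z: "z \<in> \<Omega>'" and \<kappa>: "0 < \<kappa>" for z \<kappa>
  proof -
   obtain x s y where zz: "z = (x, s, y)" by (cases z)
   have z1: "(x, s, y) \<in> \<Omega>" "s0 - 1 < s" using z by (auto simp: \<Omega>'_def zz)
   note b = ball[OF z1(1)]
   have YY: "0 \<le> ?ys z" by (intro sum_nonneg) auto
   show ?thesis
   proof (cases "kk x = 0 \<or> F s + G x - (y - y0) \<bullet> (y - y0) \<le> 0")
    case True
    then have "?w kk \<kappa> \<mu> z = 0" using psq_nonpos by (auto simp: wt_def zz)
    then show ?thesis using T M2(1) by simp
   next
    case False
    then have "\<not> (x < \<delta> \<or> 2 * \<delta> < x)" using kk0[of x] by blast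
    then have x: "\<delta> \<le> x" "x \<le> 2 * \<delta>" by simp_all
    have f: "0 < F s + G x - (y - y0) \<bullet> (y - y0)" using False by simp
    note su = supp[OF z[unfolded zz] x(2) f]
    have zQ: "z \<in> Q" using x z1(2) su dist[OF su(1)] by (simp add: Q_def zz)
    have "\<alpha> * (s1 + 1 - s) \<le> \<alpha> * S" using z1(2) S \<alpha> by (intro mult_left_mono) auto
    moreover have "\<beta> * x\<^sup>2 \<le> \<alpha> / 2" using x2[of x] b x by blast
    moreover have "0 \<le> (y - y0) \<bullet> (y - y0)" by simp
    ultimately have fle: "F s + G x - (y - y0) \<bullet> (y - y0) \<le> \<rho>\<^sup>2 / 4"
     using \<alpha>(2,3) zero_less_power[OF \<rho>, of 2] unfolding F_def G_def by linarith
    have "\<mu> * (x - s) \<le> \<mu> * (2 - s0)" using \<mu> z1(2) x \<delta> by (intro mult_left_mono) auto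
    then have ee: "exp (\<mu> * (x - s)) \<le> exp (\<mu> * (2 - s0))" by simp
    have "psq (1 - \<kappa> * (exp s * inverse (x * x))) \<le> 1\<^sup>2"
     using b \<kappa> by (intro psq_le) auto
    then have p1: "psq (1 - \<kappa> * (exp s * inverse (x * x))) \<le> 1" by simp
    have p2: "psq (F s + G x - (y - y0) \<bullet> (y - y0)) \<le> (\<rho>\<^sup>2 / 4)\<^sup>2" by (rule psq_le[OF fle]) simp
    have "?w kk \<kappa> \<mu> z \<le> T"
     unfolding wt_def T_def zz fst_conv snd_conv
     by (rule mult_mono[OF kk2[OF b(2)] mult_mono[OF p1 mult_mono[OF ee p2]]])
       (simp_all add: psq_nonneg mult_nonneg_nonneg del: inverse_mult_distrib)
    then show ?thesis using M2(2)[OF zQ] zQ YY T by (simp add: mult_mono)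
   qed
  qed
  \<comment> \<open>Lower bound of the weight on the target region, factor by factor; it contains
    neither \<kappa> nor the box.\<close>
  define c0 where "c0 = \<delta>\<^sup>2 * ((1/2)\<^sup>2 * (exp (- (\<mu> * s1)) * (\<alpha> / 2)\<^sup>2))"
  have c0: "0 < c0" using \<delta> \<alpha> by (simp add: c0_def)
  define C' where "C' = (T * M2 * measure lborel Q) / c0"
  have C': "0 \<le> C'" using T M2 c0 by (simp add: C'_def)
  define SS where "SS = (\<lambda>z. jet_sum k w z)"
  have SS0: "0 \<le> SS z" for z unfolding SS_def by (intro sum_nonneg) auto
  show ?thesis
  proof (intro exI[of _ C'] allI impI)
   fix p q :: "'n pt" assume sub: "cbox p q \<subseteq> {0<..\<delta>} \<times> {..s1} \<times> cball y0 r"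
   have B\<Omega>: "cbox p q \<subseteq> \<Omega>"
    using sub \<delta> r unfolding reg_def by fastforce
   have cSS: "continuous_on (cbox p q) SS"
    unfolding SS_def by (intro continuous_intros continuous_on_subset[OF cY(1) B\<Omega>] continuous_on_subset[OF cY(2) B\<Omega>])
   have iSS: "set_integrable lborel (cbox p q) SS"
    unfolding set_integrable_def by (rule borel_integrable_compact[OF compact_cbox cSS])
   have "(LINT z:cbox p q|lborel. SS z) \<le> C'"
   proof (cases "cbox p q = {}")
    case True
    then show ?thesis using C' by (simp add: set_lebesgue_integral_def)
   next
    case False
    then have "p \<in> cbox p q" by (simp add: box_ne_empty mem_box)
    then have p: "0 < fst p" using sub by auto
    have pz: "fst p \<le> fst z" if "z \<in> cbox p q" for z
     using that by (cases p, cases q, cases z) (auto simp: cbox_Pair_eq)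
    \<comment> \<open>On the box x \<ge> \<open>fst p\<close> and s \<le> s1, so the argument of the
      null cutoff is at least 1/2 there.\<close>
    define \<kappa> where "\<kappa> = (fst p)\<^sup>2 / (2 * exp s1)"
    have \<kappa>: "0 < \<kappa>" using p by (simp add: \<kappa>_def)
    \<comment> \<open>On the support of the null cutoff x^2 > \<kappa> e^s, where s > s0 - 1; this
      is the resulting lower bound for x, and it makes K compact.\<close>
    define xk where "xk = sqrt (\<kappa> * exp (s0 - 1))"
    define K where "K = {xk..2*\<delta>} \<times> {s0..s1 + 2} \<times> cball y0 (\<rho> / 2)"
    have kpos: "0 < xk" using \<kappa> by (simp add: xk_def)
    have K: "compact K" "K \<subseteq> \<Omega>'"
     unfolding K_def \<Omega>'_def reg_def using kpos \<delta> \<rho> by (auto intro!: compact_Times)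
    have off: "null_off (?w cf \<kappa> \<mu>) (?w kk \<kappa> \<mu>) (tlists k) (\<lambda>i. Dl i w) z"
     if z: "z \<in> \<Omega>' - K" for z
    proof (cases "fst (snd z) < s0")
     case True
     then show ?thesis using Wvan[of z] z \<Omega>' by blast
    next
     case False
     obtain x s y where zz: "z = (x, s, y)" by (cases z)
     have z1: "(x, s, y) \<in> \<Omega>'" "s0 \<le> s" "(x, s, y) \<in> \<Omega>" using z False \<Omega>' by (auto simp: zz)
     note b = ball[OF z1(3)]
     have "?w g \<kappa> \<mu> z = 0" if g: "g x \<noteq> 0 \<Longrightarrow> x \<le> 2 * \<delta>" for g
     proof (rule ccontr)
      assume "?w g \<kappa> \<mu> z \<noteq> 0"
      then have n: "g x \<noteq> 0" "psq (1 - \<kappa> * (exp s * inverse (x * x))) \<noteq> 0" "psq (F s + G x - (y - y0) \<bullet> (y - y0)) \<noteq> 0"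
       by (auto simp: wt_def zz)
      have 1: "0 < 1 - \<kappa> * (exp s * inverse (x * x))" and 2: "0 < F s + G x - (y - y0) \<bullet> (y - y0)"
       using n psq_nonpos not_less by blast+
      have x: "x \<le> 2 * \<delta>" using g n(1) by blast
      note su = supp[OF z1(1) x 2]
      have "\<kappa> * exp s < x * x" using 1 b by (simp add: field_simps)
      moreover have "\<kappa> * exp (s0 - 1) \<le> \<kappa> * exp s" using z1(2) \<kappa> by simp
      ultimately have "\<kappa> * exp (s0 - 1) \<le> x\<^sup>2" by (simp add: power2_eq_square)
      then have "xk \<le> x" unfolding xk_def using b by (intro real_le_lsqrt) (use \<kappa> in auto)
      then have "z \<in> K" using x z1(2) su dist[OF su(1)] by (simp add: K_def zz)
      then show False using z by blast
     qed
     moreover have "x \<le> 2 * \<delta>" if "cf x \<noteq> 0" using that psq_nonpos[of "2 * \<delta> - x"] by (force simp: cf_def)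
     moreover have "x \<le> 2 * \<delta>" if "kk x \<noteq> 0" using that kk0[of x] by force
     ultimately show ?thesis by blast
    qed
    have "\<forall>z\<in>\<Omega>' - K. null_off (?w cf \<kappa> \<mu>) (?w kk \<kappa> \<mu>) (tlists k) (\<lambda>i. Dl i w) z"
     using off by blast
    from est[THEN spec, THEN mp, OF \<kappa>, THEN spec, THEN mp, OF K(1), THEN mp, OF K(2), THEN mp, OF this]
    have e: "set_integrable lborel \<Omega>' (\<lambda>z. ?w cf \<kappa> \<mu> z * ?en z)"
     "(LINT z:\<Omega>'|lborel. ?w cf \<kappa> \<mu> z * ?en z)
      \<le> (LINT z:\<Omega>'|lborel. ?w kk \<kappa> \<mu> z * ?ys z)" by blast+
    have r1: "(LINT z:\<Omega>'|lborel. ?w kk \<kappa> \<mu> z * ?ys z) \<le> T * M2 * measure lborel Q"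
    proof -
     have "(LINT z:\<Omega>'|lborel. ?w kk \<kappa> \<mu> z * ?ys z) \<le> (LINT z|lborel. T * M2 * indicator Q z)"
      unfolding set_lebesgue_integral_def
     proof (rule integral_mono')
      have "integrable lborel (\<lambda>z. indicator Q z *\<^sub>R (T * M2))" by (rule borel_integrable_compact[OF Q(1)]) simp
      then show "integrable lborel (\<lambda>z. T * M2 * indicator Q z)" by (simp add: mult.commute)
      show "indicator \<Omega>' z *\<^sub>R (?w kk \<kappa> \<mu> z * ?ys z) \<le> T * M2 * indicator Q z" for z
       using wkk[of z \<kappa>] \<kappa> T M2(1) by (cases "z \<in> \<Omega>'") auto
      show "0 \<le> T * M2 * indicator Q z" for z using T M2(1) by simp
     qed
     also have "\<dots> = T * M2 * measure lborel Q"
      using Q(1) by (simp add: borel_compact)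
     finally show ?thesis .
    qed
    have e0: "(Dl l w z)\<^sup>2 + (Yd (Dl l w) z)\<^sup>2 \<le> energy a (Dl l w) z" if "z \<in> \<Omega>" for z l
    proof -
     have "0 \<le> fst z * qf a (Dl l w) z"
      unfolding qf_def using a_nonneg[OF that] x_bounds[OF that] by (intro mult_nonneg_nonneg) auto
     then show ?thesis by (simp add: energy_def)
    qed
    have "(LINT z:cbox p q|lborel. SS z) \<le> (LINT z:\<Omega>'|lborel. (1 / c0) * (?w cf \<kappa> \<mu> z * ?en z))"
     unfolding set_lebesgue_integral_def
    proof (rule integral_mono')
     show "integrable lborel (\<lambda>z. indicat_real \<Omega>' z *\<^sub>R ((1 / c0) * (?w cf \<kappa> \<mu> z * ?en z)))"
      using set_integrable_mult_right[of "1 / c0", OF e(1)] by (simp add: set_integrable_def)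
     have e1: "SS z \<le> ?en z" if "z \<in> \<Omega>" for z
      unfolding SS_def by (intro sum_mono e0 that)
     have nn: "0 \<le> ?en z" if "z \<in> \<Omega>" for z
      using e1[OF that] SS0[of z] by linarith
     have wn: "0 \<le> ?w cf \<kappa> \<mu> z" for z by (rule wt_nonneg) (rule cf0)
     show nn': "0 \<le> indicat_real \<Omega>' z *\<^sub>R ((1 / c0) * (?w cf \<kappa> \<mu> z * ?en z))" for z
      using nn[of z] wn[of z] \<Omega>' c0 by (cases "z \<in> \<Omega>'") auto
     show "indicat_real (cbox p q) z *\<^sub>R SS z \<le> indicat_real \<Omega>' z *\<^sub>R ((1 / c0) * (?w cf \<kappa> \<mu> z * ?en z))" for z
     proof (cases "z \<in> cbox p q \<and> s0 \<le> fst (snd z)")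
      case False
      \<comment> \<open>The box may extend to s below s0 - 1 and so leave \<Omega>'; w and its
        derivatives vanish for s < s0.\<close>
      have "SS z = 0" if "z \<in> cbox p q"
      proof -
       have "z \<in> \<Omega>" "fst (snd z) < s0" using False that B\<Omega> by auto
       then show ?thesis unfolding SS_def Yd_def by (intro sum.neutral ballI) (simp add: Wvan)
      qed
      then have eq0: "indicat_real (cbox p q) z *\<^sub>R SS z = 0" by (simp add: indicator_def)
      show ?thesis unfolding eq0 by (rule nn')
     next
      case True
      obtain x s y where zz: "z = (x, s, y)" by (cases z)
      have zB: "(x, s, y) \<in> cbox p q" "s0 \<le> s" using True by (auto simp: zz)
      have z1: "z \<in> \<Omega>'" using True B\<Omega> by (auto simp: \<Omega>'_def)
      have xs: "0 < x" "x \<le> \<delta>" "s \<le> s1" "dist y0 y \<le> r" using sub zB(1) by auto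
      have px: "fst p \<le> x" using pz[OF zB(1)] by simp
      have "c0 \<le> ?w cf \<kappa> \<mu> z"
       unfolding c0_def wt_def zz fst_conv snd_conv
      proof (intro mult_mono mult_nonneg_nonneg psq_nonneg)
       show "\<delta>\<^sup>2 \<le> cf x" unfolding cf_def by (rule le_psq) (use xs \<delta> in auto)
       show "(1/2)\<^sup>2 \<le> psq (1 - \<kappa> * (exp s * inverse (x * x)))"
       proof (rule le_psq)
        have "\<kappa> * exp s \<le> \<kappa> * exp s1" using xs \<kappa> by simp
        also have "\<dots> = (fst p)\<^sup>2 / 2" by (simp add: \<kappa>_def)
        also have "\<dots> \<le> x\<^sup>2 / 2" using px p by (simp add: power_mono)
        finally have "\<kappa> * exp s * inverse (x * x) \<le> x\<^sup>2 / 2 * inverse (x * x)" using xs by (intro mult_right_mono) auto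
        also have "\<dots> = 1 / 2" using xs by (simp add: power2_eq_square field_simps)
        finally show "1 / 2 \<le> 1 - \<kappa> * (exp s * inverse (x * x))" by (simp add: mult.assoc)
       qed simp
       have "\<mu> * s \<le> \<mu> * s1" "0 \<le> \<mu> * x" using \<mu> xs by (auto intro: mult_left_mono)
       then show "exp (- (\<mu> * s1)) \<le> exp (\<mu> * (x - s))" by (simp add: right_diff_distrib)
       show "(\<alpha> / 2)\<^sup>2 \<le> psq (F s + G x - (y - y0) \<bullet> (y - y0))"
       proof (rule le_psq)
        have "(dist y0 y)\<^sup>2 \<le> r\<^sup>2" using xs by (intro power_mono) auto
        then have "(y - y0) \<bullet> (y - y0) \<le> \<alpha> / 2" using r(3) unfolding dist_sq by linarith
        moreover have "\<alpha> * 1 \<le> \<alpha> * (s1 + 1 - s)" using xs \<alpha> by (intro mult_left_mono) auto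
        moreover have "0 \<le> \<beta> * x\<^sup>2" using \<beta> by simp
        ultimately show "\<alpha> / 2 \<le> F s + G x - (y - y0) \<bullet> (y - y0)" unfolding F_def G_def by linarith
       qed (use \<alpha> in simp)
      qed (use cf0 in auto)
      then have "c0 * ?en z \<le> ?w cf \<kappa> \<mu> z * ?en z"
       using nn[of z] z1 \<Omega>' by (intro mult_right_mono) auto
      moreover have "c0 * SS z \<le> c0 * ?en z"
       using c0 e1[of z] z1 \<Omega>' by (intro mult_left_mono) auto
      ultimately have "c0 * SS z \<le> ?w cf \<kappa> \<mu> z * ?en z" by linarith
      then have "SS z \<le> (1 / c0) * (?w cf \<kappa> \<mu> z * ?en z)"
       using c0 by (simp add: field_simps)
      then show ?thesis using True z1 by simp
     qed
    qed
    also have "\<dots> = (1 / c0) * (LINT z:\<Omega>'|lborel. ?w cf \<kappa> \<mu> z * ?en z)"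
     by (rule set_integral_mult_right)
    also have "\<dots> \<le> (1 / c0) * (T * M2 * measure lborel Q)"
     using e(2) r1 c0 by (intro mult_left_mono) auto
    also have "\<dots> = C'" by (simp add: C'_def)
    finally show ?thesis .
   qed
   then show "jet_l2 k w p q C'"
    using iSS by (simp add: SS_def)
  qed
 qed
 show ?thesis
  using \<delta>(1,2) r(1,2) main by blast
qed

text \<open>The Sobolev inequality uses at most one derivative in x, and x d/dx is \<open>Yd\<close>
  minus 2 d/ds, both of which are bounded in L2 on every word. The cube lies at larger x than its
  corner, so division by x costs a single factor 1/x at the corner.\<close>

lemma pointwise_bound:
 assumes w: "Cinf_on \<Omega> w" and sol: "solves w"
  and van: "\<And>z. z \<in> \<Omega> \<Longrightarrow> fst (snd z) < s0 \<Longrightarrow> w z = 0"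
 shows "\<exists>\<delta> r. 0 < \<delta> \<and> \<delta> < x0 \<and> 0 < r \<and> r < \<rho> \<and> (\<forall>l. set l \<subseteq> tang \<longrightarrow> (\<exists>C. \<forall>x s y.
   0 < x \<longrightarrow> x \<le> \<delta> \<longrightarrow> s \<le> s1 \<longrightarrow> dist y0 y \<le> r \<longrightarrow> \<bar>Dl l w (x, s, y)\<bar> \<le> C / x))"
proof -
 \<comment> \<open>The cubes reach up to 1 beyond the bound s1, hence s1 + 1.\<close>
 obtain \<delta> r where \<delta>: "0 < \<delta>" "2 * \<delta> < x0" and r: "0 < r" "r < \<rho>" and
  L2: "\<And>k. \<exists>C. \<forall>p q. cbox p q \<subseteq> {0<..\<delta>} \<times> {..s1 + 1} \<times> cball y0 r \<longrightarrow>
   jet_l2 k w p q C"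
  using l2_bound[OF w sol van, of s0 "s1 + 1"] by blast
 define n where "n = real CARD('n)"
 have n: "1 \<le> n" unfolding n_def by (simp add: Suc_leI)
 \<comment> \<open>One side length for all points: a cube with corner at x \<le> \<delta> / 2 stays
   below \<delta>, below s1 + 1 and, the l1 norm being an upper bound of the euclidean one, in the
   ball of radius r.\<close>
 define h where "h = min (min (\<delta> / 2) 1) (r / (2 * n))"
 have h: "0 < h" "h \<le> \<delta> / 2" "h \<le> 1" "n * h \<le> r / 2"
 proof -
  show "0 < h" "h \<le> \<delta> / 2" "h \<le> 1" using \<delta> r n by (auto simp: h_def)
  have "n * h \<le> n * (r / (2 * n))" using n by (intro mult_left_mono) (auto simp: h_def)
  then show "n * h \<le> r / 2" using n by simp
 qed
 obtain xs :: "'n list" where xs: "set xs = UNIV" "distinct xs" using finite_distinct_list[of "UNIV :: 'n set"] by auto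
 define rest :: "'n pt list" where "rest = eS # map eH xs"
 have injH: "inj (eH :: 'n \<Rightarrow> 'n pt)" by (auto simp: inj_def eH_def axis_eq_axis)
 have dist: "distinct (eX # rest)"
  using xs injH by (auto simp: rest_def distinct_map eX_def eS_def eH_def intro: inj_on_subset)
 have "Basis = (insert eX (insert eS (range eH)) :: 'n pt set)"
 proof -
  have B: "Basis = range (\<lambda>i::'n. axis i (1::real))" by (auto simp: Basis_vec_def)
  show ?thesis
   unfolding Basis_prod_def eX_def eS_def eH_def B by (auto simp: image_Un image_image zero_prod_def)
 qed
 then have bas: "set (eX # rest) = Basis" by (simp add: rest_def xs)
 have rest_tang: "set rest \<subseteq> tang" by (auto simp: rest_def eS_tang eH_tang)
 have pt: "\<exists>C. \<forall>x s y. 0 < x \<longrightarrow> x \<le> \<delta> / 2 \<longrightarrow> s \<le> s1 \<longrightarrow> dist y0 y \<le> r / 2 \<longrightarrow> \<bar>Dl l0 w (x, s, y)\<bar> \<le> C / x"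
  if l0: "set l0 \<subseteq> tang" for l0
 proof -
  \<comment> \<open>Room for the words of the Sobolev inequality, for \<open>l0\<close>, and for one
    more d/ds, which comes from expressing d/dx through \<open>Yd\<close>.\<close>
  define k where "k = length rest + length l0 + 1"
  define SS where "SS = (\<lambda>z. jet_sum k w z)"
  obtain C where C: "\<And>p q. cbox p q \<subseteq> {0<..\<delta>} \<times> {..s1 + 1} \<times> cball y0 r \<Longrightarrow>
   set_integrable lborel (cbox p q) SS \<and> (LINT z:cbox p q|lborel. SS z) \<le> C"
   using L2[of k] unfolding SS_def by blast
  define N where "N = real (length (subseqs rest))"
  define m where "m = max 1 (1 / h) ^ length (eX # rest)"
  have m: "0 \<le> m" by (simp add: m_def)
  define C' where "C' = m * N * (4 + 3 * \<bar>C\<bar>)"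
  have "\<bar>Dl l0 w (x, s, y)\<bar> \<le> C' / x" if x: "0 < x" "x \<le> \<delta> / 2" and s: "s \<le> s1" and d: "dist y0 y \<le> r / 2" for x s y
  proof -
   define z where "z = (x, s, y)"
   define B where "B = cbox z (z + h *\<^sub>R One)"
   have mem: "x \<le> fst z' \<and> fst z' \<le> x + h \<and> s \<le> fst (snd z') \<and> fst (snd z') \<le> s + h \<and> (\<forall>i. \<bar>snd (snd z') $ i - y $ i\<bar> \<le> h)"
    if "z' \<in> B" for z'
   proof -
    have b: "z \<bullet> e \<le> z' \<bullet> e \<and> z' \<bullet> e \<le> z \<bullet> e + h" if "e \<in> Basis" for e
     using \<open>z' \<in> B\<close> that by (auto simp: B_def mem_box inner_add_left)
    have "eX \<in> (Basis::'n pt set)" "eS \<in> (Basis::'n pt set)" "eH i \<in> (Basis::'n pt set)" for i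
     unfolding bas[symmetric] by (auto simp: rest_def xs)
    note bb = b[OF this(1)] b[OF this(2)] b[OF this(3)]
    have "\<bar>snd (snd z') $ i - y $ i\<bar> \<le> h" for i
     using bb(3)[of i] by (cases z') (auto simp: eH_def z_def inner_axis)
    then show ?thesis using bb(1,2) by (cases z') (auto simp: eX_def eS_def z_def)
   qed
   have sub: "B \<subseteq> {0<..\<delta>} \<times> {..s1 + 1} \<times> cball y0 r"
   proof
    fix z' assume z': "z' \<in> B"
    note mm = mem[OF z']
    have "norm (snd (snd z') - y) \<le> (\<Sum>!i. \<bar>(snd (snd z') - y) $ i\<bar>)" by (rule norm_le_l1_cart)
    also have "\<dots> \<le> (\<Sum>i\<in>(UNIV::'n set). h)" by (rule sum_mono) (use mm in auto)
    also have "\<dots> = n * h" by (simp add: n_def)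
    finally have "dist y (snd (snd z')) \<le> r / 2" using h(4) by (simp add: dist_norm norm_minus_commute)
    then have "dist y0 (snd (snd z')) \<le> r" using d dist_triangle[of y0 "snd (snd z')" y] by linarith
    then show "z' \<in> {0<..\<delta>} \<times> {..s1 + 1} \<times> cball y0 r"
     using mm x s h by (cases z') auto
   qed
   have B\<Omega>: "B \<subseteq> \<Omega>" using sub \<delta> r unfolding reg_def by fastforce
   have iSS: "set_integrable lborel B SS" "(LINT z:B|lborel. SS z) \<le> C" using C[of z "z + h *\<^sub>R One"] sub unfolding B_def by blast+
   have pw: "m * mixed_sum (eX # rest) (Dl l0 w) z' \<le> m * (N / x) * (4 + 3 * SS z')" if z': "z' \<in> B" for z'
   proof -
    have x': "x \<le> fst z'" "fst z' \<le> 1" using mem[OF z'] x_bounds[of z'] z' B\<Omega> by auto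
    have one: "\<bar>Dl l (Dl l0 w) z'\<bar> + \<bar>dd eX (Dl l (Dl l0 w)) z'\<bar> \<le> (1 / x) * (4 + 3 * SS z')" if l: "l \<in> set (subseqs rest)" for l
    proof -
     have "set l \<subseteq> set rest" using l subseqs_powset[of rest] by blast
     then have lt: "set (l @ l0) \<subseteq> tang" using rest_tang l0 by auto
     have ll: "l @ l0 \<in> tlists k" "eS # l @ l0 \<in> tlists k"
      using lt length_subseqs_le[OF l] eS_tang by (auto simp: tlists_def k_def)
     define D where "D = Dl (l @ l0) w"
     have eq: "Dl l (Dl l0 w) = D" by (simp add: D_def Dl_append)
     have le: "(Dl l' w z')\<^sup>2 + (Yd (Dl l' w) z')\<^sup>2 \<le> SS z'" if "l' \<in> tlists k" for l'
      unfolding SS_def by (rule member_le_sum[OF that]) (auto intro: finite_tlists)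
     have 1: "(D z')\<^sup>2 + (Yd D z')\<^sup>2 \<le> SS z'" using le[OF ll(1)] by (simp add: D_def)
     have eqS: "Dl (eS # l @ l0) w = dd eS D" by (simp add: D_def fun_eq_iff)
     have 2: "(dd eS D z')\<^sup>2 \<le> SS z'"
      using le[OF ll(2)] zero_le_power2[of "Yd (dd eS D) z'"] unfolding eqS by linarith
     \<comment> \<open>Passes from the L1 norms of the Sobolev inequality to the L2 bounds; the
       constant 1 is harmless because the cube has measure at most 1.\<close>
     have sq: "\<bar>t\<bar> \<le> 1 + t\<^sup>2" for t :: real
     proof -
      have "0 \<le> (\<bar>t\<bar> - 1)\<^sup>2" by simp
      also have "\<dots> = t\<^sup>2 - 2 * \<bar>t\<bar> + 1" by (simp add: power2_diff)
      finally show ?thesis using zero_le_power2[of t] by linarith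
     qed
     have Y: "\<bar>fst z' * dd eX D z'\<bar> \<le> \<bar>Yd D z'\<bar> + 2 * \<bar>dd eS D z'\<bar>" unfolding Yd_def by linarith
     have "x * \<bar>dd eX D z'\<bar> \<le> \<bar>fst z' * dd eX D z'\<bar>"
      unfolding abs_mult using x' x by (intro mult_right_mono) auto
     moreover have "x * \<bar>D z'\<bar> \<le> 1 * \<bar>D z'\<bar>" using x x' by (intro mult_right_mono) auto
     ultimately have "x * (\<bar>D z'\<bar> + \<bar>dd eX D z'\<bar>) \<le> \<bar>D z'\<bar> + \<bar>Yd D z'\<bar> + 2 * \<bar>dd eS D z'\<bar>"
      using Y by (simp add: distrib_left)
     also have "\<dots> \<le> 4 + 3 * SS z'"
      using sq[of "D z'"] sq[of "Yd D z'"] sq[of "dd eS D z'"] 1 2 by linarith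
     finally show ?thesis unfolding eq using x by (simp add: field_simps)
    qed
    have "mixed_sum (eX # rest) (Dl l0 w) z' \<le> (\<Sum>l\<leftarrow>subseqs rest. (1 / x) * (4 + 3 * SS z'))"
     unfolding mixed_sum_Cons by (rule sum_list_mono) (rule one)
    also have "\<dots> = (N / x) * (4 + 3 * SS z')" by (simp add: sum_list_triv N_def)
    finally have "m * mixed_sum (eX # rest) (Dl l0 w) z' \<le> m * ((N / x) * (4 + 3 * SS z'))" using m by (rule mult_left_mono)
    then show ?thesis by (simp only: mult.assoc)
   qed
   have SS0: "0 \<le> SS z'" for z' unfolding SS_def by (intro sum_nonneg) auto
   have N0: "0 \<le> N / x" using x by (simp add: N_def)
   define M where "M = m * (N / x)"
   have M0: "0 \<le> M" unfolding M_def using m N0 by (rule mult_nonneg_nonneg)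
   have MSS: "0 \<le> M * (4 + 3 * SS z')" for z'
    by (rule mult_nonneg_nonneg[OF M0]) (use SS0[of z'] in linarith)
   note pw = pw[folded M_def]
   have "ennreal \<bar>Dl l0 w z\<bar> \<le> (\<integral>\<^sup>+z'. ennreal (m * mixed_sum (eX # rest) (Dl l0 w) z') * indicator B z' \<partial>lborel)"
    unfolding m_def B_def
   proof (rule sobolev_cube[OF open_reg _ h(1) _ dist bas])
    show "cbox z (z + h *\<^sub>R One) \<subseteq> \<Omega>" using B\<Omega> by (simp add: B_def)
    show "Ck_on (length (eX # rest)) \<Omega> (Dl l0 w)" using Cinf_on_Dl[OF w] by (simp add: Cinf_on_def)
   qed
   also have "\<dots> \<le> (\<integral>\<^sup>+z'. ennreal (indicator B z' *\<^sub>R (M * (4 + 3 * SS z'))) \<partial>lborel)"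
    by (rule nn_integral_mono) (use pw in \<open>auto simp: indicator_def intro!: ennreal_leI\<close>)
   also have "\<dots> = ennreal (LINT z':B|lborel. M * (4 + 3 * SS z'))"
    unfolding set_lebesgue_integral_def
   proof (rule nn_integral_eq_integral)
    have "set_integrable lborel B (\<lambda>z'. 4 :: real)"
     unfolding B_def set_integrable_def by (rule borel_integrable_compact[OF compact_cbox]) simp
    then have "set_integrable lborel B (\<lambda>z'. M * (4 + 3 * SS z'))"
     using iSS(1) by (intro set_integrable_mult_right set_integral_add(1)) auto
    then show "integrable lborel (\<lambda>z'. indicat_real B z' *\<^sub>R (M * (4 + 3 * SS z')))" by (simp add: set_integrable_def)
    show "AE z' in lborel. 0 \<le> indicat_real B z' *\<^sub>R (M * (4 + 3 * SS z'))"
     by (intro AE_I2) (simp only: real_scaleR_def, rule mult_nonneg_nonneg[OF indicator_pos_le MSS])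
   qed
   finally have 1: "ennreal \<bar>Dl l0 w z\<bar> \<le> ennreal (LINT z':B|lborel. M * (4 + 3 * SS z'))" .
   have i4: "set_integrable lborel B (\<lambda>z'. 4 :: real)"
    unfolding B_def set_integrable_def by (rule borel_integrable_compact[OF compact_cbox]) simp
   have v: "measure lborel B \<le> 1"
   proof -
    have "measure lborel B = (\<Prod>e\<in>Basis. (z + h *\<^sub>R One - z) \<bullet> e)"
     unfolding B_def using h by (subst measure_lborel_cbox) (auto simp: inner_add_left)
    also have "\<dots> = h ^ DIM('n pt)" by simp
    also have "\<dots> \<le> 1" by (rule power_le_one) (use h in auto)
    finally show ?thesis .
   qed
   have "(LINT z':B|lborel. M * (4 + 3 * SS z')) = M * ((LINT z':B|lborel. 4) + 3 * (LINT z':B|lborel. SS z'))"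
    using iSS(1) i4 by (simp add: set_integral_add(2))
   also have "(LINT z':B|lborel. 4) = 4 * measure lborel B"
    by (simp add: set_lebesgue_integral_def B_def)
   finally have 2: "(LINT z':B|lborel. M * (4 + 3 * SS z')) = M * (4 * measure lborel B + 3 * (LINT z':B|lborel. SS z'))" .
   have "0 \<le> (LINT z':B|lborel. SS z')"
    unfolding set_lebesgue_integral_def by (rule integral_nonneg_AE) (use SS0 in auto)
   then have "0 \<le> M * (4 * measure lborel B + 3 * (LINT z':B|lborel. SS z'))"
    by (intro mult_nonneg_nonneg[OF M0]) simp
   then have "\<bar>Dl l0 w z\<bar> \<le> M * (4 * measure lborel B + 3 * (LINT z':B|lborel. SS z'))"
    using 1 unfolding 2 by (simp only: ennreal_le_iff)
   also have "\<dots> \<le> M * (4 + 3 * \<bar>C\<bar>)"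
    by (rule mult_left_mono[OF _ M0]) (use v iSS(2) in linarith)
   also have "\<dots> = C' / x" by (simp add: C'_def M_def)
   finally show ?thesis by (simp add: z_def)
  qed
  then show ?thesis by blast
 qed
 show ?thesis
 proof (rule exI[of _ "\<delta> / 2"], rule exI[of _ "r / 2"], intro conjI)
  show "\<forall>l. set l \<subseteq> tang \<longrightarrow> (\<exists>C. \<forall>x s y. 0 < x \<longrightarrow> x \<le> \<delta> / 2 \<longrightarrow> s \<le> s1 \<longrightarrow> dist y0 y \<le> r / 2 \<longrightarrow> \<bar>Dl l w (x, s, y)\<bar> \<le> C / x)"
   using pt by (intro allI impI)
 qed (use \<delta> r in linarith)+
qed

end

section \<open>Transport along characteristics\<close>

definition gr :: "real \<Rightarrow> real \<Rightarrow> real \<Rightarrow> real ^ 'n::finite \<Rightarrow> 'n pt set" where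
 "gr \<delta> s1 r y0 = {0<..\<delta>} \<times> {..s1} \<times> cball y0 r"

text \<open>A growth rate at the boundary that is stable under tangential derivatives. These pass
  through \<open>Yd\<close> and through d/dx, so every estimate for f itself yields one for all
  words.\<close>

definition og :: "real \<Rightarrow> 'n::finite pt set \<Rightarrow> 'n fn \<Rightarrow> bool" where
 "og \<gamma> G f \<longleftrightarrow> (\<forall>l. set l \<subseteq> tang \<longrightarrow> (\<exists>C. \<forall>z\<in>G. \<bar>Dl l f z\<bar> \<le> C * fst z powr (- \<gamma>)))"

text \<open>Only derivatives in x are counted; each comes with all tangential derivatives, so that
  no mixed order has to be tracked.\<close>

primrec bdk :: "nat \<Rightarrow> 'n::finite pt set \<Rightarrow> 'n fn \<Rightarrow> bool" where
 "bdk 0 G f \<longleftrightarrow> og 0 G f"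
| "bdk (Suc k) G f \<longleftrightarrow> og 0 G f \<and> bdk k G (dd eX f)"

lemma og_dd:
 assumes "og \<gamma> G f" "v \<in> tang"
 shows "og \<gamma> G (dd v f)"
 unfolding og_def
proof (intro allI impI)
 fix l :: "'a pt list" assume "set l \<subseteq> tang"
 then have "set (l @ [v]) \<subseteq> tang" using assms(2) by auto
 then have "\<exists>C. \<forall>z\<in>G. \<bar>Dl (l @ [v]) f z\<bar> \<le> C * fst z powr (- \<gamma>)" using assms(1) unfolding og_def by blast
 then show "\<exists>C. \<forall>z\<in>G. \<bar>Dl l (dd v f) z\<bar> \<le> C * fst z powr (- \<gamma>)" by (simp add: Dl_append)
qed

lemma og_bound: "og \<gamma> G f \<Longrightarrow> \<exists>C. \<forall>z\<in>G. \<bar>f z\<bar> \<le> C * fst z powr (- \<gamma>)"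
proof -
 assume "og \<gamma> G f"
 then have "\<exists>C. \<forall>z\<in>G. \<bar>Dl [] f z\<bar> \<le> C * fst z powr (- \<gamma>)" unfolding og_def by (elim allE[of _ "[]"]) simp
 then show ?thesis by simp
qed

lemma bdk_og: "bdk k G f \<Longrightarrow> og 0 G f" by (cases k) auto

lemma bdk_SucD: "bdk (Suc k) G f \<Longrightarrow> bdk k G f"
 by (induction k arbitrary: f) (auto simp: bdk_og)

context
 fixes \<Omega> G :: "'n::finite pt set"
 assumes S: "open \<Omega>" and G: "G \<subseteq> \<Omega>" and G1: "\<And>z. z \<in> G \<Longrightarrow> 0 < fst z \<and> fst z \<le> 1"
begin

lemma og_cong: "(\<And>z. z \<in> \<Omega> \<Longrightarrow> f z = g z) \<Longrightarrow> og \<gamma> G f \<longleftrightarrow> og \<gamma> G g"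
 unfolding og_def using Dl_cong[OF S, of f g] G by (simp add: subset_eq)

lemma bdk_cong: "(\<And>z. z \<in> \<Omega> \<Longrightarrow> f z = g z) \<Longrightarrow> bdk k G f \<longleftrightarrow> bdk k G g"
proof (induction k arbitrary: f g)
 case 0
 then show ?case unfolding bdk.simps by (rule og_cong)
next
 case (Suc k)
 have "og 0 G f \<longleftrightarrow> og 0 G g" by (rule og_cong[OF Suc.prems])
 moreover have "bdk k G (dd eX f) \<longleftrightarrow> bdk k G (dd eX g)"
  by (rule Suc.IH) (rule dd_cong_open[OF S Suc.prems])
 ultimately show ?case unfolding bdk.simps by (rule arg_cong2)
qed

lemma Dl_add:
 assumes "Cinf_on \<Omega> f" "Cinf_on \<Omega> g" "z \<in> \<Omega>"
 shows "Dl l (\<lambda>z. f z + g z) z = Dl l f z + Dl l g z"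
 using assms(3)
proof (induction l arbitrary: z)
 case (Cons v l)
 have "dd v (Dl l (\<lambda>z. f z + g z)) z = dd v (\<lambda>z. Dl l f z + Dl l g z) z"
  by (rule dd_cong_open[OF S _ Cons.prems]) (rule Cons.IH)
 also have "\<dots> = dd v (Dl l f) z + dd v (Dl l g) z"
  by (rule dd_add; rule Cinf_on_differentiable[OF Cinf_on_Dl Cons.prems]; fact)
 finally show ?case by simp
qed simp

lemma og_add:
 assumes "Cinf_on \<Omega> f" "Cinf_on \<Omega> g" "og \<gamma> G f" "og \<gamma> G g"
 shows "og \<gamma> G (\<lambda>z. f z + g z)"
 unfolding og_def
proof (intro allI impI)
 fix l :: "'n pt list" assume l: "set l \<subseteq> tang"
 note eq = Dl_add[OF assms(1,2)]
 obtain C C' where "\<And>z. z \<in> G \<Longrightarrow> \<bar>Dl l f z\<bar> \<le> C * fst z powr (- \<gamma>)" "\<And>z. z \<in> G \<Longrightarrow> \<bar>Dl l g z\<bar> \<le> C' * fst z powr (- \<gamma>)"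
  using assms(3,4) l unfolding og_def by meson
 then have "\<bar>Dl l f z + Dl l g z\<bar> \<le> (C + C') * fst z powr (- \<gamma>)" if "z \<in> G" for z
  using abs_triangle_ineq[of "Dl l f z" "Dl l g z"] that unfolding distrib_right by fastforce
 then show "\<exists>C. \<forall>z\<in>G. \<bar>Dl l (\<lambda>z. f z + g z) z\<bar> \<le> C * fst z powr (- \<gamma>)"
  using eq G by (intro exI[of _ "C + C'"]) auto
qed

lemma og_mult:
 assumes "Cinf_on \<Omega> f" "Cinf_on \<Omega> g" "og 0 G f" "og \<gamma> G g"
 shows "og \<gamma> G (\<lambda>z. f z * g z)"
proof -
 have "\<exists>C. \<forall>z\<in>G. \<bar>Dl l (\<lambda>z. f z * g z) z\<bar> \<le> C * fst z powr (- \<gamma>)" if "set l \<subseteq> tang" for l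
  using that assms
 \<comment> \<open>Reverse induction: the letter that acts first meets the product itself, and the
   product rule returns products of the same kind, to which the induction hypothesis
   applies.\<close>
 proof (induction l arbitrary: f g rule: rev_induct)
  case Nil
  obtain C where C: "\<And>z. z \<in> G \<Longrightarrow> \<bar>f z\<bar> \<le> C"
  proof -
   obtain C where "\<forall>z\<in>G. \<bar>f z\<bar> \<le> C * fst z powr (- 0)" using og_bound[OF Nil.prems(4)] by blast
   then have "\<And>z. z \<in> G \<Longrightarrow> \<bar>f z\<bar> \<le> C" using G1 by fastforce
   then show ?thesis using that by blast
  qed
  obtain C' where C': "\<And>z. z \<in> G \<Longrightarrow> \<bar>g z\<bar> \<le> C' * fst z powr (- \<gamma>)"
   using og_bound[OF Nil.prems(5)] by blast
  have "\<bar>f z * g z\<bar> \<le> (C * C') * fst z powr (- \<gamma>)" if "z \<in> G" for z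
   using mult_mono[OF C[OF that] C'[OF that]] order_trans[OF abs_ge_zero C[OF that]] by (simp add: abs_mult mult.assoc)
  then have "\<forall>z\<in>G. \<bar>Dl [] (\<lambda>z. f z * g z) z\<bar> \<le> (C * C') * fst z powr (- \<gamma>)" by simp
  then show ?case by (intro exI)
 next
  case (snoc v l)
  have v: "v \<in> tang" and l: "set l \<subseteq> tang" using snoc.prems(1) by auto
  note p = snoc.prems
  obtain C where C: "\<And>z. z \<in> G \<Longrightarrow> \<bar>Dl l (\<lambda>z. dd v f z * g z) z\<bar> \<le> C * fst z powr (- \<gamma>)"
   using snoc.IH[OF l Cinf_on_dd[OF p(2)] p(3) og_dd[OF p(4) v] p(5)] by blast
  obtain C' where C': "\<And>z. z \<in> G \<Longrightarrow> \<bar>Dl l (\<lambda>z. f z * dd v g z) z\<bar> \<le> C' * fst z powr (- \<gamma>)"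
   using snoc.IH[OF l p(2) Cinf_on_dd[OF p(3)] p(4) og_dd[OF p(5) v]] by blast
  have "\<bar>Dl (l @ [v]) (\<lambda>z. f z * g z) z\<bar> \<le> (C + C') * fst z powr (- \<gamma>)" if z: "z \<in> G" for z
  proof -
   have z': "z \<in> \<Omega>" using z G by blast
   have "Dl (l @ [v]) (\<lambda>z. f z * g z) z = Dl l (\<lambda>z. dd v f z * g z + f z * dd v g z) z"
    unfolding Dl_append Dl.simps
    by (rule Dl_cong[OF S _ z'], rule dd_mult)
      (erule Cinf_on_differentiable[OF p(2)], erule Cinf_on_differentiable[OF p(3)])
   also have "\<dots> = Dl l (\<lambda>z. dd v f z * g z) z + Dl l (\<lambda>z. f z * dd v g z) z"
    by (rule Dl_add[OF Cinf_on_mult[OF S Cinf_on_dd[OF p(2)] p(3)] Cinf_on_mult[OF S p(2) Cinf_on_dd[OF p(3)]] z'])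
   finally show ?thesis using C[OF z] C'[OF z] unfolding distrib_right by linarith
  qed
  then show ?case by (intro exI ballI)
 qed
 then show ?thesis by (simp add: og_def)
qed

lemma og_zero: "og \<gamma> G (\<lambda>_. 0)"
 unfolding og_def
proof (intro allI impI)
 fix l :: "'n pt list"
 have "Dl l (\<lambda>_. 0) = (\<lambda>_. 0 :: real)" by (induction l) (simp_all add: dd_const[abs_def])
 then show "\<exists>C. \<forall>z\<in>G. \<bar>Dl l (\<lambda>_. 0) z\<bar> \<le> C * fst z powr (- \<gamma>)" by (intro exI[of _ 0]) simp
qed

lemma og_sum:
 "(\<And>i. i \<in> I \<Longrightarrow> Cinf_on \<Omega> (f i) \<and> og \<gamma> G (f i)) \<Longrightarrow> og \<gamma> G (\<lambda>z. \<Sum>i\<in>I. f i z)"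
proof (induction I rule: infinite_finite_induct)
 case (insert i I)
 then show ?case using og_add[of "f i" "\<lambda>z. \<Sum>i\<in>I. f i z"] Cinf_on_sum[OF S, of I f] by auto
qed (auto simp: og_zero)

lemma og_bsmooth: "bsmooth \<Omega> f \<Longrightarrow> og 0 G f"
 unfolding bsmooth_def og_def
proof (intro allI impI)
 fix l :: "'n pt list" assume f: "Cinf_on \<Omega> f \<and> (\<forall>l. \<exists>C. \<forall>z\<in>\<Omega>. \<bar>Dl l f z\<bar> \<le> C)"
 then obtain C where "\<forall>z\<in>\<Omega>. \<bar>Dl l f z\<bar> \<le> C" by blast
 then show "\<exists>C. \<forall>z\<in>G. \<bar>Dl l f z\<bar> \<le> C * fst z powr (- 0)"
  using G G1 by (intro exI[of _ C]) (force simp: subset_eq)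
qed

lemma bdk_zero: "bdk k G (\<lambda>_. 0)"
 by (induction k) (auto simp: og_zero dd_const[abs_def])

lemma bdk_bsmooth: "bsmooth \<Omega> f \<Longrightarrow> bdk k G f"
 by (induction k arbitrary: f) (auto simp: og_bsmooth bsmooth_dd)

lemma bdk_add: "Cinf_on \<Omega> f \<Longrightarrow> Cinf_on \<Omega> g \<Longrightarrow> bdk k G f \<Longrightarrow> bdk k G g \<Longrightarrow> bdk k G (\<lambda>z. f z + g z)"
proof (induction k arbitrary: f g)
 case (Suc k)
 have "bdk k G (\<lambda>z. dd eX f z + dd eX g z)"
  using Suc.prems by (intro Suc.IH Cinf_on_dd) auto
 then have "bdk k G (dd eX (\<lambda>z. f z + g z))"
  using Suc.prems(1,2) by (subst bdk_cong) (auto intro!: dd_add Cinf_on_differentiable)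
 then show ?case using Suc.prems og_add by simp
qed (simp add: og_add)

lemma bdk_sum:
 "(\<And>i. i \<in> I \<Longrightarrow> Cinf_on \<Omega> (f i) \<and> bdk k G (f i)) \<Longrightarrow> bdk k G (\<lambda>z. \<Sum>i\<in>I. f i z)"
proof (induction I rule: infinite_finite_induct)
 case (insert i I)
 then show ?case using bdk_add[of "f i" "\<lambda>z. \<Sum>i\<in>I. f i z"] Cinf_on_sum[OF S, of I f] by auto
qed (auto simp: bdk_zero)

lemma bdk_mult: "Cinf_on \<Omega> f \<Longrightarrow> Cinf_on \<Omega> g \<Longrightarrow> bdk k G f \<Longrightarrow> bdk k G g \<Longrightarrow> bdk k G (\<lambda>z. f z * g z)"
proof (induction k arbitrary: f g)
 case (Suc k)
 have "bdk k G (\<lambda>z. dd eX f z * g z + f z * dd eX g z)"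
  using Suc.prems bdk_SucD by (intro bdk_add Suc.IH Cinf_on_dd Cinf_on_mult S) auto
 then have "bdk k G (dd eX (\<lambda>z. f z * g z))"
  using Suc.prems(1,2) by (subst bdk_cong) (auto intro!: dd_mult Cinf_on_differentiable)
 then show ?case using Suc.prems og_mult by simp
qed (simp add: og_mult)

lemma bdk_dd: "Cinf_on \<Omega> f \<Longrightarrow> bdk k G f \<Longrightarrow> v \<in> tang \<Longrightarrow> bdk k G (dd v f)"
proof (induction k arbitrary: f)
 case (Suc k)
 have "bdk k G (dd v (dd eX f))" using Suc.prems by (intro Suc.IH Cinf_on_dd) auto
 then have "bdk k G (dd eX (dd v f))"
  using Suc.prems(1) by (subst bdk_cong) (auto intro!: Cinf_on_commute S)
 then show ?case using Suc.prems og_dd[of 0 G f v] by simp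
qed (simp add: og_dd)

end

lemma bsmooth_fst: "bsmooth (reg x0 \<rho> y0) fst"
proof -
 let ?\<Omega> = "reg x0 \<rho> y0"
 have "\<exists>C. \<forall>z\<in>?\<Omega>. \<bar>Dl l fst z\<bar> \<le> C" for l
 proof (cases l rule: rev_cases)
  case Nil
  then show ?thesis by (intro exI[of _ x0]) (auto simp: reg_def)
 next
  case (snoc l' v)
  have "dd v fst = (\<lambda>z. fst v)" by (simp add: fun_eq_iff dd_linear[OF bounded_linear_fst])
  then show ?thesis using bsmooth_const[OF open_reg, of x0 \<rho> y0 "fst v"] unfolding snoc Dl_append bsmooth_def by simp
 qed
 then show ?thesis unfolding bsmooth_def using Cinf_on_linear[OF open_reg bounded_linear_fst] by blast
qed

context wave_eq
begin

text \<open>The commutator of d/dx and \<open>Yd\<close> is d/dx, because \<open>Yd\<close> contains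
  x d/dx. Each derivative in x thus adds 1 to the zero-order coefficient of a transport equation,
  with the favourable sign.\<close>

lemma dd_eX_Yd:
 assumes p: "Cinf_on \<Omega> p" and z: "z \<in> \<Omega>"
 shows "dd eX (Yd p) z = Yd (dd eX p) z + dd eX p z"
proof -
 note d = Cinf_on_differentiable[OF _ z]
 have "dd eX (Yd p) z = dd eX (\<lambda>z. fst z * dd eX p z) z + dd eX (\<lambda>z. 2 * dd eS p z) z"
  unfolding Yd_def[abs_def] by (intro dd_add d Cinf_x_mult[OF p] Cinf_on_dd p Cinf_on_cmult open_reg)
 also have "dd eX (\<lambda>z. fst z * dd eX p z) z = dd eX fst z * dd eX p z + fst z * dd eX (dd eX p) z"
  by (intro dd_mult d Cinf_on_linear open_reg bounded_linear_fst Cinf_on_dd p)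
 also have "dd eX fst z = 1" by (simp add: dd_linear[OF bounded_linear_fst] eX_def)
 also have "dd eX (\<lambda>z. 2 * dd eS p z) z = 2 * dd eX (dd eS p) z"
  by (rule dd_bounded_linear[OF bounded_linear_mult_right d[OF Cinf_on_dd[OF p]]])
 also have "dd eX (dd eS p) z = dd eS (dd eX p) z" by (rule Cinf_on_commute[OF open_reg p z])
 finally show ?thesis unfolding Yd_def by linarith
qed

context
 fixes \<delta> r s1 :: real
 assumes \<delta>: "0 < \<delta>" "\<delta> < x0" and r: "r < \<rho>"
begin

abbreviation G where "G \<equiv> gr \<delta> s1 r y0"

lemma G_sub: "G \<subseteq> \<Omega>" and G1: "z \<in> G \<Longrightarrow> 0 < fst z \<and> fst z \<le> 1"
 unfolding gr_def reg_def using \<delta> r x0 by auto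

text \<open>Integration along the characteristic \<open>\<tau> \<mapsto> (x e\<^sup>\<tau>, s + 2 \<tau>, y)\<close> of \<open>Yd\<close>, which reaches the zero
 set \<open>s < s0\<close> while \<open>x e\<^sup>\<tau>\<close> stays comparable to \<open>x\<close>.\<close>

lemma transport:
 assumes p: "Cinf_on \<Omega> p" and eq: "\<And>z. z \<in> \<Omega> \<Longrightarrow> Yd p z + \<kappa> * p z = F z" and \<kappa>: "0 \<le> \<kappa>"
  and van: "\<And>z. z \<in> \<Omega> \<Longrightarrow> fst (snd z) < s0 \<Longrightarrow> p z = 0"
  and \<gamma>: "0 \<le> \<gamma>" and M: "\<And>z. z \<in> G \<Longrightarrow> \<bar>F z\<bar> \<le> M * fst z powr (- \<gamma>)"
 shows "\<exists>C. \<forall>z\<in>G. \<bar>p z\<bar> \<le> C * fst z powr (- \<gamma>)"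
proof -
 \<comment> \<open>Going back by T along the characteristic lowers s by 2 T, from at most s1 to
   below s0.\<close>
 define T where "T = max 1 ((s1 - s0 + 1) / 2)"
 have T: "0 < T" "s1 - 2 * T < s0" by (auto simp: T_def max_def field_simps)
 have "\<bar>p z\<bar> \<le> (T * \<bar>M\<bar> * exp (\<gamma> * T)) * fst z powr (- \<gamma>)" if z: "z \<in> G" for z
 proof -
  obtain x s y where zz: "z = (x, s, y)" by (cases z)
  have x: "0 < x" "x \<le> \<delta>" and s: "s \<le> s1" and e: "dist y0 y \<le> r" using z by (auto simp: zz gr_def)
  define k where "k = (\<lambda>\<tau>. (x * exp \<tau>, s + 2 * \<tau>, y))"
  have kG: "k \<tau> \<in> G" if "\<tau> \<le> 0" for \<tau>
  proof -
   have "x * exp \<tau> \<le> x * 1" using x that by (intro mult_left_mono) auto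
   then show ?thesis using x s e that order_trans[of "x * exp \<tau>" x \<delta>] by (simp add: k_def gr_def)
  qed
  \<comment> \<open>The integrating factor turns the equation into f' = e^(\<kappa> \<tau>) F along
    the curve; for \<tau> \<le> 0 this factor is at most 1.\<close>
  define f where "f = (\<lambda>\<tau>. exp (\<kappa> * \<tau>) * p (k \<tau>))"
  define f' where "f' = (\<lambda>\<tau>. exp (\<kappa> * \<tau>) * F (k \<tau>))"
  have der: "(f has_real_derivative f' \<tau>) (at \<tau>)" if "\<tau> \<le> 0" for \<tau>
  proof -
   have k\<Omega>: "k \<tau> \<in> \<Omega>" using kG[OF that] G_sub by blast
   have kd: "(k has_derivative (\<lambda>h. h *\<^sub>R (x * exp \<tau>, 2, 0))) (at \<tau>)"
    unfolding k_def by (auto intro!: derivative_eq_intros simp: zero_prod_def)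
   have dp: "p differentiable (at (k \<tau>))" by (rule Cinf_on_differentiable[OF p k\<Omega>])
   have Y: "dd (h *\<^sub>R (x * exp \<tau>, 2, 0)) p (k \<tau>) = Yd p (k \<tau>) * h" for h
   proof -
    have e: "h *\<^sub>R (x * exp \<tau>, 2, 0) = (h * (x * exp \<tau>)) *\<^sub>R eX + (h * 2) *\<^sub>R (eS :: 'n pt)"
     by (simp add: eX_def eS_def)
    show ?thesis unfolding e Yd_def
     using linear_add[OF linear_dd[OF dp]] linear_scale[OF linear_dd[OF dp]]
     by (simp add: k_def algebra_simps)
   qed
   have "((\<lambda>\<tau>. p (k \<tau>)) has_derivative (\<lambda>h. dd (h *\<^sub>R (x * exp \<tau>, 2, 0)) p (k \<tau>))) (at \<tau>)"
    by (rule has_derivative_compose[OF kd has_derivative_dd[OF dp]])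
   then have "((\<lambda>\<tau>. p (k \<tau>)) has_real_derivative Yd p (k \<tau>)) (at \<tau>)"
    unfolding Y has_field_derivative_def .
   then have "(f has_real_derivative (\<kappa> * exp (\<kappa> * \<tau>)) * p (k \<tau>) + Yd p (k \<tau>) * exp (\<kappa> * \<tau>)) (at \<tau>)"
    unfolding f_def by (auto intro!: derivative_eq_intros)
   then show ?thesis using eq[OF k\<Omega>, symmetric] by (simp add: f'_def algebra_simps)
  qed
  obtain \<tau> where \<tau>: "- T < \<tau>" "\<tau> < 0" "f 0 - f (- T) = (0 - - T) * f' \<tau>"
   using MVT2[of "- T" 0 f f'] T der by auto
  have "f (- T) = 0"
   using van[of "k (- T)"] kG[of "- T"] G_sub T s by (auto simp: f_def k_def)
  then have pz: "p z = T * f' \<tau>" using \<tau>(3) by (simp add: f_def k_def zz)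
  have "\<bar>f' \<tau>\<bar> = exp (\<kappa> * \<tau>) * \<bar>F (k \<tau>)\<bar>" by (simp add: f'_def abs_mult)
  also have "\<dots> \<le> 1 * \<bar>F (k \<tau>)\<bar>"
   using \<kappa> \<tau> by (intro mult_right_mono) (auto simp: mult_nonneg_nonpos)
  also have "\<dots> \<le> M * (x * exp \<tau>) powr (- \<gamma>)" using M[OF kG[of \<tau>]] \<tau> by (simp add: k_def)
  also have "\<dots> \<le> \<bar>M\<bar> * (exp (\<gamma> * T) * x powr (- \<gamma>))"
  proof (intro mult_mono)
   have "(x * exp \<tau>) powr (- \<gamma>) = exp (- (\<gamma> * \<tau>)) * x powr (- \<gamma>)"
    using x by (simp add: powr_mult exp_powr_real mult.commute)
   also have "- (\<gamma> * \<tau>) \<le> \<gamma> * T" using \<gamma> \<tau> mult_left_mono[of "- \<tau>" T \<gamma>] by simp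
   finally show "(x * exp \<tau>) powr (- \<gamma>) \<le> exp (\<gamma> * T) * x powr (- \<gamma>)" by (simp add: mult_right_mono)
  qed auto
  finally have "T * \<bar>f' \<tau>\<bar> \<le> T * (\<bar>M\<bar> * (exp (\<gamma> * T) * x powr (- \<gamma>)))" using T by simp
  then show ?thesis using T unfolding pz by (simp add: abs_mult zz mult.assoc)
 qed
 then show ?thesis by blast
qed

lemma transport_og:
 assumes p: "Cinf_on \<Omega> p" and F: "Cinf_on \<Omega> F" and eq: "\<And>z. z \<in> \<Omega> \<Longrightarrow> Yd p z + \<kappa> * p z = F z" and \<kappa>: "0 \<le> \<kappa>"
  and van: "\<And>z. z \<in> \<Omega> \<Longrightarrow> fst (snd z) < s0 \<Longrightarrow> p z = 0"
  and \<gamma>: "0 \<le> \<gamma>" and og: "og \<gamma> G F"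
 shows "og \<gamma> G p"
 unfolding og_def
proof (intro allI impI)
 fix l :: "'n pt list" assume l: "set l \<subseteq> tang"
 obtain M where M: "\<And>z. z \<in> G \<Longrightarrow> \<bar>Dl l F z\<bar> \<le> M * fst z powr (- \<gamma>)" using og l unfolding og_def by blast
 have eq': "Yd (Dl l p) z + \<kappa> * Dl l p z = Dl l F z" if "z \<in> \<Omega>" for z
  using that l
 proof (induction l arbitrary: z)
  case (Cons v l)
  then have v: "v \<in> tang" by simp
  have pl: "Cinf_on \<Omega> (Dl l p)" using p by (rule Cinf_on_Dl)
  have "dd v (Dl l F) z = dd v (\<lambda>z. Yd (Dl l p) z + \<kappa> * Dl l p z) z"
   by (rule dd_cong_open[OF open_reg _ Cons.prems(1)]) (use Cons in auto)
  also have "\<dots> = dd v (Yd (Dl l p)) z + dd v (\<lambda>z. \<kappa> * Dl l p z) z"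
   by (intro dd_add Cinf_on_differentiable[OF _ Cons.prems(1)] Cinf_Yd[OF pl] Cinf_on_cmult open_reg pl)
  also have "dd v (\<lambda>z. \<kappa> * Dl l p z) z = \<kappa> * dd v (Dl l p) z"
   by (rule dd_bounded_linear[OF bounded_linear_mult_right Cinf_on_differentiable[OF pl Cons.prems(1)]])
  finally show ?case using Yd_tang[OF pl pl Cons.prems(1) v] by simp
 qed (use eq in simp)
 have op: "open (\<Omega> \<inter> {z. fst (snd z) < s0})" by (auto intro!: open_Int open_reg open_Collect_less continuous_intros)
 show "\<exists>C. \<forall>z\<in>G. \<bar>Dl l p z\<bar> \<le> C * fst z powr (- \<gamma>)"
  by (rule transport[OF Cinf_on_Dl[OF p] eq' \<kappa> _ \<gamma> M, where ?s0.0=s0])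
    (use Dl_zero_open[OF op, of p _ l] van in auto)
qed

text \<open>\<kappa> varies in the induction, since it becomes \<kappa> + 1 with every derivative in
  x (\<open>dd_eX_Yd\<close>).\<close>

lemma transport_bdk:
 assumes "Cinf_on \<Omega> p" "Cinf_on \<Omega> F" "\<And>z. z \<in> \<Omega> \<Longrightarrow> Yd p z + \<kappa> * p z = F z" "0 \<le> \<kappa>"
  "\<And>z. z \<in> \<Omega> \<Longrightarrow> fst (snd z) < s0 \<Longrightarrow> p z = 0" "bdk k G F"
 shows "bdk k G p"
 using assms
proof (induction k arbitrary: p F \<kappa>)
 case 0
 then show ?case using transport_og[of p F \<kappa> s0 0] by simp
next
 case (Suc k)
 note p = Suc.prems
 have op: "open (\<Omega> \<inter> {z. fst (snd z) < s0})" by (auto intro!: open_Int open_reg open_Collect_less continuous_intros)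
 have "og 0 G p"
  by (rule transport_og[where ?s0.0=s0 and \<kappa>=\<kappa>, OF p(1,2)]) (use p in auto)
 moreover have "bdk k G (dd eX p)"
 proof (rule Suc.IH[where p="dd eX p" and F="dd eX F" and \<kappa>="\<kappa> + 1"])
  fix z assume z: "z \<in> \<Omega>"
  note d = Cinf_on_differentiable[OF _ z]
  have "dd eX F z = dd eX (\<lambda>z. Yd p z + \<kappa> * p z) z"
   by (rule dd_cong_open[OF open_reg _ z]) (use p(3) in simp)
  also have "\<dots> = dd eX (Yd p) z + \<kappa> * dd eX p z"
   using dd_add[OF d[OF Cinf_Yd[OF p(1,1)]] d[OF Cinf_on_cmult[OF open_reg p(1)]], of eX \<kappa>]
    dd_bounded_linear[OF bounded_linear_mult_right d[OF p(1)], of eX \<kappa>] by simp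
  also have "dd eX (Yd p) z = Yd (dd eX p) z + dd eX p z" by (rule dd_eX_Yd[OF p(1) z])
  finally show "Yd (dd eX p) z + (\<kappa> + 1) * dd eX p z = dd eX F z" by (simp add: algebra_simps)
  show "dd eX p z = 0" if "fst (snd z) < s0" using dd_zero_open[OF op, of p z eX] p(5) z that by auto
 qed (use p in \<open>auto intro: Cinf_on_dd\<close>)
 ultimately show ?case by simp
qed

text \<open>Integration of d/dx f from the face x = \<delta> inwards, phrased as monotonicity of h -
  f and h + f, where h is a primitive of a bound for |d/dx f|. The exponent e = 0, whose primitive
  is a logarithm, is left out.\<close>

lemma integrate_og:
 assumes f: "Cinf_on \<Omega> f" and og1: "og \<gamma> G f" and og': "og \<gamma>' G (dd eX f)" and e: "e \<noteq> 0" "\<gamma>' \<le> 1 - e"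
 shows "og (max 0 (- e)) G f"
 unfolding og_def
proof (intro allI impI)
 fix l :: "'n pt list" assume l: "set l \<subseteq> tang"
 obtain C where C: "\<And>z. z \<in> G \<Longrightarrow> \<bar>Dl l f z\<bar> \<le> C * fst z powr (- \<gamma>)" using og1 l unfolding og_def by blast
 obtain M' where M': "\<And>z. z \<in> G \<Longrightarrow> \<bar>Dl l (dd eX f) z\<bar> \<le> M' * fst z powr (- \<gamma>')" using og' l unfolding og_def by blast
 define M where "M = \<bar>M'\<bar> / \<bar>e\<bar>"
 have M0: "0 \<le> M" by (simp add: M_def)
 let ?\<gamma> = "max 0 (- e)"
 define C' where "C' = \<bar>C\<bar> * \<delta> powr (- \<gamma>) + M * (\<delta> powr e + 1)"
 have comm: "Dl l (dd eX f) z = dd eX (Dl l f) z" if "z \<in> \<Omega>" for z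
  using that
 proof (induction l arbitrary: z)
  case (Cons v l)
  have "dd v (Dl l (dd eX f)) z = dd v (dd eX (Dl l f)) z"
   by (rule dd_cong_open[OF open_reg _ Cons.prems]) (rule Cons.IH)
  also have "\<dots> = dd eX (dd v (Dl l f)) z" by (rule Cinf_on_commute[OF open_reg Cinf_on_Dl[OF f] Cons.prems])
  finally show ?case by simp
 qed simp
 have "\<bar>Dl l f z\<bar> \<le> C' * fst z powr (- ?\<gamma>)" if z: "z \<in> G" for z
 proof -
  obtain x s y where zz: "z = (x, s, y)" by (cases z)
  have x: "0 < x" "x \<le> \<delta>" and s: "s \<le> s1" and eta: "dist y0 y \<le> r" using z by (auto simp: zz gr_def)
  have inG: "(x', s, y) \<in> G" if "0 < x'" "x' \<le> \<delta>" for x' using that s eta by (auto simp: gr_def)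
  define g where "g = (\<lambda>x'. Dl l f (x', s, y))"
  \<comment> \<open>The sign makes the derivative equal to |M'| times x^(e - 1) for either sign of
    e.\<close>
  define h where "h = (\<lambda>x'. M * sgn e * x' powr e)"
  have gd: "(g has_real_derivative dd eX (Dl l f) (x', s, y)) (at x')" if "0 < x'" "x' \<le> \<delta>" for x'
  proof -
   have "(x', s, y) \<in> \<Omega>" using inG[OF that] G_sub by blast
   from dd_line[of "Dl l f" "(0, s, y)" x' eX UNIV, simplified, unfolded eX_def, simplified, OF Cinf_on_differentiable[OF Cinf_on_Dl[OF f] this]]
   show ?thesis by (simp add: g_def eX_def)
  qed
  have hd: "(h has_real_derivative \<bar>M'\<bar> * x' powr (e - 1)) (at x')" if "0 < x'" for x'
  proof -
   have "(h has_real_derivative M * sgn e * (e * x' powr (e - 1))) (at x')"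
    unfolding h_def using that by (auto intro!: derivative_eq_intros)
   moreover have "M * sgn e * (e * x' powr (e - 1)) = \<bar>M'\<bar> * x' powr (e - 1)"
    using e(1) by (auto simp: M_def sgn_if)
   ultimately show ?thesis by simp
  qed
  have le: "\<bar>dd eX (Dl l f) (x', s, y)\<bar> \<le> \<bar>M'\<bar> * x' powr (e - 1)" if "0 < x'" "x' \<le> \<delta>" for x'
  proof -
   have "\<bar>dd eX (Dl l f) (x', s, y)\<bar> \<le> M' * x' powr (- \<gamma>')"
    using M'[OF inG[OF that]] comm[of "(x', s, y)"] inG[OF that] G_sub by auto
   also have "\<dots> \<le> \<bar>M'\<bar> * x' powr (e - 1)"
    using that \<delta> x0 e(2) by (intro mult_mono powr_mono') auto
   finally show ?thesis .
  qed
  have "h x - g x \<le> h \<delta> - g \<delta>" "h x + g x \<le> h \<delta> + g \<delta>"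
  proof -
   have "\<exists>u. ((\<lambda>x. h x - g x) has_real_derivative u) (at x') \<and> 0 \<le> u" if "x \<le> x'" "x' \<le> \<delta>" for x'
    using DERIV_diff[OF hd gd, of x'] le[of x'] that x
    by (intro exI[of _ "\<bar>M'\<bar> * x' powr (e - 1) - dd eX (Dl l f) (x', s, y)"]) auto
   then show "h x - g x \<le> h \<delta> - g \<delta>" using DERIV_nonneg_imp_nondecreasing[of x \<delta> "\<lambda>x. h x - g x"] x by blast
   have "\<exists>u. ((\<lambda>x. h x + g x) has_real_derivative u) (at x') \<and> 0 \<le> u" if "x \<le> x'" "x' \<le> \<delta>" for x'
    using DERIV_add[OF hd gd, of x'] le[of x'] that x
    by (intro exI[of _ "\<bar>M'\<bar> * x' powr (e - 1) + dd eX (Dl l f) (x', s, y)"]) auto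
   then show "h x + g x \<le> h \<delta> + g \<delta>" using DERIV_nonneg_imp_nondecreasing[of x \<delta> "\<lambda>x. h x + g x"] x by blast
  qed
  moreover have "h \<delta> - h x \<le> M * (\<delta> powr e + x powr e)"
  proof -
   have "\<bar>h u\<bar> \<le> M * u powr e" for u
    using M0 by (auto simp: h_def abs_mult sgn_if)
   from this[of \<delta>] this[of x] show ?thesis by (simp add: distrib_left abs_le_iff)
  qed
  ultimately have "\<bar>g x\<bar> \<le> \<bar>g \<delta>\<bar> + M * (\<delta> powr e + x powr e)" by linarith
  also have "\<bar>g \<delta>\<bar> \<le> \<bar>C\<bar> * \<delta> powr (- \<gamma>)"
  proof -
   have "C * \<delta> powr (- \<gamma>) \<le> \<bar>C\<bar> * \<delta> powr (- \<gamma>)" by (intro mult_right_mono) auto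
   moreover have "\<bar>Dl l f (\<delta>, s, y)\<bar> \<le> C * \<delta> powr (- \<gamma>)" using C[OF inG[of \<delta>]] \<delta> by simp
   ultimately show ?thesis unfolding g_def by linarith
  qed
  finally have 1: "\<bar>g x\<bar> \<le> (\<bar>C\<bar> * \<delta> powr (- \<gamma>) + M * \<delta> powr e) * 1 + M * x powr e" by (simp add: algebra_simps)
  have x1: "x \<le> 1" using x \<delta> x0 by linarith
  have "x powr 0 \<le> x powr (- ?\<gamma>)" using x x1 by (intro powr_mono') auto
  then have 2: "1 \<le> x powr (- ?\<gamma>)" using x by simp
  have 3: "x powr e \<le> x powr (- ?\<gamma>)" using x x1 by (intro powr_mono') auto
  have "(\<bar>C\<bar> * \<delta> powr (- \<gamma>) + M * \<delta> powr e) * 1 \<le> (\<bar>C\<bar> * \<delta> powr (- \<gamma>) + M * \<delta> powr e) * x powr (- ?\<gamma>)"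
   using 2 M0 by (intro mult_left_mono) auto
  moreover have "M * x powr e \<le> M * x powr (- ?\<gamma>)" using 3 M0 by (rule mult_left_mono)
  ultimately have "\<bar>g x\<bar> \<le> C' * x powr (- ?\<gamma>)" using 1 unfolding C'_def by (simp add: algebra_simps)
  then show ?thesis by (simp add: g_def zz)
 qed
 then show "\<exists>C. \<forall>z\<in>G. \<bar>Dl l f z\<bar> \<le> C * fst z powr (- ?\<gamma>)" by blast
qed

text \<open>The equation is a transport equation for d/dx w whose right side F involves w only
  through tangential derivatives, hence grows no faster than w. Transport gives d/dx w the growth of
  w, integration in x improves the growth of w, and the two alternate until w is bounded. From then
  on each further derivative in x follows by transport alone.\<close>

lemma solves_bdk:
 assumes w: "Cinf_on \<Omega> w" and sol: "solves w"
  and van: "\<And>z. z \<in> \<Omega> \<Longrightarrow> fst (snd z) < s0 \<Longrightarrow> w z = 0" and og1: "og 1 G w"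
 shows "bdk k G w"
proof -
 define F where "F = (\<lambda>z. (- fst z) * (\<Sum>!i j. a i j z * dd (eH i) (dd (eH j) w) z)
  + ((- fst z) * (\<Sum>!i. c i z * dd (eH i) w z) + (- b z) * w z))"
 have sx: "bsmooth \<Omega> (\<lambda>z. - fst z)" by (rule bsmooth_minus[OF open_reg bsmooth_fst])
 have sb: "bsmooth \<Omega> (\<lambda>z. - b z)" by (rule bsmooth_minus[OF open_reg b])
 note Ci = Cinf_on_add Cinf_on_mult Cinf_on_sum Cinf_on_dd open_reg w bsmooth_Cinf[OF a] bsmooth_Cinf[OF c] bsmooth_Cinf[OF sx] bsmooth_Cinf[OF sb]
 have F: "Cinf_on \<Omega> F" unfolding F_def by (intro Ci)
 note rr = open_reg G_sub G1
 note bs = og_bsmooth[OF rr] bdk_bsmooth[OF rr]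
 have ogF: "og \<gamma> G F" if o: "og \<gamma> G w" for \<gamma>
  unfolding F_def
  by (intro og_add[OF rr] og_mult[OF rr] og_sum[OF rr] conjI bs a c sx sb og_dd o eH_tang Ci)
 have bdF: "bdk k G F" if o: "bdk k G w" for k
  unfolding F_def
  by (intro bdk_add[OF rr] bdk_mult[OF rr] bdk_sum[OF rr] conjI bs a c sx sb bdk_dd[OF rr] o eH_tang Ci)
 have eq: "Yd (dd eX w) z + 1 * dd eX w z = F z" if z: "z \<in> \<Omega>" for z
  using sol z dd_eX_Yd[OF w z] unfolding solves_def wave_op_def F_def by (force simp: algebra_simps)
 have op: "open (\<Omega> \<inter> {z. fst (snd z) < s0})" by (auto intro!: open_Int open_reg open_Collect_less continuous_intros)
 have van': "dd eX w z = 0" if "z \<in> \<Omega>" "fst (snd z) < s0" for z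
  using dd_zero_open[OF op, of w z eX] van that by auto
 have tr: "og \<gamma> G (dd eX w)" if "og \<gamma> G w" "0 \<le> \<gamma>" for \<gamma>
  by (rule transport_og[OF Cinf_on_dd[OF w] F eq _ van' that(2) ogF[OF that(1)]]) simp_all
 \<comment> \<open>A derivative of size 1/x leaves a logarithm, majorised here by x^(-1/4). In the
   next round the derivative is of size x^(-1/4), which is integrable, and w becomes
   bounded.\<close>
 have "og (max 0 (- (- 1 / 4))) G w"
  by (rule integrate_og[OF w og1 tr[OF og1]]) simp_all
 then have q: "og (1 / 4) G w" by simp
 have "og (max 0 (- (3 / 4))) G w"
  by (rule integrate_og[OF w q tr[OF q]]) simp_all
 then have o0: "og 0 G w" by simp
 show ?thesis
 proof (induction k)
  case (Suc k)
  have "bdk k G (dd eX w)"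
   by (rule transport_bdk[OF Cinf_on_dd[OF w] F eq _ van' bdF[OF Suc]]) simp_all
  then show ?case using o0 by simp
 qed (use o0 in simp)
qed

end

lemma bounded_derivatives:
 assumes w: "Cinf_on \<Omega> w" and sol: "solves w"
  and van: "\<And>z. z \<in> \<Omega> \<Longrightarrow> fst (snd z) < s0 \<Longrightarrow> w z = 0"
 shows "\<exists>\<delta> r. 0 < \<delta> \<and> \<delta> < x0 \<and> 0 < r \<and> r < \<rho> \<and> (\<forall>k. bdk k (gr \<delta> s1 r y0) w)"
proof -
 obtain \<delta> r where d: "0 < \<delta>" "\<delta> < x0" "0 < r" "r < \<rho>" and
  pb: "\<forall>l. set l \<subseteq> tang \<longrightarrow> (\<exists>C. \<forall>x s y. 0 < x \<longrightarrow> x \<le> \<delta> \<longrightarrow> s \<le> s1 \<longrightarrow> dist y0 y \<le> r \<longrightarrow> \<bar>Dl l w (x, s, y)\<bar> \<le> C / x)"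
  using pointwise_bound[OF w sol van, of s0 s1] by blast
 have "og 1 (gr \<delta> s1 r y0) w"
  unfolding og_def
 proof (intro allI impI)
  fix l :: "'n pt list" assume "set l \<subseteq> tang"
  then obtain C where "\<forall>x s y. 0 < x \<longrightarrow> x \<le> \<delta> \<longrightarrow> s \<le> s1 \<longrightarrow> dist y0 y \<le> r \<longrightarrow> \<bar>Dl l w (x, s, y)\<bar> \<le> C / x" using pb by blast
  then show "\<exists>C. \<forall>z\<in>gr \<delta> s1 r y0. \<bar>Dl l w z\<bar> \<le> C * fst z powr (- 1)"
   by (intro exI[of _ C]) (auto simp: gr_def powr_minus_divide)
 qed
 then show ?thesis using solves_bdk[OF d(1,2,4) w sol van] d by blast
qed

end

section \<open>Taylor expansion at the boundary\<close>

abbreviation rexp_bound :: "real \<Rightarrow> 'q set \<Rightarrow> (real \<Rightarrow> 'q \<Rightarrow> real) \<Rightarrow> (nat \<Rightarrow> 'q \<Rightarrow> real) \<Rightarrow> nat \<Rightarrow> real \<Rightarrow> bool" where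
 "rexp_bound \<delta> Q v W N C \<equiv> \<forall>q\<in>Q. \<forall>x. 0 < x \<longrightarrow> x \<le> \<delta> \<longrightarrow> \<bar>v x q - (\<Sum>k\<le>N. W k q * x ^ k)\<bar> \<le> C * x ^ (N + 1)"

context
 fixes x0 \<rho> \<delta> s1 r :: real and y0 :: "real ^ 'n::finite"
 assumes \<delta>: "0 < \<delta>" "\<delta> < x0" "x0 \<le> 1" and r: "r < \<rho>"
begin

definition slab :: "(real \<times> (real ^ 'n)) set" where "slab = {..<s1} \<times> ball y0 r"

definition regular :: "'n fn \<Rightarrow> bool" where
 "regular f \<longleftrightarrow> Cinf_on (reg x0 \<rho> y0) f \<and> (\<forall>k. bdk k (gr \<delta> s1 r y0) f)"

text \<open>Taken along one fixed sequence tending to 0, so that it is defined for every f; for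
  regular f it is the boundary value, attained with rate O(x).\<close>

definition blim :: "'n fn \<Rightarrow> real \<times> (real ^ 'n) \<Rightarrow> real" where
 "blim f q = lim (\<lambda>n. f (\<delta> / real (Suc n), q))"

lemma gr_sub: "gr \<delta> s1 r y0 \<subseteq> reg x0 \<rho> y0" and gr_1: "z \<in> gr \<delta> s1 r y0 \<Longrightarrow> 0 < fst z \<and> fst z \<le> 1"
 unfolding gr_def reg_def using \<delta> r by auto

lemma slab_gr: "q \<in> slab \<Longrightarrow> 0 < x \<Longrightarrow> x \<le> \<delta> \<Longrightarrow> (x, q) \<in> gr \<delta> s1 r y0"
 by (auto simp: slab_def gr_def)

lemma slab_reg: "q \<in> slab \<Longrightarrow> 0 < x \<Longrightarrow> x \<le> \<delta> \<Longrightarrow> (x, q) \<in> reg x0 \<rho> y0"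
 using slab_gr gr_sub by blast

lemma open_slab: "open slab" unfolding slab_def by (intro open_Times) auto
lemma convex_slab: "convex slab" unfolding slab_def by (intro convex_Times convex_ball) auto

lemma regular_bdk:
 assumes "regular f" shows "bdk k (gr \<delta> s1 r y0) f" "Cinf_on (reg x0 \<rho> y0) f"
 using assms by (auto simp: regular_def)

lemma regular_eX: "regular f \<Longrightarrow> regular (dd eX f)"
 unfolding regular_def by (metis Cinf_on_dd bdk.simps(2))

lemma regular_diff: "regular f \<Longrightarrow> z \<in> reg x0 \<rho> y0 \<Longrightarrow> f differentiable (at z)"
 unfolding regular_def using Cinf_on_differentiable by blast

lemma regular_cong:
 assumes "\<And>z. z \<in> reg x0 \<rho> y0 \<Longrightarrow> f z = g z" "regular f" shows "regular g"
 using assms(2) Cinf_on_cong[OF open_reg, of x0 \<rho> y0 f g, OF assms(1)] bdk_cong[OF open_reg gr_sub gr_1, of f g, OF _ assms(1)]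
 unfolding regular_def by simp

lemma regular_mult: "regular f \<Longrightarrow> regular g \<Longrightarrow> regular (\<lambda>z. f z * g z)"
 unfolding regular_def using Cinf_on_mult[OF open_reg, of x0 \<rho> y0 f g] bdk_mult[OF open_reg gr_sub gr_1, of f g] by blast

lemma regular_bsmooth: "bsmooth (reg x0 \<rho> y0) f \<Longrightarrow> regular f"
 unfolding regular_def using bsmooth_Cinf bdk_bsmooth[OF open_reg gr_sub gr_1] by blast

lemma tangential_decomp:
 fixes f :: "'n fn"
 shows "f differentiable (at z) \<Longrightarrow> dd (0, v) f z = fst v * dd eS f z + (\<Sum>!i. snd v $ i * dd (eH i) f z)"
proof -
 assume f: "f differentiable (at z)"
 have "(0, v) = fst v *\<^sub>R (eS :: 'n pt) + (\<Sum>!i. snd v $ i *\<^sub>R eH i)"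
 proof -
  have "(\<Sum>!i. snd v $ i *\<^sub>R (eH i :: 'n pt)) = (0, 0, \<Sum>!i. snd v $ i *\<^sub>R axis i 1)"
   by (simp add: eH_def sum_prod)
  also have "(\<Sum>!i. snd v $ i *\<^sub>R axis i 1) = snd v"
   using basis_expansion[of "snd v"] by (simp add: scalar_mult_eq_scaleR)
  finally show ?thesis by (simp add: eS_def)
 qed
 then show ?thesis
  using linear_add[OF linear_dd[OF f]] linear_scale[OF linear_dd[OF f]] dd_sum_dir[OF f, of "\<lambda>i. snd v $ i" eH UNIV] by simp
qed

lemma regular_tangential:
 assumes f: "regular f" shows "regular (dd (0, v) f)"
proof -
 note o = open_reg gr_sub gr_1
 have c: "regular (\<lambda>_. c)" for c by (rule regular_bsmooth[OF bsmooth_const[OF open_reg]])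
 have t: "regular (dd e f)" if "e \<in> tang" for e
  using f bdk_dd[OF o _ _ that] Cinf_on_dd unfolding regular_def by blast
 have "regular (\<lambda>z. fst v * dd eS f z + (\<Sum>!i. snd v $ i * dd (eH i) f z))"
  using regular_mult[OF c t[OF eS_tang]] regular_mult[OF c t[OF eH_tang]]
  unfolding regular_def
  by (intro conjI allI bdk_add[OF o] bdk_sum[OF o] Cinf_on_add Cinf_on_sum open_reg) auto
 then show ?thesis
  by (rule regular_cong[rotated]) (rule tangential_decomp[symmetric, OF regular_diff[OF f]])
qed

lemma regular_x_line:
 assumes "regular f" "q \<in> slab" "0 < x" "x \<le> \<delta>"
 shows "((\<lambda>x. f (x, q)) has_real_derivative dd eX f (x, q)) (at x)"
proof -
 have "((\<lambda>x. f ((0, q) + x *\<^sub>R eX)) has_real_derivative dd eX f ((0, q) + x *\<^sub>R eX)) (at x)"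
  by (rule dd_line, rule regular_diff[OF assms(1)]) (use slab_reg[OF assms(2-4)] in \<open>cases q; simp add: eX_def\<close>)
 then show ?thesis by (cases q) (simp add: eX_def)
qed

text \<open>The bound of d/dx f makes f Lipschitz in x with one constant for the whole slab. Hence
  the values along the sequence are Cauchy, and the rate passes to the limit.\<close>

lemma blim:
 assumes f: "regular f"
 shows "\<exists>C. \<forall>q\<in>slab. \<forall>x. 0 < x \<longrightarrow> x \<le> \<delta> \<longrightarrow> \<bar>f (x, q) - blim f q\<bar> \<le> C * x"
  and "q \<in> slab \<Longrightarrow> (\<lambda>n. f (\<delta> / real (Suc n), q)) \<longlonglongrightarrow> blim f q"
proof -
 have "og 0 (gr \<delta> s1 r y0) (dd eX f)" using bdk_og[OF regular_bdk(1)[OF regular_eX[OF f]]] .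
 then obtain C' where C': "\<And>z. z \<in> gr \<delta> s1 r y0 \<Longrightarrow> \<bar>dd eX f z\<bar> \<le> C' * fst z powr (- 0)" using og_bound by blast
 define C where "C = \<bar>C'\<bar>"
 have C: "\<bar>dd eX f z\<bar> \<le> C" if "z \<in> gr \<delta> s1 r y0" for z
  using C'[OF that] gr_1[OF that] unfolding C_def by simp
 have lip: "\<bar>f (x, q) - f (u, q)\<bar> \<le> C * \<bar>x - u\<bar>" if q: "q \<in> slab" and "0 < x" "x \<le> \<delta>" "0 < u" "u \<le> \<delta>" for x u q
 proof -
  have "norm (f (x, q) - f (u, q)) \<le> C * norm (x - u)"
  proof (rule field_differentiable_bound[where S="{0<..\<delta>}" and f'="\<lambda>x. dd eX f (x, q)"])
   fix z assume "z \<in> {0<..\<delta>}"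
   then show "((\<lambda>x. f (x, q)) has_real_derivative dd eX f (z, q)) (at z within {0<..\<delta>})"
    using regular_x_line[OF f q] by (auto intro: has_field_derivative_at_within)
   show "norm (dd eX f (z, q)) \<le> C" using C[OF slab_gr[OF q]] \<open>z \<in> {0<..\<delta>}\<close> by simp
  qed (use that in auto)
  then show ?thesis by simp
 qed
 define xn where "xn = (\<lambda>n. \<delta> / real (Suc n))"
 have xn: "0 < xn n" "xn n \<le> \<delta>" for n using \<delta> by (auto simp: xn_def field_simps)
 have xn0: "xn \<longlonglongrightarrow> 0" unfolding xn_def by (rule lim_const_over_n[THEN LIMSEQ_Suc])
 have conv: "(\<lambda>n. f (xn n, q)) \<longlonglongrightarrow> blim f q" if q: "q \<in> slab" for q
 proof -
  have "Cauchy (\<lambda>n. f (xn n, q))"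
  proof (rule CauchyI)
   fix e :: real assume e: "0 < e"
   have "Cauchy xn" using xn0 by (rule LIMSEQ_imp_Cauchy)
   moreover have "0 < e / (C + 1)" using e by (simp add: C_def)
   ultimately obtain M where M: "\<And>m n. M \<le> m \<Longrightarrow> M \<le> n \<Longrightarrow> norm (xn m - xn n) < e / (C + 1)"
    using CauchyD by blast
   have "norm (f (xn m, q) - f (xn n, q)) < e" if "M \<le> m" "M \<le> n" for m n
   proof -
    have "norm (f (xn m, q) - f (xn n, q)) \<le> C * \<bar>xn m - xn n\<bar>" using lip[OF q xn xn] by simp
    also have "\<dots> \<le> (C + 1) * \<bar>xn m - xn n\<bar>" by (simp add: distrib_right)
    also have "\<dots> < (C + 1) * (e / (C + 1))" using M[OF that] by (intro mult_strict_left_mono) (auto simp: C_def)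
    also have "\<dots> = e" by (simp add: C_def add_nonneg_eq_0_iff)
    finally show ?thesis .
   qed
   then show "\<exists>M. \<forall>m\<ge>M. \<forall>n\<ge>M. norm (f (xn m, q) - f (xn n, q)) < e" by blast
  qed
  then have "convergent (\<lambda>n. f (xn n, q))" by (rule Cauchy_convergent)
  then show ?thesis unfolding blim_def xn_def by (rule convergent_LIMSEQ_iff[THEN iffD1])
 qed
 then show "q \<in> slab \<Longrightarrow> (\<lambda>n. f (\<delta> / real (Suc n), q)) \<longlonglongrightarrow> blim f q" unfolding xn_def .
 have "\<bar>f (x, q) - blim f q\<bar> \<le> C * x" if q: "q \<in> slab" and x: "0 < x" "x \<le> \<delta>" for x q
 proof (rule tendsto_le[OF trivial_limit_sequentially])
  show "(\<lambda>n. \<bar>f (x, q) - f (xn n, q)\<bar>) \<longlonglongrightarrow> \<bar>f (x, q) - blim f q\<bar>"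
   by (intro tendsto_intros conv[OF q])
  have "(\<lambda>n. C * \<bar>x - xn n\<bar>) \<longlonglongrightarrow> C * \<bar>x - 0\<bar>" by (intro tendsto_intros xn0)
  then show "(\<lambda>n. C * \<bar>x - xn n\<bar>) \<longlonglongrightarrow> C * x" using x by simp
  show "\<forall>\<^sub>F n in sequentially. \<bar>f (x, q) - f (xn n, q)\<bar> \<le> C * \<bar>x - xn n\<bar>"
   using lip[OF q x xn] by (intro always_eventually) blast
 qed
 then show "\<exists>C. \<forall>q\<in>slab. \<forall>x. 0 < x \<longrightarrow> x \<le> \<delta> \<longrightarrow> \<bar>f (x, q) - blim f q\<bar> \<le> C * x"
  by (intro exI[of _ C]) simp
qed

lemma blim_decomp:
 assumes f: "regular f" and q: "q \<in> slab"
 shows "blim (dd (0, v) f) q = fst v * blim (dd eS f) q + (\<Sum>!i. snd v $ i * blim (dd (eH i) f) q)"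
proof (rule LIMSEQ_unique[OF blim(2)[OF regular_tangential[OF f] q]])
 have e: "dd (0, v) f (\<delta> / real (Suc n), q) =
   fst v * dd eS f (\<delta> / real (Suc n), q) + (\<Sum>!i. snd v $ i * dd (eH i) f (\<delta> / real (Suc n), q))" for n
  by (rule tangential_decomp[OF regular_diff[OF f slab_reg[OF q]]]) (use \<delta> in \<open>auto simp: field_simps\<close>)
 have S: "regular (dd eS f)" using regular_tangential[OF f, of "(1, 0)"] by (simp add: eS_def)
 have H: "regular (dd (eH i) f)" for i using regular_tangential[OF f, of "(0, axis i 1)"] by (simp add: eH_def)
 show "(\<lambda>n. dd (0, v) f (\<delta> / real (Suc n), q)) \<longlonglongrightarrow>
   fst v * blim (dd eS f) q + (\<Sum>!i. snd v $ i * blim (dd (eH i) f) q)"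
  unfolding e by (intro tendsto_intros blim(2)[OF S q] blim(2)[OF H q])
qed

text \<open>Limit and derivative may be exchanged because the slab is convex and the tangential
  derivatives converge uniformly on it. The rate C x |v|, uniform in the direction v, comes from
  treating \<open>eS\<close> and the \<open>eH i\<close> one by one.\<close>

lemma blim_has_derivative:
 assumes f: "regular f" and q: "q \<in> slab"
 shows "(blim f has_derivative (\<lambda>v. blim (dd (0, v) f) q)) (at q)"
proof -
 have S: "regular (dd eS f)" using regular_tangential[OF f, of "(1, 0)"] by (simp add: eS_def)
 have H: "regular (dd (eH i) f)" for i using regular_tangential[OF f, of "(0, axis i 1)"] by (simp add: eH_def)
 obtain CS where CS': "\<forall>q\<in>slab. \<forall>x. 0 < x \<longrightarrow> x \<le> \<delta> \<longrightarrow> \<bar>dd eS f (x, q) - blim (dd eS f) q\<bar> \<le> CS * x"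
  using blim(1)[OF S] by (rule exE)
 note CS = CS'[rule_format]
 have "\<forall>i. \<exists>C. \<forall>q\<in>slab. \<forall>x. 0 < x \<longrightarrow> x \<le> \<delta> \<longrightarrow> \<bar>dd (eH i) f (x, q) - blim (dd (eH i) f) q\<bar> \<le> C * x"
  using blim(1)[OF H] by (rule allI)
 from choice[OF this] obtain CH where CH': "\<forall>i. \<forall>q\<in>slab. \<forall>x. 0 < x \<longrightarrow> x \<le> \<delta> \<longrightarrow> \<bar>dd (eH i) f (x, q) - blim (dd (eH i) f) q\<bar> \<le> CH i * x"
  by (rule exE)
 note CH = CH'[rule_format]
 define C where "C = \<bar>CS\<bar> + (\<Sum>!i. \<bar>CH i\<bar>)"
 have C0: "0 \<le> C" unfolding C_def by (intro add_nonneg_nonneg sum_nonneg) auto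
 have bd: "\<bar>dd (0, v) f (x, q) - blim (dd (0, v) f) q\<bar> \<le> C * x * norm v" if q: "q \<in> slab" and x: "0 < x" "x \<le> \<delta>" for q x v
 proof -
  have e: "dd (0, v) f (x, q) - blim (dd (0, v) f) q = fst v * (dd eS f (x, q) - blim (dd eS f) q)
    + (\<Sum>!i. snd v $ i * (dd (eH i) f (x, q) - blim (dd (eH i) f) q))"
   unfolding blim_decomp[OF f q] tangential_decomp[OF regular_diff[OF f slab_reg[OF q x]]]
   by (simp add: right_diff_distrib sum_subtractf)
  have "\<bar>dd (0, v) f (x, q) - blim (dd (0, v) f) q\<bar> \<le> \<bar>fst v\<bar> * \<bar>dd eS f (x, q) - blim (dd eS f) q\<bar> + (\<Sum>!i. \<bar>snd v $ i\<bar> * \<bar>dd (eH i) f (x, q) - blim (dd (eH i) f) q\<bar>)"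
   unfolding e abs_mult[symmetric] by (rule order_trans[OF abs_triangle_ineq add_left_mono[OF sum_abs]])
  also have "\<dots> \<le> norm v * (\<bar>CS\<bar> * x) + (\<Sum>!i. norm v * (\<bar>CH i\<bar> * x))"
  proof (rule add_mono[OF mult_mono sum_mono[OF mult_mono]])
   show "\<bar>fst v\<bar> \<le> norm v" using norm_fst_le[of "fst v" "snd v"] unfolding prod.collapse real_norm_def .
   have "CS * x \<le> \<bar>CS\<bar> * x" using x by (intro mult_right_mono) auto
   then show "\<bar>dd eS f (x, q) - blim (dd eS f) q\<bar> \<le> \<bar>CS\<bar> * x" using CS[OF q x] by linarith
   fix i
   show "\<bar>snd v $ i\<bar> \<le> norm v"         using order_trans[OF component_le_norm_cart[of "snd v" i] norm_snd_le[of "snd v" "fst v"]] unfolding prod.collapse .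
   have "CH i * x \<le> \<bar>CH i\<bar> * x" using x by (intro mult_right_mono) auto
   then show "\<bar>dd (eH i) f (x, q) - blim (dd (eH i) f) q\<bar> \<le> \<bar>CH i\<bar> * x" using CH[OF q x, of i] by linarith
  qed auto
  also have "\<dots> = C * x * norm v" by (simp add: C_def algebra_simps sum_distrib_left sum_distrib_right)
  finally show ?thesis .
 qed
 define xn where "xn = (\<lambda>n. \<delta> / real (Suc n))"
 have xn: "0 < xn n" "xn n \<le> \<delta>" for n using \<delta> by (auto simp: xn_def field_simps)
 have xn0: "xn \<longlonglongrightarrow> 0" unfolding xn_def by (rule lim_const_over_n[THEN LIMSEQ_Suc])
 have "\<exists>g. \<forall>q\<in>slab. (\<lambda>n. f (xn n, q)) \<longlonglongrightarrow> g q \<and> (g has_derivative (\<lambda>v. blim (dd (0, v) f) q)) (at q within slab)"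
 proof (rule has_derivative_sequence[OF convex_slab, where f'="\<lambda>n q v. dd (0, v) f (xn n, q)"])
  show "((\<lambda>q. f (xn n, q)) has_derivative (\<lambda>v. dd (0, v) f (xn n, p))) (at p within slab)" if "p \<in> slab" for n p
  proof -
   have "((\<lambda>q. (xn n, q)) has_derivative (\<lambda>v. (0, v))) (at p within slab)" by (auto intro!: derivative_eq_intros)
   from has_derivative_compose[OF this has_derivative_dd[OF regular_diff[OF f slab_reg[OF that xn[of n]]]]]
   show ?thesis by simp
  qed
  show "\<forall>\<^sub>F n in sequentially. \<forall>p\<in>slab. \<forall>h. norm (dd (0, h) f (xn n, p) - blim (dd (0, h) f) p) \<le> e * norm h" if "0 < e" for e
  proof -
   have "(\<lambda>n. C * xn n) \<longlonglongrightarrow> C * 0" by (intro tendsto_intros xn0)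
   then have "\<forall>\<^sub>F n in sequentially. C * xn n < e" using \<open>0 < e\<close> by (intro order_tendstoD(2)) auto
   then show ?thesis
   proof eventually_elim
    case (elim n)
    show ?case
    proof (intro ballI allI)
     fix p h :: "real \<times> (real ^ 'n)" assume p: "p \<in> slab"
     have "C * xn n * norm h \<le> e * norm h" using elim by (intro mult_right_mono) auto
     then show "norm (dd (0, h) f (xn n, p) - blim (dd (0, h) f) p) \<le> e * norm h"
      using bd[OF p xn, of h n] by simp
    qed
   qed
  qed
 qed (use q blim(2)[OF f q] in \<open>auto simp: xn_def\<close>)
 then obtain g where g': "\<forall>q\<in>slab. (\<lambda>n. f (xn n, q)) \<longlonglongrightarrow> g q \<and> (g has_derivative (\<lambda>v. blim (dd (0, v) f) q)) (at q within slab)"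
  by (rule exE)
 note g = g'[rule_format, THEN conjunct1] g'[rule_format, THEN conjunct2]
 have "g p = blim f p" if "p \<in> slab" for p
  using LIMSEQ_unique[OF g(1)[OF that] blim(2)[OF f that, folded fun_cong[OF xn_def]]] by simp
 moreover have "(g has_derivative (\<lambda>v. blim (dd (0, v) f) q)) (at q)"
  using g(2)[OF q] at_within_open[OF q open_slab] by simp
 ultimately show ?thesis using has_derivative_transform_within_open[OF _ open_slab q] by blast
qed

lemma Cinf_blim: "regular f \<Longrightarrow> Cinf_on slab (blim f)"
proof -
 have "regular f \<Longrightarrow> Ck_on k slab (blim f)" for k
 proof (induction k arbitrary: f)
  case 0
  show ?case unfolding Ck_on.simps(1)
   by (intro continuous_at_imp_continuous_on ballI) (rule has_derivative_continuous[OF blim_has_derivative[OF 0]])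
 next
  case (Suc k)
  have "Ck_on k slab (dd v (blim f))" for v
   by (rule Ck_on_cong[OF open_slab _ Suc.IH[OF regular_tangential[OF Suc.prems, of v]]])
     (rule dd_eqI[symmetric, OF blim_has_derivative[OF Suc.prems]])
  then show ?case unfolding Ck_on_Suc_iff using blim_has_derivative[OF Suc.prems] differentiableI by blast
 qed
 then show "regular f \<Longrightarrow> Cinf_on slab (blim f)" by (simp add: Cinf_on_def)
qed

text \<open>The remainder of order N + 1 of f has the remainder of order N of d/dx f as its
  derivative and tends to 0 with x. The mean value inequality on [u, x], with u tending to 0, gains
  one power of x.\<close>

lemma taylor:
 "regular f \<Longrightarrow> \<exists>C. rexp_bound \<delta> slab (\<lambda>x q. f (x, q)) (\<lambda>k q. blim ((dd eX ^^ k) f) q / fact k) N C"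
proof (induction N arbitrary: f)
 case 0
 then show ?case using blim(1)[of f] by simp
next
 case (Suc N)
 define g where "g = dd eX f"
 obtain C where C': "rexp_bound \<delta> slab (\<lambda>x q. g (x, q)) (\<lambda>k q. blim ((dd eX ^^ k) g) q / fact k) N C"
  using Suc.IH[OF regular_eX[OF Suc.prems]] unfolding g_def by (rule exE)
 note C = C'[rule_format]
 have "\<bar>f (x, q) - (\<Sum>k\<le>Suc N. blim ((dd eX ^^ k) f) q / fact k * x ^ k)\<bar> \<le> \<bar>C\<bar> * x ^ (Suc N + 1)"
  if q: "q \<in> slab" and x: "0 < x" "x \<le> \<delta>" for q x
 proof -
  define R where "R = (\<lambda>x. f (x, q) - (\<Sum>k\<le>Suc N. blim ((dd eX ^^ k) f) q / fact k * x ^ k))"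
  define R' where "R' = (\<lambda>x. g (x, q) - (\<Sum>k\<le>N. blim ((dd eX ^^ k) g) q / fact k * x ^ k))"
  have R: "R u = f (u, q) - blim f q - (\<Sum>k\<le>N. blim ((dd eX ^^ k) g) q / fact (Suc k) * u ^ Suc k)" for u
   unfolding R_def g_def by (simp only: sum.atMost_Suc_shift funpow_Suc_right o_apply) simp
  have der: "(R has_real_derivative R' u) (at u)" if "0 < u" "u \<le> \<delta>" for u
  proof -
   have "((\<lambda>u. \<Sum>k\<le>N. blim ((dd eX ^^ k) g) q / fact (Suc k) * u ^ Suc k) has_real_derivative
     (\<Sum>k\<le>N. blim ((dd eX ^^ k) g) q / fact (Suc k) * (real (Suc k) * u ^ k))) (at u)"
    by (intro DERIV_sum DERIV_cmult) (use DERIV_pow[of "Suc _" u UNIV] in simp)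
   also have "(\<Sum>k\<le>N. blim ((dd eX ^^ k) g) q / fact (Suc k) * (real (Suc k) * u ^ k)) = (\<Sum>k\<le>N. blim ((dd eX ^^ k) g) q / fact k * u ^ k)"
    by (intro sum.cong refl) (simp add: fact_Suc field_simps del: of_nat_Suc)
   finally show ?thesis
    unfolding R[abs_def] R'_def g_def
    by (intro DERIV_diff regular_x_line[OF Suc.prems q that, THEN DERIV_diff[OF _ DERIV_const], simplified])
  qed
  have "\<bar>R x - R u\<bar> \<le> \<bar>C\<bar> * x ^ (N + 1) * \<bar>x - u\<bar>" if "0 < u" "u \<le> x" for u
  proof -
   have "norm (R x - R u) \<le> \<bar>C\<bar> * x ^ (N + 1) * norm (x - u)"
   proof (rule field_differentiable_bound[where S="{u..x}" and f'=R'])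
    fix z assume z: "z \<in> {u..x}"
    then show "(R has_real_derivative R' z) (at z within {u..x})"
     using der[of z] that x by (auto intro: has_field_derivative_at_within)
    have "norm (R' z) \<le> C * z ^ (N + 1)" unfolding R'_def using C[OF q, of z] z that x by simp
    also have "\<dots> \<le> \<bar>C\<bar> * x ^ (N + 1)" using z that by (intro mult_mono power_mono) auto
    finally show "norm (R' z) \<le> \<bar>C\<bar> * x ^ (N + 1)" .
   qed (use that in auto)
   then show ?thesis by simp
  qed
  note lip = this
  have "\<bar>R x - 0\<bar> \<le> \<bar>C\<bar> * x ^ (N + 1) * \<bar>x - 0\<bar>"
  proof (rule tendsto_le[OF trivial_limit_sequentially])
   define xn where "xn = (\<lambda>n. \<delta> / real (Suc n))"
   have xn: "0 < xn n" for n using \<delta> by (auto simp: xn_def)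
   have xn0: "xn \<longlonglongrightarrow> 0" unfolding xn_def by (rule lim_const_over_n[THEN LIMSEQ_Suc])
   have "(\<lambda>n. R (xn n)) \<longlonglongrightarrow> blim f q - blim f q - (\<Sum>k\<le>N. blim ((dd eX ^^ k) g) q / fact (Suc k) * 0 ^ Suc k)"
    unfolding R by (intro tendsto_intros xn0) (use blim(2)[OF Suc.prems q] in \<open>simp add: xn_def\<close>)
   then have R0: "(\<lambda>n. R (xn n)) \<longlonglongrightarrow> 0" by simp
   show "(\<lambda>n. \<bar>R x - R (xn n)\<bar>) \<longlonglongrightarrow> \<bar>R x - 0\<bar>" by (intro tendsto_intros R0)
   show "(\<lambda>n. \<bar>C\<bar> * x ^ (N + 1) * \<bar>x - xn n\<bar>) \<longlonglongrightarrow> \<bar>C\<bar> * x ^ (N + 1) * \<bar>x - 0\<bar>" by (intro tendsto_intros xn0)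
   have "\<forall>\<^sub>F n in sequentially. xn n < x" using xn0 x by (intro order_tendstoD(2)) auto
   then show "\<forall>\<^sub>F n in sequentially. \<bar>R x - R (xn n)\<bar> \<le> \<bar>C\<bar> * x ^ (N + 1) * \<bar>x - xn n\<bar>"
    by eventually_elim (use lip xn in auto)
  qed
  moreover have "\<bar>x - 0\<bar> = x" using x by simp
  ultimately have "\<bar>R x\<bar> \<le> \<bar>C\<bar> * (x ^ (N + 1) * x)" by (simp only: diff_zero mult.assoc)
  moreover have "x ^ (N + 1) * x = x ^ (Suc N + 1)" by simp
  ultimately show ?thesis unfolding R_def by metis
 qed
 then show ?case by (intro exI[of _ "\<bar>C\<bar>"]) simp
qed

lemma regular_expansion:
 assumes f: "regular f"
 shows "\<exists>W. (\<forall>k. Cinf_on slab (W k)) \<and> (\<forall>N. \<exists>C. rexp_bound \<delta> slab (\<lambda>x q. f (x, q)) W N C)"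
proof (rule exI[of _ "\<lambda>k q. blim ((dd eX ^^ k) f) q / fact k"], intro conjI allI)
 have "regular ((dd eX ^^ k) f)" for k by (induction k) (auto simp: f regular_eX)
 then have "Cinf_on slab (\<lambda>q. inverse (fact k) * blim ((dd eX ^^ k) f) q)" for k
  by (intro Cinf_on_cmult open_slab Cinf_blim)
 then show "Cinf_on slab (\<lambda>q. blim ((dd eX ^^ k) f) q / fact k)" for k by (simp add: field_simps)
qed (rule taylor[OF f])

end

section \<open>Reduction to the model equation\<close>

lemma glue_has_derivative:
 fixes F L :: "'a::real_normed_vector \<Rightarrow> real"
 assumes V: "open V" "z \<in> V" and L: "bounded_linear L" and F: "F differentiable (at z)"
  and van: "L z = 0 \<Longrightarrow> F z = 0" "\<And>v. L z = 0 \<Longrightarrow> dd v F z = 0"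
 shows "((\<lambda>z. if 0 \<le> L z then F z else 0) has_derivative (\<lambda>v. if 0 \<le> L z then dd v F z else 0)) (at z)"
  (is "(?g has_derivative _) _")
proof -
 have cL: "continuous_on UNIV L" using L by (rule linear_continuous_on)
 consider "0 < L z" | "L z < 0" | "L z = 0" by linarith
 then show ?thesis
 proof cases
  case 1
  have "open {z. 0 < L z}" by (intro open_Collect_less continuous_on_const cL)
  from has_derivative_transform_within_open[OF has_derivative_dd[OF F] this] show ?thesis using 1 by simp
 next
  case 2
  have "open {z. L z < 0}" by (intro open_Collect_less continuous_on_const cL)
  from has_derivative_transform_within_open[OF has_derivative_const[of 0 "at z"] this, of ?g] show ?thesis using 2 by simp
 next
  case 3
  have "(F has_derivative (\<lambda>v. 0)) (at z)" using has_derivative_dd[OF F] van(2)[OF 3] by simp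
  then have "(\<lambda>h. norm (F (z + h) - F z - 0) / norm h) \<midarrow>0\<rightarrow> 0" by (simp add: has_derivative_at)
  then have lim: "(\<lambda>h. \<bar>F (z + h)\<bar> / norm h) \<midarrow>0\<rightarrow> 0" using van(1)[OF 3] by simp
  have "(\<lambda>h. norm (?g (z + h) - ?g z - 0) / norm h) \<midarrow>0\<rightarrow> 0"
   by (rule Lim_null_comparison[OF _ lim])
     (use van(1)[OF 3] 3 in \<open>auto intro!: always_eventually divide_right_mono\<close>)
  then have "(?g has_derivative (\<lambda>v. 0)) (at z)" by (simp add: has_derivative_at)
  then show ?thesis using van(2)[OF 3] 3 by simp
 qed
qed

text \<open>The derivative of the glued function is the glued derivative, and \<open>dd v F\<close>
  inherits the vanishing on the hyperplane for words shorter by one.\<close>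

lemma Ck_on_glue:
 fixes F L :: "'a::real_normed_vector \<Rightarrow> real"
 assumes V: "open V" and L: "bounded_linear L"
 shows "Ck_on k V F \<Longrightarrow> (\<And>l z. length l \<le> k \<Longrightarrow> z \<in> V \<Longrightarrow> L z = 0 \<Longrightarrow> Dl l F z = 0) \<Longrightarrow>
  Ck_on k V (\<lambda>z. if 0 \<le> L z then F z else 0)"
proof (induction k arbitrary: F)
 case 0
 have cL: "continuous_on V L" using L by (rule linear_continuous_on)
 have "continuous_on (V \<inter> {z. 0 \<le> L z} \<union> V \<inter> {z. L z \<le> 0}) (\<lambda>z. if 0 \<le> L z then F z else 0)"
 proof (rule continuous_on_cases_local)
  have eq: "V \<inter> {z. 0 \<le> L z} \<union> V \<inter> {z. L z \<le> 0} = V" by auto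
  show "closedin (top_of_set (V \<inter> {z. 0 \<le> L z} \<union> V \<inter> {z. L z \<le> 0})) (V \<inter> {z. 0 \<le> L z})"
   unfolding eq using continuous_closedin_preimage[OF cL closed_atLeast[of 0]] by (simp add: vimage_def)
  show "closedin (top_of_set (V \<inter> {z. 0 \<le> L z} \<union> V \<inter> {z. L z \<le> 0})) (V \<inter> {z. L z \<le> 0})"
   unfolding eq using continuous_closedin_preimage[OF cL closed_atMost[of 0]] by (simp add: vimage_def)
  show "continuous_on (V \<inter> {z. 0 \<le> L z}) F" using 0(1) by (auto intro: continuous_on_subset)
 qed (use 0(2)[of "[]"] in auto)
 moreover have "V \<inter> {z. 0 \<le> L z} \<union> V \<inter> {z. L z \<le> 0} = V" by auto
 ultimately show ?case by simp
next
 case (Suc k)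
 have F: "F differentiable (at z)" if "z \<in> V" for z using Suc.prems(1) that by (simp add: Ck_on_Suc_iff)
 have d: "((\<lambda>z. if 0 \<le> L z then F z else 0) has_derivative (\<lambda>v. if 0 \<le> L z then dd v F z else 0)) (at z)" if "z \<in> V" for z
  using Suc.prems(2)[of "[]" z] Suc.prems(2)[of "[v]" z for v] that
  by (intro glue_has_derivative[OF V that L F]) auto
 have "Ck_on k V (dd v (\<lambda>z. if 0 \<le> L z then F z else 0))" for v
 proof (rule Ck_on_cong[OF V])
  show "Ck_on k V (\<lambda>z. if 0 \<le> L z then dd v F z else 0)"
  proof (rule Suc.IH)
   show "Ck_on k V (dd v F)" using Suc.prems(1) by (simp add: Ck_on_Suc_iff)
   show "Dl l (dd v F) z = 0" if "length l \<le> k" "z \<in> V" "L z = 0" for l z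
    using Suc.prems(2)[of "l @ [v]" z] that by (simp add: Dl_append)
  qed
  show "(if 0 \<le> L z then dd v F z else 0) = dd v (\<lambda>z. if 0 \<le> L z then F z else 0) z" if "z \<in> V" for z
   using dd_eqI[OF d[OF that]] by simp
 qed
 then show ?case unfolding Ck_on_Suc_iff using d differentiableI by blast
qed

section \<open>Functions independent of s and the change of variables\<close>

definition sinv :: "('n::finite pt \<Rightarrow> 'b) \<Rightarrow> bool" where
 "sinv f \<longleftrightarrow> (\<forall>x s y. f (x, s, y) = f (x, 0, y))"

lemma sinv_dd:
 fixes f :: "'n::finite fn"
 assumes "sinv f" shows "sinv (dd v f)"
 unfolding sinv_def
proof (intro allI)
 fix x s :: real and y :: "real ^ 'n"
 have f: "f z = f (z + (0, s, 0))" for z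
  using assms unfolding sinv_def by (cases z) (metis add_Pair add_0_right)
 have "(f has_derivative D) (at (x, s, y)) \<longleftrightarrow> (f has_derivative D) (at (x, 0, y))" for D
 proof -
  have "(f (x, s, y) = f (x, 0, y))" "f ((x, s, y) + h) = f ((x, 0, y) + h)" for h
   using f[of "(x, 0, y)"] f[of "(x, 0, y) + h"] by (cases h; simp add: add.commute)+
  then show ?thesis by (simp add: has_derivative_at)
 qed
 then show "dd v f (x, s, y) = dd v f (x, 0, y)" by (simp add: dd_def frechet_derivative_def)
qed

lemma sinv_compose: "sinv f \<Longrightarrow> sinv (\<lambda>z. k (f z))"
 unfolding sinv_def by (intro allI arg_cong[where f=k]) (elim allE)

lemma sinv_compose2: "sinv f \<Longrightarrow> sinv g \<Longrightarrow> sinv (\<lambda>z. k (f z) (g z))"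
 unfolding sinv_def by (intro allI arg_cong2[where f=k]) (elim allE, assumption)+

text \<open>The region is unbounded in s, so compactness is available for x and y only; independence
  of s moves every point to the slice s = 0.\<close>

lemma bsmooth_sinv:
 fixes y0 :: "real ^ 'n::finite"
 assumes \<Omega>: "open \<Omega>" and K: "{0..x0} \<times> UNIV \<times> cball y0 \<rho> \<subseteq> \<Omega>"
  and f: "Cinf_on \<Omega> f" "sinv f"
 shows "bsmooth (reg x0 \<rho> y0) f"
 unfolding bsmooth_def
proof (intro conjI allI)
 have "reg x0 \<rho> y0 \<subseteq> {0..x0} \<times> UNIV \<times> cball y0 \<rho>" by (auto simp: reg_def)
 then show "Cinf_on (reg x0 \<rho> y0) f" using K f(1) Cinf_on_subset by blast
 fix l :: "'n pt list"
 let ?K = "{0..x0} \<times> {0::real} \<times> cball y0 \<rho>"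
 have "continuous_on ?K (Dl l f)"
  by (rule continuous_on_subset[OF Cinf_on_continuous[OF Cinf_on_Dl[OF f(1)]]]) (use K in auto)
 then have "bounded (Dl l f ` ?K)"
  by (intro compact_imp_bounded compact_continuous_image compact_Times) auto
 then obtain C where C: "\<And>z. z \<in> ?K \<Longrightarrow> \<bar>Dl l f z\<bar> \<le> C" by (auto simp: bounded_iff)
 have "sinv (Dl l f)" by (induction l) (auto simp: f(2) sinv_dd)
 then have "\<bar>Dl l f (x, s, y)\<bar> \<le> C" if "(x, s, y) \<in> reg x0 \<rho> y0" for x s y
  using C[of "(x, 0, y)"] that spec[OF spec[OF spec[OF \<open>sinv (Dl l f)\<close>[unfolded sinv_def], of x], of s], of y]
  by (simp add: reg_def)
 then show "\<exists>C. \<forall>z\<in>reg x0 \<rho> y0. \<bar>Dl l f z\<bar> \<le> C" by (intro exI[of _ C]) auto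
qed

lemma dd_fst_powr:
 fixes z :: "'n::finite pt"
 assumes "0 < fst z"
 shows "(\<lambda>z. fst z powr p) differentiable (at z)" "dd v (\<lambda>z. fst z powr p) z = p * fst z powr (p - 1) * fst v"
proof -
 have "((\<lambda>z. fst z powr p) has_derivative (\<lambda>v. p * fst z powr (p - 1) * fst v)) (at z)"
  using assms by (auto intro!: derivative_eq_intros simp: powr_diff field_simps)
 then show "(\<lambda>z. fst z powr p) differentiable (at z)" "dd v (\<lambda>z. fst z powr p) z = p * fst z powr (p - 1) * fst v"
  by (auto intro: differentiableI dd_eqI)
qed

text \<open>From the variables \<open>(x, s, y)\<close>, \<open>s = t + ln x\<close>, back to \<open>(x, t, y)\<close>.\<close>

definition kap :: "'n::finite pt \<Rightarrow> 'n pt" where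
 "kap z = (fst z, fst (snd z) - ln (fst z), snd (snd z))"

lemma kap_reg: "z \<in> reg x0 \<rho> y0 \<Longrightarrow> kap z \<in> reg x0 \<rho> y0"
 by (auto simp: kap_def reg_def)

lemma kap_has_derivative:
 assumes "0 < fst z"
 shows "(kap has_derivative (\<lambda>v. (fst v, fst (snd v) - fst v / fst z, snd (snd v)))) (at z)"
proof -
 have "((\<lambda>z. ln (fst z)) has_derivative (\<lambda>v. fst v / fst z)) (at z)"
  using assms by (auto intro!: derivative_eq_intros simp: divide_inverse)
 then show ?thesis
  unfolding kap_def[abs_def] by (intro has_derivative_Pair has_derivative_diff)
   (auto intro!: derivative_eq_intros)
qed

lemma kap_dd:
 assumes z: "0 < fst z" and U: "U differentiable (at (kap z))"
 shows "(\<lambda>z. U (kap z)) differentiable (at z)"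
  and "dd eX (\<lambda>z. U (kap z)) z = dd eX U (kap z) - dd eS U (kap z) / fst z"
  and "dd eS (\<lambda>z. U (kap z)) z = dd eS U (kap z)"
  and "dd (eH i) (\<lambda>z. U (kap z)) z = dd (eH i) U (kap z)"
proof -
 note d = has_derivative_compose[OF kap_has_derivative[OF z] has_derivative_dd[OF U]]
 then show "(\<lambda>z. U (kap z)) differentiable (at z)" by (rule differentiableI)
 note e = dd_eqI[OF d]
 have "(1, - 1 / fst z, 0) = eX - (1 / fst z) *\<^sub>R (eS :: 'a pt)" by (simp add: eX_def eS_def)
 then have "dd (1, - 1 / fst z, 0) U (kap z) = dd eX U (kap z) - dd eS U (kap z) / fst z"
  using linear_diff[OF linear_dd[OF U]] linear_scale[OF linear_dd[OF U]] by simp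
 then show "dd eX (\<lambda>z. U (kap z)) z = dd eX U (kap z) - dd eS U (kap z) / fst z"
  unfolding e by (simp add: eX_def)
 show "dd eS (\<lambda>z. U (kap z)) z = dd eS U (kap z)" "dd (eH i) (\<lambda>z. U (kap z)) z = dd (eH i) U (kap z)"
  unfolding e by (simp_all add: eS_def eH_def)
qed

lemma Ck_on_kap:
 fixes \<Omega> :: "'n::finite pt set"
 shows "open \<Omega> \<Longrightarrow> \<Omega> \<subseteq> {z. 0 < fst z} \<Longrightarrow> Ck_on k \<Omega> kap"
proof -
 assume \<Omega>: "open \<Omega>" "\<Omega> \<subseteq> {z. 0 < fst z}"
 have "Cinf_on \<Omega> (\<lambda>z. ln (fst z))"
  by (rule Cinf_on_compose_real(2)[OF \<Omega>(1) Cinf_on_linear[OF \<Omega>(1) bounded_linear_fst]]) (use \<Omega> in auto)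
 then have "Cinf_on \<Omega> (\<lambda>z. z + ln (fst z) *\<^sub>R (0, - 1, 0))"
  by (intro Cinf_on_add \<Omega> Cinf_on_bounded_linear[OF \<Omega>(1) bounded_linear_scaleR_left])
    (simp add: Cinf_on_def)
 moreover have "(kap :: 'n pt \<Rightarrow> 'n pt) = (\<lambda>z. z + ln (fst z) *\<^sub>R (0, - 1, 0))" by (auto simp: kap_def fun_eq_iff)
 ultimately have "Cinf_on \<Omega> kap" by (simp only:)
 then show ?thesis unfolding Cinf_on_def by (rule spec)
qed

lemma Ck_on_comp_kap:
 fixes U :: "'n::finite fn"
 shows "Ck_on k (reg x0 \<rho> y0) U \<Longrightarrow> Ck_on k (reg x0 \<rho> y0) (\<lambda>z. U (kap z))"
 by (rule Ck_on_compose[where f=kap, OF open_reg Ck_on_kap[OF open_reg]]) (auto simp: reg_def kap_def)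

lemma Yd_kap:
 assumes "0 < fst z" "U differentiable (at (kap z))"
 shows "Yd (\<lambda>z. U (kap z)) z = fst z * dd eX U (kap z) + dd eS U (kap z)"
 unfolding Yd_def kap_dd[OF assms] using assms(1) by (simp add: field_simps)

text \<open>The product of the null fields d/dx - (1/x) d/dt and x d/dx + d/dt has no cross term,
  since the two mixed derivatives cancel.\<close>

lemma dd_Yd_kap:
 assumes U: "Ck_on 2 (reg x0 \<rho> y0) U" and z: "z \<in> reg x0 \<rho> y0"
 shows "dd eX (Yd (\<lambda>z. U (kap z))) z = fst z * dd eX (dd eX U) (kap z) + dd eX U (kap z) - dd eS (dd eS U) (kap z) / fst z"
  and "Yd (\<lambda>z. U (kap z)) differentiable (at z)"
proof -
 let ?\<Omega> = "reg x0 \<rho> y0"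
 have U1: "U differentiable (at z)" if "z \<in> ?\<Omega>" for z using U that by (simp add: numeral_2_eq_2 Ck_on_Suc_iff)
 have "Ck_on 1 ?\<Omega> (dd v U)" for v using U by (simp add: numeral_2_eq_2 Ck_on_Suc_iff del: split_paired_All)
 then have U2: "dd v U differentiable (at z)" if "z \<in> ?\<Omega>" for z v using that by (simp add: Ck_on_Suc_iff[of 0, simplified] del: split_paired_All)
 have pos: "0 < fst z" if "z \<in> ?\<Omega>" for z using that by (auto simp: reg_def)
 note kz = kap_reg[OF z]
 note k = kap_dd[OF pos[OF z] U2[OF kz]]
 have x: "fst differentiable (at z)" by (rule bounded_linear_imp_differentiable[OF bounded_linear_fst])
 have eq: "Yd (\<lambda>z. U (kap z)) z = fst z * dd eX U (kap z) + dd eS U (kap z)" if "z \<in> ?\<Omega>" for z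
  using Yd_kap[OF pos U1[OF kap_reg]] that by blast
 have d: "(\<lambda>z. fst z * dd eX U (kap z) + dd eS U (kap z)) differentiable (at z)"
  by (intro differentiable_add differentiable_mult x k(1))
 show "Yd (\<lambda>z. U (kap z)) differentiable (at z)"
  by (rule differentiable_cong_open[OF open_reg _ z d]) (simp add: eq)
 have "dd eX (Yd (\<lambda>z. U (kap z))) z = dd eX (\<lambda>z. fst z * dd eX U (kap z) + dd eS U (kap z)) z"
  by (rule dd_cong_open[OF open_reg _ z]) (rule eq)
 also have "\<dots> = dd eX (\<lambda>z. fst z * dd eX U (kap z)) z + dd eX (\<lambda>z. dd eS U (kap z)) z"
  by (intro dd_add differentiable_mult x k(1))
 also have "dd eX (\<lambda>z. fst z * dd eX U (kap z)) z = dd eX fst z * dd eX U (kap z) + fst z * dd eX (\<lambda>z. dd eX U (kap z)) z"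
  by (intro dd_mult x k(1))
 also have "dd eX fst z = 1" by (simp add: dd_linear[OF bounded_linear_fst] eX_def)
 also note k(2)
 also note k(2)
 also have "dd eS (dd eX U) (kap z) = dd eX (dd eS U) (kap z)" by (rule dd_commute[OF open_reg kz U])
 finally show "dd eX (Yd (\<lambda>z. U (kap z))) z = fst z * dd eX (dd eX U) (kap z) + dd eX U (kap z) - dd eS (dd eS U) (kap z) / fst z"
  using pos[OF z] by (simp add: right_diff_distrib)
qed

text \<open>\<open>d\<close> stands for \<open>(det h)\<^sup>1\<^sup>/\<^sup>4\<close>, \<open>a\<close> for the inverse of \<open>h\<close> in boundary coordinates, and \<open>pde\<close> for \<open>-\<Delta> + n\<^sup>2/4\<close>
 in the variables \<open>(x, y)\<close>.\<close>

locale model_wave =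
 fixes x1 \<rho> \<theta> n :: real and y0 :: "real ^ 'n::finite" and \<Omega>' :: "'n pt set"
  and a :: "'n \<Rightarrow> 'n \<Rightarrow> 'n fn" and e :: "'n \<Rightarrow> 'n fn" and d :: "'n fn"
 assumes x1: "0 < x1" "x1 \<le> 1" and \<rho>: "0 < \<rho>" and \<theta>: "0 < \<theta>"
  and \<Omega>': "open \<Omega>'" "{0..x1} \<times> UNIV \<times> cball y0 \<rho> \<subseteq> \<Omega>'"
  and a: "\<And>i j. Cinf_on \<Omega>' (a i j)" "\<And>i j. sinv (a i j)"
  and e: "\<And>i. Cinf_on \<Omega>' (e i)" "\<And>i. sinv (e i)"
  and d: "Cinf_on \<Omega>' d" "sinv d" "\<And>z. z \<in> \<Omega>' \<Longrightarrow> 0 < d z"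
  and sym: "\<And>i j z. z \<in> reg x1 \<rho> y0 \<Longrightarrow> a i j z = a j i z"
  and ell: "\<And>z \<xi>. z \<in> reg x1 \<rho> y0 \<Longrightarrow> \<theta> * sqn \<xi> \<le> qform a z \<xi>"
begin

abbreviation \<Omega> :: "'n pt set" where "\<Omega> \<equiv> reg x1 \<rho> y0"

lemma sub: "\<Omega> \<subseteq> \<Omega>'" using \<Omega>'(2) by (auto simp: reg_def)

lemma pos: "z \<in> \<Omega> \<Longrightarrow> 0 < fst z" by (auto simp: reg_def)

text \<open>The first-order coefficients of the equation for x^(-n/2) d U; \<open>bb\<close> is the
  zero-order one. The terms in 1/x have cancelled, so both are smooth up to x = 0.\<close>

definition cc :: "'n \<Rightarrow> 'n fn" where
 "cc j z = e j z - 2 * (inverse (d z) * (\<Sum>!i. a i j z * dd (eH i) d z))"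

definition bb :: "'n fn" where
 "bb z = - (inverse (d z) * ((1 - n) * dd eX d z + fst z * dd eX (dd eX d) z))
   - fst z * (inverse (d z) * ((\<Sum>!i j. a i j z * dd (eH i) (dd (eH j) d) z) + (\<Sum>!j. e j z * dd (eH j) d z)
    - 2 * (inverse (d z) * (\<Sum>!i j. a i j z * (dd (eH i) d z * dd (eH j) d z)))))"

definition pde :: "'n fn \<Rightarrow> 'n fn" where
 "pde U z = n\<^sup>2 / 4 * U z + (fst z)\<^sup>2 * dd eX (dd eX U) z + (1 - n) * fst z * dd eX U z
   + 2 * (fst z)\<^sup>2 * (dd eX d z * inverse (d z)) * dd eX U z
   + (fst z)\<^sup>2 * ((\<Sum>!i j. a i j z * dd (eH i) (dd (eH j) U) z) + (\<Sum>!j. e j z * dd (eH j) U z))"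

lemma Cinf_id: "Cinf_on \<Omega>' (\<lambda>z. inverse (d z))"
 by (rule Cinf_on_compose_real(3)[OF \<Omega>'(1) d(1) d(3)])

lemma sinvs: "f (x, s, y) = f (x, 0, y)" if "sinv f" using that by (simp add: sinv_def)

lemma sinv_eq:
 assumes "sinv f" "fst z = fst z'" "snd (snd z) = snd (snd z')"
 shows "f z = f z'"
proof -
 obtain x s y s' where z: "z = (x, s, y)" "z' = (x, s', y)" using assms(2,3) by (cases z, cases z') auto
 show ?thesis unfolding z using sinvs[OF assms(1), of x s y] sinvs[OF assms(1), of x s' y] by simp
qed

lemma Cinf_cc: "Cinf_on \<Omega>' (cc j)" and Cinf_bb: "Cinf_on \<Omega>' bb"
 unfolding cc_def[abs_def] bb_def[abs_def]
 by (intro Cinf_on_diff Cinf_on_add Cinf_on_minus Cinf_on_cmult Cinf_on_mult Cinf_on_sum Cinf_on_dd Cinf_id a e d \<Omega>'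
   Cinf_on_linear[OF \<Omega>'(1) bounded_linear_fst])+

lemma sinv_cc: "sinv (cc j)"
 unfolding sinv_def cc_def
 by (intro allI arg_cong2[where f="(-)"] arg_cong2[where f="(*)"] arg_cong[where f=inverse] sum.cong refl sinvs a e d sinv_dd)

lemma sinv_bb: "sinv bb"
 unfolding sinv_def bb_def fst_conv
 by (intro allI arg_cong2[where f="(-)"] arg_cong2[where f="(+)"] arg_cong2[where f="(*)"] arg_cong[where f=inverse] arg_cong[where f=uminus]
    sum.cong refl sinvs a e d sinv_dd)

text \<open>Stated for all smaller regions around the same point, because finite speed of
  propagation forces a second, smaller one.\<close>

lemma wave_eq: "0 < x0 \<Longrightarrow> x0 \<le> x1 \<Longrightarrow> 0 < r \<Longrightarrow> r \<le> \<rho> \<Longrightarrow> wave_eq x0 r \<theta> y0 a cc bb"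
proof
 assume x0: "0 < x0" "x0 \<le> x1" and r: "0 < r" "r \<le> \<rho>"
 show "0 < x0" "x0 \<le> 1" "0 < r" "0 < \<theta>" using x0 x1 r \<theta> by auto
 have "{0..x0} \<times> UNIV \<times> cball y0 r \<subseteq> {0..x1} \<times> UNIV \<times> cball y0 \<rho>" using x0 r by auto
 then have K: "{0..x0} \<times> UNIV \<times> cball y0 r \<subseteq> \<Omega>'" using \<Omega>'(2) by (rule order_trans)
 have s: "reg x0 r y0 \<subseteq> \<Omega>" using x0 r by (auto simp: reg_def)
 show "bsmooth (reg x0 r y0) (a i j)" "bsmooth (reg x0 r y0) (cc i)" "bsmooth (reg x0 r y0) bb" for i j
  by (rule bsmooth_sinv[OF \<Omega>'(1) K]; fact a Cinf_cc Cinf_bb sinv_cc sinv_bb)+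
 show "a i j z = a j i z" if "z \<in> reg x0 r y0" for i j z using sym that s by blast
 show "\<theta> * sqn \<xi> \<le> qform a z \<xi>" if "z \<in> reg x0 r y0" for z \<xi>
  using ell that s by blast
qed

definition ww :: "'n fn \<Rightarrow> 'n fn" where
 "ww U z = fst z powr (- n / 2) * d z * U (kap z)"

context
 fixes U :: "'n fn"
 assumes U: "Ck_on 2 \<Omega> U"
begin

lemma U1: "z \<in> \<Omega> \<Longrightarrow> U differentiable (at z)"
 using U by (simp add: numeral_2_eq_2 Ck_on_Suc_iff del: split_paired_All)

lemma U2: "z \<in> \<Omega> \<Longrightarrow> dd v U differentiable (at z)"
proof -
 have "Ck_on 1 \<Omega> (dd v U)" using U by (simp add: numeral_2_eq_2 Ck_on_Suc_iff del: split_paired_All)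
 then show "z \<in> \<Omega> \<Longrightarrow> dd v U differentiable (at z)" by (simp add: Ck_on_Suc_iff[of 0, simplified] del: split_paired_All)
qed

lemma dd_cross: "z \<in> \<Omega> \<Longrightarrow> dd v (\<lambda>z. fst z powr p * f z) z = fst z powr p * dd v f z + (p * fst z powr (p - 1) * fst v) * f z"
 if "f differentiable (at z)" for f :: "'n fn"
 using dd_mult[OF dd_fst_powr(1)[OF pos] that] dd_fst_powr(2)[OF pos] by simp

lemma d1: "z \<in> \<Omega> \<Longrightarrow> d differentiable (at z)"
 and d2: "z \<in> \<Omega> \<Longrightarrow> dd v d differentiable (at z)"
 using sub Cinf_on_differentiable[OF d(1)] Cinf_on_differentiable[OF Cinf_on_dd[OF d(1)]] by blast+

text \<open>The factor \<open>x\<^sup>-\<^sup>n\<^sup>/\<^sup>2 d\<close> cancels the first-order terms in \<open>x\<close> and the singular term \<open>n\<^sup>2/4\<close>.\<close>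

lemma ww_solves:
 assumes pde: "\<And>z. z \<in> \<Omega> \<Longrightarrow> dd eS (dd eS U) z = pde U z"
  and z: "z \<in> \<Omega>"
 shows "wave_op a (ww U) z + fst z * (\<Sum>!i. cc i z * dd (eH i) (ww U) z) + bb z * ww U z = 0"
proof -
 define p where "p = - n / 2"
 define P where "P = (\<lambda>z::'n pt. fst z powr p)"
 define g where "g = (\<lambda>z. U (kap z))"
 define m where "m = (\<lambda>z. P z * d z)"
 define m' where "m' = (\<lambda>z. P z * dd eX d z + p * (fst z powr (p - 1) * d z))"
 define m'' where "m'' = P z * dd eX (dd eX d) z + 2 * p * (fst z powr (p - 1) * dd eX d z) + p * (p - 1) * (fst z powr (p - 2) * d z)"
 have ww: "ww U = (\<lambda>z. m z * g z)" by (auto simp: ww_def m_def P_def p_def g_def)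
 have x: "fst differentiable (at z)" for z :: "'n pt" by (rule bounded_linear_imp_differentiable[OF bounded_linear_fst])
 have P: "P differentiable (at z)" if "z \<in> \<Omega>" for z using dd_fst_powr(1)[OF pos[OF that]] by (simp add: P_def)
 have m1: "m differentiable (at z)" if "z \<in> \<Omega>" for z unfolding m_def by (intro differentiable_mult P d1 that)
 have m'1: "m' differentiable (at z)" if "z \<in> \<Omega>" for z
  unfolding m'_def by (intro differentiable_add differentiable_mult differentiable_const P d1 d2 dd_fst_powr pos that)
 have mX: "dd eX m z = m' z" if "z \<in> \<Omega>" for z
  unfolding m_def P_def m'_def dd_cross[OF d1[OF that] that] by (simp add: eX_def)
 have mT: "dd v m z = P z * dd v d z" if "z \<in> \<Omega>" "fst v = 0" for z v
  unfolding m_def P_def dd_cross[OF d1[OF that(1)] that(1)] using that by simp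
 have mXX: "dd eX m' z = m'' "
 proof -
  have "dd eX m' z = dd eX (\<lambda>z. P z * dd eX d z) z + dd eX (\<lambda>z. p * (fst z powr (p - 1) * d z)) z"
   unfolding m'_def by (intro dd_add differentiable_mult differentiable_const P d1 d2 dd_fst_powr pos z)
  also have "dd eX (\<lambda>z. p * (fst z powr (p - 1) * d z)) z = p * dd eX (\<lambda>z. fst z powr (p - 1) * d z) z"
   by (intro dd_bounded_linear[OF bounded_linear_mult_right] differentiable_mult dd_fst_powr pos d1 z)
  finally show ?thesis
   unfolding P_def m''_def dd_cross[OF d1[OF z] z] dd_cross[OF d2[OF z] z] by (simp add: eX_def algebra_simps)
 qed
 note k1 = kap_dd[OF pos U1[OF kap_reg], folded g_def]
 have g1: "g differentiable (at z)" if "z \<in> \<Omega>" for z using k1(1)[OF that that] .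
 have YY: "dd eX (Yd g) z = fst z * dd eX (dd eX U) (kap z) + dd eX U (kap z) - dd eS (dd eS U) (kap z) / fst z"
  "Yd g differentiable (at z)"
  using dd_Yd_kap[OF U z] by (simp_all add: g_def)
 have Yg: "Yd g z = fst z * dd eX U (kap z) + dd eS U (kap z)"
  unfolding g_def by (rule Yd_kap[OF pos[OF z] U1[OF kap_reg[OF z]]])
 have gX: "dd eX g z = dd eX U (kap z) - dd eS U (kap z) / fst z" by (rule k1(2)[OF z z])
 \<comment> \<open>d does not depend on s, so \<open>Yd\<close> of the factor m is x m'.\<close>
 have Yw: "Yd (ww U) z = fst z * (m' z * g z) + m z * Yd g z" if "z \<in> \<Omega>" for z
 proof -
  have "fst (eS :: 'n pt) = 0" "sinv d" using d by (simp_all add: eS_def)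
  moreover have "dd eS d z = 0"
  proof -
   have "((\<lambda>\<sigma>. d (z + \<sigma> *\<^sub>R eS)) has_real_derivative 0) (at 0)"
   proof -
    have "d (z + \<sigma> *\<^sub>R eS) = d z" for \<sigma> by (rule sinv_eq[OF d(2)]) (simp_all add: eS_def)
    then show ?thesis by simp
   qed
   then show ?thesis by (rule dd_eq_line[OF d1[OF that]])
  qed
  ultimately show ?thesis
   unfolding ww Yd_def dd_mult[OF m1[OF that] g1[OF that]] mX[OF that] mT[OF that \<open>fst eS = 0\<close>]
   by (simp add: algebra_simps)
 qed
 have "dd eX (Yd (ww U)) z = dd eX (\<lambda>z. fst z * (m' z * g z) + m z * Yd g z) z"
  by (rule dd_cong_open[OF open_reg _ z]) (rule Yw)
 also have "\<dots> = dd eX (\<lambda>z. fst z * (m' z * g z)) z + dd eX (\<lambda>z. m z * Yd g z) z"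
  by (intro dd_add differentiable_mult x m1 m'1 g1 YY z)
 also have "dd eX (\<lambda>z. fst z * (m' z * g z)) z = m' z * g z + fst z * dd eX (\<lambda>z. m' z * g z) z"
  using dd_mult[OF x differentiable_mult[OF m'1[OF z] g1[OF z]], of eX] by (simp add: dd_linear[OF bounded_linear_fst] eX_def)
 also have "dd eX (\<lambda>z. m' z * g z) z = m'' * g z + m' z * dd eX g z"
  unfolding mXX[symmetric] by (rule dd_mult[OF m'1[OF z] g1[OF z]])
 also have "dd eX (\<lambda>z. m z * Yd g z) z = m' z * Yd g z + m z * dd eX (Yd g) z"
  unfolding mX[OF z, symmetric] by (rule dd_mult[OF m1[OF z] YY(2)])
 finally have W0: "dd eX (Yd (ww U)) z = m' z * g z + fst z * (m'' * g z + m' z * dd eX g z) + (m' z * Yd g z + m z * dd eX (Yd g) z)" .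
 have W1: "dd eX (Yd (ww U)) z = (m' z + fst z * m'') * g z + 2 * fst z * m' z * dd eX U (kap z)
   + m z * (fst z * dd eX (dd eX U) (kap z) + dd eX U (kap z) - dd eS (dd eS U) (kap z) / fst z)"
 proof -
  define T where "T = dd eS U (kap z) / fst z"
  have T: "dd eS U (kap z) = fst z * T" using pos[OF z] by (simp add: T_def)
  show ?thesis
   unfolding W0 YY(1) Yg gX T_def[symmetric] unfolding T by (simp add: algebra_simps)
 qed
 have gj: "dd (eH j) g z = dd (eH j) U (kap z)" if "z \<in> \<Omega>" for z j by (rule k1(4)[OF that that])
 have gjd: "dd (eH j) g differentiable (at z)" for j
  by (rule differentiable_cong_open[where f="\<lambda>z. dd (eH j) U (kap z)", OF open_reg _ z])
    (simp add: gj, rule kap_dd(1)[OF pos[OF z] U2[OF kap_reg[OF z]]])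
 have gij: "dd (eH i) (dd (eH j) g) z = dd (eH i) (dd (eH j) U) (kap z)" for i j
 proof -
  have "dd (eH i) (dd (eH j) g) z = dd (eH i) (\<lambda>z. dd (eH j) U (kap z)) z"
   by (rule dd_cong_open[OF open_reg _ z]) (rule gj)
  then show ?thesis unfolding kap_dd(4)[OF pos[OF z] U2[OF kap_reg[OF z]]] .
 qed
 have eH0: "fst (eH i :: 'n pt) = 0" for i by (simp add: eH_def)
 have wj: "dd (eH j) (ww U) z = P z * (dd (eH j) d z * g z) + m z * dd (eH j) g z" if "z \<in> \<Omega>" for z j
  unfolding ww dd_mult[OF m1[OF that] g1[OF that]] mT[OF that eH0] by simp
 have wij: "dd (eH i) (dd (eH j) (ww U)) z = P z * (dd (eH i) (dd (eH j) d) z * g z) + P z * (dd (eH j) d z * dd (eH i) g z)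
   + (P z * (dd (eH i) d z * dd (eH j) g z) + m z * dd (eH i) (dd (eH j) g) z)" for i j
 proof -
  have "dd (eH i) (dd (eH j) (ww U)) z = dd (eH i) (\<lambda>z. P z * (dd (eH j) d z * g z) + m z * dd (eH j) g z) z"
   by (rule dd_cong_open[OF open_reg wj z])
  also have "\<dots> = dd (eH i) (\<lambda>z. P z * (dd (eH j) d z * g z)) z + dd (eH i) (\<lambda>z. m z * dd (eH j) g z) z"
   by (intro dd_add differentiable_mult P m1 g1 gjd d2 z)
  also have "dd (eH i) (\<lambda>z. m z * dd (eH j) g z) z = P z * dd (eH i) d z * dd (eH j) g z + m z * dd (eH i) (dd (eH j) g) z"
   unfolding dd_mult[OF m1[OF z] gjd] mT[OF z eH0] ..
  also have "dd (eH i) (\<lambda>z. P z * (dd (eH j) d z * g z)) z = P z * dd (eH i) (\<lambda>z. dd (eH j) d z * g z) z"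
   unfolding P_def dd_cross[OF differentiable_mult[OF d2[OF z] g1[OF z]] z] eH0 by simp
  also have "dd (eH i) (\<lambda>z. dd (eH j) d z * g z) z = dd (eH i) (dd (eH j) d) z * g z + dd (eH j) d z * dd (eH i) g z"
   by (rule dd_mult[OF d2[OF z] g1[OF z]])
  finally show ?thesis by (simp add: algebra_simps)
 qed
 define Sx where "Sx = (\<Sum>!i j. a i j z * (dd (eH i) d z * dd (eH j) g z))"
 define SA where "SA = (\<Sum>!i j. a i j z * dd (eH i) (dd (eH j) U) (kap z))"
 define SE where "SE = (\<Sum>!j. e j z * dd (eH j) U (kap z))"
 define Sd where "Sd = (\<Sum>!i j. a i j z * dd (eH i) (dd (eH j) d) z)"
 define Se where "Se = (\<Sum>!j. e j z * dd (eH j) d z)"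
 define Sdd where "Sdd = (\<Sum>!i j. a i j z * (dd (eH i) d z * dd (eH j) d z))"
 have Sx': "(\<Sum>!i j. a i j z * (dd (eH j) d z * dd (eH i) g z)) = Sx"
  unfolding Sx_def by (subst sum.swap) (simp add: sym[OF z])
 have A: "(\<Sum>!i j. a i j z * dd (eH i) (dd (eH j) (ww U)) z) = P z * (Sd * g z) + 2 * (P z * Sx) + m z * SA"
 proof -
  have "(\<Sum>!i j. a i j z * dd (eH i) (dd (eH j) (ww U)) z)
   = (\<Sum>!i j. P z * g z * (a i j z * dd (eH i) (dd (eH j) d) z) + P z * (a i j z * (dd (eH j) d z * dd (eH i) g z))
    + P z * (a i j z * (dd (eH i) d z * dd (eH j) g z)) + m z * (a i j z * dd (eH i) (dd (eH j) U) (kap z)))"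
   unfolding wij gij by (intro sum.cong refl) (simp add: algebra_simps)
  also have "\<dots> = P z * g z * Sd + P z * Sx + P z * Sx + m z * SA"
   unfolding sum.distrib sum_distrib_left[symmetric] Sx' Sd_def[symmetric] Sx_def[symmetric] SA_def[symmetric] ..
  finally show ?thesis by simp
 qed
 have C: "(\<Sum>!j. cc j z * dd (eH j) (ww U) z) = P z * (Se * g z) + m z * SE - 2 * (inverse (d z) * (P z * (g z * Sdd) + m z * Sx))"
 proof -
  have "(\<Sum>!j. cc j z * dd (eH j) (ww U) z) = (\<Sum>!j. P z * g z * (e j z * dd (eH j) d z) + m z * (e j z * dd (eH j) U (kap z))
   - (2 * inverse (d z) * P z * g z * (\<Sum>!i. a i j z * (dd (eH i) d z * dd (eH j) d z))
   + 2 * inverse (d z) * m z * (\<Sum>!i. a i j z * (dd (eH i) d z * dd (eH j) g z))))"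
   unfolding wj[OF z] gj[OF z] cc_def mult.assoc[symmetric] sum_distrib_right[symmetric] by (intro sum.cong refl) (simp add: algebra_simps)
  also have "\<dots> = P z * g z * Se + m z * SE - (2 * inverse (d z) * P z * g z * (\<Sum>!j i. a i j z * (dd (eH i) d z * dd (eH j) d z))
   + 2 * inverse (d z) * m z * (\<Sum>!j i. a i j z * (dd (eH i) d z * dd (eH j) g z)))"
   unfolding sum_subtractf sum.distrib sum_distrib_left[symmetric] Se_def[symmetric] SE_def[symmetric] ..
  also have "(\<Sum>!j i. a i j z * (dd (eH i) d z * dd (eH j) d z)) = Sdd" unfolding Sdd_def by (rule sum.swap)
  also have "(\<Sum>!j i. a i j z * (dd (eH i) d z * dd (eH j) g z)) = Sx" unfolding Sx_def by (rule sum.swap)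
  finally show ?thesis by (simp add: algebra_simps)
 qed
 \<comment> \<open>All powers of x in the factor and its derivatives are polynomials in x times R,
   which makes the identity below a polynomial one.\<close>
 define R where "R = fst z powr (p - 2)"
 define x where "x = fst z"
 have xp: "0 < x" using pos[OF z] by (simp add: x_def)
 have PR: "P z = x * x * R" "fst z powr (p - 1) = x * R"
  using xp by (simp_all add: P_def R_def x_def powr_diff power2_eq_square)
 have ks: "f (kap z) = f z" if "sinv f" for f :: "'n fn"
  by (rule sinv_eq[OF that]) (simp_all add: kap_def)
 have Utt: "dd eS (dd eS U) (kap z) = n\<^sup>2 / 4 * g z + x\<^sup>2 * dd eX (dd eX U) (kap z) + (1 - n) * x * dd eX U (kap z)
   + 2 * x\<^sup>2 * (dd eX d z * inverse (d z)) * dd eX U (kap z) + x\<^sup>2 * (SA + SE)"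
  unfolding pde[OF kap_reg[OF z]] pde_def ks[OF d(2)] ks[OF sinv_dd[OF d(2)]] ks[OF a(2)] ks[OF e(2)] SA_def SE_def
  by (simp add: kap_def g_def x_def)
 have id: "inverse (d z) * d z = 1" using d(3)[of z] z sub by auto
 \<comment> \<open>The cancellation as a polynomial identity, with \<psi> for 1/d and with n = -2 p,
   so that n^2 / 4 is p^2.\<close>
 have key: "(m1 + x * m2) * G + 2 * x * m1 * Ux + x * x * R * D * (x * Uxx + Ux) - x * R * D * Utt
   + x * (x * x * R * (Sd * G) + 2 * (x * x * R * Sx) + x * x * R * D * SA)
   + x * (x * x * R * (Se * G) + x * x * R * D * SE - 2 * (\<psi> * (x * x * R * (G * Sdd) + x * x * R * D * Sx)))
   + (- (\<psi> * ((1 - n) * dx + x * dxx)) - x * (\<psi> * (Sd + Se - 2 * (\<psi> * Sdd)))) * (x * x * R * D * G) = 0"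
  if "\<psi> * D = 1" "n = - 2 * p" "m1 = x * x * R * dx + p * (x * R * D)" "m2 = x * x * R * dxx + 2 * p * (x * R * dx) + p * (p - 1) * (R * D)"
   "Utt = p * p * G + x * x * Uxx + (1 - n) * x * Ux + 2 * (x * x) * (dx * \<psi>) * Ux + x * x * (SA + SE)"
  for m1 m2 G Ux Uxx Utt D \<psi> dx dxx Sd Se Sdd Sx SA SE n :: real
 proof -
  show ?thesis unfolding that(2-5) using that(1) by algebra
 qed
 have np: "n = - 2 * p" by (simp add: p_def)
 have mz: "m z = x * x * R * d z" and m'z: "m' z = x * x * R * dd eX d z + p * (x * R * d z)"
  and m''z: "m'' = x * x * R * dd eX (dd eX d) z + 2 * p * (x * R * dd eX d z) + p * (p - 1) * (R * d z)"
  unfolding m_def m'_def m''_def PR R_def[symmetric] by simp_all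
 have n2: "n\<^sup>2 / 4 = p * p" by (simp add: p_def power2_eq_square)
 note K = key[OF id np m'z m''z Utt[unfolded n2 power2_eq_square[of x]]]
 have W2: "m z * (x * dd eX (dd eX U) (kap z) + dd eX U (kap z) - dd eS (dd eS U) (kap z) / x)
  = x * x * R * d z * (x * dd eX (dd eX U) (kap z) + dd eX U (kap z)) - x * R * d z * dd eS (dd eS U) (kap z)"
  using xp by (simp add: mz right_diff_distrib)
 have w0: "ww U z = x * x * R * d z * g z" using mz by (simp add: ww)
 show ?thesis
  unfolding wave_op_def W1 A C bb_def Sd_def[symmetric] Se_def[symmetric] Sdd_def[symmetric] w0 x_def[symmetric] W2 unfolding PR mz
  using K[of Sd Sx Se Sdd] by (simp only: algebra_simps)
qed

end

end

section \<open>Extension of the solution by zero to negative times\<close>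

lemma limit_zero:
 fixes H :: "'a::real_normed_vector \<Rightarrow> real"
 assumes S: "open S" "p \<in> S" and H: "continuous_on S H" and z: "\<And>\<tau>. 0 < \<tau> \<Longrightarrow> p + \<tau> *\<^sub>R v \<in> S \<Longrightarrow> H (p + \<tau> *\<^sub>R v) = 0"
 shows "H p = 0"
proof -
 have l: "((\<lambda>\<tau>. p + \<tau> *\<^sub>R v) \<longlongrightarrow> p) (at_right 0)" by (auto intro!: tendsto_eq_intros)
 have "isCont H p" using H S by (simp add: continuous_on_eq_continuous_at)
 then have 1: "((\<lambda>\<tau>. H (p + \<tau> *\<^sub>R v)) \<longlongrightarrow> H p) (at_right 0)" using l by (rule isCont_tendsto_compose)
 have "\<forall>\<^sub>F \<tau> in at_right 0. p + \<tau> *\<^sub>R v \<in> S" using l S by (rule topological_tendstoD)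
 moreover have "\<forall>\<^sub>F \<tau> in at_right (0::real). 0 < \<tau>" by (rule eventually_at_right_less)
 ultimately have "\<forall>\<^sub>F \<tau> in at_right 0. 0 = H (p + \<tau> *\<^sub>R v)" by eventually_elim (use z in simp)
 then have "((\<lambda>\<tau>. H (p + \<tau> *\<^sub>R v)) \<longlongrightarrow> 0) (at_right 0)" by (rule Lim_transform_eventually[OF tendsto_const])
 then show ?thesis using 1 tendsto_unique trivial_limit_at_right_real by blast
qed

lemma dd_plane_zero:
 fixes G L :: "'a::real_normed_vector \<Rightarrow> real"
 assumes S: "open S" "p \<in> S" and G: "G differentiable (at p)" and L: "bounded_linear L" "L v = 0"
  and z: "\<And>q. q \<in> S \<Longrightarrow> L q = L p \<Longrightarrow> G q = 0"
 shows "dd v G p = 0"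
proof (rule dd_eq_line[OF G])
 have o: "open {\<sigma>::real. p + \<sigma> *\<^sub>R v \<in> S}"
  using open_vimage[OF S(1), of "\<lambda>\<sigma>. p + \<sigma> *\<^sub>R v"] by (simp add: vimage_def continuous_intros)
 interpret L: bounded_linear L by (rule L)
 have "G (p + \<sigma> *\<^sub>R v) = 0" if "p + \<sigma> *\<^sub>R v \<in> S" for \<sigma>
  by (rule z[OF that]) (simp add: L.add L.scaleR L(2))
 moreover have "((\<lambda>_. 0::real) has_real_derivative 0) (at 0)" by simp
 ultimately show "((\<lambda>\<sigma>. G (p + \<sigma> *\<^sub>R v)) has_real_derivative 0) (at 0)"
  using has_field_derivative_transform_within_open[OF _ o, of "\<lambda>_. 0" 0 0 "\<lambda>\<sigma>. G (p + \<sigma> *\<^sub>R v)"] S by simp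
qed

lemma Cinf_on_Union: "(\<And>S. S \<in> \<S> \<Longrightarrow> open S \<and> Cinf_on S f) \<Longrightarrow> Cinf_on (\<Union>\<S>) f"
 unfolding Cinf_on_def using Ck_on_Union by blast

context model_wave
begin

context
 fixes U :: "'n fn"
 assumes smooth: "smooth_on (\<Omega> \<inter> {z. 0 \<le> fst (snd z)}) U"
  and init: "\<And>z. z \<in> \<Omega> \<Longrightarrow> fst (snd z) = 0 \<Longrightarrow> U z = 0"
  and init': "\<And>z. z \<in> \<Omega> \<Longrightarrow> fst (snd z) = 0 \<Longrightarrow> ((\<lambda>\<tau>. U (z + \<tau> *\<^sub>R eS)) has_real_derivative 0) (at 0 within {0..})"
  and eq: "\<And>z. z \<in> \<Omega> \<Longrightarrow> 0 < fst (snd z) \<Longrightarrow> dd eS (dd eS U) z = pde U z"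
begin

abbreviation (input) tm :: "'n fn" where "tm \<equiv> \<lambda>z. fst (snd z)"

lemma tm: "bounded_linear (\<lambda>z::'n pt. fst (snd z))"
 by (rule bounded_linear_compose[OF bounded_linear_fst bounded_linear_snd])

lemma open_tm: "open {z::'n pt. 0 < fst (snd z)}" "open {z::'n pt. fst (snd z) < 0}"
 by (intro open_Collect_less continuous_intros)+

lemma pde_cong:
 assumes S: "open S" "z \<in> S" and eq: "\<And>z. z \<in> S \<Longrightarrow> F z = G z"
 shows "pde F z = pde G z" "dd v (dd w F) z = dd v (dd w G) z"
proof -
 have 1: "dd v F z = dd v G z" if "z \<in> S" for z v by (rule dd_cong_open[OF S(1) eq that])
 have 2: "dd v (dd w F) z = dd v (dd w G) z" for v w by (rule dd_cong_open[OF S(1) 1 S(2)])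
 show "pde F z = pde G z" "dd v (dd w F) z = dd v (dd w G) z" unfolding pde_def 1[OF S(2)] 2 eq[OF S(2)] by (rule refl)+
qed

lemma pde_zero: "F z = 0 \<Longrightarrow> (\<And>v. dd v F z = 0) \<Longrightarrow> (\<And>v w. fst (snd v) = 0 \<Longrightarrow> dd v (dd w F) z = 0) \<Longrightarrow> pde F z = 0"
 by (simp add: pde_def eX_def eH_def)

lemma continuous_pde:
 assumes "S \<subseteq> \<Omega>" "Ck_on 2 S F"
 shows "continuous_on S (\<lambda>z. pde F z)" "continuous_on S (dd v (dd w F))" "continuous_on S (dd v F)"
proof -
 have 2: "Ck_on (Suc (Suc 0)) S F" using assms(2) by (simp only: numeral_2_eq_2)
 then have c2: "continuous_on S (dd v (dd w F))" for v w
  unfolding Ck_on_Suc_iff Ck_on.simps(1) by (elim conjE) (simp del: split_paired_All)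
 have c1: "continuous_on S (dd v F)" for v
 proof -
  have "Ck_on (Suc 0) S (dd v F)" using 2 unfolding Ck_on_Suc_iff[of "Suc 0"] by (elim conjE allE)
  then show ?thesis by (rule Ck_on_continuous)
 qed
 have c0: "continuous_on S F" using assms(2) by (rule Ck_on_continuous)
 have O: "Cinf_on \<Omega>' f \<Longrightarrow> continuous_on S f" for f :: "'n fn"
  by (rule continuous_on_subset[OF Cinf_on_continuous]) (assumption, use assms(1) sub in auto)
 show "continuous_on S (\<lambda>z. pde F z)"
  unfolding pde_def by (intro continuous_intros c0 c1 c2 O[OF a(1)] O[OF e(1)] O[OF Cinf_on_dd[OF d(1)]] O[OF Cinf_id])
 show "continuous_on S (dd v (dd w F))" "continuous_on S (dd v F)" by (rule c2 c1)+
qed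

text \<open>Derivatives along the plane t = 0 vanish together with the data. The second derivative
  in t comes from the equation, which holds for t > 0 and reaches t = 0 by continuity.\<close>

lemma extension_vanishes:
 assumes S: "open S" "S \<subseteq> \<Omega>" and F: "Cinf_on S F" and FU: "\<And>z. z \<in> S \<Longrightarrow> 0 \<le> fst (snd z) \<Longrightarrow> F z = U z"
  and p: "p \<in> S" "fst (snd p) = 0"
 shows "F p = 0" "dd v F p = 0" "dd v (dd w F) p = 0"
proof -
 note D = Cinf_on_differentiable[OF F] Cinf_on_differentiable[OF Cinf_on_dd[OF F]]
 have F0: "F q = 0" if "q \<in> S" "fst (snd q) = 0" for q
  using FU[of q] init[of q] that S by auto
 have split: "v = (fst v, 0, snd (snd v)) + fst (snd v) *\<^sub>R eS" for v :: "'n pt" by (cases v) (simp add: eS_def)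
 have dsplit: "dd v G q = fst (snd v) * dd eS G q"
  if "q \<in> S" "fst (snd q) = 0" "G differentiable (at q)" "\<And>q. q \<in> S \<Longrightarrow> fst (snd q) = 0 \<Longrightarrow> G q = 0" for G q v
 proof -
  have "dd v G q = dd (fst v, 0, snd (snd v)) G q + fst (snd v) * dd eS G q"
   by (subst split[of v]) (simp only: linear_add[OF linear_dd[OF that(3)]] linear_scale[OF linear_dd[OF that(3)]] real_scaleR_def)
  moreover have "dd (fst v, 0, snd (snd v)) G q = 0"
   by (rule dd_plane_zero[OF S(1) that(1,3) tm]) (use that in simp_all)
  ultimately show ?thesis by simp
 qed
 \<comment> \<open>The initial velocity is prescribed as a one-sided derivative, whereas F is
   differentiable on both sides; derivatives within {0..} at 0 are unique.\<close>
 have FS: "dd eS F q = 0" if q: "q \<in> S" "fst (snd q) = 0" for q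
 proof -
  have "((\<lambda>\<sigma>. F (q + \<sigma> *\<^sub>R eS)) has_real_derivative dd eS F q) (at 0 within {0..})"
   using dd_line0[OF D(1)[OF q(1)]] by (rule has_field_derivative_at_within)
  moreover have "((\<lambda>\<sigma>. F (q + \<sigma> *\<^sub>R eS)) has_real_derivative 0) (at 0 within {0..})"
  proof -
   have o: "open {\<sigma>::real. q + \<sigma> *\<^sub>R eS \<in> S}"
    using open_vimage[OF S(1), of "\<lambda>\<sigma>. q + \<sigma> *\<^sub>R eS"] by (simp add: vimage_def continuous_intros)
   have "0 \<in> {\<sigma>::real. q + \<sigma> *\<^sub>R eS \<in> S}" using q(1) by simp
   from openE[OF o this] obtain e where e0: "0 < e" "ball 0 e \<subseteq> {\<sigma>. q + \<sigma> *\<^sub>R eS \<in> S}" .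
   have e: "0 < e" "\<And>\<sigma>. \<bar>\<sigma>\<bar> < e \<Longrightarrow> q + \<sigma> *\<^sub>R eS \<in> S" using e0 by auto
   show ?thesis
    by (rule has_field_derivative_transform_within[OF init'[of q] e(1)])
      (use q S e FU[of "q + _ *\<^sub>R eS"] in \<open>auto simp: eS_def\<close>)
  qed
  ultimately show ?thesis
   unfolding has_real_derivative_iff_has_vector_derivative
   by (intro vector_derivative_unique_within) (simp_all add: at_within_Ici_at_right)
 qed
 have F1: "dd v F q = 0" if "q \<in> S" "fst (snd q) = 0" for q v
  using dsplit[OF that D(1)[OF that(1)] F0] FS[OF that] by simp
 have tangential: "dd v (dd w F) q = 0" if "fst (snd v) = 0" "q \<in> S" "fst (snd q) = 0" for v w q
  using dsplit[OF that(2,3) D(2)[OF that(2)] F1, of v w] that by simp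
 have F2: "Ck_on 2 S F" using F by (simp add: Cinf_on_def)
 have "dd eS (dd eS F) p - pde F p = 0"
 proof (rule limit_zero[OF S(1) p(1), where v=eS])
  show "continuous_on S (\<lambda>z. dd eS (dd eS F) z - pde F z)"
   by (intro continuous_intros continuous_pde[OF S(2) F2])
  fix \<tau> :: real assume t: "0 < \<tau>" "p + \<tau> *\<^sub>R eS \<in> S"
  let ?T = "S \<inter> {z. 0 < fst (snd z)}"
  have T: "open ?T" "p + \<tau> *\<^sub>R eS \<in> ?T" using S open_tm t p by (auto simp: eS_def intro: open_Int)
  have FU': "F z = U z" if "z \<in> ?T" for z using FU that by auto
  have c: "pde F (p + \<tau> *\<^sub>R eS) = pde U (p + \<tau> *\<^sub>R eS)"
   "dd eS (dd eS F) (p + \<tau> *\<^sub>R eS) = dd eS (dd eS U) (p + \<tau> *\<^sub>R eS)"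
   by (rule pde_cong[OF T FU'], assumption)+
  show "dd eS (dd eS F) (p + \<tau> *\<^sub>R eS) - pde F (p + \<tau> *\<^sub>R eS) = 0"
   unfolding c using eq[of "p + \<tau> *\<^sub>R eS"] T S(2) by auto
 qed
 moreover have "pde F p = 0" by (rule pde_zero[OF F0[OF p] F1[OF p] tangential[OF _ p]])
 ultimately have SS: "dd eS (dd eS F) p = 0" by simp
 show "F p = 0" "dd v F p = 0" by (rule F0[OF p] F1[OF p])+
 have "dd v (dd w F) p = fst (snd v) * dd eS (dd w F) p" by (rule dsplit[OF p D(2)[OF p(1)] F1])
 also have "dd eS (dd w F) p = dd w (dd eS F) p" by (rule Cinf_on_commute[OF S(1) F p(1)])
 also have "dd w (dd eS F) p = fst (snd w) * dd eS (dd eS F) p" by (rule dsplit[OF p D(2)[OF p(1)] F1])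
 finally show "dd v (dd w F) p = 0" using SS by simp
qed

text \<open>The model region contains all s, also s < ln x, where t is negative; extension by zero
  provides values there.\<close>

definition Ue :: "'n fn" where "Ue z = (if 0 \<le> fst (snd z) then U z else 0)"

lemma local_extension:
 assumes "p \<in> \<Omega>" "0 \<le> fst (snd p)"
 obtains S F where "open S" "S \<subseteq> \<Omega>" "p \<in> S" "Cinf_on S F" "\<And>z. z \<in> S \<Longrightarrow> 0 \<le> fst (snd z) \<Longrightarrow> F z = U z"
proof -
 have "p \<in> \<Omega> \<inter> {z. 0 \<le> fst (snd z)}" using assms by simp
 from bspec[OF smooth[unfolded smooth_on_def] this]
 obtain V F where V: "open V" "p \<in> V" "\<forall>k. Ck_on k V F" "\<forall>q\<in>V \<inter> (\<Omega> \<inter> {z. 0 \<le> fst (snd z)}). F q = U q"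
  by (elim exE conjE)
 show ?thesis
 proof (rule that[of "V \<inter> \<Omega>" F])
  show "open (V \<inter> \<Omega>)" using V(1) open_reg by (rule open_Int)
  show "Cinf_on (V \<inter> \<Omega>) F" unfolding Cinf_on_def
   by (intro allI) (rule Ck_on_subset[OF spec[OF V(3)]], simp)
  show "F z = U z" if "z \<in> V \<inter> \<Omega>" "0 \<le> fst (snd z)" for z by (rule bspec[OF V(4)]) (use that in simp)
 qed (use V(2) assms in simp_all)
qed

text \<open>Near a point with t \<ge> 0 a local smooth extension of U is glued with zero along t =
  0, which \<open>extension_vanishes\<close> permits up to second order; for t < 0 there is nothing
  to glue.\<close>

lemma Ck_Ue: "Ck_on 2 \<Omega> Ue"
proof -
 let ?\<S> = "{S. open S \<and> S \<subseteq> \<Omega> \<and> Ck_on 2 S Ue}"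
 have "p \<in> \<Union>?\<S>" if p: "p \<in> \<Omega>" for p
 proof (cases "0 \<le> fst (snd p)")
  case True
  obtain S F where S: "open S" "S \<subseteq> \<Omega>" "p \<in> S" "Cinf_on S F" "\<And>z. z \<in> S \<Longrightarrow> 0 \<le> fst (snd z) \<Longrightarrow> F z = U z"
   by (rule local_extension[OF p True]) (rule that)
  have gl: "Ck_on 2 S (\<lambda>z. if 0 \<le> fst (snd z) then F z else 0)"
  proof (rule Ck_on_glue[OF S(1) tm])
   show "Ck_on 2 S F" using S(4) by (simp add: Cinf_on_def)
   fix l :: "'n pt list" and z assume l: "length l \<le> 2" and z: "z \<in> S" "fst (snd z) = 0"
   note ev = extension_vanishes[OF S(1,2,4,5) z]
   show "Dl l F z = 0"
   proof (cases l)
    case l1: (Cons v l')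
    show ?thesis
    proof (cases l')
     case l2: (Cons w l'')
     then have "l'' = []" using l l1 by simp
     then show ?thesis unfolding l1 l2 by (simp add: ev(3))
    qed (simp add: l1 ev(2))
   qed (simp add: ev(1))
  qed
  have "Ck_on 2 S Ue" by (rule Ck_on_cong[OF S(1) _ gl]) (simp add: S(5) Ue_def)
  then show ?thesis using S(1-3) by (intro UnionI[of S]) simp_all
 next
  case False
  have o: "open (\<Omega> \<inter> {z. fst (snd z) < 0})" using open_reg open_tm(2) by (rule open_Int)
  have "Ck_on 2 (\<Omega> \<inter> {z. fst (snd z) < 0}) Ue"
   by (rule Ck_on_cong[OF o _ Ck_on_const[of _ _ 0]]) (simp add: Ue_def)
  then show ?thesis using False p o by (intro UnionI[of "\<Omega> \<inter> {z. fst (snd z) < 0}"]) simp_all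
 qed
 then have "\<Omega> \<subseteq> \<Union>?\<S>" by (rule subsetI)
 moreover have "Ck_on 2 (\<Union>?\<S>) Ue" by (rule Ck_on_Union) simp
 ultimately show ?thesis using Ck_on_subset by blast
qed

lemma Cinf_Ue: "Cinf_on (\<Omega> \<inter> {z. 0 < fst (snd z)}) Ue"
proof -
 let ?\<S> = "{S. open S \<and> S \<subseteq> \<Omega> \<inter> {z. 0 < fst (snd z)} \<and> Cinf_on S Ue}"
 have "p \<in> \<Union>?\<S>" if p: "p \<in> \<Omega>" "0 < fst (snd p)" for p
 proof -
  obtain S F where S: "open S" "S \<subseteq> \<Omega>" "p \<in> S" "Cinf_on S F" "\<And>z. z \<in> S \<Longrightarrow> 0 \<le> fst (snd z) \<Longrightarrow> F z = U z"
   by (rule local_extension[OF p(1) less_imp_le[OF p(2)]]) (rule that)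
  let ?T = "S \<inter> {z. 0 < fst (snd z)}"
  have o: "open ?T" using S(1) open_tm(1) by (rule open_Int)
  have "Cinf_on ?T Ue"
   by (rule Cinf_on_cong[OF o _ Cinf_on_subset[OF S(4)]]) (use S(5) in \<open>auto simp: Ue_def\<close>)
  moreover have "?T \<subseteq> \<Omega> \<inter> {z. 0 < fst (snd z)}" using S(2) by blast
  ultimately show ?thesis using S(3) o p(2) by (intro UnionI[of ?T]) simp_all
 qed
 then have "\<Omega> \<inter> {z. 0 < fst (snd z)} \<subseteq> \<Union>?\<S>" by (intro subsetI) simp
 moreover have "Cinf_on (\<Union>?\<S>) Ue" by (rule Cinf_on_Union) simp
 ultimately show ?thesis using Cinf_on_subset by blast
qed

lemma Ue_negative:
 assumes z: "fst (snd z) < 0"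
 shows "Ue z = 0" "dd v Ue z = 0" "dd v (dd w Ue) z = 0"
proof -
 have 0: "Ue q = 0" if "q \<in> {z. fst (snd z) < 0}" for q using that by (simp add: Ue_def)
 note 1 = dd_zero_open[OF open_tm(2) 0]
 note 2 = dd_zero_open[OF open_tm(2) 1]
 show "Ue z = 0" "dd v Ue z = 0" "dd v (dd w Ue) z = 0" using 0 1 2 z by simp_all
qed

lemma Ue_nonpositive:
 assumes z: "z \<in> \<Omega>" "fst (snd z) \<le> 0"
 shows "Ue z = 0 \<and> dd v Ue z = 0"
proof (cases "fst (snd z) < 0")
 case False
 then have t: "fst (snd z) = 0" using z by simp
 have "Ue z = 0" using init[OF z(1) t] t by (simp add: Ue_def)
 moreover have "dd v Ue z = 0"
  by (rule limit_zero[OF open_reg z(1) continuous_pde(3)[OF order_refl Ck_Ue], where v="- eS"])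
    (use Ue_negative t in \<open>auto simp: eS_def\<close>)
 ultimately show ?thesis ..
qed (simp add: Ue_negative)

text \<open>At t = 0 both sides are limits from t < 0, where the extension is identically
  zero.\<close>

lemma pde_Ue:
 assumes z: "z \<in> \<Omega>"
 shows "dd eS (dd eS Ue) z = pde Ue z"
proof -
 consider "0 < fst (snd z)" | "fst (snd z) < 0" | "fst (snd z) = 0" by linarith
 then show ?thesis
 proof cases
  case 1
  have m: "z \<in> {z. 0 < fst (snd z)}" and u: "\<And>z. z \<in> {z. 0 < fst (snd z)} \<Longrightarrow> Ue z = U z" using 1 by (auto simp: Ue_def)
  have "pde Ue z = pde U z" "dd eS (dd eS Ue) z = dd eS (dd eS U) z"       by (rule pde_cong[OF open_tm(1) m u], assumption)+
  then show ?thesis using eq[OF z 1] by simp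
 next
  case 2
  then show ?thesis using pde_zero[OF Ue_negative[OF 2]] by (simp add: Ue_negative(3))
 next
  case 3
  have "dd eS (dd eS Ue) z - pde Ue z = 0"
  proof (rule limit_zero[OF open_reg z, where v="- eS"])
   show "continuous_on \<Omega> (\<lambda>z. dd eS (dd eS Ue) z - pde Ue z)"
    by (intro continuous_intros continuous_pde[OF order_refl Ck_Ue])
   fix \<tau> :: real assume t: "0 < \<tau>" "z + \<tau> *\<^sub>R - eS \<in> \<Omega>"
   have n: "fst (snd (z + \<tau> *\<^sub>R - eS)) < 0" using t 3 by (simp add: eS_def)
   show "dd eS (dd eS Ue) (z + \<tau> *\<^sub>R - eS) - pde Ue (z + \<tau> *\<^sub>R - eS) = 0"
    unfolding Ue_negative(3)[OF n] pde_zero[OF Ue_negative[OF n]] by simp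
  qed
  then show ?thesis by simp
 qed
qed

text \<open>Finite speed of propagation, for w of class C2, determines s0 and a smaller ball; on a
  thinner region over this ball w is smooth and the bounds for all derivatives apply.\<close>

lemma local_expansion:
 "\<exists>\<delta> r W. 0 < \<delta> \<and> 0 < r \<and> r \<le> \<rho> \<and> (\<forall>k. Cinf_on ({..<s1} \<times> ball y0 r) (W k)) \<and>
   (\<forall>N. \<exists>C. rexp_bound \<delta> ({..<s1} \<times> ball y0 r) (\<lambda>x q. x powr (- n / 2) * Ue (kap (x, q))) W N C)"
proof -
 define w where "w = ww Ue"
 have U1: "Ue differentiable (at z)" if "z \<in> \<Omega>" for z by (rule U1[OF Ck_Ue that])
 have pw: "Cinf_on \<Omega> (\<lambda>z. fst z powr (- n / 2))"
  by (rule Cinf_on_compose_real(1)[OF open_reg Cinf_on_linear[OF open_reg bounded_linear_fst]]) (rule pos)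
 have md: "Cinf_on \<Omega> (\<lambda>z. fst z powr (- n / 2) * d z)"
  by (rule Cinf_on_mult[OF open_reg pw Cinf_on_subset[OF d(1) sub]])
 have w2: "Ck_on 2 \<Omega> w"
  unfolding w_def ww_def[abs_def]
  by (rule Ck_on_mult[OF open_reg _ Ck_on_comp_kap[OF Ck_Ue]]) (use md in \<open>simp add: Cinf_on_def\<close>)
 have wz: "wave_op a w z + fst z * (\<Sum>!i. cc i z * dd (eH i) w z) + bb z * w z = 0" if "z \<in> \<Omega>" for z
  unfolding w_def by (rule ww_solves[OF Ck_Ue pde_Ue that])
 \<comment> \<open>e^s \<le> x means t \<le> 0, where the extension vanishes together with its
   gradient.\<close>
 have early: "w z = 0 \<and> dd v w z = 0" if z: "z \<in> \<Omega>" and s: "exp (fst (snd z)) \<le> fst z" for z v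
 proof -
  have "fst (snd z) \<le> ln (fst z)" using s pos[OF z] by (simp add: ln_ge_iff)
  then have t: "fst (snd (kap z)) \<le> 0" by (simp add: kap_def)
  note k = kap_reg[OF z]
  have U0: "Ue (kap z) = 0" and dU0: "dd v Ue (kap z) = 0" for v using Ue_nonpositive[OF k t, of v] by auto
  have m: "(\<lambda>z. fst z powr (- n / 2) * d z) differentiable (at z)" by (rule Cinf_on_differentiable[OF md z])
  have g: "(\<lambda>z. Ue (kap z)) differentiable (at z)" by (rule kap_dd(1)[OF pos[OF z] U1[OF k]])
  have "dd v (\<lambda>z. Ue (kap z)) z = 0"
   using dd_eqI[OF has_derivative_compose[OF kap_has_derivative[OF pos[OF z]] has_derivative_dd[OF U1[OF k]]]] dU0 by simp
  then have "dd v w z = 0"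
   unfolding w_def ww_def[abs_def] dd_mult[OF m g] U0 by simp
  moreover have "w z = 0" by (simp add: w_def ww_def U0)
  ultimately show ?thesis by simp
 qed
 interpret w1: wave_eq x1 \<rho> \<theta> y0 a cc bb using x1 \<rho> by (intro wave_eq) auto
 have sol1: "w1.solves w" unfolding w1.solves_def using wz by (rule ballI)
 obtain s0 r0 where r0: "0 < r0" "r0 \<le> \<rho>" and
  fs: "\<forall>x s y. (x, s, y) \<in> \<Omega> \<longrightarrow> s < s0 \<longrightarrow> dist y0 y < r0 \<longrightarrow> w (x, s, y) = 0"
  using w1.finite_speed[OF w2 sol1, OF early, simplified] by (elim exE conjE)
 \<comment> \<open>For x < x2 the points with t \<le> 0 have s \<le> ln x < s0 - 1. They lie inside
   the zero set of w, so w is smooth although the extension of U across t = 0 is only C2.\<close>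
 define x2 where "x2 = min x1 (exp (s0 - 1))"
 have x2: "0 < x2" "x2 \<le> x1" "ln x2 \<le> s0 - 1"   proof -
  show "0 < x2" "x2 \<le> x1" using x1 by (auto simp: x2_def)
  then have "ln x2 \<le> ln (exp (s0 - 1))" by (subst ln_le_cancel_iff) (auto simp: x2_def)
  then show "ln x2 \<le> s0 - 1" by simp
 qed
 let ?R = "reg x2 r0 y0"
 have R: "?R \<subseteq> \<Omega>" using x2 r0 by (auto simp: reg_def)
 have van: "w z = 0" if z: "z \<in> ?R" "fst (snd z) < s0" for z
 proof -
  obtain x s y where zz: "z = (x, s, y)" by (cases z)
  have "(x, s, y) \<in> \<Omega>" using subsetD[OF R z(1)] by (simp add: zz)
  moreover have "s < s0" "dist y0 y < r0" using z by (auto simp: zz reg_def)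
  ultimately
  show ?thesis using fs zz by simp
 qed
 have Cw: "Cinf_on ?R w"
 proof -
  let ?A = "?R \<inter> {z. fst (snd z) < s0}" and ?B = "?R \<inter> {z. s0 - 1 < fst (snd z)}"
  have A: "open ?A" and B: "open ?B" by (intro open_Int open_reg open_Collect_less continuous_intros)+
  have "Cinf_on ?A w" by (rule Cinf_on_cong[OF A _ Cinf_on_const[of _ 0]]) (use van in simp)
  moreover have "Cinf_on ?B w"
   unfolding w_def ww_def[abs_def]
  proof (rule Cinf_on_mult[OF B Cinf_on_subset[OF md]])
   have kp: "Cinf_on ?B kap" unfolding Cinf_on_def by (intro allI Ck_on_kap[OF B]) (auto simp: reg_def)
   have "kap z \<in> \<Omega> \<inter> {z. 0 < fst (snd z)}" if z: "z \<in> ?B" for z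
   proof -
    have "0 < fst z" "fst z < x2" "s0 - 1 < fst (snd z)" using z by (auto simp: reg_def)
    then have "ln (fst z) < fst (snd z)" using x2(3) ln_less_cancel_iff[of "fst z" x2] x2(1) by linarith
    then show ?thesis using kap_reg[of z x1 \<rho> y0] z R by (auto simp: kap_def)
   qed
   then show "Cinf_on ?B (\<lambda>z. Ue (kap z))" by (intro Cinf_on_compose[OF B kp Cinf_Ue]) blast
  qed (use R in blast)
  ultimately have "Cinf_on (\<Union>{?A, ?B}) w" using A B by (intro Cinf_on_Union) auto
  moreover have "\<Union>{?A, ?B} = ?R" by auto
  ultimately show ?thesis by simp
 qed
 interpret w2: wave_eq x2 r0 \<theta> y0 a cc bb using x2 r0 by (intro wave_eq)
 have sol2: "w2.solves w" unfolding w2.solves_def using wz R by blast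
 note dsinv = d(2)
 obtain \<delta> r where d': "0 < \<delta>" "\<delta> < x2" "0 < r" "r < r0" and bd: "\<forall>k. bdk k (gr \<delta> s1 r y0) w"
  using w2.bounded_derivatives[OF Cw sol2, of s0 s1, OF van, simplified] by (elim exE conjE)
 have x21: "x2 \<le> 1" using x2 x1 by linarith
 note D = d'(1,2) x21 d'(4)
 have rw: "regular x2 r0 \<delta> s1 r y0 w" unfolding regular_def[OF D] using Cw bd by simp
 \<comment> \<open>The expansion is wanted for x^(-n/2) u, so the factor d is divided out again; 1/d
   is smooth up to x = 0.\<close>
 have "{0..x2} \<times> UNIV \<times> cball y0 r0 \<subseteq> \<Omega>'"
  by (rule order_trans[OF _ \<Omega>'(2)]) (use x2 r0 in auto)
 moreover have "sinv (\<lambda>z. inverse (d z))" unfolding sinv_def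
  by (intro allI arg_cong[where f=inverse] sinvs dsinv)
 ultimately have "bsmooth ?R (\<lambda>z. inverse (d z))" by (rule bsmooth_sinv[OF \<Omega>'(1) _ Cinf_id])
 then have "regular x2 r0 \<delta> s1 r y0 (\<lambda>z. inverse (d z))" by (rule regular_bsmooth[OF D])
 from regular_expansion[OF D regular_mult[OF D this rw]]
 obtain W where W: "\<forall>k. Cinf_on ({..<s1} \<times> ball y0 r) (W k)" "\<forall>N. \<exists>C. rexp_bound \<delta> ({..<s1} \<times> ball y0 r) (\<lambda>x q. inverse (d (x, q)) * w (x, q)) W N C"
  unfolding slab_def[OF D] by (elim exE conjE)
 have eq: "inverse (d (x, q)) * w (x, q) = x powr (- n / 2) * Ue (kap (x, q))"
  if "q \<in> {..<s1} \<times> ball y0 r" "0 < x" "x \<le> \<delta>" for x q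
 proof -
  have "(x, q) \<in> \<Omega>" using that d' r0 x2 by (auto simp: reg_def)
  then have "0 < d (x, q)" using d(3) sub by blast
  then show ?thesis by (simp add: w_def ww_def)
 qed
 show ?thesis
 proof (intro exI conjI)
  show "\<forall>N. \<exists>C. rexp_bound \<delta> ({..<s1} \<times> ball y0 r) (\<lambda>x q. x powr (- n / 2) * Ue (kap (x, q))) W N C"
  proof
   fix N
   obtain C where "rexp_bound \<delta> ({..<s1} \<times> ball y0 r) (\<lambda>x q. inverse (d (x, q)) * w (x, q)) W N C" using spec[OF W(2), of N] by (rule exE)
   note C = this[rule_format]
   show "\<exists>C. rexp_bound \<delta> ({..<s1} \<times> ball y0 r) (\<lambda>x q. x powr (- n / 2) * Ue (kap (x, q))) W N C"
    by (intro exI[of _ C] ballI allI impI) (subst eq[symmetric], assumption+, rule C)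
  qed
 qed (use d' r0 W(1) in \<open>simp_all del: split_paired_All\<close>)
qed

end

end

section \<open>Boundary charts of the product decomposition\<close>

lemma det_scaleR_matrix:
 fixes A :: "real ^ 'm::finite ^ 'm"
 shows "det (c *\<^sub>R A) = c ^ CARD('m) * det A"
proof -
 have "c *\<^sub>R A = (\<chi> i. c *s A $ i)" by (simp add: vec_eq_iff)
 then show ?thesis using det_rows_mul[of "\<lambda>_. c" "\<lambda>i. A $ i"] by simp
qed

lemma matrix_inv_works:
 fixes A :: "real ^ 'm::finite ^ 'm"
 assumes "det A \<noteq> 0"
 shows "A ** matrix_inv A = mat 1" "matrix_inv A ** A = mat 1"
proof -
 have "\<exists>B. A ** B = mat 1 \<and> B ** A = mat 1"
  using assms invertible_det_nz[of A] unfolding invertible_def by blast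
 from someI_ex[OF this] show "A ** matrix_inv A = mat 1" "matrix_inv A ** A = mat 1"
  unfolding matrix_inv_def by simp_all
qed

lemma matrix_inv_eqI:
 fixes A B :: "real ^ 'm::finite ^ 'm"
 assumes "A ** B = mat 1"
 shows "matrix_inv A = B"
proof -
 have "det A * det B = 1" using det_mul[of A B] assms by simp
 then have "det A \<noteq> 0" by auto
 then have "matrix_inv A ** (A ** B) = B"
  unfolding matrix_mul_assoc by (subst matrix_inv_works(2)) simp_all
 then show ?thesis using assms by simp
qed

lemma matrix_inv_scaleR:
 fixes A :: "real ^ 'm::finite ^ 'm"
 assumes "c \<noteq> 0" "det A \<noteq> 0"
 shows "matrix_inv (c *\<^sub>R A) = (1 / c) *\<^sub>R matrix_inv A"
proof (rule matrix_inv_eqI)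
 have "(c *\<^sub>R A) ** ((1 / c) *\<^sub>R matrix_inv A) = A ** matrix_inv A"
  using assms(1) by (simp add: vec_eq_iff matrix_matrix_mult_def)
 then show "(c *\<^sub>R A) ** ((1 / c) *\<^sub>R matrix_inv A) = mat 1" using matrix_inv_works(1)[OF assms(2)] by simp
qed

text \<open>Exhibits the entries of the inverse as quotients of determinants, hence as smooth
  functions of the entries of A.\<close>

lemma matrix_inv_cramer:
 fixes A :: "real ^ 'm::finite ^ 'm"
 assumes "det A \<noteq> 0"
 shows "matrix_inv A $ k $ l = det (\<chi> i j. if j = k then axis l 1 $ i else A $ i $ j) / det A"
proof -
 have "A *v (matrix_inv A *v axis l 1) = axis l 1"
  using matrix_inv_works(1)[OF assms] by (simp add: matrix_vector_mul_assoc)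
 then have "matrix_inv A *v axis l 1 = (\<chi> k. det (\<chi> i j. if j = k then axis l 1 $ i else A $ i $ j) / det A)"
  using cramer[OF assms] by simp
 then show ?thesis by (simp add: matrix_vector_mult_basis column_def vec_eq_iff)
qed

lemma continuous_on_det:
 fixes A :: "'a::topological_space \<Rightarrow> real ^ 'm::finite ^ 'm"
 shows "continuous_on S A \<Longrightarrow> continuous_on S (\<lambda>x. det (A x))"
 unfolding det_def by (intro continuous_intros)

text \<open>Every matrix on the segment from the identity to M has trivial kernel, so the
  determinant, which is 1 at the identity, cannot change sign along it.\<close>

lemma pos_def_det:
 fixes M :: "real ^ 'm::finite ^ 'm"
 assumes "pos_def M"
 shows "0 < det M"
proof (rule ccontr)
 assume n: "\<not> ?thesis"
 let ?f = "\<lambda>s::real. (1 - s) *\<^sub>R mat 1 + s *\<^sub>R M"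
 have c: "continuous_on {0..1} (\<lambda>s. det (?f s))" by (intro continuous_on_det continuous_intros)
 obtain s where s: "0 \<le> s" "s \<le> 1" "det (?f s) = 0"
  using IVT2'[of "\<lambda>s. det (?f s)" 1 0 0] n c by auto
 then have "\<not> invertible (?f s)" using invertible_det_nz by blast
 then obtain v where v: "v \<noteq> 0" "?f s *v v = 0"
  using matrix_left_invertible_ker[of "?f s"] invertible_left_inverse by metis
 have "?f s *v v = (1 - s) *\<^sub>R v + s *\<^sub>R (M *v v)"
  by (simp add: matrix_vector_mult_add_rdistrib scaleR_matrix_vector_assoc[symmetric])
 then have "0 = (1 - s) * (v \<bullet> v) + s * (v \<bullet> (M *v v))" using v(2) by (metis inner_add_right inner_scaleR_right inner_zero_right)
 moreover have "0 < v \<bullet> (M *v v)" "0 < v \<bullet> v" using assms v(1) by (simp_all add: pos_def_def)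
 moreover have "0 \<le> (1 - s) * (v \<bullet> v)" "0 \<le> s * (v \<bullet> (M *v v))" using s calculation by simp_all
 ultimately have "(1 - s) * (v \<bullet> v) = 0" "s * (v \<bullet> (M *v v)) = 0" by linarith+
 then show False using \<open>0 < v \<bullet> (M *v v)\<close> \<open>0 < v \<bullet> v\<close> by auto
qed

lemma pos_def_inv:
 fixes M :: "real ^ 'm::finite ^ 'm"
 assumes "pos_def M"
 shows "pos_def (matrix_inv M)"
proof -
 have d: "det M \<noteq> 0" using pos_def_det[OF assms] by simp
 have t: "transpose M = M" using assms by (simp add: pos_def_def)
 have "M ** transpose (matrix_inv M) = transpose (matrix_inv M ** M)" by (simp add: matrix_transpose_mul t)
 also have "\<dots> = mat 1" by (simp add: matrix_inv_works(2)[OF d] transpose_mat)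
 finally have "matrix_inv M = transpose (matrix_inv M)" by (rule matrix_inv_eqI)
 moreover have "0 < v \<bullet> (matrix_inv M *v v)" if "v \<noteq> 0" for v
 proof -
  let ?w = "matrix_inv M *v v"
  have "M *v ?w = v" using matrix_inv_works(1)[OF d] by (simp add: matrix_vector_mul_assoc)
  moreover from this have "?w \<noteq> 0" using that by auto
  then have "0 < ?w \<bullet> (M *v ?w)" using assms by (simp add: pos_def_def)
  ultimately show ?thesis by (simp add: inner_commute)
 qed
 ultimately show ?thesis by (simp add: pos_def_def)
qed

lemma sum_option: "(\<Sum>!i. f i) = f None + (\<Sum>!i. f (Some i))" for f :: "'n::finite option \<Rightarrow> 'b::comm_monoid_add"
proof -
 have "(\<Sum>!i. f i) = f None + sum f (range Some)"
  unfolding UNIV_option_conv by (subst sum.insert) auto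
 also have "sum f (range Some) = (\<Sum>!i. f (Some i))" by (subst sum.reindex) auto
 finally show ?thesis .
qed

lemma product_metric_matrix_simps [simp]:
 "product_metric_matrix M $ None $ None = 1" "product_metric_matrix M $ None $ Some j = 0"
 "product_metric_matrix M $ Some i $ None = 0" "product_metric_matrix M $ Some i $ Some j = M $ i $ j"
 by (simp_all add: product_metric_matrix_def)

lemma pos_def_product:
 assumes M: "pos_def M"
 shows "pos_def (product_metric_matrix M)"
 unfolding pos_def_def
proof (intro conjI allI impI)
 have t: "M $ i $ j = M $ j $ i" for i j
  using M unfolding pos_def_def by (metis transpose_def vec_lambda_beta)
 have "transpose (product_metric_matrix M) $ i $ j = product_metric_matrix M $ i $ j" for i j
  using t by (cases i; cases j; simp add: transpose_def)
 then show "transpose (product_metric_matrix M) = product_metric_matrix M" by (simp add: vec_eq_iff)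
 fix v :: "real ^ ('a option)" assume v: "v \<noteq> 0"
 define w where "w = (\<chi> i. v $ Some i)"
 have "v \<bullet> (product_metric_matrix M *v v) = (v $ None)\<^sup>2 + w \<bullet> (M *v w)"
  by (simp add: inner_vec_def matrix_vector_mult_def sum_option w_def power2_eq_square)
 moreover have "0 < (v $ None)\<^sup>2 + w \<bullet> (M *v w)"
 proof (cases "w = 0")
  case True
  then have "v $ Some i = 0" for i by (simp add: w_def vec_eq_iff)
  then have "v $ None \<noteq> 0" using v by (metis not_None_eq vec_eq_iff zero_index)
  then show ?thesis using True by simp
 next
  case False
  then have "0 < w \<bullet> (M *v w)" using M by (simp add: pos_def_def)
  then show ?thesis using zero_le_power2[of "v $ None"] by linarith
 qed
 ultimately show "0 < v \<bullet> (product_metric_matrix M *v v)" by simp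
qed

text \<open>The \<open>None\<close> row and column of the product metric are unit vectors, so the
  corresponding row and column of the inverse can be read off from the two products, without
  inverting the tangential block.\<close>

lemma inv_product_metric_matrix:
 assumes d: "det (product_metric_matrix M) \<noteq> 0"
 defines "P \<equiv> matrix_inv (product_metric_matrix M)"
 shows "P $ None $ None = 1" "P $ None $ Some j = 0" "P $ Some i $ None = 0"
proof -
 let ?p = "product_metric_matrix M"
 have "(?p ** P) $ None $ l = mat 1 $ None $ l" "(P ** ?p) $ l $ None = mat 1 $ l $ None" for l
  unfolding P_def matrix_inv_works[OF d] by simp_all
 then have "P $ None $ l = mat 1 $ None $ l" "P $ l $ None = mat 1 $ l $ None" for l
  by (simp_all add: matrix_matrix_mult_def sum_option)
 then show "P $ None $ None = 1" "P $ None $ Some j = 0" "P $ Some i $ None = 0" by (simp_all add: mat_def)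
qed

lemma Cinf_on_det:
 fixes A :: "'a::real_normed_vector \<Rightarrow> real ^ 'm::finite ^ 'm"
 assumes "open S" "\<And>i j. Cinf_on S (\<lambda>x. A x $ i $ j)"
 shows "Cinf_on S (\<lambda>x. det (A x))"
 unfolding det_def by (intro Cinf_on_sum Cinf_on_mult Cinf_on_prod Cinf_on_const assms)

lemma Cinf_on_matrix_inv:
 fixes A :: "'a::real_normed_vector \<Rightarrow> real ^ 'm::finite ^ 'm"
 assumes S: "open S" and A: "\<And>i j. Cinf_on S (\<lambda>x. A x $ i $ j)" and d: "\<And>x. x \<in> S \<Longrightarrow> 0 < det (A x)"
 shows "Cinf_on S (\<lambda>x. matrix_inv (A x) $ k $ l)"
proof (rule Cinf_on_cong[OF S])
 have "Cinf_on S (\<lambda>x. (\<chi> i j. if j = k then axis l 1 $ i else A x $ i $ j) $ i $ j)" for i j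
  using A by (cases "j = k") simp_all
 then show "Cinf_on S (\<lambda>x. det (\<chi> i j. if j = k then axis l 1 $ i else A x $ i $ j) * inverse (det (A x)))"
  by (intro Cinf_on_mult S Cinf_on_det Cinf_on_compose_real(3)[OF S Cinf_on_det[OF S A] d])
 show "det (\<chi> i j. if j = k then axis l 1 $ i else A x $ i $ j) * inverse (det (A x)) = matrix_inv (A x) $ k $ l" if "x \<in> S" for x
  using matrix_inv_cramer[of "A x" k l] d[OF that] by (simp add: divide_inverse)
qed

section \<open>Coordinates of the collar and its charts\<close>

lemma cons_coord_simps [simp]: "cons_coord x \<eta> $ None = x" "cons_coord x \<eta> $ Some i = \<eta> $ i"
 by (simp_all add: cons_coord_def)

definition tpart :: "real ^ ('n::finite option) \<Rightarrow> real ^ 'n" where "tpart q = (\<chi> i. q $ Some i)"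

lemma tpart_nth [simp]: "tpart q $ i = q $ Some i" by (simp add: tpart_def)

lemma cons_coord_tpart: "cons_coord (q $ None) (tpart q) = q"
 unfolding vec_eq_iff by (auto simp: cons_coord_def split: option.split)

lemma tpart_cons_coord [simp]: "tpart (cons_coord x \<eta>) = \<eta>" by (simp add: vec_eq_iff)

lemma bounded_linear_cons_coord: "bounded_linear (\<lambda>z. cons_coord (fst z) (snd z))"
proof -
 have "linear (\<lambda>z::real \<times> (real ^ 'n::finite). cons_coord (fst z) (snd z))"
  by (rule linearI; unfold vec_eq_iff; intro allI; case_tac i; simp)
 then show ?thesis by (simp add: linear_conv_bounded_linear)
qed

lemma bounded_linear_tpart: "bounded_linear (tpart :: _ \<Rightarrow> real ^ 'n::finite)"
proof -
 have "linear (tpart :: _ \<Rightarrow> real ^ 'n)" by (rule linearI) (simp_all add: vec_eq_iff)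
 then show ?thesis by (simp add: linear_conv_bounded_linear)
qed

locale collar =
 fixes A :: "('a::{t2_space,second_countable_topology}, 'n::finite) chart set"
  and g :: "('a, 'n) metric" and \<epsilon> :: real and \<Phi> :: "real \<times> 'a \<Rightarrow> 'a"
  and h :: "real \<Rightarrow> ('a, 'n) bmetric" and h0 :: "('a, 'n) bmetric"
 assumes manifold: "compact_smooth_manifold A"
  and product: "product_decomposition A g \<epsilon> \<Phi> h h0"
begin

lemma chart: "c \<in> A \<Longrightarrow> is_chart c"
 using manifold by (simp add: compact_smooth_manifold_def smooth_structure_def)

lemma chart_homeo:
 assumes "c \<in> A"
 shows "open (cdom c)" "openin (top_of_set half_space) (cimg c)" "homeomorphism (cdom c) (cimg c) (cmap c) (cinv c)"
 using chart[OF assms] by (simp_all add: is_chart_def)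

lemma cinv_cmap: "c \<in> A \<Longrightarrow> p \<in> cdom c \<Longrightarrow> cinv c (cmap c p) = p"
 using chart_homeo(3) by (simp add: homeomorphism_def)

lemma cimg_half: "c \<in> A \<Longrightarrow> q \<in> cimg c \<Longrightarrow> 0 \<le> q $ None"
 using subsetD[OF openin_imp_subset[OF chart_homeo(2)], of c q] by (simp add: half_space_def)

text \<open>A transition map cannot carry a boundary point to an interior one, by invariance of domain.\<close>

lemma boundary_None:
 assumes c: "c \<in> A" and p: "p \<in> cdom c" "p \<in> mbdry A"
 shows "cmap c p $ None = 0"
proof (rule ccontr)
 assume ne: "cmap c p $ None \<noteq> 0"
 obtain c' where c': "c' \<in> A" "p \<in> cdom c'" "cmap c' p $ None = 0" using p(2) by (auto simp: mbdry_def)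
 have "cmap c p \<in> cimg c" using p by (simp add: cimg_def)
 then have pos: "0 < cmap c p $ None" using ne cimg_half[OF c] by fastforce
 let ?W = "cdom c \<inter> cdom c'"
 \<comment> \<open>Where the \<open>None\<close> coordinate is positive, the image of the overlap is
   open in the whole vector space and not merely in the half space, as invariance of domain
   requires.\<close>
 define U where "U = cmap c ` ?W \<inter> {q. 0 < q $ None}"
 have "openin (top_of_set (cdom c)) ?W"
  using chart_homeo(1)[OF c'(1)] by (simp add: openin_open_Int)
 then have "openin (top_of_set (cimg c)) (cmap c ` ?W)"
  by (rule homeomorphism_imp_open_map[OF chart_homeo(3)[OF c]])
 then have "openin (top_of_set half_space) (cmap c ` ?W)"
  using chart_homeo(2)[OF c] by (rule openin_trans)
 then obtain T where T: "open T" "cmap c ` ?W = half_space \<inter> T" by (auto simp: openin_open)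
 have "U = T \<inter> {q. 0 < q $ None}" unfolding U_def T(2) by (auto simp: half_space_def)
 moreover have "open {q :: real ^ 'n option. 0 < q $ None}" by (intro open_Collect_less continuous_intros)
 ultimately have U: "open U" using T(1) by (simp add: open_Int)
 define f where "f = (\<lambda>q. cmap c' (cinv c q))"
 have UW: "cinv c q \<in> ?W \<and> q \<in> cimg c" if "q \<in> U" for q
  using that cinv_cmap[OF c] by (auto simp: U_def cimg_def)
 have "continuous_on U f"
  unfolding f_def
  by (rule continuous_on_compose2[of "cdom c'" "cmap c'" U "cinv c"])
    (use chart_homeo(3)[OF c'(1)] chart_homeo(3)[OF c] UW in \<open>auto simp: homeomorphism_def intro: continuous_on_subset\<close>)
 moreover have "inj_on f U"
 proof (rule inj_onI)
  fix q r assume qr: "q \<in> U" "r \<in> U" "f q = f r"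
  have "cinv c q = cinv c r"
   using qr(3) cinv_cmap[OF c'(1)] UW[OF qr(1)] UW[OF qr(2)] unfolding f_def by (metis IntD2)
  moreover have "cmap c (cinv c q) = q" "cmap c (cinv c r) = r"
   using UW qr chart_homeo(3)[OF c] by (auto simp: homeomorphism_def)
  ultimately show "q = r" by metis
 qed
 ultimately have "open (f ` U)" using U by (intro invariance_of_domain)
 moreover have fp: "cmap c' p \<in> f ` U"
  using p c'(2) pos cinv_cmap[OF c p(1)] by (auto simp: f_def U_def image_iff intro!: bexI[of _ "cmap c p"])
 ultimately obtain e where e: "0 < e" "ball (cmap c' p) e \<subseteq> f ` U" by (auto simp: open_contains_ball)
 \<comment> \<open>A point of the supposedly open image with negative \<open>None\<close>
   coordinate, which no chart attains.\<close>
 let ?r = "cmap c' p - (e / 2) *\<^sub>R axis None 1"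
 have "?r \<in> ball (cmap c' p) e" using e(1) by (simp add: dist_norm norm_axis_1)
 then have "?r \<in> f ` U" using e(2) by blast
 then have "?r \<in> cimg c'" using UW by (auto simp: f_def cimg_def)
 then have "0 \<le> ?r $ None" using cimg_half[OF c'(1)] by blast
 then show False using c'(3) e(1) by simp
qed

text \<open>Membership in \<open>mbdry A\<close> may be witnessed by any chart; by
  \<open>boundary_None\<close> each chart detects it with its own coordinate.\<close>

lemma bdom_iff: "c \<in> A \<Longrightarrow> p \<in> bdom A c \<longleftrightarrow> p \<in> cdom c \<and> cmap c p $ None = 0"
 using boundary_None[of c p] by (auto simp: bdom_def mbdry_def)

lemma bdom_mbdry: "p \<in> bdom A c \<Longrightarrow> p \<in> mbdry A" by (simp add: bdom_def)

lemma bmap_tpart: "bmap c p = tpart (cmap c p)" by (simp add: bmap_def tpart_def)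

lemma cmap_bdom: "c \<in> A \<Longrightarrow> p \<in> bdom A c \<Longrightarrow> cmap c p = cons_coord 0 (bmap c p)"
 unfolding bmap_tpart using cons_coord_tpart[of "cmap c p"] bdom_iff by metis

lemma inj_bmap: "c \<in> A \<Longrightarrow> inj_on (bmap c) (bdom A c)"
proof (rule inj_onI)
 fix p q assume c: "c \<in> A" and p: "p \<in> bdom A c" "q \<in> bdom A c" "bmap c p = bmap c q"
 then have "cmap c p = cmap c q" by (simp add: cmap_bdom)
 moreover have "p \<in> cdom c" "q \<in> cdom c" using p by (auto simp: bdom_def)
 ultimately show "p = q" using cinv_cmap[OF c] by metis
qed

lemma binv_bmap: "c \<in> A \<Longrightarrow> p \<in> bdom A c \<Longrightarrow> binv A c (bmap c p) = p"
 unfolding binv_def by (rule inv_into_f_f[OF inj_bmap])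

abbreviation bimg :: "('a, 'n) chart \<Rightarrow> (real ^ 'n) set" where "bimg c \<equiv> bmap c ` bdom A c"

lemma binv: "c \<in> A \<Longrightarrow> \<eta> \<in> bimg c \<Longrightarrow> binv A c \<eta> \<in> bdom A c" "c \<in> A \<Longrightarrow> \<eta> \<in> bimg c \<Longrightarrow> bmap c (binv A c \<eta>) = \<eta>"
 unfolding binv_def by (auto intro: inv_into_into f_inv_into_f)

lemma open_bimg:
 assumes c: "c \<in> A" shows "open (bimg c)"
proof -
 obtain T where T: "open T" "cimg c = half_space \<inter> T" using chart_homeo(2)[OF c] by (auto simp: openin_open)
 have "\<eta> \<in> bimg c \<longleftrightarrow> cons_coord 0 \<eta> \<in> T" for \<eta>
 proof
  assume "\<eta> \<in> bimg c"
  then obtain p where p: "p \<in> bdom A c" "\<eta> = bmap c p" by auto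
  then have "cons_coord 0 \<eta> \<in> cimg c"
   unfolding p(2) cmap_bdom[OF c p(1), symmetric] by (auto simp: cimg_def bdom_def)
  then show "cons_coord 0 \<eta> \<in> T" using T by blast
 next
  assume "cons_coord 0 \<eta> \<in> T"
  then have "cons_coord 0 \<eta> \<in> cimg c" using T by (simp add: half_space_def)
  then obtain p where p: "p \<in> cdom c" "cmap c p = cons_coord 0 \<eta>" by (auto simp: cimg_def)
  then have "p \<in> bdom A c" using bdom_iff[OF c] by simp
  moreover have "bmap c p = \<eta>" using p by (simp add: bmap_tpart)
  ultimately show "\<eta> \<in> bimg c" by blast
 qed
 then have "bimg c = cons_coord 0 -` T" by blast
 moreover have "continuous_on UNIV (\<lambda>\<eta>. cons_coord (fst (0, \<eta>)) (snd (0 :: real, \<eta>)))"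
  by (rule continuous_on_compose2[OF linear_continuous_on[OF bounded_linear_cons_coord]]) (auto intro: continuous_intros)
 ultimately show ?thesis using open_vimage[OF T(1), of "cons_coord 0"] by simp
qed

lemma product':
 shows eps: "\<epsilon> > 0" and inj: "inj_on \<Phi> ({0..<\<epsilon>} \<times> mbdry A)" and Phi0: "\<And>y. y \<in> mbdry A \<Longrightarrow> \<Phi> (0, y) = y"
  and collar_in: "\<And>c. c \<in> A \<Longrightarrow> collar_chart A \<epsilon> \<Phi> c \<in> A"
  and family: "bdry_metric_family A \<epsilon> h"
  and metric: "\<And>c x y. c \<in> A \<Longrightarrow> x \<in> {0<..<\<epsilon>} \<Longrightarrow> y \<in> bdom A c \<Longrightarrow>
    g (collar_chart A \<epsilon> \<Phi> c) (\<Phi> (x, y)) = (1 / x\<^sup>2) *\<^sub>R product_metric_matrix (h x c y)"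
 using product by (simp_all add: product_decomposition_def)

abbreviation cc :: "('a, 'n) chart \<Rightarrow> ('a, 'n) chart" where "cc c \<equiv> collar_chart A \<epsilon> \<Phi> c"

lemma cdom_cc: "cdom (cc c) = \<Phi> ` ({0..<\<epsilon>} \<times> bdom A c)" by (simp add: collar_chart_def)

lemma cmap_cc:
 assumes "0 \<le> x" "x < \<epsilon>" "y \<in> mbdry A"
 shows "cmap (cc c) (\<Phi> (x, y)) = cons_coord x (bmap c y)"
 using inv_into_f_f[OF inj, of "(x, y)"] assms by (simp add: collar_chart_def)

lemma cimg_cc: "cimg (cc c) = {cons_coord x \<eta> |x \<eta>. 0 \<le> x \<and> x < \<epsilon> \<and> \<eta> \<in> bimg c}"
proof -
 have "cimg (cc c) = {cmap (cc c) (\<Phi> (x, y)) |x y. 0 \<le> x \<and> x < \<epsilon> \<and> y \<in> bdom A c}"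
  unfolding cimg_def cdom_cc image_image
  by (rule set_eqI) (simp add: image_iff Bex_def, blast)
 also have "\<dots> = {cons_coord x (bmap c y) |x y. 0 \<le> x \<and> x < \<epsilon> \<and> y \<in> bdom A c}"
  by (intro Collect_cong ex_cong1) (auto simp: cmap_cc bdom_mbdry)
 finally show ?thesis by blast
qed

lemma cinv_cc:
 assumes c: "c \<in> A" and x: "0 \<le> x" "x < \<epsilon>" and eta: "\<eta> \<in> bimg c"
 shows "cinv (cc c) (cons_coord x \<eta>) = \<Phi> (x, binv A c \<eta>)"
proof -
 note b = binv[OF c eta]
 have "\<Phi> (x, binv A c \<eta>) \<in> cdom (cc c)" using x b by (auto simp: cdom_cc)
 from cinv_cmap[OF collar_in[OF c] this] show ?thesis
  using cmap_cc[OF x bdom_mbdry[OF b(1)]] b(2) by simp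
qed

text \<open>If \<open>\<Phi> (x, y)\<close> were a boundary point p, then
  \<open>\<Phi> (0, p)\<close> would be the same point, and injectivity would force x = 0.\<close>

lemma Phi_interior:
 assumes x: "0 \<le> x" "x < \<epsilon>" and y: "y \<in> mbdry A"
 shows "\<Phi> (x, y) \<in> minterior A \<longleftrightarrow> 0 < x"
proof
 assume i: "\<Phi> (x, y) \<in> minterior A"
 then have "x \<noteq> 0" using Phi0[OF y] y by (auto simp: minterior_def)
 then show "0 < x" using x by simp
next
 assume x0: "0 < x"
 show "\<Phi> (x, y) \<in> minterior A"
 proof (rule ccontr)
  assume "\<Phi> (x, y) \<notin> minterior A"
  then have p: "\<Phi> (x, y) \<in> mbdry A" by (simp add: minterior_def)
  then have "\<Phi> (0, \<Phi> (x, y)) = \<Phi> (x, y)" by (rule Phi0)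
  then have "(0, \<Phi> (x, y)) = (x, y)" by (rule inj_onD[OF inj]) (use x y p eps in auto)
  then show False using x0 by simp
 qed
qed

end

section \<open>The wave equation in a collar chart\<close>

lemma dd_linear_comp:
 assumes L: "bounded_linear L" and F: "F differentiable (at (L z))"
 shows "dd v (\<lambda>z. F (L z)) z = dd (L v) F (L z)" "(\<lambda>z. F (L z)) differentiable (at z)"
proof -
 have "((\<lambda>z. F (L z)) has_derivative (\<lambda>v. dd (L v) F (L z))) (at z)"
  by (rule has_derivative_compose[OF bounded_linear_imp_has_derivative[OF L] has_derivative_dd[OF F]])
 then show "dd v (\<lambda>z. F (L z)) z = dd (L v) F (L z)" "(\<lambda>z. F (L z)) differentiable (at z)"
  by (auto intro: dd_eqI differentiableI)
qed

lemma open_linear_vimage: "bounded_linear L \<Longrightarrow> open V \<Longrightarrow> open (L -` V)"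
 using continuous_open_vimage linear_continuous_at by blast

lemma Ck_on_linear_comp:
 assumes L: "bounded_linear L" and V: "open V"
 shows "Ck_on k V F \<Longrightarrow> Ck_on k (L -` V) (\<lambda>z. F (L z))"
proof (induction k arbitrary: F)
 case 0
 then show ?case using continuous_on_compose2[OF _ linear_continuous_on[OF L], of V F "L -` V"] by auto
next
 case (Suc k)
 note o = open_linear_vimage[OF L V]
 have F: "F differentiable (at (L z))" if "z \<in> L -` V" for z using Suc.prems that by (auto simp: Ck_on_Suc_iff)
 have "Ck_on k (L -` V) (dd v (\<lambda>z. F (L z)))" for v
 proof (rule Ck_on_cong[OF o])
  show "Ck_on k (L -` V) (\<lambda>z. dd (L v) F (L z))" using Suc by (simp add: Ck_on_Suc_iff)
  show "dd (L v) F (L z) = dd v (\<lambda>z. F (L z)) z" if "z \<in> L -` V" for z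
   by (rule dd_linear_comp(1)[OF L F[OF that], symmetric])
 qed
 then show ?case unfolding Ck_on_Suc_iff using dd_linear_comp(2)[OF L F] by blast
qed

lemma smooth_on_linear_comp:
 assumes L: "bounded_linear L" and f: "smooth_on S f" and T: "\<And>z. z \<in> T \<Longrightarrow> L z \<in> S \<and> f' z = f (L z)"
 shows "smooth_on T f'"
 unfolding smooth_on_def
proof
 fix p assume p: "p \<in> T"
 then have "L p \<in> S" using T by blast
 from bspec[OF f[unfolded smooth_on_def] this]
 obtain V F where V: "open V" "L p \<in> V" "\<forall>k. Ck_on k V F" "\<forall>q\<in>V \<inter> S. F q = f q" by (elim exE conjE)
 show "\<exists>V F. open V \<and> p \<in> V \<and> (\<forall>k. Ck_on k V F) \<and> (\<forall>q\<in>V \<inter> T. F q = f' q)"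
 proof (intro exI conjI allI ballI)
  show "open (L -` V)" by (rule open_linear_vimage[OF L V(1)])
  show "Ck_on k (L -` V) (\<lambda>z. F (L z))" for k by (rule Ck_on_linear_comp[OF L V(1)]) (use V(3) in simp)
  show "F (L q) = f' q" if "q \<in> L -` V \<inter> T" for q using T[of q] V(4) that by simp
 qed (use V(2) in simp)
qed

lemma smooth_on_bounded_linear:
 assumes L: "bounded_linear L" and f: "smooth_on S f"
 shows "smooth_on S (\<lambda>z. L (f z))"
 unfolding smooth_on_def
proof
 fix p assume p: "p \<in> S"
 from bspec[OF f[unfolded smooth_on_def] this]
 obtain V F where V: "open V" "p \<in> V" "\<forall>k. Ck_on k V F" "\<forall>q\<in>V \<inter> S. F q = f q" by (elim exE conjE)
 have "Ck_on k V (\<lambda>z. L (F z))" for k by (rule Ck_on_bounded_linear[OF V(1) L]) (use V(3) in simp)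
 then show "\<exists>V F. open V \<and> p \<in> V \<and> (\<forall>k. Ck_on k V F) \<and> (\<forall>q\<in>V \<inter> S. F q = L (f q))"
  using V by (intro exI[of _ V] exI[of _ "\<lambda>z. L (F z)"]) simp
qed

lemma smooth_on_subset: "smooth_on S f \<Longrightarrow> T \<subseteq> S \<Longrightarrow> smooth_on T f"
 using smooth_on_linear_comp[OF bounded_linear_ident, of S f T f] by auto

text \<open>On an open set the local extension coincides with f near each point, so that smoothness
  by extension becomes smoothness by two-sided derivatives.\<close>

lemma smooth_on_open:
 assumes S: "open S" and f: "smooth_on S f"
 shows "Cinf_on S f"
 unfolding Cinf_on_def
proof
 fix k
 let ?\<S> = "{V. open V \<and> Ck_on k V f}"
 have "p \<in> \<Union>?\<S>" if p: "p \<in> S" for p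
 proof -
  from bspec[OF f[unfolded smooth_on_def] p]
  obtain V F where V: "open V" "p \<in> V" "\<forall>k. Ck_on k V F" "\<forall>q\<in>V \<inter> S. F q = f q" by (elim exE conjE)
  have o: "open (V \<inter> S)" using V(1) S by (rule open_Int)
  have "Ck_on k (V \<inter> S) f"
   by (rule Ck_on_cong[OF o _ Ck_on_subset[OF spec[OF V(3)]]]) (use V(4) in auto)
  then show ?thesis using o V(2) p by (intro UnionI[of "V \<inter> S"]) simp_all
 qed
 then have "S \<subseteq> \<Union>?\<S>" by (rule subsetI)
 moreover have "Ck_on k (\<Union>?\<S>) f" by (rule Ck_on_Union) simp
 ultimately show "Ck_on k S f" using Ck_on_subset by blast
qed

section \<open>The solution in the coordinates of a collar chart\<close>

definition dir :: "'n::finite option \<Rightarrow> 'n pt" where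
 "dir i = (case i of None \<Rightarrow> eX | Some k \<Rightarrow> eH k)"

locale wave_solution = collar A g \<epsilon> \<Phi> h h0
 for A :: "('a::{t2_space,second_countable_topology}, 'n::finite) chart set" and g \<epsilon> \<Phi> h h0 +
 fixes u :: "real \<Rightarrow> 'a \<Rightarrow> complex" and c :: "('a, 'n) chart"
 assumes smooth_u: "smooth_evolution A u" and c: "c \<in> A"
begin

definition pt :: "'n pt \<Rightarrow> 'a" where "pt z = \<Phi> (fst z, binv A c (snd (snd z)))"

text \<open>Here the middle coordinate of z is the time t; it is replaced by s - ln x only on
  composition with \<open>kap\<close>.\<close>

definition uu :: "'n pt \<Rightarrow> complex" where "uu z = u (fst (snd z)) (pt z)"

definition NN :: "'n pt set" where "NN = {0<..<\<epsilon>} \<times> UNIV \<times> bimg c"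

definition Gz :: "'n pt \<Rightarrow> real ^ ('n option) ^ ('n option)" where
 "Gz z = (1 / (fst z)\<^sup>2) *\<^sub>R product_metric_matrix (h (fst z) c (binv A c (snd (snd z))))"

lemma open_NN: "open NN" unfolding NN_def by (intro open_Times open_bimg c) auto

lemma NN_D: "z \<in> NN \<Longrightarrow> 0 < fst z" "z \<in> NN \<Longrightarrow> fst z < \<epsilon>" "z \<in> NN \<Longrightarrow> snd (snd z) \<in> bimg c"
 by (auto simp: NN_def)

lemma pt_cc:
 assumes z: "z \<in> NN"
 shows "cmap (cc c) (pt z) = cons_coord (fst z) (snd (snd z))" "pt z \<in> cdom (cc c) \<inter> minterior A"
  "cinv (cc c) (cons_coord (fst z) (snd (snd z))) = pt z" "g (cc c) (pt z) = Gz z"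
proof -
 note n = NN_D[OF z]
 note b = binv[OF c n(3)]
 show "cmap (cc c) (pt z) = cons_coord (fst z) (snd (snd z))"
  unfolding pt_def using cmap_cc[of "fst z" "binv A c (snd (snd z))" c] n bdom_mbdry[OF b(1)] b(2) by simp
 show "pt z \<in> cdom (cc c) \<inter> minterior A"
  unfolding pt_def cdom_cc using Phi_interior[of "fst z" "binv A c (snd (snd z))"] n b(1) bdom_mbdry[OF b(1)] by simp
 show "cinv (cc c) (cons_coord (fst z) (snd (snd z))) = pt z"
  unfolding pt_def by (rule cinv_cc[OF c]) (use n in auto)
 show "g (cc c) (pt z) = Gz z" unfolding pt_def Gz_def by (rule metric[OF c]) (use n b in auto)
qed

lemma smooth_uu: "smooth_on (NN \<inter> {z. 0 \<le> fst (snd z)}) uu"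
proof (rule smooth_on_linear_comp)
 show "bounded_linear (\<lambda>z::'n pt. (fst (snd z), cons_coord (fst z) (snd (snd z))))"
  by (intro bounded_linear_Pair bounded_linear_compose[OF bounded_linear_fst bounded_linear_snd]
   bounded_linear_compose[OF bounded_linear_cons_coord, of "\<lambda>z. (fst z, snd (snd z))", unfolded fst_conv snd_conv]
   bounded_linear_fst bounded_linear_compose[OF bounded_linear_snd bounded_linear_snd])
 show "smooth_on ({0..} \<times> cmap (cc c) ` (cdom (cc c) \<inter> minterior A)) (\<lambda>(t, q). u t (cinv (cc c) q))"
  using smooth_u collar_in[OF c] by (simp add: smooth_evolution_def)
 fix z assume z: "z \<in> NN \<inter> {z. 0 \<le> fst (snd z)}"
 then show "(fst (snd z), cons_coord (fst z) (snd (snd z))) \<in> {0..} \<times> cmap (cc c) ` (cdom (cc c) \<inter> minterior A) \<and>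
   uu z = (case (fst (snd z), cons_coord (fst z) (snd (snd z))) of (t, q) \<Rightarrow> u t (cinv (cc c) q))"
  using pt_cc(1-3)[of z] by (auto simp: uu_def intro: rev_image_eqI)
qed

abbreviation NP :: "'n pt set" where "NP \<equiv> NN \<inter> {z. 0 < fst (snd z)}"

lemma open_NP: "open NP" by (intro open_Int open_NN open_Collect_less continuous_intros)

lemma Cinf_uu: "Cinf_on NP uu"
 by (rule smooth_on_open[OF open_NP smooth_on_subset[OF smooth_uu]]) auto

lemma Dt_Dt:
 assumes z: "z \<in> NP"
 shows "Dt (Dt u) (fst (snd z)) (pt z) = - dd eS (dd eS uu) z"
proof -
 obtain x t \<eta> where zz: "z = (x, t, \<eta>)" by (cases z)
 have t: "0 < t" using z by (simp add: zz)
 define \<phi> where "\<phi> = (\<lambda>\<tau>. u \<tau> (pt z))"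
 have NPt: "(x, \<tau>, \<eta>) \<in> NP" if "0 < \<tau>" for \<tau> using z that by (auto simp: zz NN_def)
 have ph: "uu (x, \<tau>, \<eta>) = \<phi> \<tau>" for \<tau> by (simp add: uu_def \<phi>_def pt_def zz)
 have line: "((\<lambda>\<tau>. F (x, \<tau>, \<eta>)) has_vector_derivative dd eS F (x, \<tau>, \<eta>)) (at \<tau>)"
  if "Cinf_on NP F" "0 < \<tau>" for F :: "'n pt \<Rightarrow> complex" and \<tau>
  using dd_line_vector[of F "(x, 0, \<eta>)" \<tau> eS UNIV] Cinf_on_differentiable[OF that(1) NPt[OF that(2)]] by (simp add: eS_def)
 have 1: "(\<phi> has_vector_derivative dd eS uu (x, \<tau>, \<eta>)) (at \<tau>)" if "0 < \<tau>" for \<tau>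
  using line[OF Cinf_uu that] unfolding ph .
 have w: "at \<tau> within {0..} = at \<tau>" if "0 < \<tau>" for \<tau> :: real
  by (rule at_within_interior) (use that in simp)
 have D1: "Dt u \<tau> (pt z) = (1 / \<i>) * dd eS uu (x, \<tau>, \<eta>)" if "0 < \<tau>" for \<tau>
  unfolding Dt_def w[OF that] using vector_derivative_at[OF 1[OF that]] by (simp add: \<phi>_def)
 have "((\<lambda>\<tau>. (1 / \<i>) * dd eS uu (x, \<tau>, \<eta>)) has_vector_derivative (1 / \<i>) * dd eS (dd eS uu) (x, t, \<eta>)) (at t)"
  by (rule has_vector_derivative_mult_right[OF line[OF Cinf_on_dd[OF Cinf_uu] t]])
 then have "((\<lambda>\<tau>. Dt u \<tau> (pt z)) has_vector_derivative (1 / \<i>) * dd eS (dd eS uu) (x, t, \<eta>)) (at t)"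
  by (rule has_vector_derivative_transform_within_open[OF _ open_greaterThan[of 0]]) (use t D1 in auto)
 from vector_derivative_at[OF this] show ?thesis
  unfolding Dt_def[of "Dt u"] zz fst_conv snd_conv w[OF t] by (simp add: zz)
qed

lemma partial_open:
 assumes "open I" "I \<subseteq> S" "r \<in> I"
 shows "partial S i f r = dd (axis i 1) f r"
 unfolding partial_def dd_def using at_within_open_subset[OF assms(3,1,2)] by simp

text \<open>Differentiation in the chart is carried over to (x, t, y) with t frozen. B names the
  coefficients by functions that are differentiable on R, which the raw expression in
  \<open>Gz\<close> does not display.\<close>

lemma laplacian_uu:
 assumes R: "open R" "R \<subseteq> NP" and B: "\<And>i j z. z \<in> R \<Longrightarrow> sqrt (det (Gz z)) * matrix_inv (Gz z) $ i $ j = B i j z"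
  and Bd: "\<And>i j z. z \<in> R \<Longrightarrow> B i j differentiable (at z)" and z: "z \<in> R"
 shows "laplacian g (cc c) (u (fst (snd z))) (pt z) =
  - (\<Sum>!i j. dd (dir i) (\<lambda>z. B i j z *\<^sub>R dd (dir j) uu z) z) / of_real (sqrt (det (Gz z)))"
proof -
 define t where "t = fst (snd z)"
 define j where "j = (\<lambda>r::real ^ 'n option. (r $ None, t, tpart r))"
 define q where "q = cons_coord (fst z) (snd (snd z))"
 have jq: "j q = z" by (cases z) (simp add: j_def q_def t_def)
 have cj: "continuous_on UNIV j" unfolding j_def
  by (intro continuous_intros linear_continuous_on[OF bounded_linear_tpart])
 define I where "I = j -` R"
 have I: "open I" "q \<in> I" unfolding I_def using open_vimage[OF R(1) cj] jq z by auto
 have jr: "r = cons_coord (fst (j r)) (snd (snd (j r)))" for r by (simp add: j_def cons_coord_tpart)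
 have jNN: "j r \<in> NN" if "r \<in> I" for r using that R by (auto simp: I_def)
 have IS: "I \<subseteq> cimg (cc c)"
 proof
  fix r assume r: "r \<in> I"
  have "cons_coord (fst (j r)) (snd (snd (j r))) \<in> cimg (cc c)"
   unfolding cimg_cc using NN_D[OF jNN[OF r]] by force
  then show "r \<in> cimg (cc c)" using jr by simp
 qed
 have cinvr: "cinv (cc c) r = pt (j r)" if "r \<in> I" for r using pt_cc(3)[OF jNN[OF that]] jr[of r] by simp
 have djr: "(j has_derivative (\<lambda>v. (v $ None, 0, tpart v))) (at r)" for r
  unfolding j_def
  by (intro has_derivative_Pair has_derivative_const bounded_linear_imp_has_derivative bounded_linear_vec_nth bounded_linear_tpart)
 have dir: "(axis i 1 $ None, 0, tpart (axis i 1)) = dir i" for i :: "'n option"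
  by (cases i) (auto simp: dir_def eX_def eH_def vec_eq_iff axis_def)
 have comp: "dd (axis i 1) (\<lambda>r. F (j r)) r = dd (dir i) F (j r)" if "F differentiable (at (j r))" for F :: "'n pt \<Rightarrow> complex" and i r
  using dd_eqI[OF has_derivative_compose[OF djr has_derivative_dd[OF that]], of "axis i 1"] unfolding dir .
 have ud: "uu differentiable (at (j r))" "dd v uu differentiable (at (j r))" if "r \<in> I" for r v
 proof -
  have "j r \<in> NP" using that R(2) unfolding I_def by blast
  then show "uu differentiable (at (j r))" "dd v uu differentiable (at (j r))"
   by (rule Cinf_on_differentiable[OF Cinf_uu] Cinf_on_differentiable[OF Cinf_on_dd[OF Cinf_uu]])+
 qed
 have P1: "partial (cimg (cc c)) k (u t \<circ> cinv (cc c)) r = dd (dir k) uu (j r)" if "r \<in> I" for k r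
 proof -
  have "partial (cimg (cc c)) k (u t \<circ> cinv (cc c)) r = dd (axis k 1) (u t \<circ> cinv (cc c)) r"
   by (rule partial_open[OF I(1) IS that])
  also have "\<dots> = dd (axis k 1) (\<lambda>r. uu (j r)) r"
   by (rule dd_cong_open[OF I(1) _ that]) (simp add: cinvr uu_def, simp add: j_def)
  also have "\<dots> = dd (dir k) uu (j r)" by (rule comp[OF ud(1)[OF that]])
  finally show ?thesis .
 qed
 have Gr: "(g (cc c) \<circ> cinv (cc c)) r = Gz (j r)" if "r \<in> I" for r
  using pt_cc(4)[OF jNN[OF that]] cinvr[OF that] by simp
 have P2: "partial (cimg (cc c)) i (\<lambda>r. of_real (sqrt (det ((g (cc c) \<circ> cinv (cc c)) r)) * matrix_inv ((g (cc c) \<circ> cinv (cc c)) r) $ i $ k)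
   * partial (cimg (cc c)) k (u t \<circ> cinv (cc c)) r) q = dd (dir i) (\<lambda>z. B i k z *\<^sub>R dd (dir k) uu z) z" for i k
 proof -
  have "partial (cimg (cc c)) i (\<lambda>r. of_real (sqrt (det ((g (cc c) \<circ> cinv (cc c)) r)) * matrix_inv ((g (cc c) \<circ> cinv (cc c)) r) $ i $ k)
   * partial (cimg (cc c)) k (u t \<circ> cinv (cc c)) r) q
   = dd (axis i 1) (\<lambda>r. of_real (sqrt (det ((g (cc c) \<circ> cinv (cc c)) r)) * matrix_inv ((g (cc c) \<circ> cinv (cc c)) r) $ i $ k)
   * partial (cimg (cc c)) k (u t \<circ> cinv (cc c)) r) q"
   by (rule partial_open[OF I(1) IS I(2)])
  also have "\<dots> = dd (axis i 1) (\<lambda>r. B i k (j r) *\<^sub>R dd (dir k) uu (j r)) q"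
  proof (rule dd_cong_open[OF I(1) _ I(2)])
   fix r assume r: "r \<in> I"
   then have "j r \<in> R" by (simp add: I_def)
   then show "of_real (sqrt (det ((g (cc c) \<circ> cinv (cc c)) r)) * matrix_inv ((g (cc c) \<circ> cinv (cc c)) r) $ i $ k)
    * partial (cimg (cc c)) k (u t \<circ> cinv (cc c)) r = B i k (j r) *\<^sub>R dd (dir k) uu (j r)"
    unfolding Gr[OF r] P1[OF r] B[OF \<open>j r \<in> R\<close>] by (simp add: scaleR_conv_of_real)
  qed
  also have "\<dots> = dd (dir i) (\<lambda>z. B i k z *\<^sub>R dd (dir k) uu z) (j q)"
   by (rule comp) (intro differentiable_scaleR ud I(2), use Bd[OF z] jq in simp)
  finally show ?thesis unfolding jq .
 qed
 have cq: "cmap (cc c) (pt z) = q" using pt_cc(1)[of z] z R by (auto simp: q_def)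
 show ?thesis
  unfolding laplacian_def Let_def t_def[symmetric] cq P2 Gr[OF I(2)] jq ..
qed

end

text \<open>The upper end is where the local expansion is made to stop; the lower end keeps s - ln x
  non-negative for all small x.\<close>

abbreviation "sbox s0 y0 r \<equiv> {s0 - 1<..<s0 + 1 :: real} \<times> ball y0 r"

text \<open>\<theta> is the minimum of the form over K times the unit sphere; homogeneity does the
  rest.\<close>

lemma uniform_ellipticity:
 fixes a :: "'n::finite \<Rightarrow> 'n \<Rightarrow> 'b::topological_space \<Rightarrow> real"
 assumes K: "compact K" "K \<noteq> {}" and a: "\<And>i j. continuous_on K (a i j)"
  and pos: "\<And>z v. z \<in> K \<Longrightarrow> v \<noteq> 0 \<Longrightarrow> 0 < (\<Sum>!i j. a i j z * (v :: real ^ 'n) $ i * v $ j)"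
 shows "\<exists>\<theta>>0. \<forall>z\<in>K. \<forall>\<xi>. \<theta> * sqn \<xi> \<le> qform a z \<xi>"
proof -
 define Q where "Q = (\<lambda>p. \<Sum>!i j. a i j (fst p) * (snd p :: real ^ 'n) $ i * snd p $ j)"
 have c: "continuous_on (K \<times> sphere 0 1) Q"
  unfolding Q_def by (intro continuous_intros continuous_on_compose2[OF a]) auto
 have "axis undefined 1 \<in> sphere (0 :: real ^ 'n) 1" by (simp add: norm_axis_1)
 then have ne: "K \<times> sphere (0 :: real ^ 'n) 1 \<noteq> {}" using K(2) by auto
 obtain p0 where p0: "p0 \<in> K \<times> sphere 0 1" "\<forall>p\<in>K \<times> sphere 0 1. Q p0 \<le> Q p"
  using continuous_attains_inf[OF compact_Times[OF K(1) compact_sphere] ne c] by (elim bexE)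
 have "snd p0 \<noteq> 0" "fst p0 \<in> K" using p0(1) by auto
 then have th: "0 < Q p0" unfolding Q_def by (intro pos)
 have "Q p0 * sqn \<xi> \<le> qform a z \<xi>" if z: "z \<in> K" for z \<xi>
 proof (cases "(\<chi> i. \<xi> i) = (0 :: real ^ 'n)")
  case True
  then have "\<xi> i = 0" for i by (simp add: vec_eq_iff)
  then show ?thesis by simp
 next
  case False
  define v where "v = (\<chi> i. \<xi> i)"
  have v: "0 < norm v" using False by (simp add: v_def)
  have "(z, (1 / norm v) *\<^sub>R v) \<in> K \<times> sphere 0 1" using z v by simp
  then have "Q p0 \<le> Q (z, (1 / norm v) *\<^sub>R v)" using p0(2) by blast
  also have "\<dots> = (1 / norm v)\<^sup>2 * qform a z \<xi>"
   unfolding Q_def sum_distrib_left by (intro sum.cong refl) (simp add: v_def power2_eq_square)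
  finally have "Q p0 * (norm v)\<^sup>2 \<le> qform a z \<xi>"
   using v by (simp add: field_simps)
  moreover have "(norm v)\<^sup>2 = sqn \<xi>"
   unfolding power2_norm_eq_inner by (simp add: inner_vec_def v_def power2_eq_square)
  ultimately show ?thesis by simp
 qed
 then show ?thesis using th by blast
qed

context wave_solution
begin

text \<open>Smoothness of h up to x = 0 supplies a local extension F across x = 0. V is shrunk so
  that the determinant stays positive also for x < 0, where F need not be a metric; powers of the
  determinant are then smooth on an open set containing the closed box.\<close>

lemma metric_extension:
 assumes eta: "\<eta>0 \<in> bimg c" and W0: "open W0" "(0, \<eta>0) \<in> W0"
 obtains x1 \<rho> V F where "0 < x1" "x1 \<le> 1" "x1 < \<epsilon>" "0 < \<rho>" "open V" "{0..x1} \<times> cball \<eta>0 \<rho> \<subseteq> V \<inter> W0"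
  "cball \<eta>0 \<rho> \<subseteq> bimg c" "Cinf_on V F" "\<And>p. p \<in> V \<Longrightarrow> 0 < det (product_metric_matrix (F p))"
  "\<And>x \<eta>. 0 \<le> x \<Longrightarrow> x \<le> x1 \<Longrightarrow> \<eta> \<in> cball \<eta>0 \<rho> \<Longrightarrow> F (x, \<eta>) = h x c (binv A c \<eta>) \<and> pos_def (F (x, \<eta>))"
proof -
 note fm = family[unfolded bdry_metric_family_def]
 have fam: "smooth_on ({0..<\<epsilon>} \<times> bimg c) (\<lambda>(x, \<eta>). h x c (binv A c \<eta>))"
  by (rule bspec[OF conjunct1[OF fm] c])
 have pd: "pos_def (h x c y)" if "x \<in> {0..<\<epsilon>}" "y \<in> bdom A c" for x y
  using conjunct1[OF conjunct2[OF fm]] c that by blast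
 have "(0, \<eta>0) \<in> {0..<\<epsilon>} \<times> bimg c" using eps eta by simp
 from bspec[OF fam[unfolded smooth_on_def] this]
 obtain V0 F where V0: "open V0" "(0, \<eta>0) \<in> V0" "\<forall>k. Ck_on k V0 F"
  "\<forall>q\<in>V0 \<inter> {0..<\<epsilon>} \<times> bimg c. F q = (case q of (x, \<eta>) \<Rightarrow> h x c (binv A c \<eta>))" by (elim exE conjE)
 have F: "Cinf_on V0 F" using V0(3) by (simp add: Cinf_on_def)
 have ext: "F (x, \<eta>) = h x c (binv A c \<eta>) \<and> pos_def (F (x, \<eta>))" if "(x, \<eta>) \<in> V0" "0 \<le> x" "x < \<epsilon>" "\<eta> \<in> bimg c" for x \<eta>
  using bspec[OF V0(4), of "(x, \<eta>)"] pd[of x "binv A c \<eta>"] binv(1)[OF c that(4)] that by simp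
 let ?D = "\<lambda>p. det (product_metric_matrix (F p))"
 have "continuous_on V0 ?D"
 proof (intro continuous_on_det)
  have "continuous_on V0 (\<lambda>p. product_metric_matrix (F p) $ i $ j)" for i j
   by (cases i; cases j; simp) (intro continuous_intros Cinf_on_continuous[OF F])
  then show "continuous_on V0 (\<lambda>p. product_metric_matrix (F p))"
   by (subst continuous_on_componentwise, auto simp: Basis_vec_def inner_axis)
 qed
 then have oV: "open (V0 \<inter> ?D -` {0<..})" using V0(1) by (intro continuous_open_preimage) auto
 define V where "V = V0 \<inter> ?D -` {0<..}"
 have "0 < ?D (0, \<eta>0)"     by (intro pos_def_det pos_def_product conjunct2[OF ext[OF V0(2)]]) (use eps eta in simp_all)
 then have V: "open V" "(0, \<eta>0) \<in> V" "V \<subseteq> V0" using oV V0(2) by (auto simp: V_def)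
 have "open (V \<inter> W0 \<inter> ({- \<epsilon><..<\<epsilon>} \<times> bimg c))" by (intro open_Int V W0 open_Times open_bimg c open_greaterThanLessThan)
 moreover have "(0, \<eta>0) \<in> V \<inter> W0 \<inter> ({- \<epsilon><..<\<epsilon>} \<times> bimg c)" using V W0 eps eta by simp
 ultimately obtain X Y where XY: "open X" "open Y" "(0, \<eta>0) \<in> X \<times> Y" "X \<times> Y \<subseteq> V \<inter> W0 \<inter> ({- \<epsilon><..<\<epsilon>} \<times> bimg c)"
  by (rule open_prod_elim)
 obtain e where e: "0 < e" "cball 0 e \<subseteq> X" using XY(1,3) by (auto simp: open_contains_cball)
 obtain \<rho> where \<rho>: "0 < \<rho>" "cball \<eta>0 \<rho> \<subseteq> Y" using XY(2,3) by (auto simp: open_contains_cball)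
 define x1 where "x1 = min e (min 1 (\<epsilon> / 2))"
 have x1: "0 < x1" "x1 \<le> 1" "x1 < \<epsilon>" "x1 \<le> e" using e eps by (auto simp: x1_def)
 have box: "(x, \<eta>) \<in> V \<inter> W0 \<inter> ({- \<epsilon><..<\<epsilon>} \<times> bimg c)" if "0 \<le> x" "x \<le> x1" "\<eta> \<in> cball \<eta>0 \<rho>" for x \<eta>
 proof -
  have "x \<in> X" using e(2) x1 that by (auto simp: dist_real_def)
  moreover have "\<eta> \<in> Y" using \<rho>(2) that by blast
  ultimately show ?thesis using XY(4) by blast
 qed
 show ?thesis
 proof (rule that[OF x1(1-3) \<rho>(1) V(1)])
  show "{0..x1} \<times> cball \<eta>0 \<rho> \<subseteq> V \<inter> W0" using box by auto
  show "cball \<eta>0 \<rho> \<subseteq> bimg c" using box[of 0] x1 by auto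
  show "Cinf_on V F" by (rule Cinf_on_subset[OF F V(3)])
  show "0 < ?D p" if "p \<in> V" for p using that by (simp add: V_def)
  show "F (x, \<eta>) = h x c (binv A c \<eta>) \<and> pos_def (F (x, \<eta>))" if "0 \<le> x" "x \<le> x1" "\<eta> \<in> cball \<eta>0 \<rho>" for x \<eta>
   using ext[of x \<eta>] box[OF that] that V(3) by auto
 qed
qed

text \<open>The closed support of f avoids the boundary, so the preimage of its complement under the
  collar coordinates is a neighbourhood of (0, \<eta>0), relative to x \<ge> 0.\<close>

lemma data_vanish:
 assumes f: "C0_infinity A f" and eta: "\<eta>0 \<in> bimg c"
 shows "\<exists>W0. open W0 \<and> (0, \<eta>0) \<in> W0 \<and> (\<forall>x \<eta>. (x, \<eta>) \<in> W0 \<longrightarrow> 0 < x \<longrightarrow> x < \<epsilon> \<longrightarrow> \<eta> \<in> bimg c \<longrightarrow> f (\<Phi> (x, binv A c \<eta>)) = 0)"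
proof -
 let ?K = "closure {z \<in> minterior A. f z \<noteq> 0}"
 define G where "G = (\<lambda>p. cinv (cc c) (cons_coord (fst p) (snd p)))"
 have Geq: "G (x, \<eta>) = \<Phi> (x, binv A c \<eta>)" if "0 \<le> x" "x < \<epsilon>" "\<eta> \<in> bimg c" for x \<eta>
  unfolding G_def using cinv_cc[OF c that] by simp
 have Gc: "continuous_on ({0..<\<epsilon>} \<times> bimg c) G"
  unfolding G_def
 proof (rule continuous_on_compose2[where g="cinv (cc c)"])
  show "continuous_on (cimg (cc c)) (cinv (cc c))"
   using chart_homeo(3)[OF collar_in[OF c]] by (rule homeomorphism_cont2)
  show "continuous_on ({0..<\<epsilon>} \<times> bimg c) (\<lambda>p. cons_coord (fst p) (snd p))"
   by (rule linear_continuous_on[OF bounded_linear_cons_coord])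
  show "(\<lambda>p. cons_coord (fst p) (snd p)) ` ({0..<\<epsilon>} \<times> bimg c) \<subseteq> cimg (cc c)"
   unfolding cimg_cc by force
 qed
 have y: "binv A c \<eta>0 \<in> mbdry A" by (rule bdom_mbdry[OF binv(1)[OF c eta]])
 then have "binv A c \<eta>0 \<notin> ?K" using f by (auto simp: C0_infinity_def minterior_def)
 then have G0: "G (0, \<eta>0) \<in> - ?K" using Geq[of 0 \<eta>0] eps eta Phi0[OF y] by simp
 have o: "open (- ?K)" by (rule open_Compl[OF closed_closure])
 have m: "(0, \<eta>0) \<in> {0..<\<epsilon>} \<times> bimg c" using eps eta by simp
 obtain W where W: "open W" "(0, \<eta>0) \<in> W" "\<forall>p\<in>{0..<\<epsilon>} \<times> bimg c. p \<in> W \<longrightarrow> G p \<in> - ?K"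
  using Gc[unfolded continuous_on_topological, rule_format, OF m o G0] by (elim exE conjE)
 have "f (\<Phi> (x, binv A c \<eta>)) = 0" if "(x, \<eta>) \<in> W" "0 < x" "x < \<epsilon>" "\<eta> \<in> bimg c" for x \<eta>
 proof -
  have "(x, \<eta>) \<in> {0..<\<epsilon>} \<times> bimg c" using that by simp
  then have "G (x, \<eta>) \<in> - ?K" using W(3) that(1) by blast
  then have "\<Phi> (x, binv A c \<eta>) \<notin> ?K" using Geq[of x \<eta>] that by simp
  then have "\<Phi> (x, binv A c \<eta>) \<notin> {z \<in> minterior A. f z \<noteq> 0}"      by (rule contra_subsetD[OF closure_subset])
  moreover have "\<Phi> (x, binv A c \<eta>) \<in> minterior A"
   using Phi_interior[OF _ that(3) bdom_mbdry[OF binv(1)[OF c that(4)]]] that(2) by simp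
  ultimately show ?thesis by simp
 qed
 then show ?thesis using W(1,2) by blast
qed

end

locale wave_problem = wave_solution A g \<epsilon> \<Phi> h h0 u c
 for A :: "('a::{t2_space,second_countable_topology}, 'n::finite) chart set" and g \<epsilon> \<Phi> h h0 u c +
 fixes f1 f2 :: "'a \<Rightarrow> complex"
 assumes f: "C0_infinity A f1" "C0_infinity A f2"
  and wave: "\<forall>t\<ge>0. \<forall>c\<in>A. \<forall>z\<in>cdom c \<inter> minterior A.
      Dt (Dt u) t z - laplacian g c (u t) z + of_real ((real CARD('n))\<^sup>2 / 4) * u t z = 0"
  and init1: "\<forall>z\<in>minterior A. u 0 z = f1 z" and init2: "\<forall>z\<in>minterior A. Dt u 0 z = f2 z"
begin

text \<open>\<open>Dt\<close> at t = 0 is a derivative within {0..}. A local smooth extension shows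
  that this one-sided derivative exists, and only then does the value of \<open>Dt\<close> determine
  it.\<close>

lemma initial_derivative:
 assumes z: "z \<in> NN" "fst (snd z) = 0" and f2: "f2 (pt z) = 0"
 shows "((\<lambda>\<tau>. uu (z + \<tau> *\<^sub>R eS)) has_vector_derivative 0) (at 0 within {0..})"
proof -
 have "z \<in> NN \<inter> {z. 0 \<le> fst (snd z)}" using z by simp
 from bspec[OF smooth_uu[unfolded smooth_on_def] this]
 obtain V F where V: "open V" "z \<in> V" "\<forall>k. Ck_on k V F" "\<forall>q\<in>V \<inter> (NN \<inter> {z. 0 \<le> fst (snd z)}). F q = uu q" by (elim exE conjE)
 have "Ck_on (Suc 0) V F" using V(3) by blast
 then have Fd: "F differentiable (at (z + 0 *\<^sub>R eS))" using V(2) by (simp add: Ck_on_Suc_iff del: split_paired_All)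
 have 1: "((\<lambda>\<tau>. F (z + \<tau> *\<^sub>R eS)) has_vector_derivative dd eS F z) (at 0 within {0..})"
  using dd_line_vector[OF Fd] by simp
 have o: "open {\<tau>::real. z + \<tau> *\<^sub>R eS \<in> V}"
  using open_vimage[OF V(1), of "\<lambda>\<tau>. z + \<tau> *\<^sub>R eS"] by (simp add: vimage_def continuous_intros)
 have "0 \<in> {\<tau>::real. z + \<tau> *\<^sub>R eS \<in> V}" using V(2) by simp
 from openE[OF o this] obtain e where e: "0 < e" "ball 0 e \<subseteq> {\<tau>. z + \<tau> *\<^sub>R eS \<in> V}" .
 have F: "F (z + \<tau> *\<^sub>R eS) = uu (z + \<tau> *\<^sub>R eS)" if "\<tau> \<in> {0..}" "dist \<tau> 0 < e" for \<tau>
 proof -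
  have "z + \<tau> *\<^sub>R eS \<in> V" using e(2) that(2) by (auto simp: dist_commute)
  moreover have "z + \<tau> *\<^sub>R eS \<in> NN \<inter> {z. 0 \<le> fst (snd z)}" using z that(1) by (cases z) (simp add: NN_def eS_def)
  ultimately show ?thesis using V(4) by blast
 qed
 have 2: "((\<lambda>\<tau>. uu (z + \<tau> *\<^sub>R eS)) has_vector_derivative dd eS F z) (at 0 within {0..})"
  by (rule has_vector_derivative_transform_within[OF 1 e(1)]) (use F in auto)
 have eq: "uu (z + \<tau> *\<^sub>R eS) = u \<tau> (pt z)" for \<tau> using z(2) by (cases z) (simp add: uu_def pt_def eS_def)
 have "vector_derivative (\<lambda>\<tau>. u \<tau> (pt z)) (at 0 within {0..}) = dd eS F z"
  using 2 unfolding eq by (intro vector_derivative_within) (simp_all add: at_within_Ici_at_right)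
 moreover have "Dt u 0 (pt z) = 0" using init2 pt_cc(2)[OF z(1)] f2 by simp
 ultimately have "dd eS F z = 0" by (simp add: Dt_def)
 then show ?thesis using 2 by simp
qed

text \<open>The equation has real coefficients, so it passes to L u for every real-linear functional
  L; the real and imaginary parts are the cases of interest. Most of the work brings the Laplacian
  of the product metric into the form \<open>pde\<close>.\<close>

lemma expansion_linear:
 fixes L :: "complex \<Rightarrow> real"
 assumes l: "bounded_linear L" and eta: "\<eta>0 \<in> bimg c"
 shows "\<exists>\<delta> r W. 0 < \<delta> \<and> 0 < r \<and> ball \<eta>0 r \<subseteq> bimg c \<and> (\<forall>k. Cinf_on (sbox s0 \<eta>0 r) (W k)) \<and>
   (\<forall>N. \<exists>C. rexp_bound \<delta> (sbox s0 \<eta>0 r) (\<lambda>x q. x powr (- real CARD('n) / 2) * L (u (fst q - ln x) (\<Phi> (x, binv A c (snd q))))) W N C)"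
proof -
 obtain Wa where Wa: "open Wa" "(0, \<eta>0) \<in> Wa" "\<forall>x \<eta>. (x, \<eta>) \<in> Wa \<longrightarrow> 0 < x \<longrightarrow> x < \<epsilon> \<longrightarrow> \<eta> \<in> bimg c \<longrightarrow> f1 (\<Phi> (x, binv A c \<eta>)) = 0"
  using data_vanish[OF f(1) eta] by (elim exE conjE)
 obtain Wb where Wb: "open Wb" "(0, \<eta>0) \<in> Wb" "\<forall>x \<eta>. (x, \<eta>) \<in> Wb \<longrightarrow> 0 < x \<longrightarrow> x < \<epsilon> \<longrightarrow> \<eta> \<in> bimg c \<longrightarrow> f2 (\<Phi> (x, binv A c \<eta>)) = 0"
  using data_vanish[OF f(2) eta] by (elim exE conjE)
 have W0: "open (Wa \<inter> Wb)" "(0, \<eta>0) \<in> Wa \<inter> Wb" using Wa Wb by auto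
 obtain x1 \<rho> V F where x1: "0 < x1" "x1 \<le> 1" "x1 < \<epsilon>" and \<rho>: "0 < \<rho>" and V: "open V" "{0..x1} \<times> cball \<eta>0 \<rho> \<subseteq> V \<inter> (Wa \<inter> Wb)"
  "cball \<eta>0 \<rho> \<subseteq> bimg c" and F: "Cinf_on V F" "\<And>p. p \<in> V \<Longrightarrow> 0 < det (product_metric_matrix (F p))"
  "\<And>x \<eta>. 0 \<le> x \<Longrightarrow> x \<le> x1 \<Longrightarrow> \<eta> \<in> cball \<eta>0 \<rho> \<Longrightarrow> F (x, \<eta>) = h x c (binv A c \<eta>) \<and> pos_def (F (x, \<eta>))"
  by (rule metric_extension[OF eta W0]) (rule that)
 define m where "m = real CARD('n)"
 define \<pi> where "\<pi> = (\<lambda>z::'n pt. (fst z, snd (snd z)))"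
 have pi: "bounded_linear \<pi>" unfolding \<pi>_def
  by (intro bounded_linear_Pair bounded_linear_fst bounded_linear_compose[OF bounded_linear_snd bounded_linear_snd])
 define \<Omega>' where "\<Omega>' = \<pi> -` V"
 have \<Omega>': "open \<Omega>'" unfolding \<Omega>'_def by (rule open_linear_vimage[OF pi V(1)])
 have K: "{0..x1} \<times> UNIV \<times> cball \<eta>0 \<rho> \<subseteq> \<Omega>'" using V(2) by (auto simp: \<Omega>'_def \<pi>_def)
 define M where "M = (\<lambda>z. product_metric_matrix (F (\<pi> z)))"
 define D where "D = (\<lambda>z. det (M z))"
 \<comment> \<open>The volume density without its power of x; d is its square root. S = d^2 is the
   source of the term with \<open>dd eX d z * inverse (d z)\<close> in \<open>pde\<close>.\<close>
 define S where "S = (\<lambda>z. D z powr (1 / 2))"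
 define d where "d = (\<lambda>z. D z powr (1 / 4))"
 define P where "P = (\<lambda>z. matrix_inv (M z))"
 define a where "a = (\<lambda>i j z. P z $ Some i $ Some j)"
 \<comment> \<open>First-order coefficients left by the divergence form, in which the derivative
   falls on S a_ij.\<close>
 define e where "e = (\<lambda>j z. inverse (S z) * (\<Sum>!i. dd (eH i) (\<lambda>z. S z * a i j z) z))"
 have Dpos: "0 < D z" if "z \<in> \<Omega>'" for z using F(2) that by (simp add: D_def M_def \<Omega>'_def)
 have CF: "Cinf_on \<Omega>' (\<lambda>z. F (\<pi> z) $ i $ j)" for i j
 proof -
  have "Cinf_on \<Omega>' (\<lambda>z. F (\<pi> z))" unfolding Cinf_on_def \<Omega>'_def
   by (intro allI Ck_on_linear_comp[OF pi V(1)]) (use F(1) in \<open>simp add: Cinf_on_def\<close>)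
  then show ?thesis
   by (rule Cinf_on_bounded_linear[OF \<Omega>' bounded_linear_compose[OF bounded_linear_vec_nth bounded_linear_vec_nth]])
 qed
 have CM: "Cinf_on \<Omega>' (\<lambda>z. M z $ i $ j)" for i j
  unfolding M_def by (cases i; cases j) (simp_all add: CF)
 have CD: "Cinf_on \<Omega>' D" unfolding D_def by (rule Cinf_on_det[OF \<Omega>' CM])
 have CS: "Cinf_on \<Omega>' S" and Cd: "Cinf_on \<Omega>' d" unfolding S_def d_def
  by (rule Cinf_on_compose_real(1)[OF \<Omega>' CD Dpos], assumption)+
 have CP: "Cinf_on \<Omega>' (\<lambda>z. P z $ i $ j)" for i j unfolding P_def
  by (rule Cinf_on_matrix_inv[OF \<Omega>' CM]) (use Dpos in \<open>simp add: D_def\<close>)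
 then have Ca: "Cinf_on \<Omega>' (a i j)" for i j unfolding a_def .
 have Spos: "0 < S z" and dpos: "0 < d z" if "z \<in> \<Omega>'" for z using Dpos[OF that] by (simp_all add: S_def d_def)
 have Ce: "Cinf_on \<Omega>' (e j)" for j unfolding e_def
  by (intro Cinf_on_mult \<Omega>' Cinf_on_compose_real(3)[OF \<Omega>' CS Spos] Cinf_on_sum Cinf_on_dd CS Ca)
 have sM: "sinv M" by (simp add: sinv_def M_def \<pi>_def)
 have sS: "sinv S" and sd: "sinv d" and sa: "sinv (a i j)" for i j
  unfolding S_def d_def a_def P_def D_def by (rule sinv_compose[OF sM])+
 note sSa = sinv_dd[OF sinv_compose2[OF sS sa, of "(*)"]]
 have se: "sinv (e j)" for j unfolding sinv_def e_def
  by (intro allI arg_cong2[where f="(*)"] arg_cong[where f=inverse] sum.cong refl)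
    (rule sS[unfolded sinv_def, rule_format], rule sSa[unfolded sinv_def, rule_format])
 have regK: "0 < fst z \<and> fst z \<le> x1 \<and> snd (snd z) \<in> cball \<eta>0 \<rho> \<and> z \<in> \<Omega>'" if "z \<in> reg x1 \<rho> \<eta>0" for z
  using that K by (cases z) (auto simp: reg_def)
 have pdM: "pos_def (M z)" if "0 \<le> fst z" "fst z \<le> x1" "snd (snd z) \<in> cball \<eta>0 \<rho>" for z
  unfolding M_def \<pi>_def by (rule pos_def_product, rule conjunct2[OF F(3)]) (use that in auto)
 have Pv: "cons_coord 0 v \<bullet> (P z *v cons_coord 0 v) = (\<Sum>!i j. a i j z * v $ i * v $ j)" for z v
  by (simp add: inner_vec_def matrix_vector_mult_def sum_option a_def sum_distrib_left mult_ac)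
 \<comment> \<open>On the slice s = 0, in order to have a compact set; independence of s extends the
   bound to the region.\<close>
 have "\<exists>\<theta>>0. \<forall>z\<in>{0..x1} \<times> {0::real} \<times> cball \<eta>0 \<rho>. \<forall>\<xi>. \<theta> * sqn \<xi> \<le> qform a z \<xi>"
 proof (rule uniform_ellipticity)
  show "compact ({0..x1} \<times> {0::real} \<times> cball \<eta>0 \<rho>)" by (intro compact_Times) auto
  show "{0..x1} \<times> {0::real} \<times> cball \<eta>0 \<rho> \<noteq> {}" using x1 \<rho> by auto
  show "continuous_on ({0..x1} \<times> {0::real} \<times> cball \<eta>0 \<rho>) (a i j)" for i j
   by (rule continuous_on_subset[OF Cinf_on_continuous[OF Ca]]) (use K in auto)
  fix z :: "'n pt" and v :: "real ^ 'n" assume z: "z \<in> {0..x1} \<times> {0::real} \<times> cball \<eta>0 \<rho>" and v: "v \<noteq> 0"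
  have "pos_def (M z)" by (rule pdM) (use z in auto)
  then have "pos_def (P z)" unfolding P_def by (rule pos_def_inv)
  moreover have "cons_coord 0 v \<noteq> 0" using v by (metis cons_coord_simps(2) vec_eq_iff zero_index)
  ultimately show "0 < (\<Sum>!i j. a i j z * v $ i * v $ j)" unfolding Pv[symmetric] by (simp add: pos_def_def)
 qed
 then obtain \<theta> where \<theta>: "0 < \<theta>" "\<forall>z\<in>{0..x1} \<times> {0::real} \<times> cball \<eta>0 \<rho>. \<forall>\<xi>. \<theta> * sqn \<xi> \<le> qform a z \<xi>"
  by (elim exE conjE)
 have ell: "\<theta> * sqn \<xi> \<le> qform a z \<xi>" if z: "z \<in> reg x1 \<rho> \<eta>0" for z \<xi>
 proof -
  obtain x s \<eta> where zz: "z = (x, s, \<eta>)" by (cases z)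
  have "a i j z = a i j (x, 0, \<eta>)" for i j using sa[unfolded sinv_def, rule_format] by (simp add: zz)
  moreover have "(x, 0, \<eta>) \<in> {0..x1} \<times> {0::real} \<times> cball \<eta>0 \<rho>" using regK[OF z] by (simp add: zz)
  ultimately show ?thesis using \<theta>(2) by simp
 qed
 have sym: "a i j z = a j i z" if z: "z \<in> reg x1 \<rho> \<eta>0" for i j z
 proof -
  have "pos_def (P z)" unfolding P_def by (rule pos_def_inv, rule pdM) (use regK[OF z] in auto)
  then have "transpose (P z) = P z" by (simp add: pos_def_def)
  then have "transpose (P z) $ Some i $ Some j = P z $ Some i $ Some j" by simp
  then show ?thesis by (simp add: transpose_def a_def)
 qed
 interpret mw: model_wave x1 \<rho> \<theta> m \<eta>0 \<Omega>' a e d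
  by unfold_locales (fact x1 \<rho> \<theta> \<Omega>' K Ca sa Ce se Cd sd dpos sym ell)+
 define U where "U = (\<lambda>z. L (uu z))"
 have regNN: "z \<in> NN" if "z \<in> reg x1 \<rho> \<eta>0" for z
  using regK[OF that] x1 V(3) by (cases z) (auto simp: NN_def)
 have data: "f1 (pt z) = 0" "f2 (pt z) = 0" if z: "z \<in> reg x1 \<rho> \<eta>0" for z
 proof -
  have "\<pi> z \<in> Wa \<inter> Wb" using regK[OF z] V(2) by (cases z) (auto simp: \<pi>_def)
  then show "f1 (pt z) = 0" "f2 (pt z) = 0"
   using Wa(3) Wb(3) regK[OF z] NN_D[OF regNN[OF z]] by (auto simp: \<pi>_def pt_def)
 qed
 have smooth: "smooth_on (reg x1 \<rho> \<eta>0 \<inter> {z. 0 \<le> fst (snd z)}) U"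
  unfolding U_def by (rule smooth_on_subset[OF smooth_on_bounded_linear[OF l smooth_uu]]) (use regNN in auto)
 have init: "U z = 0" if z: "z \<in> reg x1 \<rho> \<eta>0" "fst (snd z) = 0" for z
 proof -
  have "u 0 (pt z) = 0" using init1 pt_cc(2)[OF regNN[OF z(1)]] data(1)[OF z(1)] by simp
  then show ?thesis using z(2) by (simp add: U_def uu_def linear_0 bounded_linear.linear[OF l])
 qed
 have init': "((\<lambda>\<tau>. U (z + \<tau> *\<^sub>R eS)) has_real_derivative 0) (at 0 within {0..})" if z: "z \<in> reg x1 \<rho> \<eta>0" "fst (snd z) = 0" for z
  using bounded_linear.has_vector_derivative[OF l initial_derivative[OF regNN[OF z(1)] z(2) data(2)[OF z(1)]]]
  by (simp add: U_def has_real_derivative_iff_has_vector_derivative linear_0 bounded_linear.linear[OF l])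
 have eq: "dd eS (dd eS U) z = mw.pde U z" if z: "z \<in> reg x1 \<rho> \<eta>0" "0 < fst (snd z)" for z
 proof -
  let ?R = "reg x1 \<rho> \<eta>0 \<inter> {z. 0 < fst (snd z)}"
  have R: "open ?R" by (intro open_Int open_reg open_Collect_less continuous_intros)
  have RNP: "?R \<subseteq> NP" using regNN by blast
  have zR: "z \<in> ?R" using z by simp
  have R\<Omega>: "?R \<subseteq> \<Omega>'" using regK by blast
  have xpos: "0 < fst z" if "z \<in> ?R" for z using regK[of z] that by simp
  \<comment> \<open>For x^(-2) times M, in dimension n + 1, the volume density is x^(-1-n) S and the
    inverse has the factor x^2, which together give x^(1-n); m is n.\<close>
  define B where "B = (\<lambda>i j z. fst z powr (1 - m) * (S z * P z $ i $ j))"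
  define Q where "Q = (\<lambda>z::'n pt. fst z powr (- 1 - m))"
  have GM: "Gz z = (1 / (fst z)\<^sup>2) *\<^sub>R M z" if "z \<in> ?R" for z
   using F(3)[of "fst z" "snd (snd z)"] regK[of z] that by (simp add: Gz_def M_def \<pi>_def)
  have sq: "sqrt (det (Gz z)) = Q z * S z" if "z \<in> ?R" for z
  proof -
   have "det (Gz z) = ((1 / fst z) ^ Suc CARD('n))\<^sup>2 * D z"
    unfolding GM[OF that] det_scaleR_matrix D_def by (simp add: power_mult_distrib power_divide power_mult[symmetric] mult.commute)
   then have "sqrt (det (Gz z)) = (1 / fst z) ^ Suc CARD('n) * sqrt (D z)"
    using xpos[OF that] by (simp only: real_sqrt_mult real_sqrt_abs) simp
   moreover have "fst z powr (- 1 - m) = (1 / fst z) ^ Suc CARD('n)"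
   proof -
    have "fst z powr (- 1 - m) = fst z powr (- real (Suc CARD('n)))" by (simp add: m_def)
    also have "\<dots> = inverse (fst z ^ Suc CARD('n))" using xpos[OF that] by (simp only: powr_minus powr_realpow)
    finally show ?thesis by (simp add: power_one_over inverse_eq_divide)
   qed
   moreover have "sqrt (D z) = S z" using Dpos[of z] that R\<Omega> by (auto simp: S_def powr_half_sqrt)
   ultimately show ?thesis by (simp add: Q_def)
  qed
  have x2Q: "fst z powr (1 - m) = fst z * fst z * Q z" "fst z powr (1 - m - 1) = fst z * Q z" if "z \<in> ?R" for z
   using xpos[OF that] by (simp_all add: Q_def powr_diff powr_minus field_simps power2_eq_square)
  have BB: "sqrt (det (Gz z)) * matrix_inv (Gz z) $ i $ j = B i j z" if "z \<in> ?R" for i j z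
  proof -
   have "det (M z) \<noteq> 0" using Dpos[of z] that R\<Omega> by (auto simp: D_def)
   then have "matrix_inv (Gz z) = (fst z)\<^sup>2 *\<^sub>R P z"
    unfolding GM[OF that] using xpos[OF that] by (subst matrix_inv_scaleR) (auto simp: P_def)
   then show ?thesis unfolding sq[OF that] B_def x2Q[OF that] by (simp add: power2_eq_square)
  qed
  have dS: "S differentiable (at z)" and dP: "(\<lambda>z. P z $ k $ l) differentiable (at z)" and da: "a i j differentiable (at z)"
   and dd: "d differentiable (at z)" if "z \<in> ?R" for z k l i j
   using that R\<Omega> Cinf_on_differentiable[OF CS] Cinf_on_differentiable[OF CP] Cinf_on_differentiable[OF Ca] Cinf_on_differentiable[OF Cd] by blast+
  have Bd: "B i j differentiable (at z)" if "z \<in> ?R" for i j z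
   unfolding B_def by (intro differentiable_mult dd_fst_powr xpos dS dP that)
  have du: "uu differentiable (at z)" "dd v uu differentiable (at z)" if "z \<in> ?R" for z v
   using that RNP Cinf_on_differentiable[OF Cinf_uu] Cinf_on_differentiable[OF Cinf_on_dd[OF Cinf_uu]] by blast+
  have U1: "dd v U z = L (dd v uu z)" if "z \<in> ?R" for z v
   unfolding U_def by (rule dd_bounded_linear[OF l du(1)[OF that]])
  have dU: "dd v U differentiable (at z)" if "z \<in> ?R" for z v
   by (rule differentiable_cong_open[OF R _ that differentiable_bounded_linear[OF l du(2)[OF that, of v]]]) (simp add: U1)
  have U2: "dd v (dd w U) z = L (dd v (dd w uu) z)" for v w
  proof -
   have "dd v (dd w U) z = dd v (\<lambda>z. L (dd w uu z)) z" by (rule dd_cong_open[OF R U1 zR])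
   also have "\<dots> = L (dd v (dd w uu) z)" by (rule dd_bounded_linear[OF l du(2)[OF zR]])
   finally show ?thesis .
  qed
  define T where "T = (\<lambda>i j. dd (dir i) (\<lambda>z. B i j z * dd (dir j) U z) z)"
  have LT: "L (dd (dir i) (\<lambda>z. B i j z *\<^sub>R dd (dir j) uu z) z) = T i j" for i j
  proof -
   have "L (dd (dir i) (\<lambda>z. B i j z *\<^sub>R dd (dir j) uu z) z) = dd (dir i) (\<lambda>z. L (B i j z *\<^sub>R dd (dir j) uu z)) z"
    by (rule dd_bounded_linear[OF l, symmetric]) (intro differentiable_scaleR Bd du zR)
   also have "\<dots> = T i j"
    unfolding T_def by (rule dd_cong_open[OF R _ zR]) (simp add: U1 linear_scale[OF bounded_linear.linear[OF l]])
   finally show ?thesis .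
  qed
  have Spz: "0 < S z" "0 < d z" using Spos[of z] dpos[of z] zR R\<Omega> by auto
  have Qz: "0 < Q z" using xpos[OF zR] by (simp add: Q_def)
  define \<sigma> where "\<sigma> = Q z * S z"
  have lap: "L (laplacian g (cc c) (u (fst (snd z))) (pt z)) = - (\<Sum>!i j. T i j) / \<sigma>"
  proof -
   have "laplacian g (cc c) (u (fst (snd z))) (pt z) = (- 1 / \<sigma>) *\<^sub>R (\<Sum>!i j. dd (dir i) (\<lambda>z. B i j z *\<^sub>R dd (dir j) uu z) z)"
   proof -
    have "laplacian g (cc c) (u (fst (snd z))) (pt z) =
     - (\<Sum>!i j. dd (dir i) (\<lambda>z. B i j z *\<^sub>R dd (dir j) uu z) z) / of_real (sqrt (det (Gz z)))"
     by (rule laplacian_uu[OF R RNP BB Bd zR])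
    then show ?thesis unfolding sq[OF zR] \<sigma>_def[symmetric] scaleR_conv_of_real[of "- 1 / \<sigma>"] by simp
   qed
   then have "L (laplacian g (cc c) (u (fst (snd z))) (pt z)) = (- 1 / \<sigma>) * L (\<Sum>!i j. dd (dir i) (\<lambda>z. B i j z *\<^sub>R dd (dir j) uu z) z)"
    by (simp only: linear_scale[OF bounded_linear.linear[OF l]] real_scaleR_def)
   also have "L (\<Sum>!i j. dd (dir i) (\<lambda>z. B i j z *\<^sub>R dd (dir j) uu z) z) = (\<Sum>!i j. T i j)"
    by (simp only: linear_sum[OF bounded_linear.linear[OF l]] LT)
   finally show ?thesis by simp
  qed
  have "Dt (Dt u) (fst (snd z)) (pt z) - laplacian g (cc c) (u (fst (snd z))) (pt z) + of_real (m\<^sup>2 / 4) * u (fst (snd z)) (pt z) = 0"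
   unfolding m_def using wave collar_in[OF c] pt_cc(2)[OF regNN[OF z(1)]] z(2) less_imp_le by blast
  then have "- dd eS (dd eS uu) z - laplacian g (cc c) (u (fst (snd z))) (pt z) + (m\<^sup>2 / 4) *\<^sub>R uu z = 0"
   using Dt_Dt[of z] zR RNP by (auto simp: scaleR_conv_of_real uu_def)
  then have "L (- dd eS (dd eS uu) z - laplacian g (cc c) (u (fst (snd z))) (pt z) + (m\<^sup>2 / 4) *\<^sub>R uu z) = 0"
   by (simp add: linear_0[OF bounded_linear.linear[OF l]])
  then have main: "dd eS (dd eS U) z = m\<^sup>2 / 4 * U z + (\<Sum>!i j. T i j) / \<sigma>"
   unfolding U2 by (simp add: linear_add[OF bounded_linear.linear[OF l]] linear_diff[OF bounded_linear.linear[OF l]]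
     linear_neg[OF bounded_linear.linear[OF l]] linear_scale[OF bounded_linear.linear[OF l]] lap U_def)
  have PN: "P z $ None $ None = 1" "P z $ None $ Some j = 0" "P z $ Some i $ None = 0" if "z \<in> ?R" for z i j
   unfolding P_def M_def
   by (rule inv_product_metric_matrix; use Dpos[of z] that R\<Omega> in \<open>force simp: D_def M_def\<close>)+
  have T0: "T None (Some j) = 0" "T (Some i) None = 0" for i j
   unfolding T_def by (rule dd_zero_open[OF R _ zR]; simp add: B_def PN)+
  have TN: "T None None = fst z * fst z * Q z * (dd eX S z * dd eX U z + S z * dd eX (dd eX U) z)
    + (1 - m) * (fst z * Q z) * (S z * dd eX U z)"
  proof -
   have "T None None = dd eX (\<lambda>z. fst z powr (1 - m) * (S z * dd eX U z)) z"
    unfolding T_def dir_def option.case by (rule dd_cong_open[OF R _ zR]) (simp add: B_def PN)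
   also have "\<dots> = (1 - m) * fst z powr (1 - m - 1) * (S z * dd eX U z) + fst z powr (1 - m) * (dd eX S z * dd eX U z + S z * dd eX (dd eX U) z)"
    using dd_mult[OF dd_fst_powr(1)[OF xpos[OF zR]] differentiable_mult[OF dS[OF zR] dU[OF zR]]]
     dd_mult[OF dS[OF zR] dU[OF zR]] dd_fst_powr(2)[OF xpos[OF zR], of eX "1 - m"] by (simp add: eX_def)
   finally show ?thesis unfolding x2Q[OF zR] by simp
  qed
  have TS: "T (Some i) (Some j) = fst z * fst z * Q z * (dd (eH i) (\<lambda>z. S z * a i j z) z * dd (eH j) U z + S z * a i j z * dd (eH i) (dd (eH j) U) z)" for i j
  proof -
   have dSa: "(\<lambda>z. S z * a i j z) differentiable (at z)" by (intro differentiable_mult dS da zR)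
   have "T (Some i) (Some j) = dd (eH i) (\<lambda>z. fst z powr (1 - m) * ((S z * a i j z) * dd (eH j) U z)) z"
    unfolding T_def dir_def option.case by (rule dd_cong_open[OF R _ zR]) (simp add: B_def a_def)
   also have "\<dots> = fst z powr (1 - m) * (dd (eH i) (\<lambda>z. S z * a i j z) z * dd (eH j) U z + S z * a i j z * dd (eH i) (dd (eH j) U) z)"
    using dd_mult[OF dd_fst_powr(1)[OF xpos[OF zR]] differentiable_mult[OF dSa dU[OF zR]]]
     dd_mult[OF dSa dU[OF zR]] dd_fst_powr(2)[OF xpos[OF zR], of "eH i" "1 - m"] by (simp add: eH_def)
   finally show ?thesis unfolding x2Q[OF zR] .
  qed
  have Sx: "dd eX S z = 2 * (d z * dd eX d z)"
  proof -
   have "dd eX S z = dd eX (\<lambda>z. d z * d z) z"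
    by (rule dd_cong_open[OF R _ zR]) (simp add: S_def d_def powr_add[symmetric])
   then show ?thesis using dd_mult[OF dd[OF zR] dd[OF zR], of eX] by simp
  qed
  have Sdd: "S z = d z * d z" by (simp add: S_def d_def powr_add[symmetric])
  define E where "E = (\<Sum>!j. e j z * dd (eH j) U z)"
  define A2 where "A2 = (\<Sum>!i j. a i j z * dd (eH i) (dd (eH j) U) z)"
  have sumT: "(\<Sum>!i j. T i j) = T None None + fst z * fst z * Q z * (S z * E + S z * A2)"
  proof -
   have "S z * E = (\<Sum>!j. (\<Sum>!i. dd (eH i) (\<lambda>z. S z * a i j z) z) * dd (eH j) U z)"
    unfolding E_def sum_distrib_left using Spz by (intro sum.cong refl) (simp add: e_def)
   also have "\<dots> = (\<Sum>!i j. dd (eH i) (\<lambda>z. S z * a i j z) z * dd (eH j) U z)"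
    unfolding sum_distrib_right by (rule sum.swap)
   finally have 1: "(\<Sum>!i j. dd (eH i) (\<lambda>z. S z * a i j z) z * dd (eH j) U z) = S z * E" ..
   have 2: "(\<Sum>!i j. S z * a i j z * dd (eH i) (dd (eH j) U) z) = S z * A2"
    unfolding A2_def sum_distrib_left by (simp add: mult.assoc)
   show ?thesis unfolding sum_option T0 TS sum_distrib_left[symmetric] sum.distrib 1 2 by simp
  qed
  have "(\<Sum>!i j. T i j) = \<sigma> * ((fst z)\<^sup>2 * dd eX (dd eX U) z + (1 - m) * fst z * dd eX U z
    + 2 * (fst z)\<^sup>2 * (dd eX d z * inverse (d z)) * dd eX U z + (fst z)\<^sup>2 * (A2 + E))"
   unfolding sumT TN Sx \<sigma>_def Sdd power2_eq_square using Spz(2) by (simp add: field_simps)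
  moreover have "\<sigma> \<noteq> 0" using Qz Spz by (simp add: \<sigma>_def)
  ultimately have "(\<Sum>!i j. T i j) / \<sigma> = (fst z)\<^sup>2 * dd eX (dd eX U) z + (1 - m) * fst z * dd eX U z
    + 2 * (fst z)\<^sup>2 * (dd eX d z * inverse (d z)) * dd eX U z + (fst z)\<^sup>2 * (A2 + E)" by simp
  then show ?thesis unfolding main mw.pde_def A2_def E_def by simp
 qed
 have "\<exists>\<delta> r W. 0 < \<delta> \<and> 0 < r \<and> r \<le> \<rho> \<and> (\<forall>k. Cinf_on ({..<s0 + 1} \<times> ball \<eta>0 r) (W k)) \<and>
   (\<forall>N. \<exists>C. rexp_bound \<delta> ({..<s0 + 1} \<times> ball \<eta>0 r) (\<lambda>x q. x powr (- m / 2) * mw.Ue U (kap (x, q))) W N C)"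
  by (rule mw.local_expansion[OF smooth init init' eq])
 then obtain \<delta> r W where W: "0 < \<delta>" "0 < r" "r \<le> \<rho>" "\<forall>k. Cinf_on ({..<s0 + 1} \<times> ball \<eta>0 r) (W k)"
   "\<forall>N. \<exists>C. rexp_bound \<delta> ({..<s0 + 1} \<times> ball \<eta>0 r) (\<lambda>x q. x powr (- m / 2) * mw.Ue U (kap (x, q))) W N C"
  by (elim exE conjE)
 have UeD: "mw.Ue U z = (if 0 \<le> fst (snd z) then U z else 0)" for z by (rule mw.Ue_def[OF smooth init init' eq])
 \<comment> \<open>For s > s0 - 1 and x \<le> e^(s0 - 1) the time s - ln x is not negative, so the
   zero extension coincides with the solution.\<close>
 define \<delta>' where "\<delta>' = min \<delta> (exp (s0 - 1))"
 have Ue: "mw.Ue U (kap (x, q)) = L (u (fst q - ln x) (\<Phi> (x, binv A c (snd q))))"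
  if "q \<in> sbox s0 \<eta>0 r" "0 < x" "x \<le> \<delta>'" for x q
 proof -
  have "ln x \<le> ln (exp (s0 - 1))" using that by (subst ln_le_cancel_iff) (auto simp: \<delta>'_def)
  then have "0 \<le> fst q - ln x" using that by auto
  then show ?thesis unfolding UeD by (simp add: kap_def U_def uu_def pt_def)
 qed
 show ?thesis
 proof (rule exI[of _ \<delta>'], rule exI[of _ r], rule exI[of _ W], intro conjI allI)
  show "0 < \<delta>'" "0 < r" using W by (auto simp: \<delta>'_def)
  show "ball \<eta>0 r \<subseteq> bimg c" using V(3) W(3) by auto
  show "Cinf_on (sbox s0 \<eta>0 r) (W k)" for k
   by (rule Cinf_on_subset[OF spec[OF W(4)]]) auto
  fix N
  obtain C where C: "rexp_bound \<delta> ({..<s0 + 1} \<times> ball \<eta>0 r) (\<lambda>x q. x powr (- m / 2) * mw.Ue U (kap (x, q))) W N C" using spec[OF W(5), of N] by (rule exE)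
  show "\<exists>C. rexp_bound \<delta>' (sbox s0 \<eta>0 r) (\<lambda>x q. x powr (- real CARD('n) / 2) * L (u (fst q - ln x) (\<Phi> (x, binv A c (snd q))))) W N C"
  proof (intro exI[of _ C] ballI allI impI)
   fix q x assume q: "q \<in> sbox s0 \<eta>0 r" "0 < x" "x \<le> \<delta>'"
   have "q \<in> {..<s0 + 1} \<times> ball \<eta>0 r" "x \<le> \<delta>" using q by (auto simp: \<delta>'_def)
   then show "\<bar>x powr (- real CARD('n) / 2) * L (u (fst q - ln x) (\<Phi> (x, binv A c (snd q)))) - (\<Sum>k\<le>N. W k q * x ^ k)\<bar> \<le> C * x ^ (N + 1)"
    using C[rule_format, of q x] q(2) unfolding Ue[OF q] m_def by blast
  qed
 qed
qed

end

section \<open>Gluing the local expansions\<close>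

abbreviation cexp_bound :: "real \<Rightarrow> 'q set \<Rightarrow> (real \<Rightarrow> 'q \<Rightarrow> complex) \<Rightarrow> (nat \<Rightarrow> 'q \<Rightarrow> complex) \<Rightarrow> nat \<Rightarrow> real \<Rightarrow> bool" where
 "cexp_bound \<delta> Q v W N C \<equiv> \<forall>q\<in>Q. \<forall>x. 0 < x \<longrightarrow> x \<le> \<delta> \<longrightarrow> norm (v x q - (\<Sum>k\<le>N. W k q * of_real (x ^ k))) \<le> C * x ^ (N + 1)"

text \<open>The pointwise notion, for fixed (s, y); it already determines the coefficients.\<close>

definition is_expansion :: "(real \<Rightarrow> complex) \<Rightarrow> (nat \<Rightarrow> complex) \<Rightarrow> bool" where
 "is_expansion f W \<longleftrightarrow> (\<forall>N. \<exists>C. \<forall>\<^sub>F x in at_right 0. norm (f x - (\<Sum>k\<le>N. W k * of_real (x ^ k))) \<le> C * x ^ (N + 1))"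

text \<open>With the lower coefficients equal, the difference of the two expansions at order N is (W
  N - W' N) x^N = O(x^(N+1)).\<close>

lemma expansion_unique:
 assumes "is_expansion f W" "is_expansion f W'"
 shows "W = W'"
proof
 fix N
 show "W N = W' N"
 proof (induction N rule: less_induct)
  case (less N)
  obtain C C' where C: "\<forall>\<^sub>F x in at_right 0. norm (f x - (\<Sum>k\<le>N. W k * of_real (x ^ k))) \<le> C * x ^ (N + 1)"
   and C': "\<forall>\<^sub>F x in at_right 0. norm (f x - (\<Sum>k\<le>N. W' k * of_real (x ^ k))) \<le> C' * x ^ (N + 1)"
   using assms unfolding is_expansion_def by blast
  have "\<forall>\<^sub>F x in at_right (0::real). 0 < x" by (rule eventually_at_right_less)
  with C C' have "\<forall>\<^sub>F x in at_right 0. norm (W N - W' N) \<le> (C + C') * x"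
  proof eventually_elim
   case (elim x)
   have "(\<Sum>k\<le>N. W k * of_real (x ^ k)) - (\<Sum>k\<le>N. W' k * of_real (x ^ k)) = (\<Sum>k\<le>N. (W k - W' k) * of_real (x ^ k))"
    by (simp add: sum_subtractf left_diff_distrib)
   also have "\<dots> = (\<Sum>k\<in>{N}. (W k - W' k) * of_real (x ^ k))"
    using less.IH by (intro sum.mono_neutral_right) auto
   finally have "norm ((W N - W' N) * of_real (x ^ N)) = norm ((f x - (\<Sum>k\<le>N. W' k * of_real (x ^ k))) - (f x - (\<Sum>k\<le>N. W k * of_real (x ^ k))))" by simp
   also have "\<dots> \<le> C' * x ^ (N + 1) + C * x ^ (N + 1)"
    by (rule order_trans[OF norm_triangle_ineq4]) (use elim in linarith)
   finally have "norm (W N - W' N) * x ^ N \<le> ((C + C') * x) * x ^ N"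
    using elim(3) unfolding norm_mult norm_of_real by (simp add: algebra_simps)
   then show ?case using elim(3) by simp
  qed
  moreover have "((\<lambda>x. (C + C') * x) \<longlongrightarrow> (C + C') * 0) (at_right 0)" by (intro tendsto_intros)
  ultimately have "norm (W N - W' N) \<le> (C + C') * 0"
   by (intro tendsto_lowerbound[of _ _ "at_right (0::real)"]) simp_all
  then show ?case by simp
 qed
qed

context wave_problem
begin

lemma expansion_complex:
 assumes eta: "\<eta>0 \<in> bimg c"
 shows "\<exists>\<delta> r W. 0 < \<delta> \<and> 0 < r \<and> ball \<eta>0 r \<subseteq> bimg c \<and> (\<forall>k. Cinf_on (sbox s0 \<eta>0 r) (W k)) \<and>
   (\<forall>N. \<exists>C. cexp_bound \<delta> (sbox s0 \<eta>0 r) (\<lambda>x q. of_real (x powr (- real CARD('n) / 2)) * u (fst q - ln x) (\<Phi> (x, binv A c (snd q)))) W N C)"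
proof -
 define v where "v = (\<lambda>x q. of_real (x powr (- real CARD('n) / 2)) * u (fst q - ln x) (\<Phi> (x, binv A c (snd q))))"
 obtain \<delta>1 r1 W1 where 1: "0 < \<delta>1" "0 < r1" "ball \<eta>0 r1 \<subseteq> bimg c" "\<forall>k. Cinf_on (sbox s0 \<eta>0 r1) (W1 k)"
   "\<forall>N. \<exists>C. rexp_bound \<delta>1 (sbox s0 \<eta>0 r1) (\<lambda>x q. x powr (- real CARD('n) / 2) * Re (u (fst q - ln x) (\<Phi> (x, binv A c (snd q))))) W1 N C"
  using expansion_linear[OF bounded_linear_Re eta, of s0] by (elim exE conjE)
 obtain \<delta>2 r2 W2 where 2: "0 < \<delta>2" "0 < r2" "ball \<eta>0 r2 \<subseteq> bimg c" "\<forall>k. Cinf_on (sbox s0 \<eta>0 r2) (W2 k)"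
   "\<forall>N. \<exists>C. rexp_bound \<delta>2 (sbox s0 \<eta>0 r2) (\<lambda>x q. x powr (- real CARD('n) / 2) * Im (u (fst q - ln x) (\<Phi> (x, binv A c (snd q))))) W2 N C"
  using expansion_linear[OF bounded_linear_Im eta, of s0] by (elim exE conjE)
 define \<delta> where "\<delta> = min \<delta>1 \<delta>2"
 define r where "r = min r1 r2"
 define W where "W = (\<lambda>k q. complex_of_real (W1 k q) + \<i> * complex_of_real (W2 k q))"
 let ?Q = "sbox s0 \<eta>0 r"
 have o: "open ?Q" by (intro open_Times) auto
 have sub: "?Q \<subseteq> sbox s0 \<eta>0 r1" "?Q \<subseteq> sbox s0 \<eta>0 r2" by (auto simp: r_def)
 show ?thesis
 proof (rule exI[of _ \<delta>], rule exI[of _ r], rule exI[of _ W], intro conjI allI)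
  show "0 < \<delta>" "0 < r" using 1 2 by (auto simp: \<delta>_def r_def)
  show "ball \<eta>0 r \<subseteq> bimg c" using 1(3) by (auto simp: r_def)
  show "Cinf_on ?Q (W k)" for k
   unfolding W_def
   by (intro Cinf_on_add o Cinf_on_bounded_linear[OF o bounded_linear_of_real]
     Cinf_on_bounded_linear[OF o bounded_linear_compose[OF bounded_linear_mult_right bounded_linear_of_real]]
     Cinf_on_subset[OF spec[OF 1(4)] sub(1)] Cinf_on_subset[OF spec[OF 2(4)] sub(2)])
  fix N
  obtain C1 where C1: "rexp_bound \<delta>1 (sbox s0 \<eta>0 r1) (\<lambda>x q. x powr (- real CARD('n) / 2) * Re (u (fst q - ln x) (\<Phi> (x, binv A c (snd q))))) W1 N C1"
   using spec[OF 1(5), of N] by (rule exE)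
  obtain C2 where C2: "rexp_bound \<delta>2 (sbox s0 \<eta>0 r2) (\<lambda>x q. x powr (- real CARD('n) / 2) * Im (u (fst q - ln x) (\<Phi> (x, binv A c (snd q))))) W2 N C2"
   using spec[OF 2(5), of N] by (rule exE)
  show "\<exists>C. cexp_bound \<delta> (?Q) (\<lambda>x q. of_real (x powr (- real CARD('n) / 2)) * u (fst q - ln x) (\<Phi> (x, binv A c (snd q)))) W N C"
   unfolding v_def[THEN fun_cong, THEN fun_cong, symmetric]
  proof (intro exI[of _ "C1 + C2"] ballI allI impI)
   fix q x assume q: "q \<in> ?Q" "0 < x" "x \<le> \<delta>"
   have R: "Re (v x q - (\<Sum>k\<le>N. W k q * of_real (x ^ k))) = x powr (- real CARD('n) / 2) * Re (u (fst q - ln x) (\<Phi> (x, binv A c (snd q)))) - (\<Sum>k\<le>N. W1 k q * x ^ k)"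
    unfolding v_def W_def by (simp add: Re_sum del: of_real_power)
   have I: "Im (v x q - (\<Sum>k\<le>N. W k q * of_real (x ^ k))) = x powr (- real CARD('n) / 2) * Im (u (fst q - ln x) (\<Phi> (x, binv A c (snd q)))) - (\<Sum>k\<le>N. W2 k q * x ^ k)"
    unfolding v_def W_def by (simp add: Im_sum del: of_real_power)
   have "\<bar>Re (v x q - (\<Sum>k\<le>N. W k q * of_real (x ^ k)))\<bar> \<le> C1 * x ^ (N + 1)"
    unfolding R by (rule C1[rule_format]) (use q sub in \<open>auto simp: \<delta>_def\<close>)
   moreover have "\<bar>Im (v x q - (\<Sum>k\<le>N. W k q * of_real (x ^ k)))\<bar> \<le> C2 * x ^ (N + 1)"
    unfolding I by (rule C2[rule_format]) (use q sub in \<open>auto simp: \<delta>_def\<close>)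
   ultimately show "norm (v x q - (\<Sum>k\<le>N. W k q * of_real (x ^ k))) \<le> (C1 + C2) * x ^ (N + 1)"
    using cmod_le[of "v x q - (\<Sum>k\<le>N. W k q * of_real (x ^ k))"] unfolding distrib_right by linarith
  qed
 qed
qed

end

theorem theorem2p1:
  fixes A :: "('a::{t2_space,second_countable_topology}, 'n::finite) chart set"
    and g :: "('a, 'n) metric"
    and \<epsilon> :: real
    and \<Phi> :: "real \<times> 'a \<Rightarrow> 'a"
    and h :: "real \<Rightarrow> ('a, 'n) bmetric"
    and h0 :: "('a, 'n) bmetric"
    and f1 f2 :: "'a \<Rightarrow> complex"
    and u :: "real \<Rightarrow> 'a \<Rightarrow> complex"
  assumes "compact_smooth_manifold A"
    and "asymptotically_hyperbolic A g"
    and "product_decomposition A g \<epsilon> \<Phi> h h0"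
    and "C0_infinity A f1" and "C0_infinity A f2"
    and "smooth_evolution A u"
    and "\<forall>t\<ge>0. \<forall>c\<in>A. \<forall>z\<in>cdom c \<inter> minterior A.
           Dt (Dt u) t z - laplacian g c (u t) z + of_real ((real CARD('n))\<^sup>2 / 4) * u t z = 0"
    and "\<forall>z\<in>minterior A. u 0 z = f1 z"
    and "\<forall>z\<in>minterior A. Dt u 0 z = f2 z"
  shows "\<exists>w :: nat \<Rightarrow> real \<Rightarrow> 'a \<Rightarrow> complex.
           (\<forall>k. smooth_line_bdry A (w k)) \<and>
           asymp_expansion (mbdry A)
             (\<lambda>x s y. of_real (x powr (- real CARD('n) / 2)) * u (s - ln x) (\<Phi> (x, y))) w"
proof -
 define v where "v = (\<lambda>x s y. of_real (x powr (- real CARD('n) / 2)) * u (s - ln x) (\<Phi> (x, y)))"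
 interpret collar A g \<epsilon> \<Phi> h h0 by unfold_locales (fact assms)+
 have wp: "wave_problem A g \<epsilon> \<Phi> h h0 u c f1 f2" if "c \<in> A" for c
  by unfold_locales (fact assms that)+
 have loc: "\<exists>\<delta> r W. 0 < \<delta> \<and> 0 < r \<and> ball \<eta>0 r \<subseteq> bimg c \<and> (\<forall>k. Cinf_on (sbox s0 \<eta>0 r) (W k)) \<and>
   (\<forall>N. \<exists>C. cexp_bound \<delta> (sbox s0 \<eta>0 r) (\<lambda>x q. v x (fst q) (binv A c (snd q))) W N C)"
  if "c \<in> A" "\<eta>0 \<in> bimg c" for c \<eta>0 s0
  using wave_problem.expansion_complex[OF wp[OF that(1)] that(2), of s0] unfolding v_def .
 \<comment> \<open>Chosen point by point without reference to a chart. Uniqueness identifies it with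
   the coefficients of every local expansion, which provide smoothness and uniform bounds.\<close>
 define w where "w = (\<lambda>k s y. (SOME W. is_expansion (\<lambda>x. v x s y) W) k)"
 have weq: "w k s y = W k" if "is_expansion (\<lambda>x. v x s y) W" for k s y W
  unfolding w_def using expansion_unique[OF someI[of "is_expansion (\<lambda>x. v x s y)", OF that] that] by (rule fun_cong)
 have loc_w: "w k (fst q) (binv A c (snd q)) = W k q"
  if \<delta>: "0 < \<delta>" and q: "q \<in> Q" and W: "\<forall>N. \<exists>C. cexp_bound \<delta> Q (\<lambda>x q. v x (fst q) (binv A c (snd q))) W N C"
  for \<delta> :: real and q Q W k and c :: "('a, 'n) chart"
 proof -
  have "is_expansion (\<lambda>x. v x (fst q) (binv A c (snd q))) (\<lambda>k. W k q)"
   unfolding is_expansion_def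
  proof
   fix N
   obtain C where C: "cexp_bound \<delta> Q (\<lambda>x q. v x (fst q) (binv A c (snd q))) W N C" using spec[OF W, of N] by (rule exE)
   have "\<forall>\<^sub>F x in at_right 0. x \<in> {0<..<\<delta>}" using \<delta> by (rule eventually_at_right_real)
   then have "\<forall>\<^sub>F x in at_right 0. norm (v x (fst q) (binv A c (snd q)) - (\<Sum>k\<le>N. W k q * of_real (x ^ k))) \<le> C * x ^ (N + 1)"
    by eventually_elim (rule C[rule_format, OF q]; simp)
   then show "\<exists>C. \<forall>\<^sub>F x in at_right 0. norm (v x (fst q) (binv A c (snd q)) - (\<Sum>k\<le>N. W k q * of_real (x ^ k))) \<le> C * x ^ (N + 1)" ..
  qed
  from weq[OF this] show ?thesis .
 qed
 have "smooth_line_bdry A (w k)" for k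
  unfolding smooth_line_bdry_def smooth_on_def
 proof (intro ballI)
  fix c and p :: "real \<times> (real ^ 'n)" assume c: "c \<in> A" and p: "p \<in> UNIV \<times> bimg c"
  obtain s0 \<eta>0 where pp: "p = (s0, \<eta>0)" "\<eta>0 \<in> bimg c" using p by auto
  obtain \<delta> r W where W: "0 < \<delta>" "0 < r" "ball \<eta>0 r \<subseteq> bimg c" "\<forall>k. Cinf_on (sbox s0 \<eta>0 r) (W k)"
   "\<forall>N. \<exists>C. cexp_bound \<delta> (sbox s0 \<eta>0 r) (\<lambda>x q. v x (fst q) (binv A c (snd q))) W N C"
   using loc[OF c pp(2), of s0] by (elim exE conjE)
  show "\<exists>V F. open V \<and> p \<in> V \<and> (\<forall>k. Ck_on k V F) \<and> (\<forall>q\<in>V \<inter> UNIV \<times> bimg c. F q = (case q of (s, \<eta>) \<Rightarrow> w k s (binv A c \<eta>)))"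
  proof (rule exI[of _ "sbox s0 \<eta>0 r"], rule exI[of _ "W k"], intro conjI ballI)
   show "open (sbox s0 \<eta>0 r)" by (intro open_Times) auto
   show "p \<in> sbox s0 \<eta>0 r" using W(2) by (simp add: pp)
   show "\<forall>j. Ck_on j (sbox s0 \<eta>0 r) (W k)" using W(4) by (simp add: Cinf_on_def)
   show "W k q = (case q of (s, \<eta>) \<Rightarrow> w k s (binv A c \<eta>))" if "q \<in> sbox s0 \<eta>0 r \<inter> UNIV \<times> bimg c" for q
    using loc_w[OF W(1) _ W(5), of q k] that by (simp add: case_prod_beta)
  qed
 qed
 moreover have "asymp_expansion (mbdry A) v w"
  unfolding asymp_expansion_def
 proof (intro allI ballI)
  fix N s0 y0 assume y0: "y0 \<in> mbdry A"
  then obtain c where c: "c \<in> A" "y0 \<in> cdom c" by (auto simp: mbdry_def)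
  then have yb: "y0 \<in> bdom A c" using y0 by (simp add: bdom_def)
  define \<eta>0 where "\<eta>0 = bmap c y0"
  have eta: "\<eta>0 \<in> bimg c" using yb by (simp add: \<eta>0_def)
  obtain \<delta> r W where W: "0 < \<delta>" "0 < r" "ball \<eta>0 r \<subseteq> bimg c" "\<forall>k. Cinf_on (sbox s0 \<eta>0 r) (W k)"
   "\<forall>N. \<exists>C. cexp_bound \<delta> (sbox s0 \<eta>0 r) (\<lambda>x q. v x (fst q) (binv A c (snd q))) W N C"
   using loc[OF c(1) eta, of s0] by (elim exE conjE)
  obtain C where C: "cexp_bound \<delta> (sbox s0 \<eta>0 r) (\<lambda>x q. v x (fst q) (binv A c (snd q))) W N C"
   using spec[OF W(5), of N] by (rule exE)
  \<comment> \<open>\<open>asymp_expansion\<close> asks for a set open in the product with the whole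
    manifold; over the boundary it lies in the domain of the local expansion.\<close>
  define V where "V = {s0-1<..<s0+1} \<times> (cdom c \<inter> bmap c -` ball \<eta>0 r)"
  have "continuous_on (cdom c) (bmap c)"
  proof -
   have "continuous_on (cdom c) (cmap c)" using chart_homeo(3)[OF c(1)] by (rule homeomorphism_cont1)
   then have "continuous_on (cdom c) (\<lambda>p. tpart (cmap c p))"
    by (rule continuous_on_compose2[OF linear_continuous_on[OF bounded_linear_tpart, of UNIV]]) simp
   then show ?thesis unfolding bmap_tpart[symmetric] .
  qed
  then have "open (cdom c \<inter> bmap c -` ball \<eta>0 r)"
   using chart_homeo(1)[OF c(1)] by (intro continuous_open_preimage) auto
  then have "open V" unfolding V_def by (intro open_Times) auto
  moreover have "(s0, y0) \<in> V" using c(2) W(2) by (simp add: V_def \<eta>0_def)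
  moreover have "\<forall>\<^sub>F x in at_right 0. x \<in> {0<..<\<delta>}" using W(1) by (rule eventually_at_right_real)
  then have "\<forall>\<^sub>F x in at_right 0. \<forall>(s, y)\<in>V \<inter> UNIV \<times> mbdry A.
      norm (v x s y - (\<Sum>k\<le>N. w k s y * of_real (x ^ k))) \<le> C * x ^ (N + 1)"
  proof eventually_elim
   case (elim x)
   show ?case
   proof (intro ballI, unfold case_prod_beta)
    fix p assume p: "p \<in> V \<inter> UNIV \<times> mbdry A"
    obtain s y where pp: "p = (s, y)" by (cases p)
    have y: "y \<in> bdom A c" and q: "(s, bmap c y) \<in> sbox s0 \<eta>0 r" using p by (auto simp: V_def pp bdom_def)
    have "w k s y = W k (s, bmap c y)" for k
     using loc_w[OF W(1) q W(5), of k] binv_bmap[OF c(1) y] by simp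
    then show "norm (v x (fst p) (snd p) - (\<Sum>k\<le>N. w k (fst p) (snd p) * of_real (x ^ k))) \<le> C * x ^ (N + 1)"
     using C[rule_format, OF q, of x] elim binv_bmap[OF c(1) y] by (simp add: pp)
   qed
  qed
  ultimately show "\<exists>V C. open V \<and> (s0, y0) \<in> V \<and> (\<forall>\<^sub>F x in at_right 0. \<forall>(s, y)\<in>V \<inter> UNIV \<times> mbdry A.
      norm (v x s y - (\<Sum>k\<le>N. w k s y * of_real (x ^ k))) \<le> C * x ^ (N + 1))" by blast
 qed
 ultimately show ?thesis unfolding v_def by blast
qed

end
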